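(* Let $\mathbb{K}$ be an algebraically closed field of characteristic zero, let $A_p$ be a graded unital associative Frobenius $\mathbb{K}$-algebra with Hilbert series $(1+t)^4$, and let $[A_p]$ be the corresponding point of the moduli stack $\mathcal{A}_4$. There is a natural isomorphism $T_{[A_p]}\mathcal{A}_4\cong \mathrm{HH}^2_0(A_p)$.
   Context: **Frobenius algebras.** A finite-dimensional connected graded algebra $B=\bigoplus_{i=0}^4B_i$ with $\dim B_i=\binom4i$ is Frobenius if there is a nondegenerate pairing $\langle-,-\rangle:B\otimes B\to\mathbb{K}$, zero on $B_i\otimes B_j$ unless $i+j=4$, with $\langle a,bc\rangle=\langle ab,c\rangle$. **The stack.** Fix the graded vector space with pieces of dimensions $1,4,6,4,1$ in degrees $0,\dots,4$ and a homogeneous basis. $X_4\subset\mathbb{A}^{16^3}$ is the locally closed subscheme of structure constants $(c_{ij}^k)$ defining a graded, associative, unital (unit the degree-0 basis element), Frobenius multiplication; $G=GL_4\times GL_6\times GL_4\times GL_1$ acts by graded unit-preserving change of basis; $\mathcal{A}_4=[X_4/G]$ (quotient stack). **Tangent space of a stack.** For $x:\mathrm{Spec}\,\mathbb{K}\to\mathcal{X}$, $T_x\mathcal{X}$ is the set of pairs $(\tau,\alpha)$ with $\tau:\mathrm{Spec}\,\mathbb{K}[\varepsilon]/(\varepsilon^2)\to\mathcal{X}$ and $\alpha:x\xrightarrow{\sim}\tau\circ i$ ($i$ the canonical inclusion of $\mathrm{Spec}\,\mathbb{K}$), modulo $(\tau,\alpha)\sim(\tau',\alpha')$ if there is an isomorphism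 $\beta:\tau\xrightarrow{\sim}\tau'$ with $\alpha'=\beta|_{\mathrm{Spec}\,\mathbb{K}}\circ\alpha$. **Hochschild cohomology.** $\mathrm{HH}^2_0(A_p)$ is the degree-2 cohomology of the subcomplex of degree-preserving maps in the Hochschild cochain complex $\mathrm{Hom}_{\mathbb{K}}(A_p^{\otimes n},A_p)$. *)

theory Defs
  imports "HOL-Algebra.Algebra"
begin

section \<open>Graded Frobenius algebras with Hilbert series (1+t)^4\<close>

text \<open>A graded algebra is a record \<open>A\<close> over \<open>K\<close> together with its homogeneous pieces \<open>gr i\<close>.
  In the dimension condition, scalars act by left multiplication by elements of \<open>K \<cdot> 1\<close>.\<close>

definition graded_algebra ::
  "('k, 'm) ring_scheme \<Rightarrow> ('k, 'a) module \<Rightarrow> (nat \<Rightarrow> 'a set) \<Rightarrow> bool" where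
  "graded_algebra K A gr \<longleftrightarrow>
     field K \<and> ring A \<and> module K A \<and>
     (\<forall>k\<in>carrier K. \<forall>a\<in>carrier A. \<forall>b\<in>carrier A.
        k \<odot>\<^bsub>A\<^esub> (a \<otimes>\<^bsub>A\<^esub> b) = (k \<odot>\<^bsub>A\<^esub> a) \<otimes>\<^bsub>A\<^esub> b \<and>
        k \<odot>\<^bsub>A\<^esub> (a \<otimes>\<^bsub>A\<^esub> b) = a \<otimes>\<^bsub>A\<^esub> (k \<odot>\<^bsub>A\<^esub> b)) \<and>
     (\<forall>i. submodule (gr i) K A) \<and> \<one>\<^bsub>A\<^esub> \<in> gr 0 \<and>
     (\<forall>i j. \<forall>a\<in>gr i. \<forall>b\<in>gr j. a \<otimes>\<^bsub>A\<^esub> b \<in> gr (i + j))"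

definition hilbert_1t4 ::
  "('k, 'm) ring_scheme \<Rightarrow> ('k, 'a) module \<Rightarrow> (nat \<Rightarrow> 'a set) \<Rightarrow> bool" where
  "hilbert_1t4 K A gr \<longleftrightarrow>
     (\<forall>a\<in>carrier A. \<exists>!x. x \<in> (\<Pi>\<^sub>E i\<in>{..4}. gr i) \<and> a = (\<Oplus>\<^bsub>A\<^esub>i\<in>{..4}. x i)) \<and>
     (\<forall>i. ring.dimension A (4 choose i) ((\<lambda>k. k \<odot>\<^bsub>A\<^esub> \<one>\<^bsub>A\<^esub>) ` carrier K) (gr i))"

definition frobenius_pairing ::
  "('k, 'm) ring_scheme \<Rightarrow> ('k, 'a) module \<Rightarrow> (nat \<Rightarrow> 'a set) \<Rightarrow> ('a \<Rightarrow> 'a \<Rightarrow> 'k) \<Rightarrow> bool" where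
  "frobenius_pairing K A gr h \<longleftrightarrow>
     (\<forall>a\<in>carrier A. \<forall>b\<in>carrier A. h a b \<in> carrier K) \<and>
     (\<forall>a\<in>carrier A. \<forall>b\<in>carrier A. \<forall>c\<in>carrier A.
        h (a \<oplus>\<^bsub>A\<^esub> b) c = h a c \<oplus>\<^bsub>K\<^esub> h b c \<and> h a (b \<oplus>\<^bsub>A\<^esub> c) = h a b \<oplus>\<^bsub>K\<^esub> h a c) \<and>
     (\<forall>k\<in>carrier K. \<forall>a\<in>carrier A. \<forall>b\<in>carrier A.
        h (k \<odot>\<^bsub>A\<^esub> a) b = k \<otimes>\<^bsub>K\<^esub> h a b \<and> h a (k \<odot>\<^bsub>A\<^esub> b) = k \<otimes>\<^bsub>K\<^esub> h a b) \<and>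
     (\<forall>a\<in>carrier A. (\<forall>b\<in>carrier A. h a b = \<zero>\<^bsub>K\<^esub>) \<longrightarrow> a = \<zero>\<^bsub>A\<^esub>) \<and>
     (\<forall>b\<in>carrier A. (\<forall>a\<in>carrier A. h a b = \<zero>\<^bsub>K\<^esub>) \<longrightarrow> b = \<zero>\<^bsub>A\<^esub>) \<and>
     (\<forall>i j. i + j \<noteq> 4 \<longrightarrow> (\<forall>a\<in>gr i. \<forall>b\<in>gr j. h a b = \<zero>\<^bsub>K\<^esub>)) \<and>
     (\<forall>a\<in>carrier A. \<forall>b\<in>carrier A. \<forall>c\<in>carrier A. h a (b \<otimes>\<^bsub>A\<^esub> c) = h (a \<otimes>\<^bsub>A\<^esub> b) c)"

definition frobenius_algebra4 ::
  "('k, 'm) ring_scheme \<Rightarrow> ('k, 'a) module \<Rightarrow> (nat \<Rightarrow> 'a set) \<Rightarrow> bool" where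
  "frobenius_algebra4 K A gr \<longleftrightarrow>
     graded_algebra K A gr \<and> hilbert_1t4 K A gr \<and> (\<exists>h. frobenius_pairing K A gr h)"

definition graded_alg_iso ::
  "('k, 'm) ring_scheme \<Rightarrow> ('k, 'a) module \<Rightarrow> (nat \<Rightarrow> 'a set) \<Rightarrow>
     ('k, 'b) module \<Rightarrow> (nat \<Rightarrow> 'b set) \<Rightarrow> ('a \<Rightarrow> 'b) \<Rightarrow> bool" where
  "graded_alg_iso K A gr B gr' f \<longleftrightarrow>
     f \<in> ring_hom A B \<and> bij_betw f (carrier A) (carrier B) \<and>
     (\<forall>k\<in>carrier K. \<forall>a\<in>carrier A. f (k \<odot>\<^bsub>A\<^esub> a) = k \<odot>\<^bsub>B\<^esub> f a) \<and>
     (\<forall>i. f ` gr i = gr' i)"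

definition module_iso ::
  "('k, 'm) ring_scheme \<Rightarrow> ('k, 'a, 'c) module_scheme \<Rightarrow> ('k, 'b, 'd) module_scheme \<Rightarrow> ('a \<Rightarrow> 'b) set" where
  "module_iso K M N =
     {f. module K M \<and> module K N \<and> bij_betw f (carrier M) (carrier N) \<and>
         (\<forall>u\<in>carrier M. \<forall>v\<in>carrier M. f (u \<oplus>\<^bsub>M\<^esub> v) = f u \<oplus>\<^bsub>N\<^esub> f v) \<and>
         (\<forall>k\<in>carrier K. \<forall>u\<in>carrier M. f (k \<odot>\<^bsub>M\<^esub> u) = k \<odot>\<^bsub>N\<^esub> f u)}"


section \<open>The Hochschild complex of degree-preserving cochains\<close>

text \<open>An \<open>n\<close>-cochain \<open>A\<^sup>\<otimes>\<^sup>n \<rightarrow> A\<close> is the corresponding multilinear map, taking a list of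
  length \<open>n\<close> as its argument.\<close>

definition tuples :: "('k, 'a) module \<Rightarrow> nat \<Rightarrow> 'a list set" where
  "tuples A n = {as. length as = n \<and> set as \<subseteq> carrier A}"

definition cochains ::
  "('k, 'm) ring_scheme \<Rightarrow> ('k, 'a) module \<Rightarrow> (nat \<Rightarrow> 'a set) \<Rightarrow> nat \<Rightarrow> ('a list \<Rightarrow> 'a) set" where
  "cochains K A gr n =
     {\<phi> \<in> tuples A n \<rightarrow>\<^sub>E carrier A.
        (\<forall>as\<in>tuples A n. \<forall>i<n. \<forall>a\<in>carrier A. \<forall>b\<in>carrier A.
           \<phi> (as[i := a \<oplus>\<^bsub>A\<^esub> b]) = \<phi> (as[i := a]) \<oplus>\<^bsub>A\<^esub> \<phi> (as[i := b])) \<and>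
        (\<forall>as\<in>tuples A n. \<forall>i<n. \<forall>k\<in>carrier K. \<forall>a\<in>carrier A.
           \<phi> (as[i := k \<odot>\<^bsub>A\<^esub> a]) = k \<odot>\<^bsub>A\<^esub> \<phi> (as[i := a])) \<and>
        (\<forall>as ds. length as = n \<and> length ds = n \<and> (\<forall>i<n. as ! i \<in> gr (ds ! i))
           \<longrightarrow> \<phi> as \<in> gr (sum_list ds))}"

text \<open>Only the additive and scalar structure of this record is meaningful.\<close>

definition cochain_module ::
  "('k, 'm) ring_scheme \<Rightarrow> ('k, 'a) module \<Rightarrow> (nat \<Rightarrow> 'a set) \<Rightarrow> nat \<Rightarrow> ('k, 'a list \<Rightarrow> 'a) module" where
  "cochain_module K A gr n =
     \<lparr> carrier = cochains K A gr n, monoid.mult = undefined, monoid.one = undefined,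
       ring.zero = (\<lambda>as\<in>tuples A n. \<zero>\<^bsub>A\<^esub>),
       add = (\<lambda>\<phi> \<psi>. \<lambda>as\<in>tuples A n. \<phi> as \<oplus>\<^bsub>A\<^esub> \<psi> as),
       smult = (\<lambda>k \<phi>. \<lambda>as\<in>tuples A n. k \<odot>\<^bsub>A\<^esub> \<phi> as) \<rparr>"

definition alt :: "('k, 'a) module \<Rightarrow> nat \<Rightarrow> 'a \<Rightarrow> 'a" where
  "alt A i a = (if even i then a else \<ominus>\<^bsub>A\<^esub> a)"

definition hochschild_d ::
  "('k, 'a) module \<Rightarrow> nat \<Rightarrow> ('a list \<Rightarrow> 'a) \<Rightarrow> 'a list \<Rightarrow> 'a" where
  "hochschild_d A n \<phi> = (\<lambda>as\<in>tuples A (Suc n).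
     (hd as \<otimes>\<^bsub>A\<^esub> \<phi> (tl as)) \<oplus>\<^bsub>A\<^esub>
     (\<Oplus>\<^bsub>A\<^esub>i\<in>{..<n}. alt A (Suc i)
         (\<phi> (take i as @ [as ! i \<otimes>\<^bsub>A\<^esub> as ! Suc i] @ drop (i + 2) as))) \<oplus>\<^bsub>A\<^esub>
     alt A (Suc n) (\<phi> (butlast as) \<otimes>\<^bsub>A\<^esub> last as))"

definition cocycles ::
  "('k, 'm) ring_scheme \<Rightarrow> ('k, 'a) module \<Rightarrow> (nat \<Rightarrow> 'a set) \<Rightarrow> nat \<Rightarrow> ('a list \<Rightarrow> 'a) set" where
  "cocycles K A gr n =
     {\<phi> \<in> cochains K A gr n. hochschild_d A n \<phi> = \<zero>\<^bsub>cochain_module K A gr (Suc n)\<^esub>}"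

fun coboundaries ::
  "('k, 'm) ring_scheme \<Rightarrow> ('k, 'a) module \<Rightarrow> (nat \<Rightarrow> 'a set) \<Rightarrow> nat \<Rightarrow> ('a list \<Rightarrow> 'a) set" where
  "coboundaries K A gr 0 = {\<zero>\<^bsub>cochain_module K A gr 0\<^esub>}"
| "coboundaries K A gr (Suc n) = hochschild_d A n ` cochains K A gr n"

definition hh_class ::
  "('k, 'm) ring_scheme \<Rightarrow> ('k, 'a) module \<Rightarrow> (nat \<Rightarrow> 'a set) \<Rightarrow> nat \<Rightarrow>
     ('a list \<Rightarrow> 'a) \<Rightarrow> ('a list \<Rightarrow> 'a) set" where
  "hh_class K A gr n \<phi> = coboundaries K A gr n +>\<^bsub>cochain_module K A gr n\<^esub> \<phi>"

definition HH0 ::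
  "('k, 'm) ring_scheme \<Rightarrow> ('k, 'a) module \<Rightarrow> (nat \<Rightarrow> 'a set) \<Rightarrow> nat \<Rightarrow>
     ('k, ('a list \<Rightarrow> 'a) set) module" where
  "HH0 K A gr n =
     \<lparr> carrier = hh_class K A gr n ` cocycles K A gr n, monoid.mult = undefined, monoid.one = undefined,
       ring.zero = coboundaries K A gr n,
       add = (\<lambda>u v. u <+>\<^bsub>cochain_module K A gr n\<^esub> v),
       smult = (\<lambda>k u. \<Union>\<phi>\<in>u. hh_class K A gr n (k \<odot>\<^bsub>cochain_module K A gr n\<^esub> \<phi>)) \<rparr>"

definition HH0_map ::
  "('k, 'a) module \<Rightarrow> ('k, 'b) module \<Rightarrow> ('a \<Rightarrow> 'b) \<Rightarrow> nat \<Rightarrow>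
     ('a list \<Rightarrow> 'a) set \<Rightarrow> ('b list \<Rightarrow> 'b) set" where
  "HH0_map A B f n u =
     (\<lambda>\<phi>. \<lambda>bs\<in>tuples B n. f (\<phi> (map (inv_into (carrier A) f) bs))) ` u"


section \<open>The scheme \<open>X\<^sub>4\<close> and the group \<open>G\<close>, as functors of points\<close>

text \<open>The fixed graded vector space has basis \<open>0, \<dots>, 15\<close>.  Matrices and structure
  constants are zero outside their range of indices.\<close>

definition bdeg :: "nat \<Rightarrow> nat" where
  "bdeg i = (if i < 1 then 0 else if i < 5 then 1 else if i < 11 then 2 else if i < 15 then 3 else 4)"

type_synonym 'u mat = "nat \<Rightarrow> nat \<Rightarrow> 'u"
type_synonym 'u sconst = "nat \<Rightarrow> nat \<Rightarrow> nat \<Rightarrow> 'u"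

definition mat_mul :: "('u, 'm) ring_scheme \<Rightarrow> 'u mat \<Rightarrow> 'u mat \<Rightarrow> 'u mat" where
  "mat_mul S g h = (\<lambda>i j. \<Oplus>\<^bsub>S\<^esub>k\<in>{..<16}. g i k \<otimes>\<^bsub>S\<^esub> h k j)"

definition mat_one :: "('u, 'm) ring_scheme \<Rightarrow> 'u mat" where
  "mat_one S = (\<lambda>i j. if i = j \<and> i < 16 then \<one>\<^bsub>S\<^esub> else \<zero>\<^bsub>S\<^esub>)"

definition mats :: "('u, 'm) ring_scheme \<Rightarrow> 'u mat set" where
  "mats S = {g. (\<forall>i j. g i j \<in> carrier S) \<and> (\<forall>i j. \<not> (i < 16 \<and> j < 16) \<longrightarrow> g i j = \<zero>\<^bsub>S\<^esub>)}"

definition mat_inverse :: "('u, 'm) ring_scheme \<Rightarrow> 'u mat \<Rightarrow> 'u mat \<Rightarrow> bool" where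
  "mat_inverse S g h \<longleftrightarrow> h \<in> mats S \<and> mat_mul S g h = mat_one S \<and> mat_mul S h g = mat_one S"

definition mat_inv :: "('u, 'm) ring_scheme \<Rightarrow> 'u mat \<Rightarrow> 'u mat" where
  "mat_inv S g = (THE h. mat_inverse S g h)"

text \<open>\<open>G = GL\<^sub>4 \<times> GL\<^sub>6 \<times> GL\<^sub>4 \<times> GL\<^sub>1\<close> as block diagonal matrices whose degree-0 block is 1.\<close>

definition G_pts :: "('u, 'm) ring_scheme \<Rightarrow> 'u mat set" where
  "G_pts S = {g \<in> mats S. (\<forall>i j. bdeg i \<noteq> bdeg j \<longrightarrow> g i j = \<zero>\<^bsub>S\<^esub>) \<and> g 0 0 = \<one>\<^bsub>S\<^esub> \<and>
                (\<exists>h. mat_inverse S g h)}"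

text \<open>\<open>c i j k\<close> is the coefficient of \<open>e\<^sub>k\<close> in \<open>e\<^sub>i e\<^sub>j\<close>, and \<open>h\<close> below is the Gram matrix of the
  pairing.  Over a ring, a pairing is nondegenerate if its Gram matrix is invertible.  As
  \<open>\<langle>a, b\<rangle> = \<langle>1, ab\<rangle>\<close> depends on \<open>ab\<close> only through its degree-4 coefficient, such a pairing
  exists iff the matrices of the multiplications \<open>B\<^sub>i \<otimes> B\<^sub>4\<^sub>-\<^sub>i \<rightarrow> B\<^sub>4\<close> are invertible, so that
  \<open>X_pts\<close> is the functor of points of an open subscheme of the closed subscheme given by the
  remaining equations.\<close>

definition X_pts :: "('u, 'm) ring_scheme \<Rightarrow> 'u sconst set" where
  "X_pts S = {c.
     (\<forall>i j k. c i j k \<in> carrier S) \<and>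
     (\<forall>i j k. \<not> (i < 16 \<and> j < 16 \<and> k < 16 \<and> bdeg k = bdeg i + bdeg j) \<longrightarrow> c i j k = \<zero>\<^bsub>S\<^esub>) \<and>
     (\<forall>j k. c 0 j k = mat_one S j k \<and> c j 0 k = mat_one S j k) \<and>
     (\<forall>i<16. \<forall>j<16. \<forall>l<16. \<forall>m<16.
        (\<Oplus>\<^bsub>S\<^esub>k\<in>{..<16}. c i j k \<otimes>\<^bsub>S\<^esub> c k l m) = (\<Oplus>\<^bsub>S\<^esub>k\<in>{..<16}. c j l k \<otimes>\<^bsub>S\<^esub> c i k m)) \<and>
     (\<exists>h\<in>mats S. (\<exists>h'. mat_inverse S h h') \<and>
        (\<forall>i j. bdeg i + bdeg j \<noteq> 4 \<longrightarrow> h i j = \<zero>\<^bsub>S\<^esub>) \<and>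
        (\<forall>i<16. \<forall>j<16. \<forall>l<16.
           (\<Oplus>\<^bsub>S\<^esub>k\<in>{..<16}. c j l k \<otimes>\<^bsub>S\<^esub> h i k) = (\<Oplus>\<^bsub>S\<^esub>k\<in>{..<16}. c i j k \<otimes>\<^bsub>S\<^esub> h k l)))}"

text \<open>The multiplication \<open>(a, b) \<mapsto> g (g\<^sup>-\<^sup>1 a \<cdot> g\<^sup>-\<^sup>1 b)\<close>, where \<open>g e\<^sub>j = \<Sum>\<^sub>i g i j e\<^sub>i\<close>.\<close>

definition X_act :: "('u, 'm) ring_scheme \<Rightarrow> 'u mat \<Rightarrow> 'u sconst \<Rightarrow> 'u sconst" where
  "X_act S g c = (\<lambda>i j k. \<Oplus>\<^bsub>S\<^esub>p\<in>{..<16}. \<Oplus>\<^bsub>S\<^esub>q\<in>{..<16}. \<Oplus>\<^bsub>S\<^esub>r\<in>{..<16}.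
      mat_inv S g p i \<otimes>\<^bsub>S\<^esub> mat_inv S g q j \<otimes>\<^bsub>S\<^esub> c p q r \<otimes>\<^bsub>S\<^esub> g k r)"

definition mat_map :: "('u \<Rightarrow> 'v) \<Rightarrow> 'u mat \<Rightarrow> 'v mat" where
  "mat_map f g = (\<lambda>i j. f (g i j))"

definition sconst_map :: "('u \<Rightarrow> 'v) \<Rightarrow> 'u sconst \<Rightarrow> 'v sconst" where
  "sconst_map f c = (\<lambda>i j k. f (c i j k))"


section \<open>Algebras over a ring and etale coverings\<close>

text \<open>Affine schemes over \<open>Spec R\<close> are commutative \<open>R\<close>-algebras, that is, pairs of a ring and a
  structure map.  The ring is carried by a subset of the type \<open>'u\<close>, which plays the role of a
  universe; \<open>R\<close> itself may live on another type.  Homomorphisms are extensional, so that equal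
  morphisms are equal functions.\<close>

type_synonym ('r, 'u) ralg = "'u ring \<times> ('r \<Rightarrow> 'u)"

definition ralgs :: "('r, 'm) ring_scheme \<Rightarrow> ('r, 'u) ralg set" where
  "ralgs R = {S. cring (fst S) \<and> snd S \<in> ring_hom R (fst S)}"

definition ralg_hom ::
  "('r, 'm) ring_scheme \<Rightarrow> ('r, 'u) ralg \<Rightarrow> ('r, 'u) ralg \<Rightarrow> ('u \<Rightarrow> 'u) set" where
  "ralg_hom R S T =
     {f \<in> ring_hom (fst S) (fst T) \<inter> extensional (carrier (fst S)).
        \<forall>r\<in>carrier R. f (snd S r) = snd T r}"

definition along :: "('r \<Rightarrow> 's) \<Rightarrow> ('s, 'u) ralg \<Rightarrow> ('r, 'u) ralg" where
  "along \<rho> S = (fst S, snd S \<circ> \<rho>)"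

text \<open>A polynomial is a list of terms \<open>(a, [i\<^sub>1, \<dots>, i\<^sub>r])\<close>, standing for \<open>a x\<^sub>i\<^sub>1 \<cdots> x\<^sub>i\<^sub>r\<close>.\<close>

type_synonym 'r mpoly = "('r \<times> nat list) list"

definition mpoly_eval :: "('r, 'u) ralg \<Rightarrow> (nat \<Rightarrow> 'u) \<Rightarrow> 'r mpoly \<Rightarrow> 'u" where
  "mpoly_eval T x p =
     foldr (\<lambda>(a, is) s.
        (snd T a \<otimes>\<^bsub>fst T\<^esub> foldr (\<lambda>i y. x i \<otimes>\<^bsub>fst T\<^esub> y) is \<one>\<^bsub>fst T\<^esub>) \<oplus>\<^bsub>fst T\<^esub> s)
       p \<zero>\<^bsub>fst T\<^esub>"

text \<open>\<open>T\<close> is \<open>S[x\<^sub>0, \<dots>, x\<^sub>n\<^sub>-\<^sub>1]/(F)\<close> with \<open>F\<close> finite, expressed by the universal property of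
  this quotient.\<close>

definition finitely_presented :: "('r, 'm) ring_scheme \<Rightarrow> ('r, 'u) ralg \<Rightarrow> bool" where
  "finitely_presented S T \<longleftrightarrow>
     (\<exists>(n::nat) (F :: 'r mpoly set) x. finite F \<and>
        (\<forall>p\<in>F. \<forall>(a, is)\<in>set p. a \<in> carrier S \<and> set is \<subseteq> {..<n}) \<and>
        x \<in> {..<n} \<rightarrow> carrier (fst T) \<and> (\<forall>p\<in>F. mpoly_eval T x p = \<zero>\<^bsub>fst T\<^esub>) \<and>
        (\<forall>W\<in>ralgs S. \<forall>y\<in>{..<n} \<rightarrow> carrier (fst W). (\<forall>p\<in>F. mpoly_eval W y p = \<zero>\<^bsub>fst W\<^esub>) \<longrightarrow>
           (\<exists>!f. f \<in> ralg_hom S T W \<and> (\<forall>i<n. f (x i) = y i))))"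

definition formally_etale :: "('r, 'm) ring_scheme \<Rightarrow> ('r, 'u) ralg \<Rightarrow> bool" where
  "formally_etale S T \<longleftrightarrow>
     (\<forall>W\<in>ralgs S. \<forall>W'\<in>ralgs S. \<forall>q\<in>ralg_hom S W W'.
        q ` carrier (fst W) = carrier (fst W') \<and>
        (\<forall>a\<in>a_kernel (fst W) (fst W') q. \<forall>b\<in>a_kernel (fst W) (fst W') q.
           a \<otimes>\<^bsub>fst W\<^esub> b = \<zero>\<^bsub>fst W\<^esub>) \<longrightarrow>
        (\<forall>g\<in>ralg_hom S T W'. \<exists>!f. f \<in> ralg_hom S T W \<and> compose (carrier (fst T)) q f = g))"

definition etale_cover :: "('r, 'm) ring_scheme \<Rightarrow> ('r, 'u) ralg set \<Rightarrow> bool" where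
  "etale_cover S C \<longleftrightarrow>
     finite C \<and> C \<subseteq> ralgs S \<and> (\<forall>T\<in>C. finitely_presented S T \<and> formally_etale S T) \<and>
     (\<forall>p. primeideal p S \<longrightarrow>
        (\<exists>T\<in>C. \<exists>q. primeideal q (fst T) \<and> p = {s \<in> carrier S. snd T s \<in> q}))"


section \<open>The quotient stack \<open>[X\<^sub>4/G]\<close>\<close>

text \<open>An object over \<open>Spec R\<close> is a principal \<open>G\<close>-bundle \<open>P \<rightarrow> Spec R\<close>, locally trivial for the
  etale topology, with a \<open>G\<close>-equivariant morphism \<open>P \<rightarrow> X\<^sub>4\<close>.  As \<open>G\<close> is affine, so is \<open>P\<close>
  (and any etale sheaf torsor is of this form), so \<open>P\<close> is the spectrum of an \<open>R\<close>-algebra.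
  All of this data is given by functors of points on \<open>R\<close>-algebras: \<open>sec \<tau> S = P(S)\<close>, its
  functoriality \<open>res\<close>, the action \<open>act\<close> of \<open>G(S)\<close>, and the morphism \<open>eqv\<close> to \<open>X\<^sub>4\<close>.
  Points are taken in the type of matrices; this is no restriction up to isomorphism, as
  every nonempty \<open>P(S)\<close> is in bijection with \<open>G(S)\<close>.\<close>

record ('r, 'u) qobj =
  sec :: "('r, 'u) ralg \<Rightarrow> 'u mat set"
  res :: "('r, 'u) ralg \<Rightarrow> ('r, 'u) ralg \<Rightarrow> ('u \<Rightarrow> 'u) \<Rightarrow> 'u mat \<Rightarrow> 'u mat"
  act :: "('r, 'u) ralg \<Rightarrow> 'u mat \<Rightarrow> 'u mat \<Rightarrow> 'u mat"
  eqv :: "('r, 'u) ralg \<Rightarrow> 'u mat \<Rightarrow> 'u sconst"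

definition presheaf :: "('r, 'm) ring_scheme \<Rightarrow> ('r, 'u) qobj \<Rightarrow> bool" where
  "presheaf R \<tau> \<longleftrightarrow>
     (\<forall>S\<in>ralgs R. \<forall>T\<in>ralgs R. \<forall>f\<in>ralg_hom R S T. \<forall>p\<in>sec \<tau> S. res \<tau> S T f p \<in> sec \<tau> T) \<and>
     (\<forall>S\<in>ralgs R. \<forall>p\<in>sec \<tau> S. res \<tau> S S (\<lambda>s\<in>carrier (fst S). s) p = p) \<and>
     (\<forall>S\<in>ralgs R. \<forall>T\<in>ralgs R. \<forall>W\<in>ralgs R. \<forall>f\<in>ralg_hom R S T. \<forall>g\<in>ralg_hom R T W.
        \<forall>p\<in>sec \<tau> S. res \<tau> S W (compose (carrier (fst S)) g f) p = res \<tau> T W g (res \<tau> S T f p))"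

definition representable :: "('r, 'm) ring_scheme \<Rightarrow> ('r, 'u) qobj \<Rightarrow> bool" where
  "representable R \<tau> \<longleftrightarrow>
     (\<exists>P\<in>ralgs R. \<exists>u\<in>sec \<tau> P. \<forall>S\<in>ralgs R. \<forall>p\<in>sec \<tau> S. \<exists>!f. f \<in> ralg_hom R P S \<and> res \<tau> P S f u = p)"

definition torsor :: "('r, 'm) ring_scheme \<Rightarrow> ('r, 'u) qobj \<Rightarrow> bool" where
  "torsor R \<tau> \<longleftrightarrow> presheaf R \<tau> \<and> representable R \<tau> \<and>
     (\<forall>S\<in>ralgs R. \<forall>p\<in>sec \<tau> S.
        (\<forall>g\<in>G_pts (fst S). act \<tau> S g p \<in> sec \<tau> S) \<and>
        act \<tau> S (mat_one (fst S)) p = p \<and>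
        (\<forall>g\<in>G_pts (fst S). \<forall>h\<in>G_pts (fst S).
           act \<tau> S (mat_mul (fst S) g h) p = act \<tau> S g (act \<tau> S h p)) \<and>
        (\<forall>q\<in>sec \<tau> S. \<exists>!g. g \<in> G_pts (fst S) \<and> act \<tau> S g p = q)) \<and>
     (\<forall>S\<in>ralgs R. \<forall>T\<in>ralgs R. \<forall>f\<in>ralg_hom R S T. \<forall>g\<in>G_pts (fst S). \<forall>p\<in>sec \<tau> S.
        res \<tau> S T f (act \<tau> S g p) = act \<tau> T (mat_map f g) (res \<tau> S T f p)) \<and>
     (\<exists>C. etale_cover R C \<and> (\<forall>T\<in>C. sec \<tau> T \<noteq> {}))"

definition stack_objs :: "('r, 'm) ring_scheme \<Rightarrow> ('r, 'u) qobj set" where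
  "stack_objs R = {\<tau>. torsor R \<tau> \<and>
     (\<forall>S\<in>ralgs R. \<forall>p\<in>sec \<tau> S. eqv \<tau> S p \<in> X_pts (fst S) \<and>
        (\<forall>g\<in>G_pts (fst S). eqv \<tau> S (act \<tau> S g p) = X_act (fst S) g (eqv \<tau> S p))) \<and>
     (\<forall>S\<in>ralgs R. \<forall>T\<in>ralgs R. \<forall>f\<in>ralg_hom R S T. \<forall>p\<in>sec \<tau> S.
        eqv \<tau> T (res \<tau> S T f p) = sconst_map f (eqv \<tau> S p))}"

type_synonym ('r, 'u) qmor = "('r, 'u) ralg \<Rightarrow> 'u mat \<Rightarrow> 'u mat"

definition stack_iso ::
  "('r, 'm) ring_scheme \<Rightarrow> ('r, 'u) qobj \<Rightarrow> ('r, 'u) qobj \<Rightarrow> ('r, 'u) qmor \<Rightarrow> bool" where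
  "stack_iso R \<tau> \<tau>' \<beta> \<longleftrightarrow>
     (\<forall>S\<in>ralgs R. bij_betw (\<beta> S) (sec \<tau> S) (sec \<tau>' S) \<and>
        (\<forall>p\<in>sec \<tau> S. eqv \<tau>' S (\<beta> S p) = eqv \<tau> S p \<and>
           (\<forall>g\<in>G_pts (fst S). \<beta> S (act \<tau> S g p) = act \<tau>' S g (\<beta> S p)))) \<and>
     (\<forall>S\<in>ralgs R. \<forall>T\<in>ralgs R. \<forall>f\<in>ralg_hom R S T. \<forall>p\<in>sec \<tau> S.
        \<beta> T (res \<tau> S T f p) = res \<tau>' S T f (\<beta> S p))"

text \<open>Pullback along \<open>Spec R' \<rightarrow> Spec R\<close>, for a ring homomorphism \<open>\<rho> : R \<rightarrow> R'\<close>.\<close>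

definition pull :: "('r \<Rightarrow> 's) \<Rightarrow> ('r, 'u) qobj \<Rightarrow> ('s, 'u) qobj" where
  "pull \<rho> \<tau> =
     \<lparr> sec = (\<lambda>S. sec \<tau> (along \<rho> S)),
       res = (\<lambda>S T. res \<tau> (along \<rho> S) (along \<rho> T)),
       act = (\<lambda>S. act \<tau> (along \<rho> S)),
       eqv = (\<lambda>S. eqv \<tau> (along \<rho> S)) \<rparr>"

definition pull_mor :: "('r \<Rightarrow> 's) \<Rightarrow> ('r, 'u) qmor \<Rightarrow> ('s, 'u) qmor" where
  "pull_mor \<rho> \<beta> = (\<lambda>S. \<beta> (along \<rho> S))"

text \<open>The composite \<open>Spec R \<rightarrow> X\<^sub>4 \<rightarrow> [X\<^sub>4/G]\<close> for \<open>c \<in> X\<^sub>4(R)\<close>: the trivial torsor with its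
  orbit map \<open>g \<mapsto> g \<cdot> c\<close>.\<close>

definition stack_pt :: "'r sconst \<Rightarrow> ('r, 'u) qobj" where
  "stack_pt c =
     \<lparr> sec = (\<lambda>S. G_pts (fst S)),
       res = (\<lambda>S T f. mat_map f),
       act = (\<lambda>S. mat_mul (fst S)),
       eqv = (\<lambda>S g. X_act (fst S) g (sconst_map (snd S) c)) \<rparr>"


section \<open>The tangent space of the stack at a \<open>K\<close>-point\<close>

text \<open>\<open>K[\<epsilon>]/(\<epsilon>\<^sup>2)\<close> and \<open>K[\<epsilon>\<^sub>1, \<epsilon>\<^sub>2]/(\<epsilon>\<^sub>1, \<epsilon>\<^sub>2)\<^sup>2\<close>; the pair \<open>(a, b)\<close> stands for \<open>a + b \<epsilon>\<close>, and
  the map to \<open>K\<close> is \<open>fst\<close> in both cases.\<close>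

definition dual_numbers :: "('k, 'm) ring_scheme \<Rightarrow> ('k \<times> 'k) ring" where
  "dual_numbers K =
     \<lparr> carrier = carrier K \<times> carrier K,
       monoid.mult = (\<lambda>(a, b) (a', b'). (a \<otimes>\<^bsub>K\<^esub> a', (a \<otimes>\<^bsub>K\<^esub> b') \<oplus>\<^bsub>K\<^esub> (b \<otimes>\<^bsub>K\<^esub> a'))),
       monoid.one = (\<one>\<^bsub>K\<^esub>, \<zero>\<^bsub>K\<^esub>), ring.zero = (\<zero>\<^bsub>K\<^esub>, \<zero>\<^bsub>K\<^esub>),
       add = (\<lambda>(a, b) (a', b'). (a \<oplus>\<^bsub>K\<^esub> a', b \<oplus>\<^bsub>K\<^esub> b')) \<rparr>"

definition dual_numbers2 :: "('k, 'm) ring_scheme \<Rightarrow> ('k \<times> 'k \<times> 'k) ring" where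
  "dual_numbers2 K =
     \<lparr> carrier = carrier K \<times> carrier K \<times> carrier K,
       monoid.mult = (\<lambda>(a, b, c) (a', b', c').
         (a \<otimes>\<^bsub>K\<^esub> a', (a \<otimes>\<^bsub>K\<^esub> b') \<oplus>\<^bsub>K\<^esub> (b \<otimes>\<^bsub>K\<^esub> a'), (a \<otimes>\<^bsub>K\<^esub> c') \<oplus>\<^bsub>K\<^esub> (c \<otimes>\<^bsub>K\<^esub> a'))),
       monoid.one = (\<one>\<^bsub>K\<^esub>, \<zero>\<^bsub>K\<^esub>, \<zero>\<^bsub>K\<^esub>), ring.zero = (\<zero>\<^bsub>K\<^esub>, \<zero>\<^bsub>K\<^esub>, \<zero>\<^bsub>K\<^esub>),
       add = (\<lambda>(a, b, c) (a', b', c'). (a \<oplus>\<^bsub>K\<^esub> a', b \<oplus>\<^bsub>K\<^esub> b', c \<oplus>\<^bsub>K\<^esub> c')) \<rparr>"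

type_synonym ('k, 'u) tvec = "(('k \<times> 'k, 'u) qobj \<times> ('k, 'u) qmor) set"

definition tan_pairs ::
  "('k, 'm) ring_scheme \<Rightarrow> ('k, 'u) qobj \<Rightarrow> (('k \<times> 'k, 'u) qobj \<times> ('k, 'u) qmor) set" where
  "tan_pairs K x = {(\<tau>, \<alpha>). \<tau> \<in> stack_objs (dual_numbers K) \<and> stack_iso K x (pull fst \<tau>) \<alpha>}"

definition tan_rel ::
  "('k, 'm) ring_scheme \<Rightarrow> ('k, 'u) qobj \<Rightarrow>
     ((('k \<times> 'k, 'u) qobj \<times> ('k, 'u) qmor) \<times> (('k \<times> 'k, 'u) qobj \<times> ('k, 'u) qmor)) set" where
  "tan_rel K x = {((\<tau>, \<alpha>), (\<tau>', \<alpha>')).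
     (\<tau>, \<alpha>) \<in> tan_pairs K x \<and> (\<tau>', \<alpha>') \<in> tan_pairs K x \<and>
     (\<exists>\<beta>. stack_iso (dual_numbers K) \<tau> \<tau>' \<beta> \<and>
        (\<forall>S\<in>ralgs K. \<forall>p\<in>sec x S. \<alpha>' S p = pull_mor fst \<beta> S (\<alpha> S p)))}"

definition tan_class ::
  "('k, 'm) ring_scheme \<Rightarrow> ('k, 'u) qobj \<Rightarrow> ('k \<times> 'k, 'u) qobj \<Rightarrow> ('k, 'u) qmor \<Rightarrow> ('k, 'u) tvec" where
  "tan_class K x \<tau> \<alpha> = tan_rel K x `` {(\<tau>, \<alpha>)}"

text \<open>The vector space structure is the usual one on the tangent space of a stack.  Scalars
  act by pullback along \<open>\<epsilon> \<mapsto> a \<epsilon>\<close>.  The sum of \<open>u\<close> and \<open>v\<close> is obtained by gluing them to an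
  object over \<open>K[\<epsilon>\<^sub>1, \<epsilon>\<^sub>2]/(\<epsilon>\<^sub>1, \<epsilon>\<^sub>2)\<^sup>2 = K[\<epsilon>] \<times>\<^sub>K K[\<epsilon>]\<close> and restricting this along
  \<open>\<epsilon>\<^sub>1, \<epsilon>\<^sub>2 \<mapsto> \<epsilon>\<close>.\<close>

definition tan_sum ::
  "('k, 'm) ring_scheme \<Rightarrow> ('k, 'u) qobj \<Rightarrow> ('k, 'u) tvec \<Rightarrow> ('k, 'u) tvec \<Rightarrow> ('k, 'u) tvec \<Rightarrow> bool" where
  "tan_sum K x u v w \<longleftrightarrow>
     (\<exists>\<sigma>\<in>stack_objs (dual_numbers2 K). \<exists>\<alpha>. stack_iso K x (pull fst \<sigma>) \<alpha> \<and>
        u = tan_class K x (pull (\<lambda>(a, b, c). (a, b)) \<sigma>) \<alpha> \<and>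
        v = tan_class K x (pull (\<lambda>(a, b, c). (a, c)) \<sigma>) \<alpha> \<and>
        w = tan_class K x (pull (\<lambda>(a, b, c). (a, b \<oplus>\<^bsub>K\<^esub> c)) \<sigma>) \<alpha>)"

definition tangent_space ::
  "('k, 'm) ring_scheme \<Rightarrow> ('k, 'u) qobj \<Rightarrow> ('k, ('k, 'u) tvec) module" where
  "tangent_space K x =
     \<lparr> carrier = tan_pairs K x // tan_rel K x, monoid.mult = undefined, monoid.one = undefined,
       ring.zero = tan_class K x (pull (\<lambda>a. (a, \<zero>\<^bsub>K\<^esub>)) x) (\<lambda>S p. p),
       add = (\<lambda>u v. THE w. tan_sum K x u v w),
       smult = (\<lambda>a u. \<Union>(\<tau>, \<alpha>)\<in>u. tan_class K x (pull (\<lambda>(b, c). (b, a \<otimes>\<^bsub>K\<^esub> c)) \<tau>) \<alpha>) \<rparr>"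

text \<open>The map \<open>T\<^sub>x \<rightarrow> T\<^sub>y\<close> induced by the inverse of an isomorphism \<open>\<gamma> : y \<rightarrow> x\<close>.\<close>

definition tan_map ::
  "('k, 'm) ring_scheme \<Rightarrow> ('k, 'u) qobj \<Rightarrow> ('k, 'u) qmor \<Rightarrow> ('k, 'u) tvec \<Rightarrow> ('k, 'u) tvec" where
  "tan_map K y \<gamma> u = (\<Union>(\<tau>, \<alpha>)\<in>u. tan_class K y \<tau> (\<lambda>S p. \<alpha> S (\<gamma> S p)))"


section \<open>The point of the stack given by an algebra\<close>

definition basis_expansion ::
  "('k, 'm) ring_scheme \<Rightarrow> ('k, 'a) module \<Rightarrow> (nat \<Rightarrow> 'a) \<Rightarrow> 'a \<Rightarrow> (nat \<Rightarrow> 'k) \<Rightarrow> bool" where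
  "basis_expansion K A e a x \<longleftrightarrow>
     (\<forall>k. x k \<in> carrier K) \<and> (\<forall>k\<ge>16. x k = \<zero>\<^bsub>K\<^esub>) \<and> a = (\<Oplus>\<^bsub>A\<^esub>k\<in>{..<16}. x k \<odot>\<^bsub>A\<^esub> e k)"

definition homogeneous_basis ::
  "('k, 'm) ring_scheme \<Rightarrow> ('k, 'a) module \<Rightarrow> (nat \<Rightarrow> 'a set) \<Rightarrow> (nat \<Rightarrow> 'a) \<Rightarrow> bool" where
  "homogeneous_basis K A gr e \<longleftrightarrow>
     e 0 = \<one>\<^bsub>A\<^esub> \<and> (\<forall>i<16. e i \<in> gr (bdeg i)) \<and>
     (\<forall>a\<in>carrier A. \<exists>!x. basis_expansion K A e a x)"

definition coords ::
  "('k, 'm) ring_scheme \<Rightarrow> ('k, 'a) module \<Rightarrow> (nat \<Rightarrow> 'a) \<Rightarrow> 'a \<Rightarrow> nat \<Rightarrow> 'k" where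
  "coords K A e a = (THE x. basis_expansion K A e a x)"

definition struct_consts ::
  "('k, 'm) ring_scheme \<Rightarrow> ('k, 'a) module \<Rightarrow> (nat \<Rightarrow> 'a) \<Rightarrow> 'k sconst" where
  "struct_consts K A e =
     (\<lambda>i j k. if i < 16 \<and> j < 16 then coords K A e (e i \<otimes>\<^bsub>A\<^esub> e j) k else \<zero>\<^bsub>K\<^esub>)"

definition alg_pt ::
  "('k, 'm) ring_scheme \<Rightarrow> ('k, 'a) module \<Rightarrow> (nat \<Rightarrow> 'a) \<Rightarrow> ('k, 'u) qobj" where
  "alg_pt K A e = stack_pt (struct_consts K A e)"

text \<open>The structure constants over \<open>K[\<epsilon>]\<close> of the multiplication \<open>a b + \<epsilon> \<phi>(a, b)\<close>.\<close>

definition deformed_consts ::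
  "('k, 'm) ring_scheme \<Rightarrow> ('k, 'a) module \<Rightarrow> (nat \<Rightarrow> 'a) \<Rightarrow> ('a list \<Rightarrow> 'a) \<Rightarrow> ('k \<times> 'k) sconst" where
  "deformed_consts K A e \<phi> =
     (\<lambda>i j k. (struct_consts K A e i j k,
               if i < 16 \<and> j < 16 then coords K A e (\<phi> [e i, e j]) k else \<zero>\<^bsub>K\<^esub>))"

text \<open>If \<open>g\<close> is the matrix of an isomorphism \<open>f : A \<rightarrow> B\<close> in the bases \<open>e\<close> and \<open>e'\<close>, then
  \<open>g\<close> takes the structure constants of \<open>A\<close> to those of \<open>B\<close>, and right translation by \<open>g\<close> is an
  isomorphism from the point of \<open>B\<close> to that of \<open>A\<close>.\<close>

definition alg_pt_mor ::
  "('k, 'm) ring_scheme \<Rightarrow> (nat \<Rightarrow> 'a) \<Rightarrow> ('k, 'b) module \<Rightarrow> (nat \<Rightarrow> 'b) \<Rightarrow> ('a \<Rightarrow> 'b) \<Rightarrow> ('k, 'u) qmor" where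
  "alg_pt_mor K e B e' f =
     (\<lambda>S p. mat_mul (fst S) p
        (mat_map (snd S) (\<lambda>i j. if j < 16 then coords K B e' (f (e j)) i else \<zero>\<^bsub>K\<^esub>)))"

end

theory Submission
  imports Defs
begin

text \<open>Let \<open>c\<close> be the structure constants of \<open>A\<close>.  An object of the stack over \<open>K[\<epsilon>]\<close> whose
  restriction to \<open>K\<close> is trivial is itself trivial: the torsor has points over \<open>F[\<epsilon>]\<close> for some field
  \<open>F\<close> over \<open>K\<close>, a translation makes such a point agree with the given one modulo \<open>\<epsilon>\<close>, and a
  \<open>K\<close>-linear retraction \<open>F \<rightarrow> K\<close> brings it down to \<open>K[\<epsilon>]\<close>.  Hence tangent vectors are the
  deformations \<open>c + \<epsilon> \<phi>\<close> in \<open>X\<^sub>4(K[\<epsilon>])\<close> modulo the matrices \<open>1 + \<epsilon> L\<close> in \<open>G(K[\<epsilon>])\<close>.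
  Associativity means that \<open>\<phi>\<close> is a Hochschild cocycle and unitality that \<open>\<phi>(1, 1) = 0\<close>, while the
  Frobenius condition is open and so no restriction; \<open>1 + \<epsilon> L\<close> changes \<open>\<phi>\<close> by the coboundary of
  \<open>L\<close>.  Every class has a normalized representative, obtained by subtracting the coboundary of
  \<open>x \<mapsto> \<phi>(1, 1) x\<close>, and two normalized representatives differ by the coboundary of some \<open>L\<close> with
  \<open>L 1 = 0\<close>, as it has to be for \<open>1 + \<epsilon> L\<close> to lie in \<open>G\<close>.\<close>

section \<open>Vectors and matrices of size 16\<close>

text \<open>The obstacle is to find a section over K[\<epsilon>] at all: the cover only yields one
  over an etale algebra, and the K-linear retraction L \<rightarrow> K that should bring it down is
  not a ring homomorphism, so it cannot be applied to sections. Representability helps. A section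
  over L[\<epsilon>] that agrees with a K-section modulo \<epsilon> is a homomorphism f + \<epsilon>
  \<delta> on the ring of the torsor with f valued in K, and the derivation \<delta> may be composed
  with any K-linear map. Test rings are carried by the fixed type \<open>'u\<close>, so copies of
  K[\<epsilon>], L[\<epsilon>] and the coordinate ring of G have to be encoded there. This is
  possible because \<open>'u\<close> is infinite, which comes from characteristic zero and the
  embedding of K. The sum of tangent vectors calls for the same analysis over
  K[\<epsilon>1, \<epsilon>2]/(\<epsilon>1, \<epsilon>2)^2, which is why the results on lifting and
  normal forms are stated for a general base ring R with a map to K.\<close>

definition vecs :: "('u, 'm) ring_scheme \<Rightarrow> (nat \<Rightarrow> 'u) set" where
  "vecs S = {x. (\<forall>i. x i \<in> carrier S) \<and> (\<forall>i\<ge>16. x i = \<zero>\<^bsub>S\<^esub>)}"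

text \<open>Linearity is stated as the expansion over the standard basis, whose i-th vector is the
  row \<open>mat_one S i\<close>. This one equation is stable under linear combinations and
  composition, and it reduces identities between multilinear expressions to basis vectors.\<close>

definition linear_form :: "('u, 'm) ring_scheme \<Rightarrow> ((nat \<Rightarrow> 'u) \<Rightarrow> 'u) \<Rightarrow> bool" where
  "linear_form S L \<longleftrightarrow> (\<forall>x\<in>vecs S. L x \<in> carrier S \<and>
     L x = (\<Oplus>\<^bsub>S\<^esub>i\<in>{..<16}. x i \<otimes>\<^bsub>S\<^esub> L (mat_one S i)))"

definition mat_vec :: "('u, 'm) ring_scheme \<Rightarrow> 'u mat \<Rightarrow> (nat \<Rightarrow> 'u) \<Rightarrow> nat \<Rightarrow> 'u" where
  "mat_vec S g x = (\<lambda>i. \<Oplus>\<^bsub>S\<^esub>k\<in>{..<16}. g i k \<otimes>\<^bsub>S\<^esub> x k)"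

definition col :: "'u mat \<Rightarrow> nat \<Rightarrow> nat \<Rightarrow> 'u" where
  "col g j = (\<lambda>i. g i j)"

definition bil :: "('u, 'm) ring_scheme \<Rightarrow> 'u mat \<Rightarrow> (nat \<Rightarrow> 'u) \<Rightarrow> (nat \<Rightarrow> 'u) \<Rightarrow> 'u" where
  "bil S h x y = (\<Oplus>\<^bsub>S\<^esub>p\<in>{..<16}. x p \<otimes>\<^bsub>S\<^esub> (\<Oplus>\<^bsub>S\<^esub>q\<in>{..<16}. y q \<otimes>\<^bsub>S\<^esub> h p q))"

definition mulv :: "('u, 'm) ring_scheme \<Rightarrow> 'u sconst \<Rightarrow> (nat \<Rightarrow> 'u) \<Rightarrow> (nat \<Rightarrow> 'u) \<Rightarrow> nat \<Rightarrow> 'u" where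
  "mulv S c x y = (\<lambda>k. bil S (\<lambda>p q. c p q k) x y)"

lemma vecsI: "\<lbrakk>\<And>i. x i \<in> carrier S; \<And>i. i \<ge> 16 \<Longrightarrow> x i = \<zero>\<^bsub>S\<^esub>\<rbrakk> \<Longrightarrow> x \<in> vecs S"
  by (auto simp: vecs_def)

lemma vecs_outside: "x \<in> vecs S \<Longrightarrow> 16 \<le> i \<Longrightarrow> x i = \<zero>\<^bsub>S\<^esub>"
  by (auto simp: vecs_def)

lemma mats_outside: "g \<in> mats S \<Longrightarrow> 16 \<le> i \<or> 16 \<le> j \<Longrightarrow> g i j = \<zero>\<^bsub>S\<^esub>"
  by (auto simp: mats_def)

lemma matsI:
  "\<lbrakk>\<And>i j. g i j \<in> carrier S; \<And>i j. 16 \<le> i \<or> 16 \<le> j \<Longrightarrow> g i j = \<zero>\<^bsub>S\<^esub>\<rbrakk> \<Longrightarrow> g \<in> mats S"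
  by (auto simp: mats_def)

lemma vecs_carrier [simp]: "x \<in> vecs S \<Longrightarrow> x i \<in> carrier S"
  by (auto simp: vecs_def)

lemma mats_carrier [simp]: "g \<in> mats S \<Longrightarrow> g i j \<in> carrier S"
  by (auto simp: mats_def)

lemma mats_eqI:
  "\<lbrakk>g \<in> mats S; h \<in> mats S; \<And>i j. \<lbrakk>i < 16; j < 16\<rbrakk> \<Longrightarrow> g i j = h i j\<rbrakk> \<Longrightarrow> g = h"
proof (intro ext)
  fix i j assume *: "g \<in> mats S" "h \<in> mats S" "\<And>i j. \<lbrakk>i < 16; j < 16\<rbrakk> \<Longrightarrow> g i j = h i j"
  show "g i j = h i j"
    using * by (cases "i < 16 \<and> j < 16") (auto simp: mats_outside not_less)
qed

lemma vecs_eqI: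
  "\<lbrakk>x \<in> vecs S; y \<in> vecs S; \<And>i. i < 16 \<Longrightarrow> x i = y i\<rbrakk> \<Longrightarrow> x = y"
proof (intro ext)
  fix i assume *: "x \<in> vecs S" "y \<in> vecs S" "\<And>i. i < 16 \<Longrightarrow> x i = y i"
  show "x i = y i"
    using * by (cases "i < 16") (auto simp: vecs_outside not_less)
qed

lemma col_vecs [simp, intro]: "g \<in> mats S \<Longrightarrow> col g j \<in> vecs S"
  by (rule vecsI) (auto simp: col_def mats_outside)

context cring
begin

lemma finsum_swap:
  assumes "finite A" "finite B" "\<And>i j. \<lbrakk>i \<in> A; j \<in> B\<rbrakk> \<Longrightarrow> f i j \<in> carrier R"
  shows "(\<Oplus>i\<in>A. \<Oplus>j\<in>B. f i j) = (\<Oplus>j\<in>B. \<Oplus>i\<in>A. f i j)"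
  using assms(1,3)
proof (induction A rule: finite_induct)
  case empty
  then show ?case by simp
next
  case (insert a A)
  have "(\<Oplus>i\<in>insert a A. \<Oplus>j\<in>B. f i j) = (\<Oplus>j\<in>B. f a j) \<oplus> (\<Oplus>i\<in>A. \<Oplus>j\<in>B. f i j)"
    using insert by (subst finsum_insert) (auto intro!: finsum_closed)
  also have "\<dots> = (\<Oplus>j\<in>B. f a j) \<oplus> (\<Oplus>j\<in>B. \<Oplus>i\<in>A. f i j)"
    using insert by simp
  also have "\<dots> = (\<Oplus>j\<in>B. f a j \<oplus> (\<Oplus>i\<in>A. f i j))"
    using insert by (subst finsum_addf) (auto intro!: finsum_closed)
  also have "\<dots> = (\<Oplus>j\<in>B. \<Oplus>i\<in>insert a A. f i j)"
    using insert by (intro finsum_cong') (auto intro!: finsum_closed simp: finsum_insert)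
  finally show ?case .
qed

lemma finsum_eqI: "(\<And>i. i \<in> A \<Longrightarrow> f i = g i) \<Longrightarrow> (\<And>i. i \<in> A \<Longrightarrow> g i \<in> carrier R) \<Longrightarrow> finsum R f A = finsum R g A"
  by (rule finsum_cong') auto

lemma mat_one_sym: "mat_one R i j = mat_one R j i"
  by (auto simp: mat_one_def)

lemma mat_one_carrier [simp, intro]: "mat_one R i j \<in> carrier R"
  by (auto simp: mat_one_def)

lemma mat_one_vecs [simp, intro]: "mat_one R i \<in> vecs R"
  by (rule vecsI) (auto simp: mat_one_def)

lemma mat_one_mats [simp, intro]: "mat_one R \<in> mats R"
  by (rule matsI) (auto simp: mat_one_def)

lemma col_mat_one: "col (mat_one R) j = mat_one R j"
  by (auto simp: col_def mat_one_def)

lemma finsum_mat_one: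
  assumes "k < 16" "\<And>i. i < 16 \<Longrightarrow> x i \<in> carrier R"
  shows "(\<Oplus>i\<in>{..<16}. x i \<otimes> mat_one R i k) = x k"
    "(\<Oplus>i\<in>{..<16}. mat_one R k i \<otimes> x i) = x k"
proof -
  have "(\<Oplus>i\<in>{..<16}. x i \<otimes> mat_one R i k) = (\<Oplus>i\<in>{..<16}. if k = i then x i else \<zero>)"
    using assms by (intro finsum_eqI) (auto simp: mat_one_def)
  also have "\<dots> = x k"
    using assms by (intro add.finprod_singleton) auto
  finally show "(\<Oplus>i\<in>{..<16}. x i \<otimes> mat_one R i k) = x k" .
  have "(\<Oplus>i\<in>{..<16}. mat_one R k i \<otimes> x i) = (\<Oplus>i\<in>{..<16}. if k = i then x i else \<zero>)"
    using assms by (intro finsum_eqI) (auto simp: mat_one_def)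
  also have "\<dots> = x k"
    using assms by (intro add.finprod_singleton) auto
  finally show "(\<Oplus>i\<in>{..<16}. mat_one R k i \<otimes> x i) = x k" .
qed

section \<open>Linear forms, and equality tested on basis vectors\<close>

lemma linear_form_closed: "linear_form R L \<Longrightarrow> x \<in> vecs R \<Longrightarrow> L x \<in> carrier R"
  unfolding linear_form_def by blast

lemma linear_form_expand:
  "linear_form R L \<Longrightarrow> x \<in> vecs R \<Longrightarrow> L x = (\<Oplus>i\<in>{..<16}. x i \<otimes> L (mat_one R i))"
  unfolding linear_form_def by blast

lemma linear_form_eqI:
  assumes "linear_form R L" "linear_form R M" "x \<in> vecs R"
    "\<And>i. i < 16 \<Longrightarrow> L (mat_one R i) = M (mat_one R i)"
  shows "L x = M x"
proof -
  have "L x = (\<Oplus>i\<in>{..<16}. x i \<otimes> L (mat_one R i))"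
    using assms by (intro linear_form_expand)
  also have "\<dots> = (\<Oplus>i\<in>{..<16}. x i \<otimes> M (mat_one R i))"
    using assms linear_form_closed[OF assms(2)] by (intro finsum_eqI) auto
  also have "\<dots> = M x"
    using assms by (intro linear_form_expand [symmetric])
  finally show ?thesis .
qed

lemma linear_form_coord: "linear_form R (\<lambda>x. x k)"
proof (cases "k < 16")
  case True
  then show ?thesis by (auto simp: linear_form_def finsum_mat_one)
next
  case False
  have "x k = (\<Oplus>i\<in>{..<16}. x i \<otimes> mat_one R i k)" if "x \<in> vecs R" for x
  proof -
    have "(\<Oplus>i\<in>{..<16}. x i \<otimes> mat_one R i k) = (\<Oplus>i\<in>{..<16::nat}. \<zero>)"
      using False that by (intro finsum_eqI) (auto simp: mat_one_def)
    then show ?thesis using False that by (simp add: vecs_outside)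
  qed
  then show ?thesis by (auto simp: linear_form_def)
qed

text \<open>Each \<open>L j\<close> is expanded over the basis, and the two sums are
  interchanged.\<close>

lemma linear_form_comb:
  fixes a :: "nat \<Rightarrow> 'a"
  assumes "\<And>j. j < 16 \<Longrightarrow> a j \<in> carrier R" "\<And>j. j < 16 \<Longrightarrow> linear_form R (L j)"
  shows "linear_form R (\<lambda>x. \<Oplus>j\<in>{..<16}. a j \<otimes> L j x)"
  unfolding linear_form_def
proof (intro ballI conjI)
  fix x assume x: "x \<in> vecs R"
  note cl = linear_form_closed[OF assms(2)]
  show "(\<Oplus>j\<in>{..<16}. a j \<otimes> L j x) \<in> carrier R"
    using assms x by (auto simp: cl)
  have "(\<Oplus>j\<in>{..<16}. a j \<otimes> L j x) = (\<Oplus>j\<in>{..<16}. \<Oplus>i\<in>{..<16}. x i \<otimes> (a j \<otimes> L j (mat_one R i)))"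
  proof (intro finsum_eqI)
    fix j assume j: "j \<in> {..<16::nat}"
    have "a j \<otimes> L j x = a j \<otimes> (\<Oplus>i\<in>{..<16}. x i \<otimes> L j (mat_one R i))"
      using j assms(2) x by (subst linear_form_expand) auto
    also have "\<dots> = (\<Oplus>i\<in>{..<16}. a j \<otimes> (x i \<otimes> L j (mat_one R i)))"
      using j assms x by (intro finsum_rdistr) (auto simp: cl)
    also have "\<dots> = (\<Oplus>i\<in>{..<16}. x i \<otimes> (a j \<otimes> L j (mat_one R i)))"
      using j assms x by (intro finsum_eqI m_lcomm) (auto simp: cl)
    finally show "a j \<otimes> L j x = (\<Oplus>i\<in>{..<16}. x i \<otimes> (a j \<otimes> L j (mat_one R i)))" .
  qed (use assms x in \<open>auto simp: cl\<close>)
  also have "\<dots> = (\<Oplus>i\<in>{..<16}. \<Oplus>j\<in>{..<16}. x i \<otimes> (a j \<otimes> L j (mat_one R i)))"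
    using assms x by (intro finsum_swap) (auto simp: cl)
  also have "\<dots> = (\<Oplus>i\<in>{..<16}. x i \<otimes> (\<Oplus>j\<in>{..<16}. a j \<otimes> L j (mat_one R i)))"
    using assms x by (intro finsum_eqI finsum_rdistr[symmetric]) (auto simp: cl)
  finally show "(\<Oplus>j\<in>{..<16}. a j \<otimes> L j x) = (\<Oplus>i\<in>{..<16}. x i \<otimes> (\<Oplus>j\<in>{..<16}. a j \<otimes> L j (mat_one R i)))" .
qed

lemma linear_form_cong:
  assumes "linear_form R L" "\<And>x. x \<in> vecs R \<Longrightarrow> M x = L x"
  shows "linear_form R M"
  unfolding linear_form_def
proof (intro ballI conjI)
  fix x assume x: "x \<in> vecs R"
  show "M x \<in> carrier R" using assms x by (simp add: linear_form_closed)
  have "L x = (\<Oplus>i\<in>{..<16}. x i \<otimes> L (mat_one R i))"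
    using assms x by (intro linear_form_expand)
  then show "M x = (\<Oplus>i\<in>{..<16}. x i \<otimes> M (mat_one R i))"
    using assms x by simp
qed

lemma linear_form_comb':
  fixes a :: "nat \<Rightarrow> 'a"
  assumes "\<And>j. j < 16 \<Longrightarrow> a j \<in> carrier R" "\<And>j. j < 16 \<Longrightarrow> linear_form R (L j)"
  shows "linear_form R (\<lambda>x. \<Oplus>j\<in>{..<16}. L j x \<otimes> a j)"
  by (rule linear_form_cong[OF linear_form_comb[of a L]])
    (use assms linear_form_closed[OF assms(2)] in \<open>auto intro!: finsum_eqI m_comm\<close>)

text \<open>Expanding L over the basis turns \<open>L (M x)\<close> into a combination of the forms
  \<open>\<lambda>x. M x i\<close> with the constant coefficients
  \<open>L (mat_one R i)\<close>.\<close>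

lemma linear_form_comp:
  assumes "linear_form R L" "\<And>k. linear_form R (\<lambda>x. M x k)" "\<And>x. x \<in> vecs R \<Longrightarrow> M x \<in> vecs R"
  shows "linear_form R (\<lambda>x. L (M x))"
  by (rule linear_form_cong[OF linear_form_comb'[of "\<lambda>i. L (mat_one R i)" "\<lambda>i x. M x i"]])
    (use assms linear_form_closed[OF assms(1)] in \<open>auto intro!: linear_form_expand\<close>)

section \<open>Matrix products and inverses\<close>

lemma mat_vec_linear:
  "(\<And>i j. g i j \<in> carrier R) \<Longrightarrow> linear_form R (\<lambda>x. mat_vec R g x k)"
  unfolding mat_vec_def by (intro linear_form_comb linear_form_coord)

lemma mat_vec_carrier:
  "(\<And>i j. g i j \<in> carrier R) \<Longrightarrow> x \<in> vecs R \<Longrightarrow> mat_vec R g x k \<in> carrier R"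
  using linear_form_closed[OF mat_vec_linear] .

lemma finsum_zeroI: "(\<And>i. i \<in> A \<Longrightarrow> f i = \<zero>) \<Longrightarrow> finsum R f A = \<zero>"
  using finsum_eqI[of A f "\<lambda>_. \<zero>"] by simp

lemma mat_vec_vecs [simp, intro]: "g \<in> mats R \<Longrightarrow> x \<in> vecs R \<Longrightarrow> mat_vec R g x \<in> vecs R"
  by (rule vecsI) (auto simp: mat_vec_carrier mat_vec_def mats_outside intro!: finsum_zeroI)

lemma mat_vec_mat_one:
  "(\<And>i j. g i j \<in> carrier R) \<Longrightarrow> i < 16 \<Longrightarrow> mat_vec R g (mat_one R i) = col g i"
  by (rule ext) (simp add: mat_vec_def finsum_mat_one col_def mat_one_sym[of i])

lemma mat_one_vec: "x \<in> vecs R \<Longrightarrow> mat_vec R (mat_one R) x = x"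
proof (rule vecs_eqI[of _ R])
  fix i :: nat assume "x \<in> vecs R" "i < 16"
  then show "mat_vec R (mat_one R) x i = x i"
    by (simp add: mat_vec_def finsum_mat_one)
qed auto

lemma col_mat_mul: "col (mat_mul R g h) j = mat_vec R g (col h j)"
  by (simp add: col_def mat_mul_def mat_vec_def)

lemma mat_mul_mats [simp, intro]:
  assumes "g \<in> mats R" "h \<in> mats R" shows "mat_mul R g h \<in> mats R"
proof (rule matsI)
  show "mat_mul R g h i j \<in> carrier R" for i j
    using assms by (auto simp: mat_mul_def)
  show "mat_mul R g h i j = \<zero>" if "16 \<le> i \<or> 16 \<le> j" for i j
    using assms that by (auto simp: mat_mul_def mats_outside intro!: finsum_zeroI)
qed

text \<open>Both sides are linear in x, and on a basis vector the claim is the description of the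
  columns of a product. Associativity of \<open>mat_mul\<close> then follows column by column,
  without double sums.\<close>

lemma mat_vec_mul:
  assumes "g \<in> mats R" "h \<in> mats R" "x \<in> vecs R"
  shows "mat_vec R (mat_mul R g h) x = mat_vec R g (mat_vec R h x)"
proof
  fix k
  have L: "linear_form R (\<lambda>x. mat_vec R (mat_mul R g h) x k)"
    using assms by (intro mat_vec_linear) simp
  have M: "linear_form R (\<lambda>x. mat_vec R g (mat_vec R h x) k)"
    by (rule linear_form_comp[of "\<lambda>y. mat_vec R g y k" "mat_vec R h"]) (use assms in \<open>simp_all add: mat_vec_linear\<close>)
  show "mat_vec R (mat_mul R g h) x k = mat_vec R g (mat_vec R h x) k"
    by (rule linear_form_eqI[OF L M assms(3)]) (use assms in \<open>simp_all add: mat_vec_mat_one col_mat_mul\<close>)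
qed

lemma mats_col_eqI:
  assumes "\<And>j. col g j = col h j" shows "g = h"
  using assms by (metis col_def ext)

lemma mat_mul_assoc:
  assumes "g \<in> mats R" "h \<in> mats R" "k \<in> mats R"
  shows "mat_mul R (mat_mul R g h) k = mat_mul R g (mat_mul R h k)"
  using assms by (intro mats_col_eqI) (simp add: col_mat_mul mat_vec_mul)

lemma mat_mul_one_left [simp]: "g \<in> mats R \<Longrightarrow> mat_mul R (mat_one R) g = g"
  by (rule mats_col_eqI) (simp add: col_mat_mul mat_one_vec)

lemma mat_mul_one_right [simp]: "g \<in> mats R \<Longrightarrow> mat_mul R g (mat_one R) = g"
  by (rule mats_eqI[OF mat_mul_mats], simp_all) (simp add: mat_mul_def finsum_mat_one)

lemma mat_left_right_inverse:
  assumes "g \<in> mats R" "h \<in> mats R" "h' \<in> mats R"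
    "mat_mul R h g = mat_one R" "mat_mul R g h' = mat_one R"
  shows "h = h'"
proof -
  have "mat_mul R h (mat_mul R g h') = mat_mul R (mat_mul R h g) h'"
    using assms(1-3) by (simp add: mat_mul_assoc)
  then show ?thesis using assms by simp
qed

lemma mat_inverse_unique:
  assumes "g \<in> mats R" "mat_inverse R g h" "mat_inverse R g h'"
  shows "h = h'"
  using assms by (intro mat_left_right_inverse[of g h h']) (auto simp: mat_inverse_def)

lemma mat_inv_eq: "g \<in> mats R \<Longrightarrow> mat_inverse R g h \<Longrightarrow> mat_inv R g = h"
  unfolding mat_inv_def by (rule the_equality) (auto intro: mat_inverse_unique)

lemma mat_inverse_sym: "g \<in> mats R \<Longrightarrow> mat_inverse R g h \<Longrightarrow> mat_inverse R h g"
  by (auto simp: mat_inverse_def)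

lemma mat_inverse_one: "mat_inverse R (mat_one R) (mat_one R)"
  by (auto simp: mat_inverse_def)

lemma mat_inverse_mul:
  assumes "g \<in> mats R" "h \<in> mats R" "mat_inverse R g g'" "mat_inverse R h h'"
  shows "mat_inverse R (mat_mul R g h) (mat_mul R h' g')"
proof -
  have m: "g' \<in> mats R" "h' \<in> mats R" using assms by (auto simp: mat_inverse_def)
  have "mat_mul R (mat_mul R g h) (mat_mul R h' g') = mat_mul R g (mat_mul R (mat_mul R h h') g')"
    using assms m by (simp add: mat_mul_assoc mat_mul_mats)
  moreover have "mat_mul R (mat_mul R h' g') (mat_mul R g h) = mat_mul R h' (mat_mul R (mat_mul R g' g) h)"
    using assms m by (simp add: mat_mul_assoc mat_mul_mats)
  ultimately show ?thesis using assms m by (auto simp: mat_inverse_def)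
qed

text \<open>The block diagonal part of an inverse of a block diagonal matrix is again a right inverse,
  so the inverse itself is block diagonal.\<close>

lemma mat_inverse_block:
  assumes g: "g \<in> mats R" "\<forall>i j. bdeg i \<noteq> bdeg j \<longrightarrow> g i j = \<zero>" and h: "mat_inverse R g h"
  shows "\<forall>i j. bdeg i \<noteq> bdeg j \<longrightarrow> h i j = \<zero>"
proof -
  define h' where "h' = (\<lambda>i j. if bdeg i = bdeg j then h i j else \<zero>)"
  have hm: "h \<in> mats R" using h by (auto simp: mat_inverse_def)
  then have hm': "h' \<in> mats R" by (intro matsI) (auto simp: mats_outside h'_def)
  have "mat_mul R g h' = mat_one R"
  proof (intro ext)
    fix i j
    show "mat_mul R g h' i j = mat_one R i j"
    proof (cases "bdeg i = bdeg j")
      case True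
      have "g i k \<otimes> h' k j = g i k \<otimes> h k j" for k
        using g hm True by (cases "bdeg i = bdeg k") (auto simp: h'_def)
      then have "mat_mul R g h' i j = mat_mul R g h i j"
        by (simp add: mat_mul_def)
      then show ?thesis using h by (simp add: mat_inverse_def)
    next
      case False
      then have "g i k \<otimes> h' k j = \<zero>" for k
        using g hm by (cases "bdeg i = bdeg k") (auto simp: h'_def)
      then have "mat_mul R g h' i j = \<zero>"
        by (simp add: mat_mul_def)
      with False show ?thesis by (auto simp: mat_one_def)
    qed
  qed
  then have "h = h'"
    using g(1) h hm hm' by (intro mat_left_right_inverse[of g h h']) (auto simp: mat_inverse_def)
  then show ?thesis unfolding h'_def by metis
qed

section \<open>The group of points of G\<close>

lemma G_pts_mats [simp]: "g \<in> G_pts R \<Longrightarrow> g \<in> mats R"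
  by (auto simp: G_pts_def)

lemma G_pts_inverse: "g \<in> G_pts R \<Longrightarrow> mat_inverse R g (mat_inv R g)"
proof -
  assume "g \<in> G_pts R"
  then obtain h where "g \<in> mats R" "mat_inverse R g h" unfolding G_pts_def by blast
  then show ?thesis using mat_inv_eq by simp
qed

lemma G_pts_block: "g \<in> G_pts R \<Longrightarrow> bdeg i \<noteq> bdeg j \<Longrightarrow> g i j = \<zero>"
  unfolding G_pts_def by blast

lemma G_pts_00: "g \<in> G_pts R \<Longrightarrow> g 0 0 = \<one>"
  unfolding G_pts_def by blast

lemma G_ptsI:
  "\<lbrakk>g \<in> mats R; \<And>i j. bdeg i \<noteq> bdeg j \<Longrightarrow> g i j = \<zero>; g 0 0 = \<one>; mat_inverse R g h\<rbrakk> \<Longrightarrow> g \<in> G_pts R"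
  unfolding G_pts_def by blast

lemma bdeg_0 [simp]: "bdeg i = 0 \<longleftrightarrow> i = 0" "bdeg 0 = 0" "0 = bdeg i \<longleftrightarrow> i = 0"
  by (auto simp: bdeg_def)

text \<open>Index 0 is the only one of degree 0, so a single term survives in row 0 of a block
  diagonal matrix.\<close>

lemma block_mul_00:
  assumes "g \<in> mats R" "h \<in> mats R" "\<And>i j. bdeg i \<noteq> bdeg j \<Longrightarrow> g i j = \<zero>"
  shows "mat_mul R g h 0 0 = g 0 0 \<otimes> h 0 0"
proof -
  have "mat_mul R g h 0 0 = (\<Oplus>k\<in>{..<16::nat}. if 0 = k then g 0 k \<otimes> h k 0 else \<zero>)"
    unfolding mat_mul_def
    using assms by (intro finsum_eqI) simp_all
  also have "\<dots> = g 0 0 \<otimes> h 0 0"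
    using assms by (intro add.finprod_singleton) auto
  finally show ?thesis .
qed

lemma G_pts_one [simp, intro]: "mat_one R \<in> G_pts R"
  by (rule G_ptsI[OF mat_one_mats _ _ mat_inverse_one]) (auto simp: mat_one_def)

lemma G_pts_mul [simp, intro]:
  assumes "g \<in> G_pts R" "h \<in> G_pts R" shows "mat_mul R g h \<in> G_pts R"
proof -
  have m: "g \<in> mats R" "h \<in> mats R" using assms by auto
  have "mat_mul R g h i j = \<zero>" if "bdeg i \<noteq> bdeg j" for i j
    unfolding mat_mul_def
  proof (rule finsum_zeroI)
    fix k
    show "g i k \<otimes> h k j = \<zero>"
      using m that G_pts_block[OF assms(1), of i k] G_pts_block[OF assms(2), of k j]
      by (cases "bdeg i = bdeg k") simp_all
  qed
  moreover have "mat_mul R g h 0 0 = \<one>"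
    using m G_pts_00[of g] G_pts_00[of h] G_pts_block[of g] assms by (subst block_mul_00) simp_all
  moreover have "mat_inverse R (mat_mul R g h) (mat_mul R (mat_inv R h) (mat_inv R g))"
    using assms m by (intro mat_inverse_mul G_pts_inverse)
  ultimately show ?thesis using m by (intro G_ptsI) simp_all
qed

lemma G_pts_inv [simp, intro]: "g \<in> G_pts R \<Longrightarrow> mat_inv R g \<in> G_pts R"
proof -
  assume g: "g \<in> G_pts R"
  note i = G_pts_inverse[OF g]
  then have m: "mat_inv R g \<in> mats R" by (simp add: mat_inverse_def)
  have b: "\<forall>i j. bdeg i \<noteq> bdeg j \<longrightarrow> mat_inv R g i j = \<zero>"
    using g by (intro mat_inverse_block[OF _ _ i]) (simp_all add: G_pts_block)
  have "\<one> = mat_mul R g (mat_inv R g) 0 0" using i by (simp add: mat_inverse_def mat_one_def)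
  also have "\<dots> = mat_inv R g 0 0"
    using g m by (subst block_mul_00) (simp_all add: G_pts_00 G_pts_block)
  finally show ?thesis using m b mat_inverse_sym[OF G_pts_mats[OF g] i] by (intro G_ptsI[of _ g]) simp_all
qed

lemma G_pts_mul_inv [simp]: "g \<in> G_pts R \<Longrightarrow> mat_mul R g (mat_inv R g) = mat_one R"
    "g \<in> G_pts R \<Longrightarrow> mat_mul R (mat_inv R g) g = mat_one R"
  using G_pts_inverse[of g] by (simp_all add: mat_inverse_def)

lemma mat_inv_one: "mat_inv R (mat_one R) = mat_one R"
  by (intro mat_inv_eq mat_inverse_one) simp

lemma mat_inv_mul:
  "g \<in> G_pts R \<Longrightarrow> h \<in> G_pts R \<Longrightarrow> mat_inv R (mat_mul R g h) = mat_mul R (mat_inv R h) (mat_inv R g)"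
  by (intro mat_inv_eq mat_inverse_mul G_pts_inverse mat_mul_mats) simp_all

lemma mat_inv_vec [simp]:
  assumes "g \<in> G_pts R" "x \<in> vecs R"
  shows "mat_vec R g (mat_vec R (mat_inv R g) x) = x" "mat_vec R (mat_inv R g) (mat_vec R g x) = x"
  using assms by (simp_all flip: mat_vec_mul add: mat_one_vec)

text \<open>The degree-0 block is the 1 by 1 matrix 1 and the rest of its column vanishes by degree,
  so G fixes the basis vector that serves as the unit.\<close>

lemma G_pts_col_0: "g \<in> G_pts R \<Longrightarrow> mat_vec R g (mat_one R 0) = mat_one R 0"
proof -
  assume g: "g \<in> G_pts R"
  have "col g 0 i = mat_one R 0 i" for i
    using g G_pts_00[OF g] G_pts_block[OF g, of i 0] by (auto simp: col_def mat_one_def)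
  then show ?thesis using g by (auto simp: mat_vec_mat_one)
qed

section \<open>Bilinear forms\<close>

lemma bil_linear_left:
  "(\<And>i j. h i j \<in> carrier R) \<Longrightarrow> y \<in> vecs R \<Longrightarrow> linear_form R (\<lambda>x. bil R h x y)"
  unfolding bil_def by (intro linear_form_comb' linear_form_coord) auto

lemma bil_linear_right:
  "(\<And>i j. h i j \<in> carrier R) \<Longrightarrow> x \<in> vecs R \<Longrightarrow> linear_form R (\<lambda>y. bil R h x y)"
  unfolding bil_def by (intro linear_form_comb linear_form_comb' linear_form_coord) auto

lemma bil_mat_one:
  assumes "\<And>i j. h i j \<in> carrier R" "i < 16" "j < 16"
  shows "bil R h (mat_one R i) (mat_one R j) = h i j"
proof -
  have "bil R h (mat_one R i) (mat_one R j) = (\<Oplus>p\<in>{..<16}. mat_one R i p \<otimes> h p j)"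
    unfolding bil_def using assms by (intro finsum_eqI) (auto simp: finsum_mat_one)
  also have "\<dots> = h i j" using assms by (simp add: finsum_mat_one)
  finally show ?thesis .
qed

lemma bilinear_eqI:
  assumes "\<And>y. y \<in> vecs R \<Longrightarrow> linear_form R (\<lambda>x. B x y)" "\<And>x. x \<in> vecs R \<Longrightarrow> linear_form R (B x)"
    "\<And>y. y \<in> vecs R \<Longrightarrow> linear_form R (\<lambda>x. C x y)" "\<And>x. x \<in> vecs R \<Longrightarrow> linear_form R (C x)"
    "\<And>i j. \<lbrakk>i < 16; j < 16\<rbrakk> \<Longrightarrow> B (mat_one R i) (mat_one R j) = C (mat_one R i) (mat_one R j)"
    "x \<in> vecs R" "y \<in> vecs R"
  shows "B x y = C x y"
proof (rule linear_form_eqI[of "\<lambda>x. B x y" "\<lambda>x. C x y"])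
  fix i :: nat assume "i < 16"
  with assms show "B (mat_one R i) y = C (mat_one R i) y"
    by (intro linear_form_eqI[of "B (mat_one R i)" "C (mat_one R i)" y] assms) auto
qed (use assms in auto)

end

section \<open>Structure constants and the action of \<open>G\<close>\<close>

definition sconsts :: "('u, 'm) ring_scheme \<Rightarrow> 'u sconst set" where
  "sconsts S = {c. (\<forall>i j k. c i j k \<in> carrier S) \<and>
     (\<forall>i j k. \<not> (i < 16 \<and> j < 16 \<and> k < 16 \<and> bdeg k = bdeg i + bdeg j) \<longrightarrow> c i j k = \<zero>\<^bsub>S\<^esub>)}"

lemma sconsts_carrier: "c \<in> sconsts S \<Longrightarrow> c i j k \<in> carrier S"
  unfolding sconsts_def by blast

lemma sconsts_outside: "c \<in> sconsts S \<Longrightarrow> 16 \<le> i \<or> 16 \<le> j \<or> 16 \<le> k \<Longrightarrow> c i j k = \<zero>\<^bsub>S\<^esub>"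
  unfolding sconsts_def by (auto simp: not_less)

lemma sconsts_bdeg: "c \<in> sconsts S \<Longrightarrow> bdeg k \<noteq> bdeg i + bdeg j \<Longrightarrow> c i j k = \<zero>\<^bsub>S\<^esub>"
  unfolding sconsts_def by blast

lemma sconstsI:
  assumes "\<And>i j k. c i j k \<in> carrier S"
    "\<And>i j k. 16 \<le> i \<or> 16 \<le> j \<or> 16 \<le> k \<Longrightarrow> c i j k = \<zero>\<^bsub>S\<^esub>"
    "\<And>i j k. bdeg k \<noteq> bdeg i + bdeg j \<Longrightarrow> c i j k = \<zero>\<^bsub>S\<^esub>"
  shows "c \<in> sconsts S"
  using assms unfolding sconsts_def by (auto simp: not_less)

lemma sconsts_vecs: "c \<in> sconsts S \<Longrightarrow> c i j \<in> vecs S"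
  by (rule vecsI) (simp_all add: sconsts_carrier sconsts_outside)

context cring
begin

lemma mulv_linear_left:
  "c \<in> sconsts R \<Longrightarrow> y \<in> vecs R \<Longrightarrow> linear_form R (\<lambda>x. mulv R c x y k)"
  unfolding mulv_def by (rule bil_linear_left) (simp_all add: sconsts_carrier)

lemma mulv_linear_right:
  "c \<in> sconsts R \<Longrightarrow> x \<in> vecs R \<Longrightarrow> linear_form R (\<lambda>y. mulv R c x y k)"
  unfolding mulv_def by (rule bil_linear_right) (simp_all add: sconsts_carrier)

lemma mulv_vecs [simp]:
  assumes "c \<in> sconsts R" "x \<in> vecs R" "y \<in> vecs R" shows "mulv R c x y \<in> vecs R"
proof (rule vecsI)
  fix k :: nat
  show "mulv R c x y k \<in> carrier R"
    by (rule linear_form_closed[OF mulv_linear_left[OF assms(1,3)] assms(2)])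
  assume k: "16 \<le> k"
  have "(\<Oplus>q\<in>{..<16}. y q \<otimes> c p q k) = \<zero>" for p
    using assms k by (intro finsum_zeroI) (simp add: sconsts_outside)
  then show "mulv R c x y k = \<zero>"
    unfolding mulv_def bil_def using assms by (intro finsum_zeroI) simp
qed

lemma mulv_mat_one:
  "c \<in> sconsts R \<Longrightarrow> i < 16 \<Longrightarrow> j < 16 \<Longrightarrow> mulv R c (mat_one R i) (mat_one R j) = c i j"
  unfolding mulv_def by (rule ext) (simp add: bil_mat_one sconsts_carrier)

lemma mulv_mat_one_right:
  assumes c: "c \<in> sconsts R" and x: "x \<in> vecs R" and j: "j < 16"
  shows "mulv R c x (mat_one R j) k = (\<Oplus>p\<in>{..<16}. x p \<otimes> c p j k)"
proof -
  have "mulv R c x (mat_one R j) k = (\<Oplus>p\<in>{..<16}. x p \<otimes> mulv R c (mat_one R p) (mat_one R j) k)"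
    by (rule linear_form_expand[OF mulv_linear_left[OF c] x]) simp
  also have "\<dots> = (\<Oplus>p\<in>{..<16}. x p \<otimes> c p j k)"
    using c x j by (intro finsum_eqI) (simp_all add: mulv_mat_one sconsts_carrier)
  finally show ?thesis .
qed

lemma mulv_mat_one_left:
  assumes c: "c \<in> sconsts R" and x: "x \<in> vecs R" and j: "j < 16"
  shows "mulv R c (mat_one R j) x k = (\<Oplus>p\<in>{..<16}. x p \<otimes> c j p k)"
proof -
  have "mulv R c (mat_one R j) x k = (\<Oplus>p\<in>{..<16}. x p \<otimes> mulv R c (mat_one R j) (mat_one R p) k)"
    by (rule linear_form_expand[OF mulv_linear_right[OF c] x]) simp
  also have "\<dots> = (\<Oplus>p\<in>{..<16}. x p \<otimes> c j p k)"
    using c x j by (intro finsum_eqI) (simp_all add: mulv_mat_one sconsts_carrier)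
  finally show ?thesis .
qed

lemma sconsts_eqI:
  assumes "c \<in> sconsts R" "c' \<in> sconsts R" "\<And>i j. \<lbrakk>i < 16; j < 16\<rbrakk> \<Longrightarrow> c i j = c' i j"
  shows "c = c'"
proof (intro ext)
  fix i j k
  show "c i j k = c' i j k"
    using assms by (cases "i < 16 \<and> j < 16") (auto simp: sconsts_outside not_less)
qed

text \<open>With d as a row of a matrix, this is one coordinate of the matrix applied to the product
  of a and b. Moving the sums over p and q outward gives it the shape of the triple sum in
  \<open>X_act\<close>.\<close>

lemma mat_vec_mulv:
  assumes c: "c \<in> sconsts R" and a: "a \<in> vecs R" and b: "b \<in> vecs R" and d: "\<And>r. d r \<in> carrier R"
  shows "(\<Oplus>r\<in>{..<16}. d r \<otimes> mulv R c a b r) =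
    (\<Oplus>p\<in>{..<16}. \<Oplus>q\<in>{..<16}. \<Oplus>r\<in>{..<16}. a p \<otimes> b q \<otimes> c p q r \<otimes> d r)"
proof -
  note cl = sconsts_carrier[OF c] vecs_carrier[OF a] vecs_carrier[OF b] d
  have "d r \<otimes> mulv R c a b r = (\<Oplus>p\<in>{..<16}. \<Oplus>q\<in>{..<16}. a p \<otimes> b q \<otimes> c p q r \<otimes> d r)" for r
  proof -
    have "d r \<otimes> (a p \<otimes> (\<Oplus>q\<in>{..<16}. b q \<otimes> c p q r)) = (\<Oplus>q\<in>{..<16}. a p \<otimes> b q \<otimes> c p q r \<otimes> d r)" for p
    proof -
      have "d r \<otimes> (a p \<otimes> (\<Oplus>q\<in>{..<16}. b q \<otimes> c p q r)) = (d r \<otimes> a p) \<otimes> (\<Oplus>q\<in>{..<16}. b q \<otimes> c p q r)"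
        by (simp add: m_assoc cl)
      also have "\<dots> = (\<Oplus>q\<in>{..<16}. (d r \<otimes> a p) \<otimes> (b q \<otimes> c p q r))"
        by (intro finsum_rdistr) (simp_all add: cl)
      also have "\<dots> = (\<Oplus>q\<in>{..<16}. a p \<otimes> b q \<otimes> c p q r \<otimes> d r)"
        by (intro finsum_eqI) (simp_all add: cl m_ac)
      finally show ?thesis .
    qed
    then show ?thesis
      unfolding mulv_def bil_def by (subst finsum_rdistr) (simp_all add: cl)
  qed
  then have "(\<Oplus>r\<in>{..<16}. d r \<otimes> mulv R c a b r)
      = (\<Oplus>r\<in>{..<16}. \<Oplus>p\<in>{..<16}. \<Oplus>q\<in>{..<16}. a p \<otimes> b q \<otimes> c p q r \<otimes> d r)"
    by simp
  also have "\<dots> = (\<Oplus>p\<in>{..<16}. \<Oplus>r\<in>{..<16}. \<Oplus>q\<in>{..<16}. a p \<otimes> b q \<otimes> c p q r \<otimes> d r)"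
    by (intro finsum_swap) (simp_all add: cl)
  also have "\<dots> = (\<Oplus>p\<in>{..<16}. \<Oplus>q\<in>{..<16}. \<Oplus>r\<in>{..<16}. a p \<otimes> b q \<otimes> c p q r \<otimes> d r)"
    by (intro finsum_eqI finsum_swap) (simp_all add: cl)
  finally show ?thesis .
qed

text \<open>The triple sum is the product g((g^-1 e_i)(g^-1 e_j)), since the columns of the inverse
  are the images of the basis vectors. Most arguments about the action use this form.\<close>

lemma X_act_eq:
  assumes "g \<in> G_pts R" "c \<in> sconsts R"
  shows "X_act R g c i j = mat_vec R g (mulv R c (col (mat_inv R g) i) (col (mat_inv R g) j))"
proof
  fix k
  have "mat_vec R g (mulv R c (col (mat_inv R g) i) (col (mat_inv R g) j)) k =
    (\<Oplus>p\<in>{..<16}. \<Oplus>q\<in>{..<16}. \<Oplus>r\<in>{..<16}. col (mat_inv R g) i p \<otimes> col (mat_inv R g) j q \<otimes> c p q r \<otimes> g k r)"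
    unfolding mat_vec_def by (rule mat_vec_mulv) (use assms in simp_all)
  then show "X_act R g c i j k = mat_vec R g (mulv R c (col (mat_inv R g) i) (col (mat_inv R g) j)) k"
    by (simp add: X_act_def col_def)
qed

lemma X_act_sconsts [simp]:
  assumes g: "g \<in> G_pts R" and c: "c \<in> sconsts R" shows "X_act R g c \<in> sconsts R"
proof (rule sconstsI)
  note gi = G_pts_inv[OF g]
  have v: "X_act R g c i j \<in> vecs R" for i j
    using assms gi by (simp add: X_act_eq)
  show "X_act R g c i j k \<in> carrier R" for i j k using v by simp
  fix i j k :: nat
  have z: "(\<And>p q r. mat_inv R g p i \<otimes> mat_inv R g q j \<otimes> c p q r \<otimes> g k r = \<zero>) \<Longrightarrow> X_act R g c i j k = \<zero>"
    unfolding X_act_def by (intro finsum_zeroI)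
  note cl = mats_carrier[OF G_pts_mats[OF g]] mats_carrier[OF G_pts_mats[OF gi]] sconsts_carrier[OF c]
  {
    assume *: "16 \<le> i \<or> 16 \<le> j \<or> 16 \<le> k"
    show "X_act R g c i j k = \<zero>"
    proof (rule z)
      fix p q r
      have "mat_inv R g p i = \<zero> \<or> mat_inv R g q j = \<zero> \<or> g k r = \<zero>"
        using * mats_outside[OF G_pts_mats[OF g]] mats_outside[OF G_pts_mats[OF gi]] by blast
      then show "mat_inv R g p i \<otimes> mat_inv R g q j \<otimes> c p q r \<otimes> g k r = \<zero>"
        using cl by (elim disjE) simp_all
    qed
  next
    assume *: "bdeg k \<noteq> bdeg i + bdeg j"
    show "X_act R g c i j k = \<zero>"
    proof (rule z)
      fix p q r
      \<comment> \<open>If no factor vanished by degree, then p, q and r would have the degrees of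
        i, j and k, and the degree of r would be the sum of those of p and q, against the assumption
        on k.\<close>
      have "mat_inv R g p i = \<zero> \<or> mat_inv R g q j = \<zero> \<or> c p q r = \<zero> \<or> g k r = \<zero>"
        using * G_pts_block[OF g] G_pts_block[OF gi] sconsts_bdeg[OF c] by metis
      then show "mat_inv R g p i \<otimes> mat_inv R g q j \<otimes> c p q r \<otimes> g k r = \<zero>"
        using cl by (elim disjE) simp_all
    qed
  }
qed

lemma mat_vec_linear_comp:
  assumes "g \<in> mats R" "\<And>k. linear_form R (\<lambda>x. M x k)" "\<And>x. x \<in> vecs R \<Longrightarrow> M x \<in> vecs R"
  shows "linear_form R (\<lambda>x. mat_vec R g (M x) k)"
  by (rule linear_form_comp[of "\<lambda>y. mat_vec R g y k"]) (use assms in \<open>simp_all add: mat_vec_linear\<close>)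

text \<open>Both sides are bilinear in x and y, and on basis vectors the claim is
  \<open>X_act_eq\<close>.\<close>

lemma mulv_X_act:
  assumes g: "g \<in> G_pts R" and c: "c \<in> sconsts R" and x: "x \<in> vecs R" and y: "y \<in> vecs R"
  shows "mulv R (X_act R g c) x y
    = mat_vec R g (mulv R c (mat_vec R (mat_inv R g) x) (mat_vec R (mat_inv R g) y))"
proof
  fix k
  let ?i = "mat_vec R (mat_inv R g)"
  have gm: "g \<in> mats R" "mat_inv R g \<in> mats R" using g by simp_all
  have iv: "?i x \<in> vecs R" if "x \<in> vecs R" for x using that gm by simp
  have il: "linear_form R (\<lambda>x. ?i x k)" for k using gm by (simp add: mat_vec_linear)
  show "mulv R (X_act R g c) x y k = mat_vec R g (mulv R c (?i x) (?i y)) k"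
  proof (rule bilinear_eqI[of "\<lambda>x y. mulv R (X_act R g c) x y k" "\<lambda>x y. mat_vec R g (mulv R c (?i x) (?i y)) k"])
    fix y assume y: "y \<in> vecs R"
    show "linear_form R (\<lambda>x. mulv R (X_act R g c) x y k)"
      using g c y by (simp add: mulv_linear_left)
    have "linear_form R (\<lambda>x. mulv R c (?i x) (?i y) k)" for k
      by (rule linear_form_comp[OF mulv_linear_left[OF c iv[OF y]] il iv])
    then show "linear_form R (\<lambda>x. mat_vec R g (mulv R c (?i x) (?i y)) k)"
      using gm c iv y by (intro mat_vec_linear_comp) simp_all
  next
    fix x assume x: "x \<in> vecs R"
    show "linear_form R (\<lambda>y. mulv R (X_act R g c) x y k)"
      using g c x by (simp add: mulv_linear_right)
    have "linear_form R (\<lambda>y. mulv R c (?i x) (?i y) k)" for k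
      by (rule linear_form_comp[OF mulv_linear_right[OF c iv[OF x]] il iv])
    then show "linear_form R (\<lambda>y. mat_vec R g (mulv R c (?i x) (?i y)) k)"
      using gm c iv x by (intro mat_vec_linear_comp) simp_all
  next
    fix i j :: nat assume "i < 16" "j < 16"
    then show "mulv R (X_act R g c) (mat_one R i) (mat_one R j) k =
        mat_vec R g (mulv R c (?i (mat_one R i)) (?i (mat_one R j))) k"
      using g c gm by (simp add: mulv_mat_one X_act_eq mat_vec_mat_one)
  qed (use x y in simp_all)
qed

lemma X_act_mul:
  assumes "g \<in> G_pts R" "h \<in> G_pts R" "c \<in> sconsts R"
  shows "X_act R (mat_mul R g h) c = X_act R g (X_act R h c)"
proof (rule sconsts_eqI)
  fix i j :: nat assume "i < 16" "j < 16"
  have m: "mat_mul R g h \<in> G_pts R" using assms by simp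
  have gm: "g \<in> mats R" "h \<in> mats R" "mat_inv R g \<in> mats R" "mat_inv R h \<in> mats R" using assms by simp_all
  show "X_act R (mat_mul R g h) c i j = X_act R g (X_act R h c) i j"
    using assms gm by (simp only: X_act_eq[OF m assms(3)] X_act_eq[OF assms(1) X_act_sconsts[OF assms(2,3)]]
       mulv_X_act col_vecs mat_inv_mul col_mat_mul mat_vec_mul mat_vec_vecs mulv_vecs)
qed (use assms in simp_all)

lemma X_act_one: "c \<in> sconsts R \<Longrightarrow> X_act R (mat_one R) c = c"
proof (rule sconsts_eqI)
  fix i j :: nat assume "i < 16" "j < 16" "c \<in> sconsts R"
  then show "X_act R (mat_one R) c i j = c i j"
    by (simp add: X_act_eq mat_inv_one col_mat_one mulv_mat_one mat_one_vec sconsts_vecs)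
qed simp_all

lemma X_act_mulv_hom:
  assumes "g \<in> G_pts R" "c \<in> sconsts R" "x \<in> vecs R" "y \<in> vecs R"
  shows "mulv R (X_act R g c) (mat_vec R g x) (mat_vec R g y) = mat_vec R g (mulv R c x y)"
  using assms by (simp add: mulv_X_act)

text \<open>The equation says that g is multiplicative from the product c to the product c', which
  may be tested on basis vectors. The right-hand side contains no inverse matrix, so over the dual
  numbers it can be split into its constant part and its \<epsilon>-part.\<close>

lemma X_act_eq_iff:
  assumes g: "g \<in> G_pts R" and c: "c \<in> sconsts R" and c': "c' \<in> sconsts R"
  shows "X_act R g c = c' \<longleftrightarrow> (\<forall>i<16. \<forall>j<16. mat_vec R g (c i j) = mulv R c' (col g i) (col g j))"
    (is "_ \<longleftrightarrow> ?r")
proof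
  assume "X_act R g c = c'"
  show ?r
  proof (intro allI impI)
    fix i j :: nat assume "i < 16" "j < 16"
    with X_act_mulv_hom[OF g c, of "mat_one R i" "mat_one R j"] \<open>X_act R g c = c'\<close> g c
    show "mat_vec R g (c i j) = mulv R c' (col g i) (col g j)"
      by (simp add: mulv_mat_one mat_vec_mat_one)
  qed
next
  assume r: ?r
  have gm: "g \<in> mats R" "mat_inv R g \<in> mats R" using g by simp_all
  have gl: "linear_form R (\<lambda>x. mat_vec R g x k)" for k using gm by (simp add: mat_vec_linear)
  have gv: "mat_vec R g x \<in> vecs R" if "x \<in> vecs R" for x using gm that by simp
  \<comment> \<open>Multiplicativity passes from basis vectors to all vectors by bilinearity; it is
    needed for the columns of the inverse matrix.\<close>
  have hom: "mat_vec R g (mulv R c x y) = mulv R c' (mat_vec R g x) (mat_vec R g y)"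
    if x: "x \<in> vecs R" and y: "y \<in> vecs R" for x y
  proof
    fix k
    show "mat_vec R g (mulv R c x y) k = mulv R c' (mat_vec R g x) (mat_vec R g y) k"
    proof (rule bilinear_eqI[of "\<lambda>x y. mat_vec R g (mulv R c x y) k" "\<lambda>x y. mulv R c' (mat_vec R g x) (mat_vec R g y) k"])
      fix y assume y: "y \<in> vecs R"
      show "linear_form R (\<lambda>x. mat_vec R g (mulv R c x y) k)"
        using gm c y by (intro mat_vec_linear_comp mulv_linear_left) simp_all
      show "linear_form R (\<lambda>x. mulv R c' (mat_vec R g x) (mat_vec R g y) k)"
        by (rule linear_form_comp[OF mulv_linear_left[OF c' gv[OF y]] gl gv])
    next
      fix x assume x: "x \<in> vecs R"
      show "linear_form R (\<lambda>y. mat_vec R g (mulv R c x y) k)"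
        using gm c x by (intro mat_vec_linear_comp mulv_linear_right) simp_all
      show "linear_form R (\<lambda>y. mulv R c' (mat_vec R g x) (mat_vec R g y) k)"
        by (rule linear_form_comp[OF mulv_linear_right[OF c' gv[OF x]] gl gv])
    next
      fix i j :: nat assume "i < 16" "j < 16"
      with r gm c show "mat_vec R g (mulv R c (mat_one R i) (mat_one R j)) k =
          mulv R c' (mat_vec R g (mat_one R i)) (mat_vec R g (mat_one R j)) k"
        by (simp add: mulv_mat_one mat_vec_mat_one)
    qed (use x y in simp_all)
  qed
  show "X_act R g c = c'"
  proof (rule sconsts_eqI)
    fix i j :: nat assume "i < 16" "j < 16"
    have v: "mat_vec R g (col (mat_inv R g) j) = mat_one R j" for j
      using g gm by (simp flip: col_mat_mul add: col_mat_one)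
    show "X_act R g c i j = c' i j"
      using \<open>i < 16\<close> \<open>j < 16\<close> g c c' gm by (simp add: X_act_eq hom v mulv_mat_one)
  qed (use g c c' in simp_all)
qed

end

section \<open>The conditions that cut out X_4, one at a time, and their invariance under G\<close>

definition assoc_consts :: "('u, 'm) ring_scheme \<Rightarrow> 'u sconst \<Rightarrow> bool" where
  "assoc_consts S c \<longleftrightarrow> (\<forall>i<16. \<forall>j<16. \<forall>l<16. \<forall>m<16.
     (\<Oplus>\<^bsub>S\<^esub>k\<in>{..<16}. c i j k \<otimes>\<^bsub>S\<^esub> c k l m) = (\<Oplus>\<^bsub>S\<^esub>k\<in>{..<16}. c j l k \<otimes>\<^bsub>S\<^esub> c i k m))"

definition frob_form :: "('u, 'm) ring_scheme \<Rightarrow> 'u sconst \<Rightarrow> 'u mat \<Rightarrow> bool" where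
  "frob_form S c h \<longleftrightarrow> h \<in> mats S \<and> (\<exists>h'. mat_inverse S h h') \<and>
     (\<forall>i j. bdeg i + bdeg j \<noteq> 4 \<longrightarrow> h i j = \<zero>\<^bsub>S\<^esub>) \<and>
     (\<forall>i<16. \<forall>j<16. \<forall>l<16.
        (\<Oplus>\<^bsub>S\<^esub>k\<in>{..<16}. c j l k \<otimes>\<^bsub>S\<^esub> h i k) = (\<Oplus>\<^bsub>S\<^esub>k\<in>{..<16}. c i j k \<otimes>\<^bsub>S\<^esub> h k l))"

definition unit_consts :: "('u, 'm) ring_scheme \<Rightarrow> 'u sconst \<Rightarrow> bool" where
  "unit_consts S c \<longleftrightarrow> (\<forall>j k. c 0 j k = mat_one S j k \<and> c j 0 k = mat_one S j k)"

lemma X_pts_iff: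
  "c \<in> X_pts S \<longleftrightarrow> c \<in> sconsts S \<and> unit_consts S c \<and> assoc_consts S c \<and> (\<exists>h. frob_form S c h)"
  unfolding X_pts_def sconsts_def unit_consts_def assoc_consts_def frob_form_def by blast

lemma X_pts_sconsts [simp]: "c \<in> X_pts S \<Longrightarrow> c \<in> sconsts S"
  by (simp add: X_pts_iff)

definition mat_transpose :: "'u mat \<Rightarrow> 'u mat" where
  "mat_transpose g = (\<lambda>i j. g j i)"

context cring
begin

lemma trilinear_eqI:
  assumes "\<And>y z. y \<in> vecs R \<Longrightarrow> z \<in> vecs R \<Longrightarrow> linear_form R (\<lambda>x. B x y z)"
    "\<And>x z. x \<in> vecs R \<Longrightarrow> z \<in> vecs R \<Longrightarrow> linear_form R (\<lambda>y. B x y z)"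
    "\<And>x y. x \<in> vecs R \<Longrightarrow> y \<in> vecs R \<Longrightarrow> linear_form R (\<lambda>z. B x y z)"
    "\<And>y z. y \<in> vecs R \<Longrightarrow> z \<in> vecs R \<Longrightarrow> linear_form R (\<lambda>x. C x y z)"
    "\<And>x z. x \<in> vecs R \<Longrightarrow> z \<in> vecs R \<Longrightarrow> linear_form R (\<lambda>y. C x y z)"
    "\<And>x y. x \<in> vecs R \<Longrightarrow> y \<in> vecs R \<Longrightarrow> linear_form R (\<lambda>z. C x y z)"
    and b: "\<And>i j l. \<lbrakk>i < 16; j < 16; l < 16\<rbrakk> \<Longrightarrow>
      B (mat_one R i) (mat_one R j) (mat_one R l) = C (mat_one R i) (mat_one R j) (mat_one R l)"
    and v: "x \<in> vecs R" "y \<in> vecs R" "z \<in> vecs R"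
  shows "B x y z = C x y z"
proof (rule bilinear_eqI[of "\<lambda>x y. B x y z" "\<lambda>x y. C x y z"])
  fix i j :: nat assume ij: "i < 16" "j < 16"
  show "B (mat_one R i) (mat_one R j) z = C (mat_one R i) (mat_one R j) z"
    by (rule linear_form_eqI[of "\<lambda>z. B (mat_one R i) (mat_one R j) z" "\<lambda>z. C (mat_one R i) (mat_one R j) z"])
      (use assms(3,6) v b ij in simp_all)
qed (use assms(1,2,4,5) v in simp_all)

lemma assoc_consts_iff:
  assumes c: "c \<in> sconsts R"
  shows "assoc_consts R c \<longleftrightarrow> (\<forall>i<16. \<forall>j<16. \<forall>l<16.
    mulv R c (c i j) (mat_one R l) = mulv R c (mat_one R i) (c j l))"
proof -
  have *: "(\<Oplus>k\<in>{..<16}. c i j k \<otimes> c k l m) = mulv R c (c i j) (mat_one R l) m"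
    "(\<Oplus>k\<in>{..<16}. c j l k \<otimes> c i k m) = mulv R c (mat_one R i) (c j l) m" if "i < 16" "l < 16" for i j l m
    using c that by (simp_all add: mulv_mat_one_right mulv_mat_one_left sconsts_vecs)
  have "mulv R c (c i j) (mat_one R l) = mulv R c (mat_one R i) (c j l) \<longleftrightarrow>
    (\<forall>m<16. mulv R c (c i j) (mat_one R l) m = mulv R c (mat_one R i) (c j l) m)" for i j l
    by (rule iffI, simp) (rule vecs_eqI[of _ R], use c in \<open>simp_all add: sconsts_vecs\<close>)
  then show ?thesis
    unfolding assoc_consts_def by (simp add: *)
qed

text \<open>Both sides are trilinear, so associativity on basis vectors is enough.\<close>

lemma assoc_consts_vecs:
  assumes c: "c \<in> sconsts R" and a: "assoc_consts R c"
    and v: "x \<in> vecs R" "y \<in> vecs R" "z \<in> vecs R"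
  shows "mulv R c (mulv R c x y) z = mulv R c x (mulv R c y z)"
proof
  fix k
  note l = mulv_linear_left[OF c] and r = mulv_linear_right[OF c] and cl = mulv_vecs[OF c]
  show "mulv R c (mulv R c x y) z k = mulv R c x (mulv R c y z) k"
  proof (rule trilinear_eqI[of "\<lambda>x y z. mulv R c (mulv R c x y) z k" "\<lambda>x y z. mulv R c x (mulv R c y z) k"])
    fix i j m :: nat assume "i < 16" "j < 16" "m < 16"
    then show "mulv R c (mulv R c (mat_one R i) (mat_one R j)) (mat_one R m) k =
      mulv R c (mat_one R i) (mulv R c (mat_one R j) (mat_one R m)) k"
      using a c by (simp add: mulv_mat_one assoc_consts_iff)
  next
    fix y z assume v: "y \<in> vecs R" "z \<in> vecs R"
    show "linear_form R (\<lambda>x. mulv R c (mulv R c x y) z k)"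
      by (rule linear_form_comp[OF l[OF v(2)] l[OF v(1)]]) (use cl v in simp)
    show "linear_form R (\<lambda>x. mulv R c x (mulv R c y z) k)"
      by (rule l) (use cl v in simp)
  next
    fix x z assume v: "x \<in> vecs R" "z \<in> vecs R"
    show "linear_form R (\<lambda>y. mulv R c (mulv R c x y) z k)"
      by (rule linear_form_comp[OF l[OF v(2)] r[OF v(1)]]) (use cl v in simp)
    show "linear_form R (\<lambda>y. mulv R c x (mulv R c y z) k)"
      by (rule linear_form_comp[OF r[OF v(1)] l[OF v(2)]]) (use cl v in simp)
  next
    fix x y assume v: "x \<in> vecs R" "y \<in> vecs R"
    show "linear_form R (\<lambda>z. mulv R c (mulv R c x y) z k)"
      by (rule r) (use cl v in simp)
    show "linear_form R (\<lambda>z. mulv R c x (mulv R c y z) k)"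
      by (rule linear_form_comp[OF r[OF v(1)] r[OF v(2)]]) (use cl v in simp)
  qed (use v in simp_all)
qed

lemma bil_mat_one_right:
  assumes "\<And>i j. h i j \<in> carrier R" "x \<in> vecs R" "j < 16"
  shows "bil R h x (mat_one R j) = (\<Oplus>p\<in>{..<16}. x p \<otimes> h p j)"
  by (subst linear_form_expand[OF bil_linear_left]) (use assms in \<open>auto simp: bil_mat_one intro!: finsum_eqI\<close>)

lemma bil_mat_one_left:
  assumes "\<And>i j. h i j \<in> carrier R" "x \<in> vecs R" "j < 16"
  shows "bil R h (mat_one R j) x = (\<Oplus>p\<in>{..<16}. x p \<otimes> h j p)"
  by (subst linear_form_expand[OF bil_linear_right]) (use assms in \<open>auto simp: bil_mat_one intro!: finsum_eqI\<close>)

lemma frob_form_iff: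
  assumes c: "c \<in> sconsts R"
  shows "frob_form R c h \<longleftrightarrow> h \<in> mats R \<and> (\<exists>h'. mat_inverse R h h') \<and>
     (\<forall>i j. bdeg i + bdeg j \<noteq> 4 \<longrightarrow> h i j = \<zero>) \<and>
     (\<forall>i<16. \<forall>j<16. \<forall>l<16. bil R h (mat_one R i) (c j l) = bil R h (c i j) (mat_one R l))"
proof (cases "h \<in> mats R")
  case True
  have "(\<Oplus>k\<in>{..<16}. c j l k \<otimes> h i k) = bil R h (mat_one R i) (c j l)"
    "(\<Oplus>k\<in>{..<16}. c i j k \<otimes> h k l) = bil R h (c i j) (mat_one R l)" if "i < 16" "l < 16" for i j l
    using c that True by (simp_all add: bil_mat_one_right bil_mat_one_left sconsts_vecs)
  then show ?thesis unfolding frob_form_def by simp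
qed (simp add: frob_form_def)

lemma frob_form_vecs:
  assumes c: "c \<in> sconsts R" and f: "frob_form R c h"
    and v: "x \<in> vecs R" "y \<in> vecs R" "z \<in> vecs R"
  shows "bil R h x (mulv R c y z) = bil R h (mulv R c x y) z"
proof -
  have h: "h i j \<in> carrier R" for i j using f by (simp add: frob_form_def)
  note l = mulv_linear_left[OF c] and r = mulv_linear_right[OF c] and cl = mulv_vecs[OF c]
  note bl = bil_linear_left[OF h] and br = bil_linear_right[OF h]
  show ?thesis
  proof (rule trilinear_eqI[of "\<lambda>x y z. bil R h x (mulv R c y z)" "\<lambda>x y z. bil R h (mulv R c x y) z"])
    fix i j m :: nat assume "i < 16" "j < 16" "m < 16"
    then show "bil R h (mat_one R i) (mulv R c (mat_one R j) (mat_one R m)) =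
      bil R h (mulv R c (mat_one R i) (mat_one R j)) (mat_one R m)"
      using f c by (simp add: mulv_mat_one frob_form_iff)
  next
    fix y z assume v: "y \<in> vecs R" "z \<in> vecs R"
    show "linear_form R (\<lambda>x. bil R h (mulv R c x y) z)"
      by (rule linear_form_comp[OF bl[OF v(2)] l[OF v(1)]]) (use cl v in simp)
    show "linear_form R (\<lambda>x. bil R h x (mulv R c y z))"
      by (rule bl) (use cl v in simp)
  next
    fix x z assume v: "x \<in> vecs R" "z \<in> vecs R"
    show "linear_form R (\<lambda>y. bil R h (mulv R c x y) z)"
      by (rule linear_form_comp[OF bl[OF v(2)] r[OF v(1)]]) (use cl v in simp)
    show "linear_form R (\<lambda>y. bil R h x (mulv R c y z))"
      by (rule linear_form_comp[OF br[OF v(1)] l[OF v(2)]]) (use cl v in simp)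
  next
    fix x y assume v: "x \<in> vecs R" "y \<in> vecs R"
    show "linear_form R (\<lambda>z. bil R h (mulv R c x y) z)"
      by (rule br) (use cl v in simp)
    show "linear_form R (\<lambda>z. bil R h x (mulv R c y z))"
      by (rule linear_form_comp[OF br[OF v(1)] r[OF v(2)]]) (use cl v in simp)
  qed (use v in simp_all)
qed

lemma mat_transpose_mats [simp]: "g \<in> mats R \<Longrightarrow> mat_transpose g \<in> mats R"
  by (rule matsI) (auto simp: mat_transpose_def mats_outside)

lemma mat_transpose_mul:
  assumes "g \<in> mats R" "h \<in> mats R"
  shows "mat_mul R (mat_transpose g) (mat_transpose h) = mat_transpose (mat_mul R h g)"
  unfolding mat_mul_def mat_transpose_def using assms by (intro ext finsum_eqI) (simp_all add: m_comm)

lemma mat_transpose_one: "mat_transpose (mat_one R) = mat_one R"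
  by (intro ext) (simp add: mat_transpose_def mat_one_sym)

lemma mat_inverse_transpose:
  "g \<in> mats R \<Longrightarrow> mat_inverse R g h \<Longrightarrow> mat_inverse R (mat_transpose g) (mat_transpose h)"
  by (simp add: mat_inverse_def mat_transpose_mul mat_transpose_one)

lemma bil_col:
  assumes "g \<in> mats R" "h \<in> mats R"
  shows "bil R h (col g i) (col g j) = mat_mul R (mat_transpose g) (mat_mul R h g) i j"
proof -
  have "(\<Oplus>q\<in>{..<16}. g q j \<otimes> h p q) = (\<Oplus>q\<in>{..<16}. h p q \<otimes> g q j)" for p
    using assms by (intro finsum_eqI) (simp_all add: m_comm)
  then show ?thesis
    by (simp add: bil_def mat_mul_def mat_transpose_def col_def)
qed

text \<open>The transported pairing is (x, y) \<mapsto> h(g^-1 x, g^-1 y). Its Gram matrix is the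
  product of the transpose of g^-1, h and g^-1, which is inverted by g, the inverse of h and the
  transpose of g; and g^-1 is multiplicative from the new product to the old one.\<close>

lemma frob_form_X_act:
  assumes g: "g \<in> G_pts R" and c: "c \<in> sconsts R" and f: "frob_form R c h"
  defines "h' \<equiv> \<lambda>i j. bil R h (col (mat_inv R g) i) (col (mat_inv R g) j)"
  shows "frob_form R (X_act R g c) h'"
proof -
  let ?i = "mat_inv R g"
  note gi = G_pts_inv[OF g]
  have m: "g \<in> mats R" "?i \<in> mats R" "h \<in> mats R" using g f by (simp_all add: frob_form_def)
  have h'_eq: "h' = mat_mul R (mat_transpose ?i) (mat_mul R h ?i)"
    using m by (simp add: h'_def bil_col)
  have h'm: "h' \<in> mats R" using m by (simp add: h'_eq)
  obtain k where k: "mat_inverse R h k" using f unfolding frob_form_def by blast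
  have inv: "mat_inverse R ?i g" using g by (simp add: mat_inverse_sym[OF _ G_pts_inverse])
  have "mat_inverse R h' (mat_mul R (mat_mul R g k) (mat_transpose g))"
    unfolding h'_eq using m k inv by (intro mat_inverse_mul mat_inverse_transpose) simp_all
  moreover have "h' i j = \<zero>" if ij: "bdeg i + bdeg j \<noteq> 4" for i j
  proof -
    have z: "col ?i i p \<otimes> (col ?i j q \<otimes> h p q) = \<zero>" for p q
    proof -
      have "?i p i = \<zero> \<or> ?i q j = \<zero> \<or> h p q = \<zero>"
        using ij G_pts_block[OF gi] f unfolding frob_form_def by metis
      then show ?thesis using m by (elim disjE) (simp_all add: col_def)
    qed
    have "col ?i i p \<otimes> (\<Oplus>q\<in>{..<16}. col ?i j q \<otimes> h p q) = \<zero>" for p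
      using z m by (subst finsum_rdistr) (simp_all add: col_def)
    then show ?thesis unfolding h'_def bil_def by (intro finsum_zeroI)
  qed
  moreover have "bil R h' (mat_one R i) (X_act R g c j l) = bil R h' (X_act R g c i j) (mat_one R l)"
    if ijl: "i < 16" "j < 16" "l < 16" for i j l
  proof -
    have b: "bil R h' x y = bil R h (mat_vec R ?i x) (mat_vec R ?i y)" if v: "x \<in> vecs R" "y \<in> vecs R" for x y
    proof (rule bilinear_eqI[of "bil R h'" "\<lambda>x y. bil R h (mat_vec R ?i x) (mat_vec R ?i y)"])
      have il: "linear_form R (\<lambda>x. mat_vec R ?i x k)" for k using m by (simp add: mat_vec_linear)
      fix y assume y: "y \<in> vecs R"
      show "linear_form R (\<lambda>x. bil R h' x y)" using h'm y by (simp add: bil_linear_left)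
      show "linear_form R (bil R h' y)" using h'm y by (simp add: bil_linear_right)
      show "linear_form R (\<lambda>x. bil R h (mat_vec R ?i x) (mat_vec R ?i y))"
        by (rule linear_form_comp[OF bil_linear_left il]) (use m y in simp_all)
      show "linear_form R (\<lambda>x. bil R h (mat_vec R ?i y) (mat_vec R ?i x))"
        by (rule linear_form_comp[OF bil_linear_right il]) (use m y in simp_all)
    next
      fix i j :: nat assume "i < 16" "j < 16"
      then show "bil R h' (mat_one R i) (mat_one R j) =
          bil R h (mat_vec R ?i (mat_one R i)) (mat_vec R ?i (mat_one R j))"
        using m h'm by (simp add: bil_mat_one mat_vec_mat_one) (simp add: h'_def)
    qed (use v in simp_all)
    note X = sconsts_vecs[OF X_act_sconsts[OF g c]]
    show ?thesis
      using m ijl g c by (simp add: b X) (simp add: X_act_eq mat_vec_mat_one frob_form_vecs[OF c f])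
  qed
  ultimately show ?thesis
    unfolding frob_form_iff[OF X_act_sconsts[OF g c]] using h'm by blast
qed

text \<open>The inverse of g fixes the unit vector, associativity is carried along because g is
  multiplicative from c to its image, and the pairing is transported by
  \<open>frob_form_X_act\<close>.\<close>

lemma X_act_X_pts [simp]:
  assumes g: "g \<in> G_pts R" and c: "c \<in> X_pts R"
  shows "X_act R g c \<in> X_pts R"
proof -
  let ?i = "mat_inv R g"
  have c': "c \<in> sconsts R" and u: "unit_consts R c" and a: "assoc_consts R c" and f: "\<exists>h. frob_form R c h"
    using c by (simp_all add: X_pts_iff)
  note gi = G_pts_inv[OF g]
  have m: "g \<in> mats R" "?i \<in> mats R" using g by simp_all
  have i0: "col ?i 0 = mat_one R 0"
    using G_pts_col_0[OF gi] m by (simp add: mat_vec_mat_one)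
  \<comment> \<open>The unit law extends from basis vectors to all vectors by linearity.\<close>
  have ul: "mulv R c (mat_one R 0) x = x" "mulv R c x (mat_one R 0) = x" if x: "x \<in> vecs R" for x
  proof -
    have "mulv R c (mat_one R 0) x k = x k" for k
      by (rule linear_form_eqI[OF mulv_linear_right[OF c' mat_one_vecs] linear_form_coord x])
        (use u c' in \<open>simp add: mulv_mat_one unit_consts_def\<close>)
    moreover have "mulv R c x (mat_one R 0) k = x k" for k
      by (rule linear_form_eqI[OF mulv_linear_left[OF c' mat_one_vecs] linear_form_coord x])
        (use u c' in \<open>simp add: mulv_mat_one unit_consts_def\<close>)
    ultimately show "mulv R c (mat_one R 0) x = x" "mulv R c x (mat_one R 0) = x" by auto
  qed
  have v: "mat_vec R g (col ?i j) = mat_one R j" for j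
    using g m by (simp flip: col_mat_mul add: col_mat_one)
  have "unit_consts R (X_act R g c)"
    unfolding unit_consts_def using g c' m by (simp add: X_act_eq i0 ul v)
  moreover have "assoc_consts R (X_act R g c)"
    unfolding assoc_consts_iff[OF X_act_sconsts[OF g c']]
    using g c' m by (simp add: mulv_X_act sconsts_vecs)
      (simp add: X_act_eq mat_vec_mat_one assoc_consts_vecs[OF c' a])
  moreover have "\<exists>h. frob_form R (X_act R g c) h" using frob_form_X_act[OF g c'] f by blast
  ultimately show ?thesis using g c' by (simp add: X_pts_iff)
qed

end

section \<open>Base change of matrices and structure constants along ring homomorphisms\<close>

context ring_hom_cring
begin

lemma mat_map_mats [simp]: "g \<in> mats R \<Longrightarrow> mat_map h g \<in> mats S"
  by (rule matsI) (auto simp: mat_map_def mats_outside)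

lemma mat_map_mul:
  "g \<in> mats R \<Longrightarrow> k \<in> mats R \<Longrightarrow> mat_map h (mat_mul R g k) = mat_mul S (mat_map h g) (mat_map h k)"
  by (intro ext) (simp add: mat_map_def mat_mul_def Pi_def comp_def)

lemma mat_map_one: "mat_map h (mat_one R) = mat_one S"
  by (intro ext) (simp add: mat_map_def mat_one_def)

lemma mat_map_inverse:
  "g \<in> mats R \<Longrightarrow> mat_inverse R g k \<Longrightarrow> mat_inverse S (mat_map h g) (mat_map h k)"
  by (simp add: mat_inverse_def flip: mat_map_mul mat_map_one)

lemma mat_map_G_pts [simp]: "g \<in> G_pts R \<Longrightarrow> mat_map h g \<in> G_pts S"
  by (rule S.G_ptsI[OF _ _ _ mat_map_inverse[OF _ R.G_pts_inverse]])
    (simp_all add: R.G_pts_block R.G_pts_00, simp_all add: mat_map_def R.G_pts_block R.G_pts_00)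

lemma mat_map_inv: "g \<in> G_pts R \<Longrightarrow> mat_inv S (mat_map h g) = mat_map h (mat_inv R g)"
  by (intro S.mat_inv_eq mat_map_inverse R.G_pts_inverse) simp_all

lemma sconst_map_sconsts [simp]: "c \<in> sconsts R \<Longrightarrow> sconst_map h c \<in> sconsts S"
  by (rule sconstsI) (simp_all add: sconst_map_def sconsts_carrier sconsts_outside sconsts_bdeg)

lemma sconst_map_X_act:
  assumes "g \<in> G_pts R" "c \<in> sconsts R"
  shows "sconst_map h (X_act R g c) = X_act S (mat_map h g) (sconst_map h c)"
  using assms unfolding X_act_def mat_map_inv[OF assms(1)]
  by (intro ext) (simp add: sconst_map_def mat_map_def Pi_def comp_def sconsts_carrier)

lemma frob_form_map:
  assumes "c \<in> sconsts R" "frob_form R c k"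
  shows "frob_form S (sconst_map h c) (mat_map h k)"
proof -
  have k: "k \<in> mats R" using assms by (simp add: frob_form_def)
  have sum: "(\<Oplus>\<^bsub>S\<^esub>n\<in>{..<16}. h (c i j n) \<otimes>\<^bsub>S\<^esub> h (k p n)) = h (\<Oplus>\<^bsub>R\<^esub>n\<in>{..<16}. c i j n \<otimes>\<^bsub>R\<^esub> k p n)"
    "(\<Oplus>\<^bsub>S\<^esub>n\<in>{..<16}. h (c i j n) \<otimes>\<^bsub>S\<^esub> h (k n p)) = h (\<Oplus>\<^bsub>R\<^esub>n\<in>{..<16}. c i j n \<otimes>\<^bsub>R\<^esub> k n p)" for i j p
    using assms k by (simp_all add: Pi_def comp_def sconsts_carrier)
  show ?thesis
    unfolding frob_form_def
  proof (intro conjI)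
    show "\<exists>h'. mat_inverse S (mat_map h k) h'"
      using assms(2) mat_map_inverse[OF k] unfolding frob_form_def by blast
    show "\<forall>i<16. \<forall>j<16. \<forall>l<16.
       (\<Oplus>\<^bsub>S\<^esub>n\<in>{..<16}. sconst_map h c j l n \<otimes>\<^bsub>S\<^esub> mat_map h k i n) =
       (\<Oplus>\<^bsub>S\<^esub>n\<in>{..<16}. sconst_map h c i j n \<otimes>\<^bsub>S\<^esub> mat_map h k n l)"
      using assms(2) by (simp add: sconst_map_def mat_map_def sum frob_form_def)
    show "\<forall>i j. bdeg i + bdeg j \<noteq> 4 \<longrightarrow> mat_map h k i j = \<zero>\<^bsub>S\<^esub>"
      using assms(2) by (simp add: frob_form_def mat_map_def)
  qed (use k in simp)
qed

lemma assoc_consts_map: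
  assumes "c \<in> sconsts R" "assoc_consts R c"
  shows "assoc_consts S (sconst_map h c)"
proof -
  have sum: "(\<Oplus>\<^bsub>S\<^esub>n\<in>{..<16}. h (c i j n) \<otimes>\<^bsub>S\<^esub> h (c n l m)) = h (\<Oplus>\<^bsub>R\<^esub>n\<in>{..<16}. c i j n \<otimes>\<^bsub>R\<^esub> c n l m)"
    "(\<Oplus>\<^bsub>S\<^esub>n\<in>{..<16}. h (c i j n) \<otimes>\<^bsub>S\<^esub> h (c l n m)) = h (\<Oplus>\<^bsub>R\<^esub>n\<in>{..<16}. c i j n \<otimes>\<^bsub>R\<^esub> c l n m)" for i j l m
    using assms by (simp_all add: Pi_def comp_def sconsts_carrier)
  show ?thesis using assms by (simp add: assoc_consts_def sconst_map_def sum)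
qed

lemma unit_consts_map: "unit_consts R c \<Longrightarrow> unit_consts S (sconst_map h c)"
  by (simp add: unit_consts_def sconst_map_def) (simp add: mat_one_def)

lemma sconst_map_X_pts [simp]: "c \<in> X_pts R \<Longrightarrow> sconst_map h c \<in> X_pts S"
  unfolding X_pts_iff using frob_form_map assoc_consts_map unit_consts_map by auto

end

section \<open>Copies of a ring in another type\<close>

lemma image_ring_hom: "inj_on \<iota> (carrier R) \<Longrightarrow> \<iota> \<in> ring_hom R (image_ring \<iota> R)"
  using inj_imp_image_ring_iso by (auto simp: ring_iso_def)

lemma image_ring_cring: "cring R \<Longrightarrow> inj_on \<iota> (carrier R) \<Longrightarrow> cring (image_ring \<iota> R)"
  using cring.ring_iso_imp_img_cring[OF _ inj_imp_image_ring_iso, of R \<iota>]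
  by (simp add: image_ring_def image_group_def monoid.defs)

lemma image_ring_inv_hom:
  "ring R \<Longrightarrow> inj_on \<iota> (carrier R) \<Longrightarrow> inv_into (carrier R) \<iota> \<in> ring_hom (image_ring \<iota> R) R"
  using ring_iso_set_sym[OF _ inj_imp_image_ring_iso] by (auto simp: ring_iso_def)

section \<open>The rings of dual numbers in one and two variables\<close>

lemma dual_numbers_simps [simp]:
  "carrier (dual_numbers K) = carrier K \<times> carrier K"
  "\<one>\<^bsub>dual_numbers K\<^esub> = (\<one>\<^bsub>K\<^esub>, \<zero>\<^bsub>K\<^esub>)" "\<zero>\<^bsub>dual_numbers K\<^esub> = (\<zero>\<^bsub>K\<^esub>, \<zero>\<^bsub>K\<^esub>)"
  "(a, b) \<oplus>\<^bsub>dual_numbers K\<^esub> (a', b') = (a \<oplus>\<^bsub>K\<^esub> a', b \<oplus>\<^bsub>K\<^esub> b')"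
  "(a, b) \<otimes>\<^bsub>dual_numbers K\<^esub> (a', b') = (a \<otimes>\<^bsub>K\<^esub> a', (a \<otimes>\<^bsub>K\<^esub> b') \<oplus>\<^bsub>K\<^esub> (b \<otimes>\<^bsub>K\<^esub> a'))"
  by (simp_all add: dual_numbers_def)

lemma dual_numbers2_simps [simp]:
  "carrier (dual_numbers2 K) = carrier K \<times> carrier K \<times> carrier K"
  "\<one>\<^bsub>dual_numbers2 K\<^esub> = (\<one>\<^bsub>K\<^esub>, \<zero>\<^bsub>K\<^esub>, \<zero>\<^bsub>K\<^esub>)" "\<zero>\<^bsub>dual_numbers2 K\<^esub> = (\<zero>\<^bsub>K\<^esub>, \<zero>\<^bsub>K\<^esub>, \<zero>\<^bsub>K\<^esub>)"
  "(a, b, c) \<oplus>\<^bsub>dual_numbers2 K\<^esub> (a', b', c') = (a \<oplus>\<^bsub>K\<^esub> a', b \<oplus>\<^bsub>K\<^esub> b', c \<oplus>\<^bsub>K\<^esub> c')"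
  "(a, b, c) \<otimes>\<^bsub>dual_numbers2 K\<^esub> (a', b', c') =
    (a \<otimes>\<^bsub>K\<^esub> a', (a \<otimes>\<^bsub>K\<^esub> b') \<oplus>\<^bsub>K\<^esub> (b \<otimes>\<^bsub>K\<^esub> a'), (a \<otimes>\<^bsub>K\<^esub> c') \<oplus>\<^bsub>K\<^esub> (c \<otimes>\<^bsub>K\<^esub> a'))"
  by (simp_all add: dual_numbers2_def)

context cring
begin

lemma dual_numbers_cring: "cring (dual_numbers R)"
proof (rule cringI)
  show "abelian_group (dual_numbers R)"
  proof (rule abelian_groupI)
    fix x assume "x \<in> carrier (dual_numbers R)"
    then show "\<exists>y\<in>carrier (dual_numbers R). y \<oplus>\<^bsub>dual_numbers R\<^esub> x = \<zero>\<^bsub>dual_numbers R\<^esub>"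
      by (intro bexI[of _ "(\<ominus> fst x, \<ominus> snd x)"]) (auto simp: l_neg)
  qed (auto simp: a_ac)
  show "Group.comm_monoid (dual_numbers R)"
    by (rule comm_monoidI) (auto simp: m_ac r_distr l_distr a_ac)
qed (auto simp: l_distr r_distr a_ac m_ac)

lemma dual_numbers2_cring: "cring (dual_numbers2 R)"
proof (rule cringI)
  show "abelian_group (dual_numbers2 R)"
  proof (rule abelian_groupI)
    fix x assume "x \<in> carrier (dual_numbers2 R)"
    then show "\<exists>y\<in>carrier (dual_numbers2 R). y \<oplus>\<^bsub>dual_numbers2 R\<^esub> x = \<zero>\<^bsub>dual_numbers2 R\<^esub>"
      by (intro bexI[of _ "(\<ominus> fst x, \<ominus> fst (snd x), \<ominus> snd (snd x))"]) (auto simp: l_neg)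
  qed (auto simp: a_ac)
  show "Group.comm_monoid (dual_numbers2 R)"
    by (rule comm_monoidI) (auto simp: m_ac r_distr l_distr a_ac)
qed (auto simp: l_distr r_distr a_ac m_ac)

lemma dual_numbers_homs:
  "fst \<in> ring_hom (dual_numbers R) R" "(\<lambda>a. (a, \<zero>)) \<in> ring_hom R (dual_numbers R)"
  "a \<in> carrier R \<Longrightarrow> (\<lambda>(b, c). (b, a \<otimes> c)) \<in> ring_hom (dual_numbers R) (dual_numbers R)"
  by (rule ring_hom_memI; auto simp: r_distr m_ac)+

lemma dual_numbers2_homs:
  "fst \<in> ring_hom (dual_numbers2 R) R" "(\<lambda>a. (a, \<zero>, \<zero>)) \<in> ring_hom R (dual_numbers2 R)"
  "(\<lambda>(a, b, c). (a, b)) \<in> ring_hom (dual_numbers2 R) (dual_numbers R)"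
  "(\<lambda>(a, b, c). (a, c)) \<in> ring_hom (dual_numbers2 R) (dual_numbers R)"
  "(\<lambda>(a, b, c). (a, b \<oplus> c)) \<in> ring_hom (dual_numbers2 R) (dual_numbers R)"
  by (rule ring_hom_memI; auto simp: r_distr l_distr a_ac m_ac)+

end

lemma ring_hom_cringI2: "cring R \<Longrightarrow> cring S \<Longrightarrow> f \<in> ring_hom R S \<Longrightarrow> ring_hom_cring R S f"
  by (simp add: ring_hom_cring_def ring_hom_cring_axioms_def)

section \<open>Room in the universe: pairing functions and infinite carriers\<close>

lemma infinite_pairing:
  assumes "infinite (UNIV :: 'u set)"
  obtains pr :: "'u \<times> 'u \<Rightarrow> 'u" where "inj pr"
proof -
  have "|(UNIV :: 'u set) \<times> (UNIV :: 'u set)| =o |UNIV :: 'u set|"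
    using card_of_Times_same_infinite[OF assms] by simp
  then obtain f :: "'u \<times> 'u \<Rightarrow> 'u" where "bij_betw f (UNIV \<times> UNIV) UNIV"
    unfolding card_of_ordIso[symmetric] by blast
  then have "inj f" by (simp add: bij_betw_def)
  then show thesis by (rule that)
qed

text \<open>The multiples of 1 by natural numbers are distinct, since two equal ones would differ by
  a positive multiple of 1 that vanishes. Through the embedding of K this makes the universe
  infinite.\<close>

lemma char_0_infinite_carrier:
  assumes "cring K" "\<forall>n::nat. n > 0 \<longrightarrow> [n] \<cdot>\<^bsub>K\<^esub> \<one>\<^bsub>K\<^esub> \<noteq> \<zero>\<^bsub>K\<^esub>"
  shows "infinite (carrier K)"
proof -
  interpret K: cring K by fact
  have lt: "add_pow K m \<one>\<^bsub>K\<^esub> \<noteq> add_pow K n \<one>\<^bsub>K\<^esub>" if "m < n" for m n :: nat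
  proof
    assume eq: "add_pow K m \<one>\<^bsub>K\<^esub> = add_pow K n \<one>\<^bsub>K\<^esub>"
    have "add_pow K n \<one>\<^bsub>K\<^esub> = add_pow K m \<one>\<^bsub>K\<^esub> \<oplus>\<^bsub>K\<^esub> add_pow K (n - m) \<one>\<^bsub>K\<^esub>"
      using that by (subst K.add.nat_pow_mult) auto
    with eq have "add_pow K (n - m) \<one>\<^bsub>K\<^esub> = \<zero>\<^bsub>K\<^esub>"
      using K.add.r_cancel_one'[of "add_pow K m \<one>\<^bsub>K\<^esub>" "add_pow K (n - m) \<one>\<^bsub>K\<^esub>"] by simp
    with assms(2) that show False by simp
  qed
  have "inj (\<lambda>n::nat. add_pow K n \<one>\<^bsub>K\<^esub>)"
    using lt by (intro linorder_injI) simp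
  moreover have "range (\<lambda>n::nat. add_pow K n \<one>\<^bsub>K\<^esub>) \<subseteq> carrier K" by auto
  ultimately show ?thesis by (meson infinite_UNIV_nat finite_subset finite_imageD)
qed

text \<open>Over a square-zero extension, an invertible matrix mod the kernel is invertible: if
  \<open>g h = 1 + n\<close> with \<open>n\<close> in the kernel, then \<open>(1 + n) (1 - n) = 1\<close>.\<close>

lemma (in cring) mat_right_inverse_nilpotent:
  assumes m: "g \<in> mats R" "h \<in> mats R" "n \<in> mats R"
    and gh: "\<And>i j. i < 16 \<Longrightarrow> j < 16 \<Longrightarrow> mat_mul R g h i j = mat_one R i j \<oplus> n i j"
    and n: "\<And>i j p q. n i j \<otimes> n p q = \<zero>"
  shows "\<exists>k\<in>mats R. mat_mul R g k = mat_one R"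
proof -
  define l where "l = (\<lambda>i j. mat_one R i j \<oplus> \<ominus> n i j)"
  have l: "l \<in> mats R" using m by (intro matsI) (simp_all add: l_def mats_outside mats_outside[OF mat_one_mats])
  have "mat_mul R (mat_mul R g h) l i j = mat_one R i j" if ij: "i < 16" "j < 16" for i j
  proof -
    have "mat_mul R (mat_mul R g h) l i j = (\<Oplus>k\<in>{..<16}. mat_one R i k \<otimes> l k j \<oplus> n i k \<otimes> mat_one R k j)"
      unfolding mat_mul_def[of _ "mat_mul R g h" l]
    proof (intro finsum_eqI)
      fix k assume k: "k \<in> {..<16::nat}"
      have "mat_mul R g h i k \<otimes> l k j = mat_one R i k \<otimes> l k j \<oplus> n i k \<otimes> l k j"
        using ij k m l by (simp add: gh l_distr)
      also have "n i k \<otimes> l k j = n i k \<otimes> mat_one R k j"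
        using m n by (simp add: l_def r_distr r_minus)
      finally show "mat_mul R g h i k \<otimes> l k j = mat_one R i k \<otimes> l k j \<oplus> n i k \<otimes> mat_one R k j" .
    qed (use m l in simp)
    also have "\<dots> = l i j \<oplus> n i j"
      using ij m l by (subst finsum_addf) (auto simp: finsum_mat_one)
    also have "\<dots> = mat_one R i j" using m by (simp add: l_def a_assoc l_neg)
    finally show ?thesis .
  qed
  then have "mat_mul R (mat_mul R g h) l = mat_one R"
    using m l by (intro mats_eqI[of _ R]) simp_all
  then have "mat_mul R g (mat_mul R h l) = mat_one R"
    using m l by (simp add: mat_mul_assoc)
  then show ?thesis using m l by (intro bexI[of _ "mat_mul R h l"]) simp_all
qed

section \<open>Objects of the quotient stack with a section\<close>

lemma ralgs_cring: "S \<in> ralgs R \<Longrightarrow> cring (fst S)"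
  by (simp add: ralgs_def)

lemma ralgs_hom: "S \<in> ralgs R \<Longrightarrow> snd S \<in> ring_hom R (fst S)"
  by (simp add: ralgs_def)

lemma ralg_hom_ring_hom: "f \<in> ralg_hom R S T \<Longrightarrow> f \<in> ring_hom (fst S) (fst T)"
  by (simp add: ralg_hom_def)

lemma ralg_hom_ext: "f \<in> ralg_hom R S T \<Longrightarrow> f \<in> extensional (carrier (fst S))"
  by (simp add: ralg_hom_def)

lemma ralg_hom_struct: "f \<in> ralg_hom R S T \<Longrightarrow> r \<in> carrier R \<Longrightarrow> f (snd S r) = snd T r"
  by (simp add: ralg_hom_def)

lemma ralg_homI:
  "\<lbrakk>f \<in> ring_hom (fst S) (fst T); f \<in> extensional (carrier (fst S)); \<And>r. r \<in> carrier R \<Longrightarrow> f (snd S r) = snd T r\<rbrakk>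
    \<Longrightarrow> f \<in> ralg_hom R S T"
  by (simp add: ralg_hom_def)

lemma ralg_hom_cring: "f \<in> ralg_hom R S T \<Longrightarrow> S \<in> ralgs R \<Longrightarrow> T \<in> ralgs R \<Longrightarrow> ring_hom_cring (fst S) (fst T) f"
  by (simp add: ring_hom_cringI2 ralgs_cring ralg_hom_ring_hom)

lemma ring_hom_restrict: "f \<in> ring_hom R S \<Longrightarrow> ring R \<Longrightarrow> restrict f (carrier R) \<in> ring_hom R S"
  by (rule ring_hom_memI) (simp_all add: ring_hom_closed ring_hom_mult ring_hom_add ring_hom_one
    ring.ring_simprules)

lemma ring_hom_compose:
  "f \<in> ring_hom R S \<Longrightarrow> g \<in> ring_hom S T \<Longrightarrow> ring R \<Longrightarrow> compose (carrier R) g f \<in> ring_hom R T"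
  using ring_hom_restrict[OF ring_hom_trans[of f R S g T]] by (simp add: compose_def comp_def)

lemma ralg_hom_compose:
  assumes "f \<in> ralg_hom R S T" "g \<in> ralg_hom R T W" "S \<in> ralgs R"
  shows "compose (carrier (fst S)) g f \<in> ralg_hom R S W"
proof (rule ralg_homI)
  show "compose (carrier (fst S)) g f \<in> ring_hom (fst S) (fst W)"
    using assms by (intro ring_hom_compose[of _ _ "fst T"]) (simp_all add: ralg_hom_ring_hom ralgs_cring cring.axioms(1))
  fix r assume r: "r \<in> carrier R"
  then have "snd S r \<in> carrier (fst S)" using ralgs_hom[OF assms(3)] by (simp add: ring_hom_closed)
  then show "compose (carrier (fst S)) g f (snd S r) = snd W r"
    using assms r by (simp add: compose_def ralg_hom_struct)
qed (simp add: compose_def)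

text \<open>All conditions of \<open>stack_objs\<close> except representability and local
  triviality. They pass to a pullback by looking at the algebras \<open>along \<rho> S\<close> only,
  whereas the two others are established for a pullback through an isomorphism with a trivial
  torsor.\<close>

definition pre_obj :: "('r, 'm) ring_scheme \<Rightarrow> ('r, 'u) qobj \<Rightarrow> bool" where
  "pre_obj R \<tau> \<longleftrightarrow> presheaf R \<tau> \<and>
     (\<forall>S\<in>ralgs R. \<forall>p\<in>sec \<tau> S.
        (\<forall>g\<in>G_pts (fst S). act \<tau> S g p \<in> sec \<tau> S) \<and>
        act \<tau> S (mat_one (fst S)) p = p \<and>
        (\<forall>g\<in>G_pts (fst S). \<forall>h\<in>G_pts (fst S).
           act \<tau> S (mat_mul (fst S) g h) p = act \<tau> S g (act \<tau> S h p)) \<and>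
        (\<forall>q\<in>sec \<tau> S. \<exists>!g. g \<in> G_pts (fst S) \<and> act \<tau> S g p = q)) \<and>
     (\<forall>S\<in>ralgs R. \<forall>T\<in>ralgs R. \<forall>f\<in>ralg_hom R S T. \<forall>g\<in>G_pts (fst S). \<forall>p\<in>sec \<tau> S.
        res \<tau> S T f (act \<tau> S g p) = act \<tau> T (mat_map f g) (res \<tau> S T f p)) \<and>
     (\<forall>S\<in>ralgs R. \<forall>p\<in>sec \<tau> S. eqv \<tau> S p \<in> X_pts (fst S) \<and>
        (\<forall>g\<in>G_pts (fst S). eqv \<tau> S (act \<tau> S g p) = X_act (fst S) g (eqv \<tau> S p))) \<and>
     (\<forall>S\<in>ralgs R. \<forall>T\<in>ralgs R. \<forall>f\<in>ralg_hom R S T. \<forall>p\<in>sec \<tau> S.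
        eqv \<tau> T (res \<tau> S T f p) = sconst_map f (eqv \<tau> S p))"

lemma stack_objs_iff:
  "\<tau> \<in> stack_objs R \<longleftrightarrow> pre_obj R \<tau> \<and> representable R \<tau> \<and> (\<exists>C. etale_cover R C \<and> (\<forall>T\<in>C. sec \<tau> T \<noteq> {}))"
  unfolding stack_objs_def torsor_def pre_obj_def mem_Collect_eq by (simp only: conj_ac)

lemma pre_objD:
  assumes "pre_obj R \<tau>" and S: "S \<in> ralgs R" and p: "p \<in> sec \<tau> S"
  shows "T \<in> ralgs R \<Longrightarrow> f \<in> ralg_hom R S T \<Longrightarrow> res \<tau> S T f p \<in> sec \<tau> T"
    "res \<tau> S S (\<lambda>s\<in>carrier (fst S). s) p = p"
    "T \<in> ralgs R \<Longrightarrow> W \<in> ralgs R \<Longrightarrow> f \<in> ralg_hom R S T \<Longrightarrow> g \<in> ralg_hom R T W \<Longrightarrow>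
      res \<tau> S W (compose (carrier (fst S)) g f) p = res \<tau> T W g (res \<tau> S T f p)"
    "a \<in> G_pts (fst S) \<Longrightarrow> act \<tau> S a p \<in> sec \<tau> S"
    "act \<tau> S (mat_one (fst S)) p = p"
    "a \<in> G_pts (fst S) \<Longrightarrow> b \<in> G_pts (fst S) \<Longrightarrow> act \<tau> S (mat_mul (fst S) a b) p = act \<tau> S a (act \<tau> S b p)"
    "q \<in> sec \<tau> S \<Longrightarrow> \<exists>!a. a \<in> G_pts (fst S) \<and> act \<tau> S a p = q"
    "T \<in> ralgs R \<Longrightarrow> f \<in> ralg_hom R S T \<Longrightarrow> a \<in> G_pts (fst S) \<Longrightarrow>
       res \<tau> S T f (act \<tau> S a p) = act \<tau> T (mat_map f a) (res \<tau> S T f p)"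
    "eqv \<tau> S p \<in> X_pts (fst S)"
    "a \<in> G_pts (fst S) \<Longrightarrow> eqv \<tau> S (act \<tau> S a p) = X_act (fst S) a (eqv \<tau> S p)"
    "T \<in> ralgs R \<Longrightarrow> f \<in> ralg_hom R S T \<Longrightarrow> eqv \<tau> T (res \<tau> S T f p) = sconst_map f (eqv \<tau> S p)"
proof -
  note A = assms(1)[unfolded pre_obj_def presheaf_def]
  note A1 = A[THEN conjunct1] and A2 = A[THEN conjunct2]
  note B = bspec[OF bspec[OF A2[THEN conjunct1] S] p] and A3 = A2[THEN conjunct2]
  note C = A3[THEN conjunct2, THEN conjunct1]
  note E = bspec[OF bspec[OF C S] p]
  show "T \<in> ralgs R \<Longrightarrow> f \<in> ralg_hom R S T \<Longrightarrow> res \<tau> S T f p \<in> sec \<tau> T"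
    by (rule A1[THEN conjunct1, rule_format, OF S _ _ p])
  show "res \<tau> S S (\<lambda>s\<in>carrier (fst S). s) p = p"
    by (rule A1[THEN conjunct2, THEN conjunct1, rule_format, OF S p])
  show "T \<in> ralgs R \<Longrightarrow> W \<in> ralgs R \<Longrightarrow> f \<in> ralg_hom R S T \<Longrightarrow> g \<in> ralg_hom R T W \<Longrightarrow>
      res \<tau> S W (compose (carrier (fst S)) g f) p = res \<tau> T W g (res \<tau> S T f p)"
    by (rule A1[THEN conjunct2, THEN conjunct2, rule_format, OF S _ _ _ _ p])
  show "a \<in> G_pts (fst S) \<Longrightarrow> act \<tau> S a p \<in> sec \<tau> S"
    by (rule B[THEN conjunct1, rule_format])
  show "act \<tau> S (mat_one (fst S)) p = p"
    by (rule B[THEN conjunct2, THEN conjunct1])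
  show "a \<in> G_pts (fst S) \<Longrightarrow> b \<in> G_pts (fst S) \<Longrightarrow> act \<tau> S (mat_mul (fst S) a b) p = act \<tau> S a (act \<tau> S b p)"
    by (rule B[THEN conjunct2, THEN conjunct2, THEN conjunct1, rule_format])
  show "q \<in> sec \<tau> S \<Longrightarrow> \<exists>!a. a \<in> G_pts (fst S) \<and> act \<tau> S a p = q"
    by (rule B[THEN conjunct2, THEN conjunct2, THEN conjunct2, rule_format])
  show "T \<in> ralgs R \<Longrightarrow> f \<in> ralg_hom R S T \<Longrightarrow> a \<in> G_pts (fst S) \<Longrightarrow>
       res \<tau> S T f (act \<tau> S a p) = act \<tau> T (mat_map f a) (res \<tau> S T f p)"
    by (rule A3[THEN conjunct1, rule_format, OF S _ _ _ p])
  show "eqv \<tau> S p \<in> X_pts (fst S)" by (rule E[THEN conjunct1])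
  show "a \<in> G_pts (fst S) \<Longrightarrow> eqv \<tau> S (act \<tau> S a p) = X_act (fst S) a (eqv \<tau> S p)"
    by (rule E[THEN conjunct2, rule_format])
  show "T \<in> ralgs R \<Longrightarrow> f \<in> ralg_hom R S T \<Longrightarrow> eqv \<tau> T (res \<tau> S T f p) = sconst_map f (eqv \<tau> S p)"
    by (rule A3[THEN conjunct2, THEN conjunct2, rule_format, OF S _ _ p])
qed

lemma stack_pt_simps [simp]:
  "sec (stack_pt c) S = G_pts (fst S)" "res (stack_pt c) S T f = mat_map f"
  "act (stack_pt c) S = mat_mul (fst S)" "eqv (stack_pt c) S g = X_act (fst S) g (sconst_map (snd S) c)"
  by (simp_all add: stack_pt_def)

lemma sconst_map_comp: "sconst_map f (sconst_map g c) = sconst_map (f \<circ> g) c"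
  by (simp add: sconst_map_def comp_def)

lemma mat_map_comp: "mat_map f (mat_map g c) = mat_map (f \<circ> g) c"
  by (simp add: mat_map_def comp_def)

lemma sconst_map_cong:
  "c \<in> sconsts R \<Longrightarrow> (\<And>r. r \<in> carrier R \<Longrightarrow> f r = g r) \<Longrightarrow> sconst_map f c = sconst_map g c"
  by (intro ext) (simp add: sconst_map_def sconsts_carrier)

lemma mat_map_cong:
  "c \<in> mats R \<Longrightarrow> (\<And>r. r \<in> carrier R \<Longrightarrow> f r = g r) \<Longrightarrow> mat_map f c = mat_map g c"
  by (intro ext) (simp add: mat_map_def)

lemma pre_obj_stack_pt:
  assumes R: "cring R" and c: "c \<in> X_pts R"
  shows "pre_obj R (stack_pt c :: ('r, 'u) qobj)"
proof -
  have X: "sconst_map (snd S) c \<in> X_pts (fst S)" if "S \<in> ralgs R" for S :: "('r, 'u) ralg"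
    by (rule ring_hom_cring.sconst_map_X_pts[OF ring_hom_cringI2[OF R ralgs_cring[OF that] ralgs_hom[OF that]] c])
  have 1: "presheaf R (stack_pt c :: ('r, 'u) qobj)"
    unfolding presheaf_def
  proof (intro conjI ballI, goal_cases)
    case (1 S T f g)
    then show ?case by (simp add: ring_hom_cring.mat_map_G_pts[OF ralg_hom_cring])
  next
    case (2 S g)
    interpret S: cring "fst S" by (rule ralgs_cring) fact
    have "g \<in> mats (fst S)" using 2 by simp
    then show ?case by (intro ext) (simp add: mat_map_def)
  next
    case (3 S T W f g p)
    interpret S: cring "fst S" by (rule ralgs_cring) fact
    have "p \<in> mats (fst S)" using 3 by simp
    then show ?case by (intro ext) (simp add: mat_map_def compose_def)
  qed
  have 2: "(\<forall>a\<in>G_pts (fst S). act (stack_pt c) S a p \<in> sec (stack_pt c) S) \<and>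
        act (stack_pt c) S (mat_one (fst S)) p = p \<and>
        (\<forall>g\<in>G_pts (fst S). \<forall>h\<in>G_pts (fst S).
           act (stack_pt c) S (mat_mul (fst S) g h) p = act (stack_pt c) S g (act (stack_pt c) S h p)) \<and>
        (\<forall>q\<in>sec (stack_pt c) S. \<exists>!g. g \<in> G_pts (fst S) \<and> act (stack_pt c) S g p = q)"
    if S: "S \<in> ralgs R" and p: "p \<in> sec (stack_pt c) S" for S :: "('r, 'u) ralg" and p
  proof -
    interpret S: cring "fst S" using S by (rule ralgs_cring)
    have "\<exists>!g. g \<in> G_pts (fst S) \<and> mat_mul (fst S) g p = q" if q: "q \<in> G_pts (fst S)" for q
    proof (rule ex1I)
      show "mat_mul (fst S) q (mat_inv (fst S) p) \<in> G_pts (fst S) \<and>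
        mat_mul (fst S) (mat_mul (fst S) q (mat_inv (fst S) p)) p = q"
        using p q by (simp add: S.mat_mul_assoc)
      fix g assume g: "g \<in> G_pts (fst S) \<and> mat_mul (fst S) g p = q"
      then have gm: "g \<in> mats (fst S)" and e: "mat_mul (fst S) g p = q" by simp_all
      have "mat_mul (fst S) (mat_mul (fst S) g p) (mat_inv (fst S) p) = mat_mul (fst S) g (mat_mul (fst S) p (mat_inv (fst S) p))"
        by (rule S.mat_mul_assoc) (use p gm in simp_all)
      then show "g = mat_mul (fst S) q (mat_inv (fst S) p)" using gm p e by simp
    qed
    then show ?thesis using p by (simp add: S.mat_mul_assoc)
  qed
  have 3: "res (stack_pt c) S T f (act (stack_pt c) S g p) = act (stack_pt c) T (mat_map f g) (res (stack_pt c) S T f p)"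
    if "S \<in> ralgs R" "T \<in> ralgs R" "f \<in> ralg_hom R S T" "g \<in> G_pts (fst S)" "p \<in> sec (stack_pt c) S"
    for S T :: "('r, 'u) ralg" and f g p
  proof -
    interpret S: cring "fst S" by (rule ralgs_cring) fact
    show ?thesis using that by (simp add: ring_hom_cring.mat_map_mul[OF ralg_hom_cring])
  qed
  have 4: "eqv (stack_pt c) S p \<in> X_pts (fst S) \<and>
        (\<forall>g\<in>G_pts (fst S). eqv (stack_pt c) S (act (stack_pt c) S g p) = X_act (fst S) g (eqv (stack_pt c) S p))"
    if S: "S \<in> ralgs R" and p: "p \<in> sec (stack_pt c) S" for S :: "('r, 'u) ralg" and p
  proof -
    interpret S: cring "fst S" using S by (rule ralgs_cring)
    show ?thesis using p X[OF S] by (simp add: S.X_act_mul)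
  qed
  have 5: "eqv (stack_pt c) T (res (stack_pt c) S T f p) = sconst_map f (eqv (stack_pt c) S p)"
    if "S \<in> ralgs R" "T \<in> ralgs R" "f \<in> ralg_hom R S T" "p \<in> sec (stack_pt c) S" for S T :: "('r, 'u) ralg" and f p
  proof -
    have "sconst_map (snd T) c = sconst_map (f \<circ> snd S) c"
      using that X_pts_sconsts[OF c] by (intro sconst_map_cong[of _ R]) (simp_all add: ralg_hom_struct)
    then show ?thesis
      using that X[OF that(1)] by (simp add: ring_hom_cring.sconst_map_X_act[OF ralg_hom_cring] sconst_map_comp)
  qed
  show ?thesis
    unfolding pre_obj_def
    apply (intro conjI)
    subgoal by (rule 1)
    subgoal by (intro ballI) (rule 2)
    subgoal by (intro ballI) (rule 3)
    subgoal by (intro ballI) (rule 4)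
    subgoal by (intro ballI) (rule 5)
    done
qed

section \<open>Pullback of objects, and isomorphisms\<close>

lemma fst_along [simp]: "fst (along \<rho> S) = fst S"
  by (simp add: along_def)

lemma snd_along [simp]: "snd (along \<rho> S) = snd S \<circ> \<rho>"
  by (simp add: along_def)

lemma along_ralgs: "\<rho> \<in> ring_hom R R' \<Longrightarrow> S \<in> ralgs R' \<Longrightarrow> along \<rho> S \<in> ralgs R"
  by (simp add: ralgs_def along_def ring_hom_trans)

lemma along_ralg_hom:
  "\<rho> \<in> ring_hom R R' \<Longrightarrow> f \<in> ralg_hom R' S T \<Longrightarrow> f \<in> ralg_hom R (along \<rho> S) (along \<rho> T)"
  by (simp add: ralg_hom_def ring_hom_closed)

lemma along_along: "along \<rho> (along \<rho>' S) = along (\<rho>' \<circ> \<rho>) S"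
  by (simp add: along_def comp_assoc)

lemma pull_simps [simp]:
  "sec (pull \<rho> \<tau>) S = sec \<tau> (along \<rho> S)" "res (pull \<rho> \<tau>) S T = res \<tau> (along \<rho> S) (along \<rho> T)"
  "act (pull \<rho> \<tau>) S = act \<tau> (along \<rho> S)" "eqv (pull \<rho> \<tau>) S = eqv \<tau> (along \<rho> S)"
  by (simp_all add: pull_def)

lemma pull_pull: "pull \<rho>' (pull \<rho> \<tau>) = pull (\<rho>' \<circ> \<rho>) \<tau>"
  by (simp add: pull_def along_along)

lemma pull_stack_pt: "pull \<rho> (stack_pt c) = stack_pt (sconst_map \<rho> c)"
  by (simp add: pull_def stack_pt_def sconst_map_comp)

lemma pre_obj_pull:
  assumes "\<rho> \<in> ring_hom R R'" "pre_obj R \<tau>"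
  shows "pre_obj R' (pull \<rho> \<tau>)"
proof -
  note a = along_ralgs[OF assms(1)] and h = along_ralg_hom[OF assms(1)]
  note D = pre_objD[OF assms(2) a]
  show ?thesis
    unfolding pre_obj_def presheaf_def pull_simps
    apply (intro conjI ballI)
    subgoal by (rule D(1)[OF _ _ a h])
    subgoal using D(2) by simp
    subgoal using D(3)[OF _ _ a a h h] by simp
    subgoal using D(4) by simp
    subgoal using D(5) by simp
    subgoal using D(6) by simp
    subgoal using D(7) by simp
    subgoal using D(8)[OF _ _ a h] by simp
    subgoal using D(9) by simp
    subgoal using D(10) by simp
    subgoal by (rule D(11)[OF _ _ a h])
    done
qed

lemma stack_isoD:
  assumes "stack_iso R \<tau> \<tau>' \<beta>" and S: "S \<in> ralgs R"
  shows "bij_betw (\<beta> S) (sec \<tau> S) (sec \<tau>' S)" "p \<in> sec \<tau> S \<Longrightarrow> \<beta> S p \<in> sec \<tau>' S"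
    "p \<in> sec \<tau> S \<Longrightarrow> eqv \<tau>' S (\<beta> S p) = eqv \<tau> S p"
    "p \<in> sec \<tau> S \<Longrightarrow> g \<in> G_pts (fst S) \<Longrightarrow> \<beta> S (act \<tau> S g p) = act \<tau>' S g (\<beta> S p)"
    "p \<in> sec \<tau> S \<Longrightarrow> T \<in> ralgs R \<Longrightarrow> f \<in> ralg_hom R S T \<Longrightarrow> \<beta> T (res \<tau> S T f p) = res \<tau>' S T f (\<beta> S p)"
proof -
  show 1: "bij_betw (\<beta> S) (sec \<tau> S) (sec \<tau>' S)" using assms unfolding stack_iso_def by blast
  show "p \<in> sec \<tau> S \<Longrightarrow> \<beta> S p \<in> sec \<tau>' S" using bij_betwE[OF 1] by blast
qed (use assms in \<open>unfold stack_iso_def, blast+\<close>)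

lemma stack_isoI:
  assumes "\<And>S. S \<in> ralgs R \<Longrightarrow> bij_betw (\<beta> S) (sec \<tau> S) (sec \<tau>' S)"
    "\<And>S p. S \<in> ralgs R \<Longrightarrow> p \<in> sec \<tau> S \<Longrightarrow> eqv \<tau>' S (\<beta> S p) = eqv \<tau> S p"
    "\<And>S p g. S \<in> ralgs R \<Longrightarrow> p \<in> sec \<tau> S \<Longrightarrow> g \<in> G_pts (fst S) \<Longrightarrow> \<beta> S (act \<tau> S g p) = act \<tau>' S g (\<beta> S p)"
    "\<And>S T f p. S \<in> ralgs R \<Longrightarrow> T \<in> ralgs R \<Longrightarrow> f \<in> ralg_hom R S T \<Longrightarrow> p \<in> sec \<tau> S \<Longrightarrow>
       \<beta> T (res \<tau> S T f p) = res \<tau>' S T f (\<beta> S p)"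
  shows "stack_iso R \<tau> \<tau>' \<beta>"
  unfolding stack_iso_def using assms by blast

lemma stack_iso_id: "stack_iso R \<tau> \<tau> (\<lambda>S p. p)"
  by (rule stack_isoI) (simp_all add: bij_betw_def)

lemma stack_iso_trans:
  assumes 1: "stack_iso R \<tau> \<tau>' \<beta>" and 2: "stack_iso R \<tau>' \<tau>'' \<beta>'"
  shows "stack_iso R \<tau> \<tau>'' (\<lambda>S p. \<beta>' S (\<beta> S p))"
proof (rule stack_isoI)
  note D1 = stack_isoD[OF 1] and D2 = stack_isoD[OF 2]
  show "bij_betw (\<lambda>p. \<beta>' S (\<beta> S p)) (sec \<tau> S) (sec \<tau>'' S)" if "S \<in> ralgs R" for S
    using bij_betw_trans[OF D1(1)[OF that] D2(1)[OF that]] by (simp add: comp_def)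
qed (simp_all add: stack_isoD[OF 1] stack_isoD[OF 2])

lemma stack_iso_sym:
  fixes \<tau> :: "('r, 'u) qobj"
  assumes 1: "stack_iso R \<tau> \<tau>' \<beta>" and t: "pre_obj R \<tau>"
  shows "stack_iso R \<tau>' \<tau> (\<lambda>S. inv_into (sec \<tau> S) (\<beta> S))"
proof (rule stack_isoI)
  note D = stack_isoD[OF 1] and P = pre_objD[OF t]
  have inj: "inj_on (\<beta> S) (sec \<tau> S)" and img: "\<beta> S ` sec \<tau> S = sec \<tau>' S" if "S \<in> ralgs R" for S
    using D(1)[OF that] by (simp_all add: bij_betw_def)
  have i: "inv_into (sec \<tau> S) (\<beta> S) (\<beta> S p) = p" if "S \<in> ralgs R" "p \<in> sec \<tau> S" for S p
    using that inj by simp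
  have ex: "\<exists>q\<in>sec \<tau> S. p = \<beta> S q" if "S \<in> ralgs R" "p \<in> sec \<tau>' S" for S p
    using that img[OF that(1)] by blast
  show "bij_betw (inv_into (sec \<tau> S) (\<beta> S)) (sec \<tau>' S) (sec \<tau> S)" if "S \<in> ralgs R" for S
    using that by (intro bij_betw_inv_into D(1))
  fix S :: "('r, 'u) ralg" assume S: "S \<in> ralgs R"
  fix p assume p: "p \<in> sec \<tau>' S"
  obtain q where q: "q \<in> sec \<tau> S" "p = \<beta> S q" using ex[OF S p] by blast
  show "eqv \<tau> S (inv_into (sec \<tau> S) (\<beta> S) p) = eqv \<tau>' S p" using S q by (simp add: i D)
  show "inv_into (sec \<tau> S) (\<beta> S) (act \<tau>' S g p) = act \<tau> S g (inv_into (sec \<tau> S) (\<beta> S) p)"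
    if g: "g \<in> G_pts (fst S)" for g
  proof -
    have "act \<tau>' S g p = \<beta> S (act \<tau> S g q)" using S q g by (simp add: D)
    then show ?thesis using S q g by (simp add: i P)
  qed
  show "inv_into (sec \<tau> T) (\<beta> T) (res \<tau>' S T f p) = res \<tau> S T f (inv_into (sec \<tau> S) (\<beta> S) p)"
    if T: "T \<in> ralgs R" "f \<in> ralg_hom R S T" for T f
  proof -
    have "res \<tau>' S T f p = \<beta> T (res \<tau> S T f q)" using S q T by (simp add: D)
    then show ?thesis using S q T by (simp add: i P)
  qed
qed

lemma stack_iso_pull:
  assumes r: "\<rho> \<in> ring_hom R R'" and 1: "stack_iso R \<tau> \<tau>' \<beta>"
  shows "stack_iso R' (pull \<rho> \<tau>) (pull \<rho> \<tau>') (pull_mor \<rho> \<beta>)"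
proof -
  note a = along_ralgs[OF r] and h = along_ralg_hom[OF r]
  note D = stack_isoD[OF 1 a]
  show ?thesis
    by (rule stack_isoI) (simp_all add: pull_mor_def D D(5)[OF _ _ a h])
qed

text \<open>An isomorphism carries the universal section u over P to a universal section of the
  target, and nonempty sets of sections to nonempty ones, so the same P and the same cover
  serve.\<close>

lemma stack_objs_iso:
  assumes t: "\<tau> \<in> stack_objs R" and t': "pre_obj R \<tau>'" and b: "stack_iso R \<tau> \<tau>' \<beta>"
  shows "\<tau>' \<in> stack_objs R"
proof -
  note D = stack_isoD[OF b]
  have t0: "pre_obj R \<tau>" and rep: "representable R \<tau>" and cov: "\<exists>C. etale_cover R C \<and> (\<forall>T\<in>C. sec \<tau> T \<noteq> {})"
    using t by (simp_all add: stack_objs_iff)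
  obtain P u where P: "P \<in> ralgs R" "u \<in> sec \<tau> P"
    and u: "\<And>S p. S \<in> ralgs R \<Longrightarrow> p \<in> sec \<tau> S \<Longrightarrow> \<exists>!f. f \<in> ralg_hom R P S \<and> res \<tau> P S f u = p"
    using rep unfolding representable_def by blast
  have "representable R \<tau>'"
    unfolding representable_def
  proof (intro bexI ballI)
    fix S p assume S: "S \<in> ralgs R" and p: "p \<in> sec \<tau>' S"
    obtain q where q: "q \<in> sec \<tau> S" "p = \<beta> S q" using D(1)[OF S] p by (metis bij_betw_def imageE)
    have inj: "inj_on (\<beta> S) (sec \<tau> S)" using D(1)[OF S] by (simp add: bij_betw_def)
    have "f \<in> ralg_hom R P S \<and> res \<tau>' P S f (\<beta> P u) = p \<longleftrightarrow> f \<in> ralg_hom R P S \<and> res \<tau> P S f u = q" for f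
    proof (cases "f \<in> ralg_hom R P S")
      case True
      then have "res \<tau>' P S f (\<beta> P u) = \<beta> S (res \<tau> P S f u)" "res \<tau> P S f u \<in> sec \<tau> S"
        using D(5)[OF P S True] pre_objD(1)[OF t0 P S True] by simp_all
      then show ?thesis using q inj by (auto dest: inj_onD)
    qed simp
    then show "\<exists>!f. f \<in> ralg_hom R P S \<and> res \<tau>' P S f (\<beta> P u) = p"
      using u[OF S q(1)] by simp
  qed (use P D in simp_all)
  moreover have "\<exists>C. etale_cover R C \<and> (\<forall>T\<in>C. sec \<tau>' T \<noteq> {})"
  proof -
    obtain C where C: "etale_cover R C" "\<forall>T\<in>C. sec \<tau> T \<noteq> {}" using cov by blast
    then have "C \<subseteq> ralgs R" unfolding etale_cover_def by blast
    then have "\<forall>T\<in>C. sec \<tau>' T \<noteq> {}" using C(2) D(2) by blast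
    then show ?thesis using C by blast
  qed
  ultimately show ?thesis using t' by (simp add: stack_objs_iff)
qed

section \<open>The base ring as a test ring, and torsors with a global section\<close>

definition init_alg :: "('r \<Rightarrow> 'u) \<Rightarrow> ('r, 'm) ring_scheme \<Rightarrow> ('r, 'u) ralg" where
  "init_alg \<iota> R = (image_ring \<iota> R, \<iota>)"

definition init_hom :: "('r \<Rightarrow> 'u) \<Rightarrow> ('r, 'm) ring_scheme \<Rightarrow> ('r, 'u) ralg \<Rightarrow> 'u \<Rightarrow> 'u" where
  "init_hom \<iota> R S = (\<lambda>x\<in>carrier (image_ring \<iota> R). snd S (inv_into (carrier R) \<iota> x))"

context
  fixes R :: "('r, 'm) ring_scheme" and \<iota> :: "'r \<Rightarrow> 'u"
  assumes R: "cring R" and inj: "inj_on \<iota> (carrier R)"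
begin

lemma init_alg_ralgs: "init_alg \<iota> R \<in> ralgs R"
  using image_ring_cring[OF R inj] image_ring_hom[OF inj] by (simp add: init_alg_def ralgs_def)

lemma init_hom_ralg_hom:
  assumes "S \<in> ralgs R" shows "init_hom \<iota> R S \<in> ralg_hom R (init_alg \<iota> R) S"
proof (rule ralg_homI)
  have R': "ring R" using R by (simp add: cring.axioms(1))
  have i: "inv_into (carrier R) \<iota> \<in> ring_hom (image_ring \<iota> R) R"
    by (rule image_ring_inv_hom[OF R' inj])
  have "snd S \<circ> inv_into (carrier R) \<iota> \<in> ring_hom (image_ring \<iota> R) (fst S)"
    by (rule ring_hom_trans[OF i ralgs_hom[OF assms]])
  then show "init_hom \<iota> R S \<in> ring_hom (fst (init_alg \<iota> R)) (fst S)"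
    using ring_hom_restrict[OF _ cring.axioms(1)[OF image_ring_cring[OF R inj]]]
    by (fastforce simp: init_hom_def init_alg_def comp_def)
  show "init_hom \<iota> R S (snd (init_alg \<iota> R) r) = snd S r" if "r \<in> carrier R" for r
    using that inj by (simp add: init_hom_def init_alg_def image_ring_carrier)
qed (simp add: init_hom_def init_alg_def)

text \<open>A homomorphism out of the copy of R is determined by its compatibility with the
  structure maps, so this copy is the initial test ring. A section over it is a global section,
  restricted to S along \<open>init_hom\<close>.\<close>

lemma init_hom_unique:
  assumes "f \<in> ralg_hom R (init_alg \<iota> R) S"
  shows "f = init_hom \<iota> R S"
proof
  fix x
  show "f x = init_hom \<iota> R S x"
  proof (cases "x \<in> \<iota> ` carrier R")
    case True
    then obtain r where "r \<in> carrier R" "x = \<iota> r" by blast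
    then show ?thesis using ralg_hom_struct[OF assms, of r] inj
      by (simp add: init_hom_def init_alg_def image_ring_carrier)
  next
    case False
    then show ?thesis using ralg_hom_ext[OF assms]
      by (simp add: init_hom_def init_alg_def image_ring_carrier extensional_def)
  qed
qed

text \<open>R is presented over itself by no generators and no relations, and the universal property
  becomes initiality.\<close>

lemma init_alg_finitely_presented: "finitely_presented R (init_alg \<iota> R)"
proof -
  have "\<exists>!f. f \<in> ralg_hom R (init_alg \<iota> R) W \<and> (\<forall>i<0::nat. f (undefined i) = y i)" if "W \<in> ralgs R" for W y
    by (rule ex1I[of _ "init_hom \<iota> R W"]) (simp_all add: init_hom_ralg_hom[OF that] init_hom_unique)
  then show ?thesis
    unfolding finitely_presented_def
    by (intro exI[of _ "0::nat"] exI[of _ "{}"] exI[of _ undefined]) auto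
qed

lemma init_alg_formally_etale: "formally_etale R (init_alg \<iota> R)"
  unfolding formally_etale_def
proof (intro ballI impI)
  fix W W' q g
  assume W: "W \<in> ralgs R" "W' \<in> ralgs R" and q: "q \<in> ralg_hom R W W'" and g: "g \<in> ralg_hom R (init_alg \<iota> R) W'"
  show "\<exists>!f. f \<in> ralg_hom R (init_alg \<iota> R) W \<and> compose (carrier (fst (init_alg \<iota> R))) q f = g"
  proof (rule ex1I)
    show "init_hom \<iota> R W \<in> ralg_hom R (init_alg \<iota> R) W \<and>
        compose (carrier (fst (init_alg \<iota> R))) q (init_hom \<iota> R W) = g"
      using init_hom_unique[OF ralg_hom_compose[OF init_hom_ralg_hom[OF W(1)] q init_alg_ralgs]]
        init_hom_unique[OF g] init_hom_ralg_hom[OF W(1)] by simp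
    show "f = init_hom \<iota> R W" if "f \<in> ralg_hom R (init_alg \<iota> R) W \<and> compose (carrier (fst (init_alg \<iota> R))) q f = g" for f
      using that init_hom_unique by blast
  qed
qed

text \<open>The identity is an etale cover: a prime of R is the preimage of its own copy.\<close>

lemma init_alg_cover: "etale_cover R {init_alg \<iota> R}"
proof -
  have "\<exists>q. primeideal q (fst (init_alg \<iota> R)) \<and> p = {s \<in> carrier R. snd (init_alg \<iota> R) s \<in> q}"
    if p: "primeideal p R" for p
  proof -
    let ?I = "image_ring \<iota> R"
    have R': "ring R" and I: "cring ?I" using R image_ring_cring[OF R inj] by (simp_all add: cring.axioms(1))
    have "ring_hom_ring ?I R (inv_into (carrier R) \<iota>)"
      using R' cring.axioms(1)[OF I] image_ring_inv_hom[OF R' inj] by (simp add: ring_hom_ringI2)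
    then have "primeideal {r \<in> carrier ?I. inv_into (carrier R) \<iota> r \<in> p} ?I"
      using ring_hom_ring.primeideal_vimage I p by blast
    moreover have "p = {s \<in> carrier R. \<iota> s \<in> {r \<in> carrier ?I. inv_into (carrier R) \<iota> r \<in> p}}"
    proof -
      have "p \<subseteq> carrier R" using p by (auto simp: primeideal_def intro: ideal.Icarr)
      then show ?thesis using inj by (auto simp: image_ring_carrier inj_on_eq_iff[OF inj] subset_iff)
    qed
    ultimately show ?thesis unfolding init_alg_def by auto
  qed
  then show ?thesis
    unfolding etale_cover_def
    using init_alg_ralgs init_alg_finitely_presented init_alg_formally_etale by auto
qed

text \<open>A global section s trivializes the torsor by g \<mapsto> g s, since G acts simply
  transitively on the sections over S. By equivariance the map to X_4 becomes the orbit map of c,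
  its value at s.\<close>

lemma section_stack_iso:
  assumes t: "pre_obj R \<tau>" and s: "s \<in> sec \<tau> (init_alg \<iota> R)"
    and c: "c \<in> X_pts R" and e: "eqv \<tau> (init_alg \<iota> R) s = sconst_map \<iota> c"
  shows "stack_iso R (stack_pt c) \<tau> (\<lambda>S g. act \<tau> S g (res \<tau> (init_alg \<iota> R) S (init_hom \<iota> R S) s))"
proof (rule stack_isoI)
  let ?s = "\<lambda>S. res \<tau> (init_alg \<iota> R) S (init_hom \<iota> R S) s"
  note D = pre_objD[OF t]
  note I = init_alg_ralgs
  have sS: "?s S \<in> sec \<tau> S" if "S \<in> ralgs R" for S
    by (rule D(1)[OF I s that init_hom_ralg_hom[OF that]])
  {
    fix S :: "('r, 'u) ralg" assume S: "S \<in> ralgs R"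
    note u = D(7)[OF S sS[OF S]]
    show "bij_betw (\<lambda>g. act \<tau> S g (?s S)) (sec (stack_pt c) S) (sec \<tau> S)"
      unfolding bij_betw_def
    proof
      show "inj_on (\<lambda>g. act \<tau> S g (?s S)) (sec (stack_pt c) S)"
      proof (rule inj_onI)
        fix g h assume "g \<in> sec (stack_pt c) S" "h \<in> sec (stack_pt c) S" "act \<tau> S g (?s S) = act \<tau> S h (?s S)"
        then show "g = h" using u[OF D(4)[OF S sS[OF S], of h]] by auto
      qed
      show "(\<lambda>g. act \<tau> S g (?s S)) ` sec (stack_pt c) S = sec \<tau> S"
      proof
        show "(\<lambda>g. act \<tau> S g (?s S)) ` sec (stack_pt c) S \<subseteq> sec \<tau> S"
          using D(4)[OF S sS[OF S]] by auto
        show "sec \<tau> S \<subseteq> (\<lambda>g. act \<tau> S g (?s S)) ` sec (stack_pt c) S"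
        proof
          fix q assume "q \<in> sec \<tau> S"
          from u[OF this] show "q \<in> (\<lambda>g. act \<tau> S g (?s S)) ` sec (stack_pt c) S" by auto
        qed
      qed
    qed
    fix g assume g: "g \<in> sec (stack_pt c) S"
    have "eqv \<tau> S (?s S) = sconst_map (init_hom \<iota> R S) (sconst_map \<iota> c)"
      using D(11)[OF I s S init_hom_ralg_hom[OF S]] e by simp
    also have "\<dots> = sconst_map (snd S) c"
      unfolding sconst_map_comp using X_pts_sconsts[OF c] inj
      by (intro sconst_map_cong[of _ R]) (simp_all add: init_hom_def image_ring_carrier)
    finally show "eqv \<tau> S (act \<tau> S g (?s S)) = eqv (stack_pt c) S g"
      using D(10)[OF S sS[OF S]] g by simp
    show "act \<tau> S (act (stack_pt c) S h g) (?s S) = act \<tau> S h (act \<tau> S g (?s S))" if "h \<in> G_pts (fst S)" for h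
      using D(6)[OF S sS[OF S] that] g by simp
  }
  fix S T :: "('r, 'u) ralg" and f g
  assume S: "S \<in> ralgs R" and T: "T \<in> ralgs R" and f: "f \<in> ralg_hom R S T" and g: "g \<in> sec (stack_pt c) S"
  have "res \<tau> S T f (?s S) = ?s T"
    using D(3)[OF I s S T init_hom_ralg_hom[OF S] f]
      init_hom_unique[OF ralg_hom_compose[OF init_hom_ralg_hom[OF S] f I]] by simp
  then show "act \<tau> T (res (stack_pt c) S T f g) (?s T) = res \<tau> S T f (act \<tau> S g (?s S))"
    using D(8)[OF S sS[OF S] T f] g by simp
qed

lemma section_consts:
  assumes t: "pre_obj R \<tau>" and s: "s \<in> sec \<tau> (init_alg \<iota> R)"
  obtains c where "c \<in> X_pts R" "eqv \<tau> (init_alg \<iota> R) s = sconst_map \<iota> c"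
proof -
  have R': "ring R" using R by (simp add: cring.axioms(1))
  let ?i = "inv_into (carrier R) \<iota>"
  have e: "eqv \<tau> (init_alg \<iota> R) s \<in> X_pts (image_ring \<iota> R)"
    using pre_objD(9)[OF t init_alg_ralgs s] by (simp add: init_alg_def)
  have "ring_hom_cring (image_ring \<iota> R) R ?i"
    by (rule ring_hom_cringI2[OF image_ring_cring[OF R inj] R image_ring_inv_hom[OF R' inj]])
  then have c: "sconst_map ?i (eqv \<tau> (init_alg \<iota> R) s) \<in> X_pts R"
    by (rule ring_hom_cring.sconst_map_X_pts[OF _ e])
  have "sconst_map \<iota> (sconst_map ?i (eqv \<tau> (init_alg \<iota> R) s)) = sconst_map (\<lambda>x. x) (eqv \<tau> (init_alg \<iota> R) s)"
    unfolding sconst_map_comp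
    by (rule sconst_map_cong[OF X_pts_sconsts[OF e]]) (auto simp: image_ring_carrier f_inv_into_f)
  then show thesis using that[OF c] by (simp add: sconst_map_def)
qed

end

section \<open>The coordinate ring of \<open>G\<close>\<close>

text \<open>The coordinate ring consists of polynomial expressions in the entries of a matrix and of its
  inverse, where two expressions are identified if they agree on all points of \<open>G\<close> with values in
  algebras carried by the universe \<open>'u\<close>.  It has one element for each equivalence class of
  expressions, and so its elements can be encoded in any infinite universe that contains the base ring.\<close>

datatype 'r gterm = Cst 'r | Gen nat nat | Inv nat nat | Add "'r gterm" "'r gterm" | Mul "'r gterm" "'r gterm"

primrec gterm_eval :: "('r, 'u) ralg \<Rightarrow> 'u mat \<Rightarrow> 'r gterm \<Rightarrow> 'u" where
  "gterm_eval S g (Cst r) = snd S r"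
| "gterm_eval S g (Gen i j) = g i j"
| "gterm_eval S g (Inv i j) = mat_inv (fst S) g i j"
| "gterm_eval S g (Add a b) = gterm_eval S g a \<oplus>\<^bsub>fst S\<^esub> gterm_eval S g b"
| "gterm_eval S g (Mul a b) = gterm_eval S g a \<otimes>\<^bsub>fst S\<^esub> gterm_eval S g b"

text \<open>The choice depends on t only through its values on U, so equivalent terms get the same
  representative. Representatives are used instead of classes because they are finite terms, which
  \<open>gterm_code\<close> can encode.\<close>

definition gterm_rep :: "('r, 'm) ring_scheme \<Rightarrow> (('r, 'u) ralg \<times> 'u mat) set \<Rightarrow> 'r gterm \<Rightarrow> 'r gterm" where
  "gterm_rep R U t = (SOME t'. set_gterm t' \<subseteq> carrier R \<and> (\<forall>(S, g)\<in>U. gterm_eval S g t' = gterm_eval S g t))"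

definition coord_ring :: "('r, 'm) ring_scheme \<Rightarrow> (('r, 'u) ralg \<times> 'u mat) set \<Rightarrow> 'r gterm ring" where
  "coord_ring R U = \<lparr> carrier = gterm_rep R U ` {t. set_gterm t \<subseteq> carrier R},
     monoid.mult = (\<lambda>a b. gterm_rep R U (Mul a b)), monoid.one = gterm_rep R U (Cst \<one>\<^bsub>R\<^esub>),
     ring.zero = gterm_rep R U (Cst \<zero>\<^bsub>R\<^esub>), add = (\<lambda>a b. gterm_rep R U (Add a b)) \<rparr>"

text \<open>The labels n 0, ..., n 4 tell the five constructors apart; indices are coded through n
  and constants through \<iota>.\<close>

primrec gterm_code :: "('u \<times> 'u \<Rightarrow> 'u) \<Rightarrow> (nat \<Rightarrow> 'u) \<Rightarrow> ('r \<Rightarrow> 'u) \<Rightarrow> 'r gterm \<Rightarrow> 'u" where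
  "gterm_code pr n \<iota> (Cst r) = pr (n 0, \<iota> r)"
| "gterm_code pr n \<iota> (Gen i j) = pr (n 1, pr (n i, n j))"
| "gterm_code pr n \<iota> (Inv i j) = pr (n 2, pr (n i, n j))"
| "gterm_code pr n \<iota> (Add a b) = pr (n 3, pr (gterm_code pr n \<iota> a, gterm_code pr n \<iota> b))"
| "gterm_code pr n \<iota> (Mul a b) = pr (n 4, pr (gterm_code pr n \<iota> a, gterm_code pr n \<iota> b))"

lemma gterm_code_inj:
  assumes pr: "inj pr" and n: "inj n" and \<iota>: "inj_on \<iota> C"
  shows "inj_on (gterm_code pr n \<iota>) {t. set_gterm t \<subseteq> C}"
proof -
  have p: "pr x = pr y \<longleftrightarrow> x = y" and m: "n i = n j \<longleftrightarrow> i = j" for x y i j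
    using pr n by (auto dest: injD)
  have "t = t'" if "set_gterm t \<subseteq> C" "set_gterm t' \<subseteq> C" "gterm_code pr n \<iota> t = gterm_code pr n \<iota> t'" for t t'
    using that
  proof (induction t arbitrary: t')
    case (Cst r)
    then show ?case using inj_onD[OF \<iota>] by (cases t') (simp_all add: p m)
  next
    case (Gen i j)
    then show ?case by (cases t') (simp_all add: p m)
  next
    case (Inv i j)
    then show ?case by (cases t') (simp_all add: p m)
  next
    case (Add a b)
    then show ?case by (cases t') (simp_all add: p m)
  next
    case (Mul a b)
    then show ?case by (cases t') (simp_all add: p m)
  qed
  then show ?thesis by (auto intro: inj_onI)
qed

text \<open>U is the set of points at which terms are compared. It is kept abstract here and becomes
  the set of all points of G over all test rings.\<close>

locale coord_data =
  fixes R :: "('r, 'm) ring_scheme" and U :: "(('r, 'u) ralg \<times> 'u mat) set"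
  assumes R: "cring R" and U: "\<And>S g. (S, g) \<in> U \<Longrightarrow> S \<in> ralgs R" "\<And>S g. (S, g) \<in> U \<Longrightarrow> g \<in> G_pts (fst S)"
begin

sublocale R: cring R by (rule R)

abbreviation "rep \<equiv> gterm_rep R U"
abbreviation "P \<equiv> coord_ring R U"

lemma eval_closed:
  assumes "(S, g) \<in> U" "set_gterm t \<subseteq> carrier R" shows "gterm_eval S g t \<in> carrier (fst S)"
proof -
  interpret S: cring "fst S" using U(1)[OF assms(1)] by (rule ralgs_cring)
  have s: "snd S \<in> ring_hom R (fst S)" using U(1)[OF assms(1)] by (rule ralgs_hom)
  show ?thesis
    using assms(2) U(2)[OF assms(1)] by (induction t) (simp_all add: ring_hom_closed[OF s])
qed

lemma rep_props:
  assumes "set_gterm t \<subseteq> carrier R"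
  shows "set_gterm (rep t) \<subseteq> carrier R" "(S, g) \<in> U \<Longrightarrow> gterm_eval S g (rep t) = gterm_eval S g t"
proof -
  have "set_gterm (rep t) \<subseteq> carrier R \<and> (\<forall>(S, g)\<in>U. gterm_eval S g (rep t) = gterm_eval S g t)"
    unfolding gterm_rep_def by (rule someI[of _ t]) (use assms in auto)
  then show "set_gterm (rep t) \<subseteq> carrier R" "(S, g) \<in> U \<Longrightarrow> gterm_eval S g (rep t) = gterm_eval S g t"
    by auto
qed

lemma rep_eqI:
  assumes "\<And>S g. (S, g) \<in> U \<Longrightarrow> gterm_eval S g t = gterm_eval S g t'"
  shows "rep t = rep t'"
proof -
  have "(\<forall>(S, g)\<in>U. gterm_eval S g s = gterm_eval S g t) \<longleftrightarrow> (\<forall>(S, g)\<in>U. gterm_eval S g s = gterm_eval S g t')" for s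
    using assms by auto
  then show ?thesis unfolding gterm_rep_def by simp
qed

lemma P_simps:
  "a \<otimes>\<^bsub>P\<^esub> b = rep (Mul a b)" "a \<oplus>\<^bsub>P\<^esub> b = rep (Add a b)" "\<one>\<^bsub>P\<^esub> = rep (Cst \<one>\<^bsub>R\<^esub>)" "\<zero>\<^bsub>P\<^esub> = rep (Cst \<zero>\<^bsub>R\<^esub>)"
  by (simp_all add: coord_ring_def)

lemma P_carrier: "a \<in> carrier P \<longleftrightarrow> (\<exists>t. set_gterm t \<subseteq> carrier R \<and> a = rep t)"
  by (auto simp: coord_ring_def)

lemma rep_carrier [simp]: "set_gterm t \<subseteq> carrier R \<Longrightarrow> rep t \<in> carrier P"
  by (auto simp: P_carrier)

lemma carrier_consts: "a \<in> carrier P \<Longrightarrow> set_gterm a \<subseteq> carrier R"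
  using rep_props(1) by (auto simp: P_carrier)

text \<open>Terms with the same values at all points have the same representative. By this principle
  every identity in the coordinate ring, the ring axioms included, is inherited from the test
  rings.\<close>

lemma carrier_eqI:
  assumes "a \<in> carrier P" "b \<in> carrier P" "\<And>S g. (S, g) \<in> U \<Longrightarrow> gterm_eval S g a = gterm_eval S g b"
  shows "a = b"
proof -
  obtain s t where st: "set_gterm s \<subseteq> carrier R" "a = rep s" "set_gterm t \<subseteq> carrier R" "b = rep t"
    using assms(1,2) by (auto simp: P_carrier)
  have "rep s = rep t"
    by (rule rep_eqI) (use assms(3) st rep_props(2) in metis)
  then show ?thesis using st by simp
qed

lemma eval_P:
  assumes "(S, g) \<in> U"
  shows "a \<in> carrier P \<Longrightarrow> b \<in> carrier P \<Longrightarrow> gterm_eval S g (a \<otimes>\<^bsub>P\<^esub> b) = gterm_eval S g a \<otimes>\<^bsub>fst S\<^esub> gterm_eval S g b"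
    "a \<in> carrier P \<Longrightarrow> b \<in> carrier P \<Longrightarrow> gterm_eval S g (a \<oplus>\<^bsub>P\<^esub> b) = gterm_eval S g a \<oplus>\<^bsub>fst S\<^esub> gterm_eval S g b"
    "gterm_eval S g \<one>\<^bsub>P\<^esub> = \<one>\<^bsub>fst S\<^esub>" "gterm_eval S g \<zero>\<^bsub>P\<^esub> = \<zero>\<^bsub>fst S\<^esub>"
    "a \<in> carrier P \<Longrightarrow> gterm_eval S g a \<in> carrier (fst S)"
proof -
  interpret S: ring_hom_cring R "fst S" "snd S"
    using U(1)[OF assms] by (intro ring_hom_cringI2 R ralgs_cring ralgs_hom)
  show "gterm_eval S g \<one>\<^bsub>P\<^esub> = \<one>\<^bsub>fst S\<^esub>" "gterm_eval S g \<zero>\<^bsub>P\<^esub> = \<zero>\<^bsub>fst S\<^esub>"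
    using assms by (simp_all add: P_simps rep_props)
qed (use assms carrier_consts in \<open>simp_all add: P_simps rep_props eval_closed\<close>)

lemma P_closed:
  "a \<in> carrier P \<Longrightarrow> b \<in> carrier P \<Longrightarrow> a \<otimes>\<^bsub>P\<^esub> b \<in> carrier P"
  "a \<in> carrier P \<Longrightarrow> b \<in> carrier P \<Longrightarrow> a \<oplus>\<^bsub>P\<^esub> b \<in> carrier P"
  "\<one>\<^bsub>P\<^esub> \<in> carrier P" "\<zero>\<^bsub>P\<^esub> \<in> carrier P"
  using carrier_consts by (simp_all add: P_simps)

lemma P_cring: "cring P"
proof -
  note ev = eval_P and cl = P_closed
  have S: "cring (fst S)" if "(S, g) \<in> U" for S g using U(1)[OF that] by (rule ralgs_cring)
  show ?thesis
  proof (rule cringI)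
    show "abelian_group P"
    proof (rule abelian_groupI)
      fix x assume x: "x \<in> carrier P"
      \<comment> \<open>Terms have no constructor for negation, so the additive inverse of x is
        represented by -1 times x.\<close>
      let ?y = "rep (Mul (Cst (\<ominus>\<^bsub>R\<^esub> \<one>\<^bsub>R\<^esub>)) x)"
      have y: "set_gterm (Mul (Cst (\<ominus>\<^bsub>R\<^esub> \<one>\<^bsub>R\<^esub>)) x) \<subseteq> carrier R" using carrier_consts[OF x] by simp
      show "\<exists>y\<in>carrier P. y \<oplus>\<^bsub>P\<^esub> x = \<zero>\<^bsub>P\<^esub>"
      proof (intro bexI carrier_eqI)
        show yc: "?y \<in> carrier P" using y by simp
        fix S g assume *: "(S, g) \<in> U"
        interpret S: ring_hom_cring R "fst S" "snd S"
          using U(1)[OF *] by (intro ring_hom_cringI2 R ralgs_cring ralgs_hom)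
        have e: "gterm_eval S g ?y = \<ominus>\<^bsub>fst S\<^esub> gterm_eval S g x"
          using rep_props(2)[OF y *] ev(5)[OF * x] by (simp add: S.l_minus)
        show "gterm_eval S g (?y \<oplus>\<^bsub>P\<^esub> x) = gterm_eval S g \<zero>\<^bsub>P\<^esub>"
          using ev[OF *] x yc e by (simp add: S.l_neg)
      qed (use y x cl in simp_all)
    next
      fix x y z assume *: "x \<in> carrier P" "y \<in> carrier P" "z \<in> carrier P"
      show "x \<oplus>\<^bsub>P\<^esub> y \<oplus>\<^bsub>P\<^esub> z = x \<oplus>\<^bsub>P\<^esub> (y \<oplus>\<^bsub>P\<^esub> z)"
      proof (rule carrier_eqI)
        fix S g assume u: "(S, g) \<in> U"
        interpret S: cring "fst S" by (rule S[OF u])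
        show "gterm_eval S g (x \<oplus>\<^bsub>P\<^esub> y \<oplus>\<^bsub>P\<^esub> z) = gterm_eval S g (x \<oplus>\<^bsub>P\<^esub> (y \<oplus>\<^bsub>P\<^esub> z))"
          using * ev[OF u] cl by (simp add: S.a_assoc)
      qed (use * cl in simp_all)
    next
      fix x y assume *: "x \<in> carrier P" "y \<in> carrier P"
      show "x \<oplus>\<^bsub>P\<^esub> y = y \<oplus>\<^bsub>P\<^esub> x"
      proof (rule carrier_eqI)
        fix S g assume u: "(S, g) \<in> U"
        interpret S: cring "fst S" by (rule S[OF u])
        show "gterm_eval S g (x \<oplus>\<^bsub>P\<^esub> y) = gterm_eval S g (y \<oplus>\<^bsub>P\<^esub> x)"
          using * ev[OF u] cl by (simp add: S.a_comm)
      qed (use * cl in simp_all)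
    next
      fix x assume *: "x \<in> carrier P"
      show "\<zero>\<^bsub>P\<^esub> \<oplus>\<^bsub>P\<^esub> x = x"
      proof (rule carrier_eqI)
        fix S g assume u: "(S, g) \<in> U"
        interpret S: cring "fst S" by (rule S[OF u])
        show "gterm_eval S g (\<zero>\<^bsub>P\<^esub> \<oplus>\<^bsub>P\<^esub> x) = gterm_eval S g x"
          using * ev[OF u] cl by simp
      qed (use * cl in simp_all)
    qed (use cl in simp_all)
    show "Group.comm_monoid P"
    proof (rule comm_monoidI)
      fix x y z assume *: "x \<in> carrier P" "y \<in> carrier P" "z \<in> carrier P"
      show "x \<otimes>\<^bsub>P\<^esub> y \<otimes>\<^bsub>P\<^esub> z = x \<otimes>\<^bsub>P\<^esub> (y \<otimes>\<^bsub>P\<^esub> z)"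
      proof (rule carrier_eqI)
        fix S g assume u: "(S, g) \<in> U"
        interpret S: cring "fst S" by (rule S[OF u])
        show "gterm_eval S g (x \<otimes>\<^bsub>P\<^esub> y \<otimes>\<^bsub>P\<^esub> z) = gterm_eval S g (x \<otimes>\<^bsub>P\<^esub> (y \<otimes>\<^bsub>P\<^esub> z))"
          using * ev[OF u] cl by (simp add: S.m_assoc)
      qed (use * cl in simp_all)
    next
      fix x y assume *: "x \<in> carrier P" "y \<in> carrier P"
      show "x \<otimes>\<^bsub>P\<^esub> y = y \<otimes>\<^bsub>P\<^esub> x"
      proof (rule carrier_eqI)
        fix S g assume u: "(S, g) \<in> U"
        interpret S: cring "fst S" by (rule S[OF u])
        show "gterm_eval S g (x \<otimes>\<^bsub>P\<^esub> y) = gterm_eval S g (y \<otimes>\<^bsub>P\<^esub> x)"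
          using * ev[OF u] cl by (simp add: S.m_comm)
      qed (use * cl in simp_all)
    next
      fix x assume *: "x \<in> carrier P"
      show "\<one>\<^bsub>P\<^esub> \<otimes>\<^bsub>P\<^esub> x = x"
      proof (rule carrier_eqI)
        fix S g assume u: "(S, g) \<in> U"
        interpret S: cring "fst S" by (rule S[OF u])
        show "gterm_eval S g (\<one>\<^bsub>P\<^esub> \<otimes>\<^bsub>P\<^esub> x) = gterm_eval S g x"
          using * ev[OF u] cl by simp
      qed (use * cl in simp_all)
    qed (use cl in simp_all)
  next
    fix x y z assume *: "x \<in> carrier P" "y \<in> carrier P" "z \<in> carrier P"
    show "(x \<oplus>\<^bsub>P\<^esub> y) \<otimes>\<^bsub>P\<^esub> z = x \<otimes>\<^bsub>P\<^esub> z \<oplus>\<^bsub>P\<^esub> y \<otimes>\<^bsub>P\<^esub> z"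
    proof (rule carrier_eqI)
      fix S g assume u: "(S, g) \<in> U"
      interpret S: cring "fst S" by (rule S[OF u])
      show "gterm_eval S g ((x \<oplus>\<^bsub>P\<^esub> y) \<otimes>\<^bsub>P\<^esub> z) = gterm_eval S g (x \<otimes>\<^bsub>P\<^esub> z \<oplus>\<^bsub>P\<^esub> y \<otimes>\<^bsub>P\<^esub> z)"
        using * ev[OF u] cl by (simp add: S.l_distr)
    qed (use * cl in simp_all)
  qed
qed

lemma eval_hom: "(S, g) \<in> U \<Longrightarrow> gterm_eval S g \<in> ring_hom P (fst S)"
  by (rule ring_hom_memI) (simp_all add: eval_P)

lemma struct_hom: "(\<lambda>r. rep (Cst r)) \<in> ring_hom R P"
proof (rule ring_hom_memI)
  fix r s assume *: "r \<in> carrier R" "s \<in> carrier R"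
  have hom: "ring_hom_cring R (fst S) (snd S)" if "(S, g) \<in> U" for S g
    using U(1)[OF that] by (intro ring_hom_cringI2 R ralgs_cring ralgs_hom)
  show "rep (Cst (r \<otimes>\<^bsub>R\<^esub> s)) = rep (Cst r) \<otimes>\<^bsub>P\<^esub> rep (Cst s)"
  proof (rule carrier_eqI)
    fix S g assume u: "(S, g) \<in> U"
    interpret S: ring_hom_cring R "fst S" "snd S" by (rule hom[OF u])
    show "gterm_eval S g (rep (Cst (r \<otimes>\<^bsub>R\<^esub> s))) = gterm_eval S g (rep (Cst r) \<otimes>\<^bsub>P\<^esub> rep (Cst s))"
      using * u by (simp add: eval_P rep_props)
  qed (use * P_closed in simp_all)
  show "rep (Cst (r \<oplus>\<^bsub>R\<^esub> s)) = rep (Cst r) \<oplus>\<^bsub>P\<^esub> rep (Cst s)"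
  proof (rule carrier_eqI)
    fix S g assume u: "(S, g) \<in> U"
    interpret S: ring_hom_cring R "fst S" "snd S" by (rule hom[OF u])
    show "gterm_eval S g (rep (Cst (r \<oplus>\<^bsub>R\<^esub> s))) = gterm_eval S g (rep (Cst r) \<oplus>\<^bsub>P\<^esub> rep (Cst s))"
      using * u by (simp add: eval_P rep_props)
  qed (use * P_closed in simp_all)
qed (simp_all add: P_simps)

text \<open>The generic point of G and, in \<open>GY\<close>, its inverse: evaluation at a point g
  sends them to g and to the inverse of g.\<close>

definition GX :: "'r gterm mat" where "GX = (\<lambda>i j. rep (Gen i j))"
definition GY :: "'r gterm mat" where "GY = (\<lambda>i j. rep (Inv i j))"

lemma eval_GXY:
  "(S, g) \<in> U \<Longrightarrow> mat_map (gterm_eval S g) GX = g"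
  "(S, g) \<in> U \<Longrightarrow> mat_map (gterm_eval S g) GY = mat_inv (fst S) g"
  by (intro ext; simp add: mat_map_def GX_def GY_def rep_props)+

lemma mat_eqI:
  assumes "\<And>i j. a i j \<in> carrier P" "\<And>i j. b i j \<in> carrier P"
    "\<And>S g. (S, g) \<in> U \<Longrightarrow> mat_map (gterm_eval S g) a = mat_map (gterm_eval S g) b"
  shows "a = b"
proof (intro ext carrier_eqI assms(1,2))
  fix i j S g assume "(S, g) \<in> U"
  from fun_cong[OF fun_cong[OF assms(3)[OF this]], of i j]
  show "gterm_eval S g (a i j) = gterm_eval S g (b i j)" by (simp add: mat_map_def)
qed

lemma GX_entry: "(S, g) \<in> U \<Longrightarrow> gterm_eval S g (GX i j) = g i j"
  by (simp add: GX_def rep_props)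

lemma GY_entry: "(S, g) \<in> U \<Longrightarrow> gterm_eval S g (GY i j) = mat_inv (fst S) g i j"
  by (simp add: GY_def rep_props)

lemma GX_mats: "GX \<in> mats P" and GY_mats: "GY \<in> mats P"
proof -
  have c: "GX i j \<in> carrier P" "GY i j \<in> carrier P" for i j by (simp_all add: GX_def GY_def)
  show "GX \<in> mats P"
  proof (intro matsI c carrier_eqI)
    fix i j :: nat and S g assume ij: "16 \<le> i \<or> 16 \<le> j" and u: "(S, g) \<in> U"
    interpret S: cring "fst S" using U(1)[OF u] by (rule ralgs_cring)
    show "gterm_eval S g (GX i j) = gterm_eval S g \<zero>\<^bsub>P\<^esub>"
      using S.G_pts_mats[OF U(2)[OF u]] mats_outside[of g "fst S"] ij u by (simp add: GX_entry eval_P)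
  qed (simp add: P_closed)
  show "GY \<in> mats P"
  proof (intro matsI c carrier_eqI)
    fix i j :: nat and S g assume ij: "16 \<le> i \<or> 16 \<le> j" and u: "(S, g) \<in> U"
    interpret S: cring "fst S" using U(1)[OF u] by (rule ralgs_cring)
    show "gterm_eval S g (GY i j) = gterm_eval S g \<zero>\<^bsub>P\<^esub>"
      using S.G_pts_mats[OF S.G_pts_inv[OF U(2)[OF u]]] mats_outside[of "mat_inv (fst S) g" "fst S"] ij u
      by (simp add: GY_entry eval_P)
  qed (simp add: P_closed)
qed

lemma GXY_inverse: "mat_inverse P GX GY"
proof -
  interpret P: cring P by (rule P_cring)
  have "mat_mul P GX GY = mat_one P \<and> mat_mul P GY GX = mat_one P"
  proof (intro conjI mat_eqI)
    fix S g assume u: "(S, g) \<in> U"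
    interpret E: ring_hom_cring P "fst S" "gterm_eval S g"
      by (intro ring_hom_cringI2 P_cring ralgs_cring[OF U(1)[OF u]] eval_hom[OF u])
    show "mat_map (gterm_eval S g) (mat_mul P GX GY) = mat_map (gterm_eval S g) (mat_one P)"
      "mat_map (gterm_eval S g) (mat_mul P GY GX) = mat_map (gterm_eval S g) (mat_one P)"
      using U(2)[OF u] u by (simp_all add: E.mat_map_mul GX_mats GY_mats E.mat_map_one eval_GXY)
  qed (use GX_mats GY_mats in \<open>simp_all add: mats_carrier P.mat_mul_mats\<close>)
  then show ?thesis using GY_mats by (simp add: mat_inverse_def)
qed

lemma GX_G_pts: "GX \<in> G_pts P"
proof -
  interpret P: cring P by (rule P_cring)
  show ?thesis
  proof (rule P.G_ptsI[OF GX_mats _ _ GXY_inverse])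
    show "GX i j = \<zero>\<^bsub>P\<^esub>" if ij: "bdeg i \<noteq> bdeg j" for i j
    proof (rule carrier_eqI)
      fix S g assume u: "(S, g) \<in> U"
      interpret S: cring "fst S" using U(1)[OF u] by (rule ralgs_cring)
      show "gterm_eval S g (GX i j) = gterm_eval S g \<zero>\<^bsub>P\<^esub>"
        using S.G_pts_block[OF U(2)[OF u] ij] u by (simp add: GX_entry eval_P)
    qed (simp_all add: GX_def P_closed)
    show "GX 0 0 = \<one>\<^bsub>P\<^esub>"
    proof (rule carrier_eqI)
      fix S g assume u: "(S, g) \<in> U"
      interpret S: cring "fst S" using U(1)[OF u] by (rule ralgs_cring)
      show "gterm_eval S g (GX 0 0) = gterm_eval S g \<one>\<^bsub>P\<^esub>"
        using S.G_pts_00[OF U(2)[OF u]] u by (simp add: GX_entry eval_P)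
    qed (simp_all add: GX_def P_closed)
  qed
qed

text \<open>The values of f on constants and on the entries of \<open>GX\<close> are prescribed. On
  the entries of \<open>GY\<close> they are forced, because a homomorphism carries the inverse of
  \<open>GX\<close> to the inverse of its image. Induction on terms gives the rest.\<close>

lemma hom_unique:
  assumes u: "(S, g) \<in> U" and f: "f \<in> ring_hom P (fst S)" and s: "\<And>r. r \<in> carrier R \<Longrightarrow> f (rep (Cst r)) = snd S r"
    and GX: "mat_map f GX = g" and t: "set_gterm t \<subseteq> carrier R"
  shows "f (rep t) = gterm_eval S g t"
proof -
  interpret P: cring P by (rule P_cring)
  interpret F: ring_hom_cring P "fst S" f
    by (intro ring_hom_cringI2 P_cring ralgs_cring[OF U(1)[OF u]] f)
  have GY: "mat_map f GY = mat_inv (fst S) g"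
    using F.mat_map_inv[OF GX_G_pts] GX P.mat_inv_eq[OF GX_mats GXY_inverse] by simp
  show ?thesis
    using t
  proof (induction t)
    case (Cst r)
    then show ?case using s by simp
  next
    case (Gen i j)
    show ?case using fun_cong[OF fun_cong[OF GX], of i j] by (simp add: mat_map_def GX_def)
  next
    case (Inv i j)
    show ?case using fun_cong[OF fun_cong[OF GY], of i j] by (simp add: mat_map_def GY_def)
  next
    case (Add a b)
    have "rep (Add a b) = rep a \<oplus>\<^bsub>P\<^esub> rep b"
      unfolding P_simps by (rule rep_eqI) (use Add.prems in \<open>simp add: rep_props\<close>)
    then show ?case using Add by simp
  next
    case (Mul a b)
    have "rep (Mul a b) = rep a \<otimes>\<^bsub>P\<^esub> rep b"
      unfolding P_simps by (rule rep_eqI) (use Mul.prems in \<open>simp add: rep_props\<close>)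
    then show ?case using Mul by simp
  qed
qed

end

text \<open>The coordinate ring represents G: a point g over S corresponds to the evaluation of
  terms at g, and the generic matrix is the universal point. As this ring is carried by terms, a
  copy in the universe takes its place.\<close>

lemma stack_pt_representable:
  fixes R :: "('r, 'm) ring_scheme" and \<iota> :: "'r \<Rightarrow> 'u"
  assumes R: "cring R" and inj: "inj_on \<iota> (carrier R)" and inf: "infinite (UNIV :: 'u set)"
  shows "representable R (stack_pt c :: ('r, 'u) qobj)"
proof -
  define U where "U = {(S, g). S \<in> (ralgs R :: ('r, 'u) ralg set) \<and> g \<in> G_pts (fst S)}"
  interpret coord_data R U by (rule coord_data.intro) (auto simp: R U_def)
  obtain pr :: "'u \<times> 'u \<Rightarrow> 'u" where pr: "inj pr" using infinite_pairing[OF inf] .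
  obtain n :: "nat \<Rightarrow> 'u" where n: "inj n" using infinite_countable_subset[OF inf] by auto
  define \<kappa> where "\<kappa> = gterm_code pr n \<iota>"
  have \<kappa>: "inj_on \<kappa> (carrier P)"
    using inj_on_subset[OF gterm_code_inj[OF pr n inj]] carrier_consts by (auto simp: \<kappa>_def)
  let ?P = "(image_ring \<kappa> P, \<lambda>r. \<kappa> (rep (Cst r)))"
  have \<kappa>h: "\<kappa> \<in> ring_hom P (image_ring \<kappa> P)" by (rule image_ring_hom[OF \<kappa>])
  have Pc: "cring (image_ring \<kappa> P)" by (rule image_ring_cring[OF P_cring \<kappa>])
  have PR: "?P \<in> ralgs R"
    using Pc ring_hom_trans[OF struct_hom \<kappa>h] by (simp add: ralgs_def comp_def)
  interpret Kh: ring_hom_cring P "image_ring \<kappa> P" \<kappa> by (rule ring_hom_cringI2[OF P_cring Pc \<kappa>h])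
  have ih: "inv_into (carrier P) \<kappa> \<in> ring_hom (image_ring \<kappa> P) P"
    by (rule image_ring_inv_hom[OF cring.axioms(1)[OF P_cring] \<kappa>])
  have uniq: "\<exists>!f. f \<in> ralg_hom R ?P S \<and> mat_map f (mat_map \<kappa> GX) = g"
    if S: "S \<in> ralgs R" and g: "g \<in> G_pts (fst S)" for S g
  proof (rule ex1I)
    have u: "(S, g) \<in> U" using S g by (simp add: U_def)
    let ?f = "restrict (gterm_eval S g \<circ> inv_into (carrier P) \<kappa>) (carrier (image_ring \<kappa> P))"
    have fk: "?f (\<kappa> a) = gterm_eval S g a" if "a \<in> carrier P" for a
      using that \<kappa> by (simp add: image_ring_carrier)
    have "?f \<in> ralg_hom R ?P S"
    proof (rule ralg_homI)
      show "?f \<in> ring_hom (fst ?P) (fst S)"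
        using ring_hom_restrict[OF ring_hom_trans[OF ih eval_hom[OF u]] cring.axioms(1)[OF Pc]] by simp
      show "?f (snd ?P r) = snd S r" if "r \<in> carrier R" for r
        using that u by (simp add: fk rep_props del: restrict_apply)
    qed simp
    moreover have "mat_map ?f (mat_map \<kappa> GX) = g"
    proof -
      have "mat_map ?f (mat_map \<kappa> GX) = mat_map (gterm_eval S g) GX"
        using GX_mats by (intro ext) (simp add: mat_map_def fk mats_carrier del: restrict_apply)
      then show ?thesis using eval_GXY(1)[OF u] by simp
    qed
    ultimately show "?f \<in> ralg_hom R ?P S \<and> mat_map ?f (mat_map \<kappa> GX) = g" ..
    fix f assume f: "f \<in> ralg_hom R ?P S \<and> mat_map f (mat_map \<kappa> GX) = g"
    have fh: "f \<in> ring_hom (image_ring \<kappa> P) (fst S)" using f ralg_hom_ring_hom[of f R ?P S] by simp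
    have "(f \<circ> \<kappa>) (rep t) = gterm_eval S g t" if "set_gterm t \<subseteq> carrier R" for t
    proof (rule hom_unique[OF u ring_hom_trans[OF \<kappa>h fh] _ _ that])
      show "(f \<circ> \<kappa>) (rep (Cst r)) = snd S r" if "r \<in> carrier R" for r
        using f that ralg_hom_struct[of f R ?P S r] by simp
      show "mat_map (f \<circ> \<kappa>) GX = g" using f by (simp add: mat_map_comp)
    qed
    then have fa: "f (\<kappa> a) = gterm_eval S g a" if "a \<in> carrier P" for a
      using that u by (auto simp: P_carrier rep_props)
    show "f = ?f"
    proof
      fix x
      show "f x = ?f x"
      proof (cases "x \<in> carrier (image_ring \<kappa> P)")
        case True
        then obtain a where "a \<in> carrier P" "x = \<kappa> a" by (auto simp: image_ring_carrier)
        then show ?thesis using fa fk by (simp del: restrict_apply)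
      next
        case False
        then show ?thesis using f ralg_hom_ext[of f R ?P S] by (simp add: extensional_def)
      qed
    qed
  qed
  show ?thesis
    unfolding representable_def
    by (rule bexI[OF _ PR], rule bexI[of _ "mat_map \<kappa> GX"]) (use uniq GX_G_pts in simp_all)
qed

text \<open>The trivial torsor has the section 1 over every test ring, so the identity covering
  trivializes it.\<close>

lemma stack_pt_stack_objs:
  fixes R :: "('r, 'm) ring_scheme" and \<iota> :: "'r \<Rightarrow> 'u"
  assumes R: "cring R" and inj: "inj_on \<iota> (carrier R)" and inf: "infinite (UNIV :: 'u set)" and c: "c \<in> X_pts R"
  shows "(stack_pt c :: ('r, 'u) qobj) \<in> stack_objs R"
proof -
  have "sec (stack_pt c :: ('r, 'u) qobj) T \<noteq> {}" if "T \<in> ralgs R" for T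
    using cring.G_pts_one[OF ralgs_cring[OF that]] by auto
  then have "\<exists>C. etale_cover R C \<and> (\<forall>T\<in>C. sec (stack_pt c :: ('r, 'u) qobj) T \<noteq> {})"
    using init_alg_cover[OF R inj] init_alg_ralgs[OF R inj] by blast
  then show ?thesis
    using pre_obj_stack_pt[OF R c] stack_pt_representable[OF R inj inf] by (simp add: stack_objs_iff)
qed

section \<open>Lifting sections over square-zero extensions\<close>

text \<open>By Zorn, there is a subspace \<open>W\<close> that is maximal among those not containing \<open>1\<close>; then
  \<open>L = W \<oplus> K \<cdot> 1\<close>.\<close>

lemma unit_functional:
  assumes K: "field K" and L: "cring L" and j: "j \<in> ring_hom K L" and nz: "\<one>\<^bsub>L\<^esub> \<noteq> \<zero>\<^bsub>L\<^esub>"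
  obtains l where "\<And>x. x \<in> carrier L \<Longrightarrow> l x \<in> carrier K"
    "\<And>x y. \<lbrakk>x \<in> carrier L; y \<in> carrier L\<rbrakk> \<Longrightarrow> l (x \<oplus>\<^bsub>L\<^esub> y) = l x \<oplus>\<^bsub>K\<^esub> l y"
    "\<And>k x. \<lbrakk>k \<in> carrier K; x \<in> carrier L\<rbrakk> \<Longrightarrow> l (j k \<otimes>\<^bsub>L\<^esub> x) = k \<otimes>\<^bsub>K\<^esub> l x"
    "l \<one>\<^bsub>L\<^esub> = \<one>\<^bsub>K\<^esub>"
proof -
  interpret K: field K by fact
  interpret L: cring L by fact
  interpret j: ring_hom_cring K L j by (rule ring_hom_cringI2[OF K.cring_axioms L j])
  define sub where "sub W \<longleftrightarrow> W \<subseteq> carrier L \<and> \<zero>\<^bsub>L\<^esub> \<in> W \<and> (\<forall>x\<in>W. \<forall>y\<in>W. x \<oplus>\<^bsub>L\<^esub> y \<in> W) \<and>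
    (\<forall>k\<in>carrier K. \<forall>x\<in>W. j k \<otimes>\<^bsub>L\<^esub> x \<in> W) \<and> \<one>\<^bsub>L\<^esub> \<notin> W" for W
  have "\<exists>M\<in>Collect sub. \<forall>V\<in>Collect sub. M \<subseteq> V \<longrightarrow> V = M"
  proof (rule subset_Zorn_nonempty)
    have "sub {\<zero>\<^bsub>L\<^esub>}" using nz by (simp add: sub_def)
    then show "Collect sub \<noteq> {}" by blast
    fix C assume C: "C \<noteq> {}" "subset.chain (Collect sub) C"
    have s: "sub V" if "V \<in> C" for V using C(2) that by (auto simp: subset.chain_def)
    have tot: "V \<subseteq> V' \<or> V' \<subseteq> V" if "V \<in> C" "V' \<in> C" for V V'
      using C(2) that by (auto simp: subset.chain_def)
    have "sub (\<Union>C)"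
      unfolding sub_def
    proof (intro conjI ballI)
      show "\<Union>C \<subseteq> carrier L" using s unfolding sub_def by blast
      show "\<zero>\<^bsub>L\<^esub> \<in> \<Union>C" using s C(1) unfolding sub_def by blast
      show "\<one>\<^bsub>L\<^esub> \<notin> \<Union>C" using s unfolding sub_def by blast
      show "j k \<otimes>\<^bsub>L\<^esub> x \<in> \<Union>C" if "k \<in> carrier K" "x \<in> \<Union>C" for k x using s that unfolding sub_def by blast
      fix x y assume "x \<in> \<Union>C" "y \<in> \<Union>C"
      then obtain V V' where V: "V \<in> C" "x \<in> V" "V' \<in> C" "y \<in> V'" by blast
      then obtain V'' where "V'' \<in> C" "x \<in> V''" "y \<in> V''" using tot[of V V'] by blast
      then show "x \<oplus>\<^bsub>L\<^esub> y \<in> \<Union>C" using s unfolding sub_def by blast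
    qed
    then show "\<Union>C \<in> Collect sub" by simp
  qed
  then obtain W where W: "sub W" and max: "\<And>V. sub V \<Longrightarrow> W \<subseteq> V \<Longrightarrow> V = W" by auto
  have Wc: "x \<in> carrier L" if "x \<in> W" for x using W that unfolding sub_def by blast
  have Wa: "x \<oplus>\<^bsub>L\<^esub> y \<in> W" if "x \<in> W" "y \<in> W" for x y using W that unfolding sub_def by blast
  have Wm: "j k \<otimes>\<^bsub>L\<^esub> x \<in> W" if "k \<in> carrier K" "x \<in> W" for k x using W that unfolding sub_def by blast
  have W0: "\<zero>\<^bsub>L\<^esub> \<in> W" and W1: "\<one>\<^bsub>L\<^esub> \<notin> W" using W unfolding sub_def by blast+
  have Wn: "\<ominus>\<^bsub>L\<^esub> x \<in> W" if "x \<in> W" for x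
    using Wm[of "\<ominus>\<^bsub>K\<^esub> \<one>\<^bsub>K\<^esub>" x] that Wc[OF that] by (simp add: L.l_minus)
  have ex: "\<exists>k\<in>carrier K. \<exists>w\<in>W. x = w \<oplus>\<^bsub>L\<^esub> j k" if x: "x \<in> carrier L" for x
  proof (cases "x \<in> W")
    case True
    then show ?thesis using Wc x by (intro bexI[of _ "\<zero>\<^bsub>K\<^esub>"] bexI[of _ x]) simp_all
  next
    case False
    \<comment> \<open>The space W + K x is strictly larger than W and closed under the operations,
      so by maximality it contains 1. Solving the resulting equation for x writes x as an element of
      W plus a scalar.\<close>
    define V where "V = {w \<oplus>\<^bsub>L\<^esub> j k \<otimes>\<^bsub>L\<^esub> x | w k. w \<in> W \<and> k \<in> carrier K}"
    have WV: "W \<subseteq> V"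
    proof
      fix w assume w: "w \<in> W"
      then have "w = w \<oplus>\<^bsub>L\<^esub> j \<zero>\<^bsub>K\<^esub> \<otimes>\<^bsub>L\<^esub> x" using x Wc by simp
      then show "w \<in> V" unfolding V_def using w by blast
    qed
    have "x = \<zero>\<^bsub>L\<^esub> \<oplus>\<^bsub>L\<^esub> j \<one>\<^bsub>K\<^esub> \<otimes>\<^bsub>L\<^esub> x" using x by simp
    then have "x \<in> V" unfolding V_def using W0 by blast
    then have "\<not> sub V" using max[OF _ WV] False by blast
    moreover have "V \<subseteq> carrier L" using Wc x by (auto simp: V_def)
    moreover have "\<zero>\<^bsub>L\<^esub> \<in> V" using WV W0 by blast
    moreover have "a \<oplus>\<^bsub>L\<^esub> b \<in> V" if ab: "a \<in> V" "b \<in> V" for a b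
    proof -
      obtain w k w' k' where *: "w \<in> W" "k \<in> carrier K" "a = w \<oplus>\<^bsub>L\<^esub> j k \<otimes>\<^bsub>L\<^esub> x"
        "w' \<in> W" "k' \<in> carrier K" "b = w' \<oplus>\<^bsub>L\<^esub> j k' \<otimes>\<^bsub>L\<^esub> x" using ab unfolding V_def by blast
      then have "a \<oplus>\<^bsub>L\<^esub> b = (w \<oplus>\<^bsub>L\<^esub> w') \<oplus>\<^bsub>L\<^esub> j (k \<oplus>\<^bsub>K\<^esub> k') \<otimes>\<^bsub>L\<^esub> x"
        using x Wc by (simp add: L.l_distr L.a_ac)
      then show ?thesis unfolding V_def using * Wa by blast
    qed
    moreover have "j m \<otimes>\<^bsub>L\<^esub> a \<in> V" if a: "a \<in> V" and m: "m \<in> carrier K" for a m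
    proof -
      obtain w k where *: "w \<in> W" "k \<in> carrier K" "a = w \<oplus>\<^bsub>L\<^esub> j k \<otimes>\<^bsub>L\<^esub> x" using a unfolding V_def by blast
      then have "j m \<otimes>\<^bsub>L\<^esub> a = (j m \<otimes>\<^bsub>L\<^esub> w) \<oplus>\<^bsub>L\<^esub> j (m \<otimes>\<^bsub>K\<^esub> k) \<otimes>\<^bsub>L\<^esub> x"
        using x Wc m by (simp add: L.r_distr L.m_assoc)
      then show ?thesis unfolding V_def using * Wm m by blast
    qed
    ultimately have "\<one>\<^bsub>L\<^esub> \<in> V" unfolding sub_def by blast
    then obtain w k where wk: "w \<in> W" "k \<in> carrier K" "\<one>\<^bsub>L\<^esub> = w \<oplus>\<^bsub>L\<^esub> j k \<otimes>\<^bsub>L\<^esub> x" unfolding V_def by blast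
    have "k \<noteq> \<zero>\<^bsub>K\<^esub>" using wk W1 x Wc by auto
    then have k: "k \<in> Units K" using wk(2) K.field_Units by simp
    define k' where "k' = inv\<^bsub>K\<^esub> k"
    have k': "k' \<in> carrier K" "k' \<otimes>\<^bsub>K\<^esub> k = \<one>\<^bsub>K\<^esub>" using k by (simp_all add: k'_def)
    have "x = j (k' \<otimes>\<^bsub>K\<^esub> k) \<otimes>\<^bsub>L\<^esub> x" using x k' by simp
    also have "\<dots> = j k' \<otimes>\<^bsub>L\<^esub> (j k \<otimes>\<^bsub>L\<^esub> x)" using x k'(1) wk(2) by (simp add: L.m_assoc)
    also have "j k \<otimes>\<^bsub>L\<^esub> x = \<one>\<^bsub>L\<^esub> \<oplus>\<^bsub>L\<^esub> \<ominus>\<^bsub>L\<^esub> w"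
    proof -
      have "z = (w \<oplus>\<^bsub>L\<^esub> z) \<oplus>\<^bsub>L\<^esub> \<ominus>\<^bsub>L\<^esub> w" if "z \<in> carrier L" for z
        using that Wc[OF wk(1)] by (simp add: L.a_comm[of w z] L.a_assoc L.r_neg)
      then show ?thesis using wk x by simp
    qed
    also have "j k' \<otimes>\<^bsub>L\<^esub> (\<one>\<^bsub>L\<^esub> \<oplus>\<^bsub>L\<^esub> \<ominus>\<^bsub>L\<^esub> w) = j k' \<otimes>\<^bsub>L\<^esub> \<ominus>\<^bsub>L\<^esub> w \<oplus>\<^bsub>L\<^esub> j k'"
      using k' Wc[OF wk(1)] by (simp add: L.r_distr L.a_comm)
    finally show ?thesis using k' Wm Wn wk(1) by blast
  qed
  have un: "k = k'" if "w \<in> W" "w' \<in> W" "k \<in> carrier K" "k' \<in> carrier K" "w \<oplus>\<^bsub>L\<^esub> j k = w' \<oplus>\<^bsub>L\<^esub> j k'" for w w' k k'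
  proof (rule ccontr)
    assume ne: "k \<noteq> k'"
    \<comment> \<open>The difference would be a nonzero scalar whose image lies in W, and dividing
      by it would put 1 into W.\<close>
    let ?d = "k \<ominus>\<^bsub>K\<^esub> k'"
    have "?d \<noteq> \<zero>\<^bsub>K\<^esub>" using ne that by (simp add: K.r_right_minus_eq)
    then have d: "?d \<in> Units K" using that K.field_Units by simp
    have wc: "w \<in> carrier L" "w' \<in> carrier L" using that Wc by simp_all
    have "j k = \<ominus>\<^bsub>L\<^esub> w \<oplus>\<^bsub>L\<^esub> (w \<oplus>\<^bsub>L\<^esub> j k)" using wc that(3,4) by (simp add: L.r_neg1)
    also have "\<dots> = \<ominus>\<^bsub>L\<^esub> w \<oplus>\<^bsub>L\<^esub> (w' \<oplus>\<^bsub>L\<^esub> j k')" using that(5) by simp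
    also have "\<dots> = (w' \<oplus>\<^bsub>L\<^esub> \<ominus>\<^bsub>L\<^esub> w) \<oplus>\<^bsub>L\<^esub> j k'" using wc that(3,4) by (simp add: L.a_ac)
    finally have "j ?d = w' \<oplus>\<^bsub>L\<^esub> \<ominus>\<^bsub>L\<^esub> w"
      using wc that(3,4) by (simp add: a_minus_def L.a_assoc L.r_neg)
    then have dW: "j ?d \<in> W" using Wa Wn that by simp
    have "\<one>\<^bsub>L\<^esub> = j (inv\<^bsub>K\<^esub> ?d \<otimes>\<^bsub>K\<^esub> ?d)" using d by simp
    also have "\<dots> = j (inv\<^bsub>K\<^esub> ?d) \<otimes>\<^bsub>L\<^esub> j ?d" using d that by (simp del: K.Units_l_inv)
    also have "\<dots> \<in> W" using Wm dW d by simp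
    finally show False using W1 by simp
  qed
  define l where "l x = (THE k. k \<in> carrier K \<and> (\<exists>w\<in>W. x = w \<oplus>\<^bsub>L\<^esub> j k))" for x
  have leq: "l (w \<oplus>\<^bsub>L\<^esub> j k) = k" if "w \<in> W" "k \<in> carrier K" for w k
    unfolding l_def by (rule the_equality) (use that un in blast)+
  show thesis
  proof (rule that[of l])
    fix x assume x: "x \<in> carrier L"
    obtain w k where wk: "k \<in> carrier K" "w \<in> W" "x = w \<oplus>\<^bsub>L\<^esub> j k" using ex[OF x] by blast
    show "l x \<in> carrier K" using wk leq by simp
    show "l (j m \<otimes>\<^bsub>L\<^esub> x) = m \<otimes>\<^bsub>K\<^esub> l x" if m: "m \<in> carrier K" for m
    proof -
      have "j m \<otimes>\<^bsub>L\<^esub> x = (j m \<otimes>\<^bsub>L\<^esub> w) \<oplus>\<^bsub>L\<^esub> j (m \<otimes>\<^bsub>K\<^esub> k)" using wk m Wc by (simp add: L.r_distr)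
      then show ?thesis using leq[OF Wm[OF m wk(2)], of "m \<otimes>\<^bsub>K\<^esub> k"] leq wk m by simp
    qed
    fix y assume y: "y \<in> carrier L"
    obtain w' k' where wk': "k' \<in> carrier K" "w' \<in> W" "y = w' \<oplus>\<^bsub>L\<^esub> j k'" using ex[OF y] by blast
    have "x \<oplus>\<^bsub>L\<^esub> y = (w \<oplus>\<^bsub>L\<^esub> w') \<oplus>\<^bsub>L\<^esub> j (k \<oplus>\<^bsub>K\<^esub> k')" using wk wk' Wc by (simp add: L.a_ac)
    then show "l (x \<oplus>\<^bsub>L\<^esub> y) = l x \<oplus>\<^bsub>K\<^esub> l y"
      using leq[OF Wa[OF wk(2) wk'(2)], of "k \<oplus>\<^bsub>K\<^esub> k'"] leq wk wk' by simp
  next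
    show "l \<one>\<^bsub>L\<^esub> = \<one>\<^bsub>K\<^esub>" using leq[OF W0 K.one_closed] by simp
  qed
qed


text \<open>The quotient T/q is a domain and hence nonzero. Its elements are cosets, that is, sets;
  choosing one element in each coset copies it back into the type of T.\<close>

lemma primeideal_quotient_point:
  fixes T :: "'u ring"
  assumes q: "primeideal q T"
  obtains L :: "'u ring" and p where "cring L" "p \<in> ring_hom T L" "\<one>\<^bsub>L\<^esub> \<noteq> \<zero>\<^bsub>L\<^esub>"
    "\<And>x. x \<in> q \<Longrightarrow> p x = \<zero>\<^bsub>L\<^esub>"
proof -
  interpret q: primeideal q T by fact
  let ?Q = "T Quot q"
  interpret Q: domain ?Q by (rule q.quotient_is_domain)
  define e :: "'u set \<Rightarrow> 'u" where "e = (\<lambda>A. SOME x. x \<in> A)"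
  have em: "e A \<in> A" if A: "A \<in> carrier ?Q" for A
  proof -
    obtain x where "x \<in> carrier T" "A = q +>\<^bsub>T\<^esub> x" using A by (auto simp: FactRing_def A_RCOSETS_def')
    then have "x \<in> A" using q.a_rcos_self by simp
    then show ?thesis unfolding e_def by (rule someI)
  qed
  have e: "inj_on e (carrier ?Q)"
  proof (rule inj_onI)
    fix A B assume A: "A \<in> carrier ?Q" and B: "B \<in> carrier ?Q" and eq: "e A = e B"
    obtain x y where x: "x \<in> carrier T" "A = q +>\<^bsub>T\<^esub> x" and y: "y \<in> carrier T" "B = q +>\<^bsub>T\<^esub> y"
      using A B by (auto simp: FactRing_def A_RCOSETS_def')
    have ex: "e A \<in> q +>\<^bsub>T\<^esub> x" using em[OF A] x(2) by simp
    have ey: "e A \<in> q +>\<^bsub>T\<^esub> y" using em[OF B] y(2) eq by simp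
    have "A = q +>\<^bsub>T\<^esub> e A"
      unfolding x(2) using q.a_repr_independence[OF ex x(1) q.a_subgroup] x(2) by simp
    moreover have "B = q +>\<^bsub>T\<^esub> e A"
      using q.a_repr_independence[OF ey y(1) q.a_subgroup] y(2) by simp
    ultimately show "A = B" by simp
  qed
  have "e \<circ> (+>\<^bsub>T\<^esub>) q \<in> ring_hom T (image_ring e ?Q)"
    by (rule ring_hom_trans[OF q.rcos_ring_hom image_ring_hom[OF e]])
  moreover have "\<one>\<^bsub>image_ring e ?Q\<^esub> \<noteq> \<zero>\<^bsub>image_ring e ?Q\<^esub>"
    unfolding image_ring_one image_ring_zero
    using inj_onD[OF e _ Q.one_closed Q.zero_closed] Q.one_not_zero by blast
  moreover have "(e \<circ> (+>\<^bsub>T\<^esub>) q) x = \<zero>\<^bsub>image_ring e ?Q\<^esub>" if "x \<in> q" for x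
    using q.a_rcos_const[OF that] by (simp add: image_ring_zero FactRing_def)
  ultimately show thesis
    using that[OF image_ring_cring[OF Q.cring_axioms e]] by blast
qed

lemma ex1_unique: "\<exists>!x. Q x \<Longrightarrow> Q a \<Longrightarrow> Q b \<Longrightarrow> a = b"
  by blast

text \<open>An etale algebra \<open>T\<close> over \<open>R\<close> with a prime \<open>q\<close> over the kernel of \<open>R \<rightarrow> K\<close> maps to
  \<open>L = T/q\<close> and hence to \<open>L[\<epsilon>]\<close>, so the torsor has a section over \<open>L[\<epsilon>]\<close>.  A translation makes it
  agree modulo \<open>\<epsilon>\<close> with the given section over \<open>K\<close>.  Its \<open>\<epsilon>\<close>-part is a derivation into \<open>L\<close>, and a
  \<open>K\<close>-linear functional \<open>L \<rightarrow> K\<close> that fixes \<open>1\<close> makes it a derivation into \<open>K\<close>.\<close>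

lemma torsor_lift_hom:
  fixes K :: "('k, 'm) ring_scheme" and R :: "('r, 'n) ring_scheme" and \<tau> :: "('r, 'u) qobj"
  assumes K: "field K" and inf: "infinite (UNIV :: 'u set)" and R: "cring R"
    and \<kappa>: "\<kappa> \<in> ring_hom R (dual_numbers K)" and i: "i \<in> ring_hom K R"
    and \<kappa>i: "\<And>k. k \<in> carrier K \<Longrightarrow> \<kappa> (i k) = (k, \<zero>\<^bsub>K\<^esub>)"
    and t: "\<tau> \<in> stack_objs R" and P: "P \<in> ralgs R" and u: "u \<in> sec \<tau> P"
    and univ: "\<And>S p. S \<in> ralgs R \<Longrightarrow> p \<in> sec \<tau> S \<Longrightarrow> \<exists>!f. f \<in> ralg_hom R P S \<and> res \<tau> P S f u = p"
    and f0: "f0 \<in> ring_hom (fst P) K" and f0r: "\<And>r. r \<in> carrier R \<Longrightarrow> f0 (snd P r) = fst (\<kappa> r)"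
  obtains F where "F \<in> ring_hom (fst P) (dual_numbers K)" "\<And>x. x \<in> carrier (fst P) \<Longrightarrow> fst (F x) = f0 x"
    "\<And>r. r \<in> carrier R \<Longrightarrow> F (snd P r) = \<kappa> r"
proof -
  interpret K: field K by fact
  interpret R: cring R by fact
  note to = t[unfolded stack_objs_iff, THEN conjunct1]
  note D = pre_objD[OF to]
  have \<pi>: "fst \<circ> \<kappa> \<in> ring_hom R K" by (rule ring_hom_trans[OF \<kappa> K.dual_numbers_homs(1)])
  have "ring_hom_ring R K (fst \<circ> \<kappa>)" by (rule ring_hom_ringI2[OF R.ring_axioms K.ring_axioms \<pi>])
  \<comment> \<open>The kernel of R \<rightarrow> K is the preimage of the zero ideal of a field, so
    some member of the cover has a prime above it.\<close>
  then have prime: "primeideal {r \<in> carrier R. (fst \<circ> \<kappa>) r \<in> {\<zero>\<^bsub>K\<^esub>}} R"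
    using ring_hom_ring.primeideal_vimage R K.zeroprimeideal by blast
  obtain C where C: "etale_cover R C" "\<And>T. T \<in> C \<Longrightarrow> sec \<tau> T \<noteq> {}" using t by (auto simp: stack_objs_iff)
  obtain T q where T: "T \<in> C" and q: "primeideal q (fst T)"
    and qR: "{r \<in> carrier R. (fst \<circ> \<kappa>) r \<in> {\<zero>\<^bsub>K\<^esub>}} = {s \<in> carrier R. snd T s \<in> q}"
    using C(1) prime unfolding etale_cover_def by blast
  have TR: "T \<in> ralgs R" and et: "formally_etale R T" using C(1) T unfolding etale_cover_def by blast+
  obtain t0 where t0: "t0 \<in> sec \<tau> T" using C(2)[OF T] by blast
  obtain L :: "'u ring" and p where L: "cring L" and p: "p \<in> ring_hom (fst T) L" and nz: "\<one>\<^bsub>L\<^esub> \<noteq> \<zero>\<^bsub>L\<^esub>"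
    and pq: "\<And>x. x \<in> q \<Longrightarrow> p x = \<zero>\<^bsub>L\<^esub>"
    using primeideal_quotient_point[OF q] by metis
  interpret L: cring L by fact
  have sT: "snd T \<in> ring_hom R (fst T)" by (rule ralgs_hom[OF TR])
  interpret sT: ring_hom_cring R "fst T" "snd T" by (rule ring_hom_cringI2[OF R ralgs_cring[OF TR] sT])
  interpret p: ring_hom_cring "fst T" L p by (rule ring_hom_cringI2[OF ralgs_cring[OF TR] L p])
  interpret i: ring_hom_cring K R i by (rule ring_hom_cringI2[OF K.cring_axioms R i])
  interpret \<pi>: ring_hom_cring R K "fst \<circ> \<kappa>" by (rule ring_hom_cringI2[OF R K.cring_axioms \<pi>])
  interpret \<kappa>: ring_hom_cring R "dual_numbers K" \<kappa> by (rule ring_hom_cringI2[OF R K.dual_numbers_cring \<kappa>])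
  define j where "j = (\<lambda>k. p (snd T (i k)))"
  have j: "j \<in> ring_hom K L"
    using ring_hom_trans[OF ring_hom_trans[OF i sT] p] by (simp add: j_def comp_def)
  interpret j: ring_hom_cring K L j by (rule ring_hom_cringI2[OF K.cring_axioms L j])
  have \<kappa>c: "fst (\<kappa> r) \<in> carrier K" "snd (\<kappa> r) \<in> carrier K" if "r \<in> carrier R" for r
    using \<kappa>.hom_closed[OF that] by (simp_all add: mem_Times_iff)
  \<comment> \<open>The element r - i(fst (\<kappa> r)) is killed by R \<rightarrow> K, so its image
    in T lies in q. Hence R acts on L = T/q through K.\<close>
  have pj: "p (snd T r) = j (fst (\<kappa> r))" if r: "r \<in> carrier R" for r
  proof -
    let ?d = "r \<ominus>\<^bsub>R\<^esub> i (fst (\<kappa> r))"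
    have d: "?d \<in> carrier R" using r \<kappa>c[OF r] by simp
    have "(fst \<circ> \<kappa>) ?d = (fst \<circ> \<kappa>) r \<ominus>\<^bsub>K\<^esub> (fst \<circ> \<kappa>) (i (fst (\<kappa> r)))"
      using r \<kappa>c[OF r] by (simp only: a_minus_def \<pi>.hom_add \<pi>.hom_a_inv R.a_inv_closed i.hom_closed)
    then have "(fst \<circ> \<kappa>) ?d = \<zero>\<^bsub>K\<^esub>" using \<kappa>c[OF r] by (simp add: \<kappa>i a_minus_def K.r_neg)
    then have "snd T ?d \<in> q" using qR d by blast
    then have "p (snd T ?d) = \<zero>\<^bsub>L\<^esub>" by (rule pq)
    then have "p (snd T r) \<ominus>\<^bsub>L\<^esub> j (fst (\<kappa> r)) = \<zero>\<^bsub>L\<^esub>"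
      using r \<kappa>c[OF r] by (simp add: a_minus_def j_def)
    then show ?thesis using r \<kappa>c[OF r] by (simp add: L.r_right_minus_eq)
  qed
  define LA :: "('r, 'u) ralg" where "LA = (L, \<lambda>r. j (fst (\<kappa> r)))"
  have LA: "LA \<in> ralgs R"
    using L ring_hom_trans[OF \<pi> j] by (simp add: LA_def ralgs_def comp_def)
  obtain pr :: "'u \<times> 'u \<Rightarrow> 'u" where pr: "inj pr" using infinite_pairing[OF inf] .
  let ?D = "dual_numbers L"
  have prD: "inj_on pr (carrier ?D)" using pr by (rule inj_on_subset) simp
  \<comment> \<open>A copy of L[\<epsilon>] in the universe, on which R acts through \<kappa>
    followed by j on both components. \<open>LA\<close> is its reduction modulo \<epsilon>.\<close>
  define WA :: "('r, 'u) ralg" where "WA = (image_ring pr ?D, \<lambda>r. pr (j (fst (\<kappa> r)), j (snd (\<kappa> r))))"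
  have Wc: "cring (image_ring pr ?D)" by (rule image_ring_cring[OF L.dual_numbers_cring prD])
  have prh: "pr \<in> ring_hom ?D (image_ring pr ?D)" by (rule image_ring_hom[OF prD])
  have jj: "(\<lambda>r. (j (fst (\<kappa> r)), j (snd (\<kappa> r)))) \<in> ring_hom R ?D"
  proof (rule ring_hom_memI)
    fix r s assume rs: "r \<in> carrier R" "s \<in> carrier R"
    obtain a b a' b' where e: "\<kappa> r = (a, b)" "\<kappa> s = (a', b')" by fastforce
    have c: "a \<in> carrier K" "b \<in> carrier K" "a' \<in> carrier K" "b' \<in> carrier K"
      using \<kappa>c[OF rs(1)] \<kappa>c[OF rs(2)] by (simp_all add: e)
    show "(j (fst (\<kappa> (r \<otimes>\<^bsub>R\<^esub> s))), j (snd (\<kappa> (r \<otimes>\<^bsub>R\<^esub> s)))) =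
      (j (fst (\<kappa> r)), j (snd (\<kappa> r))) \<otimes>\<^bsub>?D\<^esub> (j (fst (\<kappa> s)), j (snd (\<kappa> s)))"
      using rs c by (simp add: e)
    show "(j (fst (\<kappa> (r \<oplus>\<^bsub>R\<^esub> s))), j (snd (\<kappa> (r \<oplus>\<^bsub>R\<^esub> s)))) =
      (j (fst (\<kappa> r)), j (snd (\<kappa> r))) \<oplus>\<^bsub>?D\<^esub> (j (fst (\<kappa> s)), j (snd (\<kappa> s)))"
      using rs c by (simp add: e)
  qed (simp_all add: \<kappa>c)
  have WA: "WA \<in> ralgs R"
    using Wc ring_hom_trans[OF jj prh] by (simp add: WA_def ralgs_def comp_def)
  define dc where "dc = inv_into (carrier ?D) pr"
  have dech: "dc \<in> ring_hom (image_ring pr ?D) ?D"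
    unfolding dc_def by (rule image_ring_inv_hom[OF cring.axioms(1)[OF L.dual_numbers_cring] prD])
  have dec: "dc (pr (a, b)) = (a, b)" if "a \<in> carrier L" "b \<in> carrier L" for a b
    using prD that by (simp add: dc_def)
  have Wcar: "\<exists>a b. a \<in> carrier L \<and> b \<in> carrier L \<and> w = pr (a, b)" if "w \<in> carrier (fst WA)" for w
    using that by (auto simp: WA_def image_ring_carrier)
  define m where "m = (\<lambda>w\<in>carrier (fst WA). fst (dc w))"
  have mpr: "m (pr (a, b)) = a" if "a \<in> carrier L" "b \<in> carrier L" for a b
    using that dec by (simp add: m_def WA_def image_ring_carrier)
  have m: "m \<in> ralg_hom R WA LA"
  proof (rule ralg_homI)
    show "m \<in> ring_hom (fst WA) (fst LA)"
      using ring_hom_restrict[OF ring_hom_trans[OF dech L.dual_numbers_homs(1)] cring.axioms(1)[OF Wc]]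
      by (simp add: m_def WA_def LA_def comp_def)
    show "m (snd WA r) = snd LA r" if "r \<in> carrier R" for r
      using mpr \<kappa>c[OF that] by (simp add: WA_def LA_def)
  qed (simp add: m_def)
  have msurj: "m ` carrier (fst WA) = carrier (fst LA)"
  proof
    show "m ` carrier (fst WA) \<subseteq> carrier (fst LA)" using ring_hom_closed[OF ralg_hom_ring_hom[OF m]] by blast
    show "carrier (fst LA) \<subseteq> m ` carrier (fst WA)"
    proof
      fix a assume "a \<in> carrier (fst LA)"
      then have a: "a \<in> carrier L" by (simp add: LA_def)
      show "a \<in> m ` carrier (fst WA)"
        by (rule image_eqI[of _ _ "pr (a, \<zero>\<^bsub>L\<^esub>)"]) (use a in \<open>simp_all add: mpr WA_def image_ring_carrier\<close>)
    qed
  qed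
  have msq: "a \<otimes>\<^bsub>fst WA\<^esub> b = \<zero>\<^bsub>fst WA\<^esub>"
    if a: "a \<in> a_kernel (fst WA) (fst LA) m" and b: "b \<in> a_kernel (fst WA) (fst LA) m" for a b
  proof -
    have k: "\<exists>y. y \<in> carrier L \<and> x = pr (\<zero>\<^bsub>L\<^esub>, y)" if "x \<in> a_kernel (fst WA) (fst LA) m" for x
    proof -
      have "fst LA = L" by (simp add: LA_def)
      then have x: "x \<in> carrier (fst WA)" "m x = \<zero>\<^bsub>L\<^esub>" using that unfolding a_kernel_def' by simp_all
      obtain y z where yz: "y \<in> carrier L" "z \<in> carrier L" "x = pr (y, z)" using Wcar[OF x(1)] by blast
      have "y = \<zero>\<^bsub>L\<^esub>" using x(2) mpr[OF yz(1,2)] yz(3) by simp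
      then show ?thesis using yz by blast
    qed
    obtain y z where yz: "y \<in> carrier L" "a = pr (\<zero>\<^bsub>L\<^esub>, y)" "z \<in> carrier L" "b = pr (\<zero>\<^bsub>L\<^esub>, z)"
      using k[OF a] k[OF b] by blast
    have "pr (\<zero>\<^bsub>L\<^esub>, y) \<otimes>\<^bsub>fst WA\<^esub> pr (\<zero>\<^bsub>L\<^esub>, z) = pr ((\<zero>\<^bsub>L\<^esub>, y) \<otimes>\<^bsub>?D\<^esub> (\<zero>\<^bsub>L\<^esub>, z))"
      using yz by (simp add: WA_def ring_hom_mult[OF prh, symmetric] del: dual_numbers_simps(5))
    then show ?thesis using yz by (simp add: WA_def image_ring_zero)
  qed
  let ?p = "restrict p (carrier (fst T))"
  have pT: "?p \<in> ralg_hom R T LA"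
  proof (rule ralg_homI)
    show "?p \<in> ring_hom (fst T) (fst LA)"
      using ring_hom_restrict[OF p cring.axioms(1)[OF ralgs_cring[OF TR]]] by (simp add: LA_def)
    show "?p (snd T r) = snd LA r" if "r \<in> carrier R" for r
      using that pj by (simp add: LA_def)
  qed simp
  \<comment> \<open>The map T \<rightarrow> L lifts along the square-zero extension L[\<epsilon>]
    \<rightarrow> L because T is formally etale. Restricting the section over T along f gives a
    section over L[\<epsilon>].\<close>
  obtain f where f: "f \<in> ralg_hom R T WA"
    using et[unfolded formally_etale_def, rule_format, OF WA LA m _ pT] msurj msq by blast
  define s where "s = res \<tau> T WA f t0"
  have s: "s \<in> sec \<tau> WA" unfolding s_def by (rule D(1)[OF TR t0 WA f])
  define sL where "sL = res \<tau> WA LA m s"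
  have sL: "sL \<in> sec \<tau> LA" unfolding sL_def by (rule D(1)[OF WA s LA m])
  define g0 where "g0 = restrict (j \<circ> f0) (carrier (fst P))"
  have g0: "g0 \<in> ralg_hom R P LA"
  proof (rule ralg_homI)
    show "g0 \<in> ring_hom (fst P) (fst LA)"
      using ring_hom_restrict[OF ring_hom_trans[OF f0 j] cring.axioms(1)[OF ralgs_cring[OF P]]]
      by (simp add: g0_def LA_def)
    show "g0 (snd P r) = snd LA r" if "r \<in> carrier R" for r
      using that ring_hom_closed[OF ralgs_hom[OF P] that] f0r by (simp add: g0_def LA_def)
  qed (simp add: g0_def)
  define pL where "pL = res \<tau> P LA g0 u"
  have pL: "pL \<in> sec \<tau> LA" unfolding pL_def by (rule D(1)[OF P u LA g0])
  \<comment> \<open>Over L the new section and the given one differ by an element of G(L). Its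
    constant lift moves the section over L[\<epsilon>] to one that reduces to the given
    section.\<close>
  obtain g where g: "g \<in> G_pts L" "act \<tau> LA g sL = pL"
    using D(7)[OF LA sL pL] by (auto simp: LA_def)
  define \<sigma> where "\<sigma> = (\<lambda>a. pr (a, \<zero>\<^bsub>L\<^esub>))"
  have \<sigma>: "\<sigma> \<in> ring_hom L (fst WA)"
    using ring_hom_trans[OF L.dual_numbers_homs(2) prh] by (simp add: \<sigma>_def WA_def comp_def)
  interpret \<sigma>: ring_hom_cring L "fst WA" \<sigma> by (rule ring_hom_cringI2[OF L ralgs_cring[OF WA] \<sigma>])
  have g': "mat_map \<sigma> g \<in> G_pts (fst WA)" using g by simp
  have mg: "mat_map m (mat_map \<sigma> g) = g"
    using L.G_pts_mats[OF g(1)] by (intro ext) (simp add: mat_map_def \<sigma>_def mpr)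
  define s' where "s' = act \<tau> WA (mat_map \<sigma> g) s"
  have s': "s' \<in> sec \<tau> WA" unfolding s'_def by (rule D(4)[OF WA s g'])
  have s'L: "res \<tau> WA LA m s' = pL"
    unfolding s'_def using D(8)[OF WA s LA m g'] mg g(2) by (simp add: sL_def)
  obtain f' where f': "f' \<in> ralg_hom R P WA" "res \<tau> P WA f' u = s'" using univ[OF WA s'] by blast
  have "res \<tau> P LA (compose (carrier (fst P)) m f') u = pL"
    using D(3)[OF P u WA LA f'(1) m] f'(2) s'L by simp
  \<comment> \<open>Both homomorphisms out of P correspond to the section \<open>pL\<close>, so the
    constant part of f' is f0, with values in K.\<close>
  then have mf': "compose (carrier (fst P)) m f' = g0"
    by (intro ex1_unique[OF univ[OF LA pL]]) (use ralg_hom_compose[OF f'(1) m P] g0 pL_def in simp_all)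
  obtain l where l: "\<And>x. x \<in> carrier L \<Longrightarrow> l x \<in> carrier K"
    "\<And>x y. \<lbrakk>x \<in> carrier L; y \<in> carrier L\<rbrakk> \<Longrightarrow> l (x \<oplus>\<^bsub>L\<^esub> y) = l x \<oplus>\<^bsub>K\<^esub> l y"
    "\<And>k x. \<lbrakk>k \<in> carrier K; x \<in> carrier L\<rbrakk> \<Longrightarrow> l (j k \<otimes>\<^bsub>L\<^esub> x) = k \<otimes>\<^bsub>K\<^esub> l x"
    "l \<one>\<^bsub>L\<^esub> = \<one>\<^bsub>K\<^esub>"
    using unit_functional[OF K L j nz] by metis
  define \<delta> where "\<delta> = (\<lambda>x. snd (dc (f' x)))"
  have f'h: "f' \<in> ring_hom (fst P) (image_ring pr ?D)" using ralg_hom_ring_hom[OF f'(1)] by (simp add: WA_def)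
  have dh: "dc \<circ> f' \<in> ring_hom (fst P) ?D" by (rule ring_hom_trans[OF f'h dech])
  have f0c: "f0 x \<in> carrier K" if "x \<in> carrier (fst P)" for x using ring_hom_closed[OF f0 that] .
  have deq: "dc (f' x) = (j (f0 x), \<delta> x)" and \<delta>c: "\<delta> x \<in> carrier L" if x: "x \<in> carrier (fst P)" for x
  proof -
    have w: "f' x \<in> carrier (fst WA)" using ring_hom_closed[OF ralg_hom_ring_hom[OF f'(1)] x] .
    then have "m (f' x) = fst (dc (f' x))" by (simp add: m_def)
    moreover have "m (f' x) = j (f0 x)" using fun_cong[OF mf', of x] x by (simp add: compose_def g0_def)
    ultimately show "dc (f' x) = (j (f0 x), \<delta> x)" by (simp add: \<delta>_def prod_eq_iff)
    show "\<delta> x \<in> carrier L" using ring_hom_closed[OF dh x] by (simp add: \<delta>_def mem_Times_iff)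
  qed
  interpret P: cring "fst P" by (rule ralgs_cring[OF P])
  have \<delta>add: "\<delta> (x \<oplus>\<^bsub>fst P\<^esub> y) = \<delta> x \<oplus>\<^bsub>L\<^esub> \<delta> y"
    and \<delta>mult: "\<delta> (x \<otimes>\<^bsub>fst P\<^esub> y) = j (f0 x) \<otimes>\<^bsub>L\<^esub> \<delta> y \<oplus>\<^bsub>L\<^esub> j (f0 y) \<otimes>\<^bsub>L\<^esub> \<delta> x"
    if xy: "x \<in> carrier (fst P)" "y \<in> carrier (fst P)" for x y
    using ring_hom_add[OF dh xy] ring_hom_mult[OF dh xy] xy \<delta>c f0c by (simp_all add: deq L.m_comm)
  have \<delta>one: "\<delta> \<one>\<^bsub>fst P\<^esub> = \<zero>\<^bsub>L\<^esub>" using ring_hom_one[OF dh] by (simp add: deq)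
  have l0: "l \<zero>\<^bsub>L\<^esub> = \<zero>\<^bsub>K\<^esub>" using l(3)[of "\<zero>\<^bsub>K\<^esub>" "\<zero>\<^bsub>L\<^esub>"] l(1)[of "\<zero>\<^bsub>L\<^esub>"] by simp
  have lj: "l (j k) = k" if "k \<in> carrier K" for k using l(3)[of k "\<one>\<^bsub>L\<^esub>"] l(4) that by simp
  show thesis
  \<comment> \<open>The derivation rule for \<delta> has coefficients in K through f0, so it
    survives composition with the K-linear l. On R the result is \<kappa> because l (j k) =
    k.\<close>
  proof (rule that[of "\<lambda>x. (f0 x, l (\<delta> x))"])
    show "(\<lambda>x. (f0 x, l (\<delta> x))) \<in> ring_hom (fst P) (dual_numbers K)"
    proof (rule ring_hom_memI)
      fix x y assume xy: "x \<in> carrier (fst P)" "y \<in> carrier (fst P)"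
      show "(f0 (x \<otimes>\<^bsub>fst P\<^esub> y), l (\<delta> (x \<otimes>\<^bsub>fst P\<^esub> y))) = (f0 x, l (\<delta> x)) \<otimes>\<^bsub>dual_numbers K\<^esub> (f0 y, l (\<delta> y))"
        using xy \<delta>c f0c l by (simp add: ring_hom_mult[OF f0] \<delta>mult K.m_comm)
      show "(f0 (x \<oplus>\<^bsub>fst P\<^esub> y), l (\<delta> (x \<oplus>\<^bsub>fst P\<^esub> y))) = (f0 x, l (\<delta> x)) \<oplus>\<^bsub>dual_numbers K\<^esub> (f0 y, l (\<delta> y))"
        using xy \<delta>c l by (simp add: ring_hom_add[OF f0] \<delta>add)
    qed (simp_all add: f0c l(1) \<delta>c ring_hom_one[OF f0] \<delta>one l0)
    fix r assume r: "r \<in> carrier R"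
    have "f' (snd P r) = pr (j (fst (\<kappa> r)), j (snd (\<kappa> r)))"
      using ralg_hom_struct[OF f'(1) r] by (simp add: WA_def)
    then have "\<delta> (snd P r) = j (snd (\<kappa> r))" using \<kappa>c[OF r] by (simp add: \<delta>_def dec)
    then show "(f0 (snd P r), l (\<delta> (snd P r))) = \<kappa> r" using f0r[OF r] \<kappa>c[OF r] by (simp add: lj prod_eq_iff)
  qed simp
qed

text \<open>If P represents the torsor, its sections over a test ring are homomorphisms out of P.
  Put in terms of homomorphisms, the condition that K-sections extend to R makes sense for K and R
  themselves, whose types may differ from \<open>'u\<close>.\<close>

definition lifts_points :: "('r, 'm) ring_scheme \<Rightarrow> ('k, 'n) ring_scheme \<Rightarrow> ('r \<Rightarrow> 'k) \<Rightarrow> ('r, 'u) qobj \<Rightarrow> bool" where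
  "lifts_points R K \<pi> \<tau> \<longleftrightarrow>
     (\<forall>P\<in>ralgs R. \<forall>u\<in>sec \<tau> P.
        (\<forall>S\<in>ralgs R. \<forall>p\<in>sec \<tau> S. \<exists>!f. f \<in> ralg_hom R P S \<and> res \<tau> P S f u = p) \<longrightarrow>
        (\<forall>f0\<in>ring_hom (fst P) K. (\<forall>r\<in>carrier R. f0 (snd P r) = \<pi> r) \<longrightarrow>
          (\<exists>F\<in>ring_hom (fst P) R. (\<forall>x\<in>carrier (fst P). \<pi> (F x) = f0 x) \<and> (\<forall>r\<in>carrier R. F (snd P r) = r))))"

lemma dual_numbers_lifts_points:
  fixes K :: "('k, 'm) ring_scheme" and \<tau> :: "('k \<times> 'k, 'u) qobj"
  assumes K: "field K" and inf: "infinite (UNIV :: 'u set)" and t: "\<tau> \<in> stack_objs (dual_numbers K)"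
  shows "lifts_points (dual_numbers K) K fst \<tau>"
proof -
  interpret K: field K by fact
  have id: "(\<lambda>x. x) \<in> ring_hom (dual_numbers K) (dual_numbers K)" by (rule ring_hom_memI) simp_all
  show ?thesis
    unfolding lifts_points_def
  proof (intro ballI impI)
    fix P u f0
    assume 1: "P \<in> ralgs (dual_numbers K)" "u \<in> sec \<tau> P"
      "\<forall>S\<in>ralgs (dual_numbers K). \<forall>p\<in>sec \<tau> S. \<exists>!f. f \<in> ralg_hom (dual_numbers K) P S \<and> res \<tau> P S f u = p"
      "f0 \<in> ring_hom (fst P) K" "\<forall>r\<in>carrier (dual_numbers K). f0 (snd P r) = fst r"
    obtain F where "F \<in> ring_hom (fst P) (dual_numbers K)" "\<And>x. x \<in> carrier (fst P) \<Longrightarrow> fst (F x) = f0 x"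
      "\<And>r. r \<in> carrier (dual_numbers K) \<Longrightarrow> F (snd P r) = r"
      by (rule torsor_lift_hom[OF K inf K.dual_numbers_cring id K.dual_numbers_homs(2) refl t 1(1,2) _ 1(4)])
        (use 1(3,5) in \<open>simp_all del: dual_numbers_simps\<close>)
    then show "\<exists>F\<in>ring_hom (fst P) (dual_numbers K). (\<forall>x\<in>carrier (fst P). fst (F x) = f0 x) \<and> (\<forall>r\<in>carrier (dual_numbers K). F (snd P r) = r)" by blast
  qed
qed

text \<open>The ring K[\<epsilon>1, \<epsilon>2]/(\<epsilon>1, \<epsilon>2)^2 is the fibre product
  of two copies of K[\<epsilon>] over K. A lift to it is therefore a pair of lifts to K[\<epsilon>]
  with the common reduction f0, one for each projection.\<close>

lemma dual_numbers2_lifts_points: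
  fixes K :: "('k, 'm) ring_scheme" and \<tau> :: "('k \<times> 'k \<times> 'k, 'u) qobj"
  assumes K: "field K" and inf: "infinite (UNIV :: 'u set)" and t: "\<tau> \<in> stack_objs (dual_numbers2 K)"
  shows "lifts_points (dual_numbers2 K) K fst \<tau>"
proof -
  interpret K: field K by fact
  show ?thesis
    unfolding lifts_points_def
  proof (intro ballI impI)
    fix P u f0
    assume 1: "P \<in> ralgs (dual_numbers2 K)" "u \<in> sec \<tau> P"
      "\<forall>S\<in>ralgs (dual_numbers2 K). \<forall>p\<in>sec \<tau> S. \<exists>!f. f \<in> ralg_hom (dual_numbers2 K) P S \<and> res \<tau> P S f u = p"
      "f0 \<in> ring_hom (fst P) K" "\<forall>r\<in>carrier (dual_numbers2 K). f0 (snd P r) = fst r"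
    note lift = torsor_lift_hom[OF K inf K.dual_numbers2_cring _ K.dual_numbers2_homs(2) _ t 1(1,2) _ 1(4)]
    obtain F where F: "F \<in> ring_hom (fst P) (dual_numbers K)" "\<And>x. x \<in> carrier (fst P) \<Longrightarrow> fst (F x) = f0 x"
      "\<And>r. r \<in> carrier (dual_numbers2 K) \<Longrightarrow> F (snd P r) = (\<lambda>(a, b, c). (a, b)) r"
      by (rule lift[OF K.dual_numbers2_homs(3)]) (use 1(3,5) in \<open>simp_all add: case_prod_beta del: dual_numbers2_simps\<close>)
    obtain F' where F': "F' \<in> ring_hom (fst P) (dual_numbers K)" "\<And>x. x \<in> carrier (fst P) \<Longrightarrow> fst (F' x) = f0 x"
      "\<And>r. r \<in> carrier (dual_numbers2 K) \<Longrightarrow> F' (snd P r) = (\<lambda>(a, b, c). (a, c)) r"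
      by (rule lift[OF K.dual_numbers2_homs(4)]) (use 1(3,5) in \<open>simp_all add: case_prod_beta del: dual_numbers2_simps\<close>)
    define b where "b = (\<lambda>x. snd (F x))"
    define b' where "b' = (\<lambda>x. snd (F' x))"
    have Fe: "F x = (f0 x, b x)" "F' x = (f0 x, b' x)" if "x \<in> carrier (fst P)" for x
      using F(2) F'(2) that by (simp_all add: b_def b'_def prod_eq_iff)
    have cl: "f0 x \<in> carrier K" "b x \<in> carrier K" "b' x \<in> carrier K" if "x \<in> carrier (fst P)" for x
      using ring_hom_closed[OF F(1) that] ring_hom_closed[OF F'(1) that] that by (simp_all add: Fe)
    interpret P: cring "fst P" by (rule ralgs_cring[OF 1(1)])
    have "(\<lambda>x. (f0 x, b x, b' x)) \<in> ring_hom (fst P) (dual_numbers2 K)"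
    proof (rule ring_hom_memI)
      fix x y assume xy: "x \<in> carrier (fst P)" "y \<in> carrier (fst P)"
      show "(f0 (x \<otimes>\<^bsub>fst P\<^esub> y), b (x \<otimes>\<^bsub>fst P\<^esub> y), b' (x \<otimes>\<^bsub>fst P\<^esub> y)) =
          (f0 x, b x, b' x) \<otimes>\<^bsub>dual_numbers2 K\<^esub> (f0 y, b y, b' y)"
        using ring_hom_mult[OF F(1) xy] ring_hom_mult[OF F'(1) xy] xy by (simp add: Fe)
      show "(f0 (x \<oplus>\<^bsub>fst P\<^esub> y), b (x \<oplus>\<^bsub>fst P\<^esub> y), b' (x \<oplus>\<^bsub>fst P\<^esub> y)) =
          (f0 x, b x, b' x) \<oplus>\<^bsub>dual_numbers2 K\<^esub> (f0 y, b y, b' y)"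
        using ring_hom_add[OF F(1) xy] ring_hom_add[OF F'(1) xy] xy by (simp add: Fe)
    next
      show "(f0 \<one>\<^bsub>fst P\<^esub>, b \<one>\<^bsub>fst P\<^esub>, b' \<one>\<^bsub>fst P\<^esub>) = \<one>\<^bsub>dual_numbers2 K\<^esub>"
        using ring_hom_one[OF F(1)] ring_hom_one[OF F'(1)] by (simp add: Fe)
    qed (simp add: cl)
    moreover have "(f0 (snd P r), b (snd P r), b' (snd P r)) = r" if r: "r \<in> carrier (dual_numbers2 K)" for r
      using F(3)[OF r] F'(3)[OF r] ring_hom_closed[OF ralgs_hom[OF 1(1)] r]
      by (simp add: Fe case_prod_beta prod_eq_iff)
    ultimately show "\<exists>F\<in>ring_hom (fst P) (dual_numbers2 K). (\<forall>x\<in>carrier (fst P). fst (F x) = f0 x) \<and> (\<forall>r\<in>carrier (dual_numbers2 K). F (snd P r) = r)" by (intro bexI[of _ "\<lambda>x. (f0 x, b x, b' x)"]) simp_all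
  qed
qed

text \<open>The value of \<alpha> at 1 is a section p0 over K. As a homomorphism out of P it lifts
  to R, which gives a section s over R that restricts to p0. The trivialization by s restricts to
  \<alpha>, because both are equivariant and agree at 1.\<close>

lemma stack_obj_normal_form:
  fixes K :: "('k, 'm) ring_scheme" and R :: "('r, 'n) ring_scheme" and \<tau> :: "('r, 'u) qobj"
    and \<iota> :: "'k \<Rightarrow> 'u" and \<iota>' :: "'r \<Rightarrow> 'u"
  assumes K: "field K" and \<iota>: "inj_on \<iota> (carrier K)" and R: "cring R" and \<iota>': "inj_on \<iota>' (carrier R)"
    and \<pi>: "\<pi> \<in> ring_hom R K" and t: "\<tau> \<in> stack_objs R" and lift: "lifts_points R K \<pi> \<tau>"
    and c: "c \<in> X_pts K" and \<alpha>: "stack_iso K (stack_pt c) (pull \<pi> \<tau>) \<alpha>"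
  obtains c' \<beta> where "c' \<in> X_pts R" "sconst_map \<pi> c' = c" "stack_iso R (stack_pt c') \<tau> \<beta>"
    "\<And>S g. S \<in> ralgs K \<Longrightarrow> g \<in> G_pts (fst S) \<Longrightarrow> \<alpha> S g = \<beta> (along \<pi> S) g"
proof -
  interpret K: field K by fact
  interpret R: cring R by fact
  interpret \<pi>: ring_hom_cring R K \<pi> by (rule ring_hom_cringI2[OF R K.cring_axioms \<pi>])
  note to = t[unfolded stack_objs_iff, THEN conjunct1]
  note D = pre_objD[OF to]
  let ?I = "init_alg \<iota> K" and ?J = "init_alg \<iota>' R"
  have I: "?I \<in> ralgs K" and J: "?J \<in> ralgs R" by (rule init_alg_ralgs[OF K.cring_axioms \<iota>] init_alg_ralgs[OF R \<iota>'])+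
  have S0: "along \<pi> ?I \<in> ralgs R" by (rule along_ralgs[OF \<pi> I])
  have G1: "mat_one (fst S) \<in> G_pts (fst S)" if "S \<in> ralgs K" for S :: "('k, 'u) ralg"
    by (rule cring.G_pts_one[OF ralgs_cring[OF that]])
  define p0 where "p0 = \<alpha> ?I (mat_one (fst ?I))"
  have p0: "p0 \<in> sec \<tau> (along \<pi> ?I)" using stack_isoD(2)[OF \<alpha> I, of "mat_one (fst ?I)"] G1[OF I] by (simp add: p0_def)
  obtain P u where P: "P \<in> ralgs R" and u: "u \<in> sec \<tau> P"
    and univ: "\<forall>S\<in>ralgs R. \<forall>p\<in>sec \<tau> S. \<exists>!f. f \<in> ralg_hom R P S \<and> res \<tau> P S f u = p"
    using t unfolding stack_objs_iff representable_def by blast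
  obtain f0' where f0': "f0' \<in> ralg_hom R P (along \<pi> ?I)" "res \<tau> P (along \<pi> ?I) f0' u = p0"
    using univ S0 p0 by blast
  define f0 where "f0 = inv_into (carrier K) \<iota> \<circ> f0'"
  have ih: "inv_into (carrier K) \<iota> \<in> ring_hom (image_ring \<iota> K) K" by (rule image_ring_inv_hom[OF K.ring_axioms \<iota>])
  have f0: "f0 \<in> ring_hom (fst P) K"
    unfolding f0_def by (rule ring_hom_trans[OF _ ih]) (use ralg_hom_ring_hom[OF f0'(1)] in \<open>simp add: init_alg_def\<close>)
  have f0r: "f0 (snd P r) = \<pi> r" if "r \<in> carrier R" for r
    using ralg_hom_struct[OF f0'(1) that] \<iota> that by (simp add: f0_def init_alg_def)
  have f0\<iota>: "\<iota> (f0 x) = f0' x" if "x \<in> carrier (fst P)" for x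
    using ring_hom_closed[OF ralg_hom_ring_hom[OF f0'(1)] that]
    by (simp add: f0_def init_alg_def image_ring_carrier f_inv_into_f)
  obtain F where F: "F \<in> ring_hom (fst P) R" "\<And>x. x \<in> carrier (fst P) \<Longrightarrow> \<pi> (F x) = f0 x"
    "\<And>r. r \<in> carrier R \<Longrightarrow> F (snd P r) = r"
    using mp[OF bspec[OF mp[OF bspec[OF bspec[OF lift[unfolded lifts_points_def] P] u] univ] f0]] f0r by blast
  define F' where "F' = restrict (\<iota>' \<circ> F) (carrier (fst P))"
  have \<iota>h: "\<iota>' \<in> ring_hom R (fst ?J)" using image_ring_hom[OF \<iota>'] by (simp add: init_alg_def)
  have F': "F' \<in> ralg_hom R P ?J"
  proof (rule ralg_homI)
    show "F' \<in> ring_hom (fst P) (fst ?J)"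
      unfolding F'_def by (rule ring_hom_restrict[OF ring_hom_trans[OF F(1) \<iota>h] cring.axioms(1)[OF ralgs_cring[OF P]]])
    show "F' (snd P r) = snd ?J r" if "r \<in> carrier R" for r
      using F(3)[OF that] ring_hom_closed[OF ralgs_hom[OF P] that] by (simp add: F'_def init_alg_def)
  qed (simp add: F'_def)
  define s where "s = res \<tau> P ?J F' u"
  have s: "s \<in> sec \<tau> ?J" unfolding s_def by (rule D(1)[OF P u J F'])
  let ?h = "init_hom \<iota>' R"
  have h: "?h S \<in> ralg_hom R ?J S" if "S \<in> ralgs R" for S by (rule init_hom_ralg_hom[OF R \<iota>' that])
  \<comment> \<open>The restriction of s to K is p0, since both are classified by the same
    homomorphism out of P.\<close>
  have "compose (carrier (fst P)) (?h (along \<pi> ?I)) F' = f0'"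
  proof
    fix x
    show "compose (carrier (fst P)) (?h (along \<pi> ?I)) F' x = f0' x"
    proof (cases "x \<in> carrier (fst P)")
      case True
      then have "F x \<in> carrier R" using ring_hom_closed[OF F(1)] by simp
      then show ?thesis
        using True \<iota>' F(2)[OF True] f0\<iota>[OF True]
        by (simp add: compose_def F'_def init_hom_def image_ring_carrier init_alg_def)
    next
      case False
      then show ?thesis using ralg_hom_ext[OF f0'(1)] by (simp add: compose_def extensional_def)
    qed
  qed
  then have hs: "res \<tau> ?J (along \<pi> ?I) (?h (along \<pi> ?I)) s = p0"
    using D(3)[OF P u J S0 F' h[OF S0]] f0'(2) by (simp add: s_def)
  obtain c' where c': "c' \<in> X_pts R" and e: "eqv \<tau> ?J s = sconst_map \<iota>' c'"
    using section_consts[OF R \<iota>' to s] by blast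
  define \<beta> where "\<beta> = (\<lambda>S g. act \<tau> S g (res \<tau> ?J S (?h S) s))"
  have \<beta>: "stack_iso R (stack_pt c') \<tau> \<beta>"
    unfolding \<beta>_def by (rule section_stack_iso[OF R \<iota>' to s c' e])
  have cs: "c \<in> sconsts K" "c' \<in> sconsts R" using c c' by simp_all
  have "sconst_map \<iota> (sconst_map \<pi> c') = sconst_map \<iota> c"
  proof -
    have "eqv \<tau> (along \<pi> ?I) p0 = sconst_map (?h (along \<pi> ?I)) (sconst_map \<iota>' c')"
      using D(11)[OF J s S0 h[OF S0]] hs e by simp
    also have "\<dots> = sconst_map (\<iota> \<circ> \<pi>) c'"
      unfolding sconst_map_comp
      by (rule sconst_map_cong[OF cs(2)]) (use \<iota>' in \<open>simp add: init_hom_def image_ring_carrier init_alg_def\<close>)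
    finally have "eqv \<tau> (along \<pi> ?I) p0 = sconst_map \<iota> (sconst_map \<pi> c')" by (simp add: sconst_map_comp)
    moreover have "eqv \<tau> (along \<pi> ?I) p0 = X_act (fst ?I) (mat_one (fst ?I)) (sconst_map \<iota> c)"
      using stack_isoD(3)[OF \<alpha> I, of "mat_one (fst ?I)"] G1[OF I] by (simp add: p0_def init_alg_def)
    moreover have "sconst_map \<iota> c \<in> sconsts (fst ?I)"
      using ring_hom_cring.sconst_map_sconsts[OF ring_hom_cringI2[OF K.cring_axioms image_ring_cring[OF K.cring_axioms \<iota>] image_ring_hom[OF \<iota>]] cs(1)]
      by (simp add: init_alg_def)
    ultimately show ?thesis by (simp add: cring.X_act_one[OF ralgs_cring[OF I]])
  qed
  then have cc: "\<iota> (\<pi> (c' i j k)) = \<iota> (c i j k)" for i j k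
    by (metis sconst_map_def)
  have "sconst_map \<pi> c' = c"
    by (intro ext) (use inj_onD[OF \<iota> cc] cs in \<open>simp add: sconst_map_def sconsts_carrier\<close>)
  moreover have "\<alpha> S g = \<beta> (along \<pi> S) g" if S: "S \<in> ralgs K" and g: "g \<in> G_pts (fst S)" for S g
  proof -
    interpret S: cring "fst S" by (rule ralgs_cring[OF S])
    have S': "along \<pi> S \<in> ralgs R" by (rule along_ralgs[OF \<pi> S])
    let ?k = "init_hom \<iota> K S"
    have k: "?k \<in> ralg_hom K ?I S" by (rule init_hom_ralg_hom[OF K.cring_axioms \<iota> S])
    have k': "?k \<in> ralg_hom R (along \<pi> ?I) (along \<pi> S)" by (rule along_ralg_hom[OF \<pi> k])
    have "mat_map ?k (mat_one (fst ?I)) = mat_one (fst S)"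
      by (rule ring_hom_cring.mat_map_one[OF ralg_hom_cring[OF k I S]])
    then have "\<alpha> S (mat_one (fst S)) = res \<tau> (along \<pi> ?I) (along \<pi> S) ?k p0"
      using stack_isoD(5)[OF \<alpha> I _ S k, of "mat_one (fst ?I)"] G1[OF I] by (simp add: p0_def)
    also have "\<dots> = res \<tau> ?J (along \<pi> S) (compose (carrier (fst ?J)) ?k (?h (along \<pi> ?I))) s"
      using D(3)[OF J s S0 S' h[OF S0] k'] hs by simp
    also have "compose (carrier (fst ?J)) ?k (?h (along \<pi> ?I)) = ?h (along \<pi> S)"
      by (rule init_hom_unique[OF R \<iota>' ralg_hom_compose[OF h[OF S0] k' J]])
    finally have "\<alpha> S (mat_one (fst S)) = res \<tau> ?J (along \<pi> S) (?h (along \<pi> S)) s" .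
    then show ?thesis
      using stack_isoD(4)[OF \<alpha> S, of "mat_one (fst S)" g] G1[OF S] g by (simp add: \<beta>_def)
  qed
  ultimately show thesis using that c' \<beta> by blast
qed

section \<open>The tangent space in terms of structure constants\<close>

definition deformations :: "('k, 'm) ring_scheme \<Rightarrow> 'k sconst \<Rightarrow> ('k \<times> 'k) sconst set" where
  "deformations K c = {c' \<in> X_pts (dual_numbers K). sconst_map fst c' = c}"

text \<open>If c' reduces to c, then the restriction of \<open>stack_pt c'\<close> to K is equal to
  \<open>stack_pt c\<close>, so the identity is a valid marking.\<close>

definition def_class :: "('k, 'm) ring_scheme \<Rightarrow> 'k sconst \<Rightarrow> ('k \<times> 'k) sconst \<Rightarrow> ('k, 'u) tvec" where
  "def_class K c c' = tan_class K (stack_pt c) (stack_pt c') (\<lambda>S p. p)"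

lemma tan_relI:
  "\<lbrakk>(\<tau>, \<alpha>) \<in> tan_pairs K x; (\<tau>', \<alpha>') \<in> tan_pairs K x; stack_iso (dual_numbers K) \<tau> \<tau>' \<beta>;
    \<And>S p. S \<in> ralgs K \<Longrightarrow> p \<in> sec x S \<Longrightarrow> \<alpha>' S p = \<beta> (along fst S) (\<alpha> S p)\<rbrakk> \<Longrightarrow> ((\<tau>, \<alpha>), (\<tau>', \<alpha>')) \<in> tan_rel K x"
  unfolding tan_rel_def pull_mor_def by blast

lemma tan_relE:
  assumes "((\<tau>, \<alpha>), (\<tau>', \<alpha>')) \<in> tan_rel K x"
  obtains \<beta> where "(\<tau>, \<alpha>) \<in> tan_pairs K x" "(\<tau>', \<alpha>') \<in> tan_pairs K x" "stack_iso (dual_numbers K) \<tau> \<tau>' \<beta>"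
    "\<And>S p. S \<in> ralgs K \<Longrightarrow> p \<in> sec x S \<Longrightarrow> \<alpha>' S p = \<beta> (along fst S) (\<alpha> S p)"
  using assms unfolding tan_rel_def pull_mor_def by blast

lemma tan_pairs_iff: "(\<tau>, \<alpha>) \<in> tan_pairs K x \<longleftrightarrow> \<tau> \<in> stack_objs (dual_numbers K) \<and> stack_iso K x (pull fst \<tau>) \<alpha>"
  by (simp add: tan_pairs_def)

lemma stack_objs_pre: "\<tau> \<in> stack_objs R \<Longrightarrow> pre_obj R \<tau>"
  by (simp add: stack_objs_iff)

lemma tan_rel_equiv:
  assumes "cring K"
  shows "equiv (tan_pairs K x) (tan_rel K x)"
proof (rule equivI)
  interpret K: cring K by fact
  have along: "along fst S \<in> ralgs (dual_numbers K)" if "S \<in> ralgs K" for S :: "('a, 'c) ralg"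
    by (rule along_ralgs[OF K.dual_numbers_homs(1) that])
  show "tan_rel K x \<subseteq> tan_pairs K x \<times> tan_pairs K x" unfolding tan_rel_def by blast
  show "refl_on (tan_pairs K x) (tan_rel K x)"
  proof (rule refl_onI)
    fix p assume "p \<in> tan_pairs K x"
    then show "(p, p) \<in> tan_rel K x"
      by (cases p) (auto intro!: tan_relI[OF _ _ stack_iso_id])
  qed
  show "sym (tan_rel K x)"
  proof (rule symI)
    fix p q assume pq: "(p, q) \<in> tan_rel K x"
    obtain \<tau> \<alpha> \<tau>' \<alpha>' where e: "p = (\<tau>, \<alpha>)" "q = (\<tau>', \<alpha>')" by fastforce
    obtain \<beta> where \<beta>: "(\<tau>, \<alpha>) \<in> tan_pairs K x" "(\<tau>', \<alpha>') \<in> tan_pairs K x" "stack_iso (dual_numbers K) \<tau> \<tau>' \<beta>"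
      "\<And>S p. S \<in> ralgs K \<Longrightarrow> p \<in> sec x S \<Longrightarrow> \<alpha>' S p = \<beta> (along fst S) (\<alpha> S p)"
      using tan_relE[OF pq[unfolded e]] by metis
    have t: "pre_obj (dual_numbers K) \<tau>" and \<alpha>: "stack_iso K x (pull fst \<tau>) \<alpha>"
      using \<beta>(1) by (simp_all add: tan_pairs_iff stack_objs_pre)
    show "(q, p) \<in> tan_rel K x"
      unfolding e
    proof (rule tan_relI[OF \<beta>(2,1) stack_iso_sym[OF \<beta>(3) t]])
      fix S p assume S: "S \<in> ralgs K" and p: "p \<in> sec x S"
      have "inj_on (\<beta> (along fst S)) (sec \<tau> (along fst S))"
        using stack_isoD(1)[OF \<beta>(3) along[OF S]] by (simp add: bij_betw_def)
      moreover have "\<alpha> S p \<in> sec \<tau> (along fst S)" using stack_isoD(2)[OF \<alpha> S p] by simp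
      ultimately show "\<alpha> S p = inv_into (sec \<tau> (along fst S)) (\<beta> (along fst S)) (\<alpha>' S p)"
        using \<beta>(4)[OF S p] by simp
    qed
  qed
  show "trans (tan_rel K x)"
  proof (rule transI)
    fix p q r assume pq: "(p, q) \<in> tan_rel K x" and qr: "(q, r) \<in> tan_rel K x"
    obtain \<tau> \<alpha> \<tau>' \<alpha>' \<tau>'' \<alpha>'' where e: "p = (\<tau>, \<alpha>)" "q = (\<tau>', \<alpha>')" "r = (\<tau>'', \<alpha>'')" by (metis surj_pair)
    obtain \<beta> where \<beta>: "(\<tau>, \<alpha>) \<in> tan_pairs K x" "stack_iso (dual_numbers K) \<tau> \<tau>' \<beta>"
      "\<And>S p. S \<in> ralgs K \<Longrightarrow> p \<in> sec x S \<Longrightarrow> \<alpha>' S p = \<beta> (along fst S) (\<alpha> S p)"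
      using tan_relE[OF pq[unfolded e]] by metis
    obtain \<beta>' where \<beta>': "(\<tau>'', \<alpha>'') \<in> tan_pairs K x" "stack_iso (dual_numbers K) \<tau>' \<tau>'' \<beta>'"
      "\<And>S p. S \<in> ralgs K \<Longrightarrow> p \<in> sec x S \<Longrightarrow> \<alpha>'' S p = \<beta>' (along fst S) (\<alpha>' S p)"
      using tan_relE[OF qr[unfolded e]] by metis
    show "(p, r) \<in> tan_rel K x"
      unfolding e by (rule tan_relI[OF \<beta>(1) \<beta>'(1) stack_iso_trans[OF \<beta>(2) \<beta>'(2)]]) (simp add: \<beta>(3) \<beta>'(3))
  qed
qed

text \<open>Right multiplication commutes with the left action of G, and the orbit maps correspond
  because (p g) c' = p (g c') = p c.\<close>

lemma right_translation_iso:
  fixes R :: "('r, 'm) ring_scheme"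
  assumes R: "cring R" and c: "c \<in> X_pts R" and c': "c' \<in> X_pts R" and g: "g \<in> G_pts R" and e: "X_act R g c' = c"
  shows "stack_iso R (stack_pt c :: ('r, 'u) qobj) (stack_pt c') (\<lambda>S p. mat_mul (fst S) p (mat_map (snd S) g))"
proof (rule stack_isoI)
  interpret R: cring R by fact
  {
    fix S :: "('r, 'u) ralg" assume S: "S \<in> ralgs R"
    interpret S: ring_hom_cring R "fst S" "snd S" by (rule ring_hom_cringI2[OF R ralgs_cring[OF S] ralgs_hom[OF S]])
    let ?g = "mat_map (snd S) g"
    have g': "?g \<in> G_pts (fst S)" and c1: "sconst_map (snd S) c' \<in> sconsts (fst S)" using g c' by simp_all
    have c2: "sconst_map (snd S) c = X_act (fst S) ?g (sconst_map (snd S) c')"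
      using g c' by (simp add: S.sconst_map_X_act flip: e)
    have canc: "mat_mul (fst S) (mat_mul (fst S) p ?g) (mat_inv (fst S) ?g) = p"
      "mat_mul (fst S) (mat_mul (fst S) p (mat_inv (fst S) ?g)) ?g = p" if "p \<in> G_pts (fst S)" for p
      using that g' S.S.mat_mul_assoc[of p ?g "mat_inv (fst S) ?g"] S.S.mat_mul_assoc[of p "mat_inv (fst S) ?g" ?g]
      by simp_all
    show "bij_betw (\<lambda>p. mat_mul (fst S) p ?g) (sec (stack_pt c) S) (sec (stack_pt c') S)"
      by (rule bij_betw_byWitness[where f' = "\<lambda>p. mat_mul (fst S) p (mat_inv (fst S) ?g)"])
        (use g' canc in \<open>auto simp: S.S.G_pts_mul S.S.G_pts_inv\<close>)
    fix p assume p: "p \<in> sec (stack_pt c) S"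
    then show "eqv (stack_pt c') S (mat_mul (fst S) p ?g) = eqv (stack_pt c) S p"
      using g' c1 c2 by (simp add: S.S.X_act_mul)
    show "mat_mul (fst S) (act (stack_pt c) S h p) ?g = act (stack_pt c') S h (mat_mul (fst S) p ?g)"
      if "h \<in> G_pts (fst S)" for h
      using that p g' by (simp add: S.S.mat_mul_assoc)
  }
  fix S T :: "('r, 'u) ralg" and f p
  assume S: "S \<in> ralgs R" and T: "T \<in> ralgs R" and f: "f \<in> ralg_hom R S T" and p: "p \<in> sec (stack_pt c) S"
  interpret S: ring_hom_cring R "fst S" "snd S" by (rule ring_hom_cringI2[OF R ralgs_cring[OF S] ralgs_hom[OF S]])
  interpret f: ring_hom_cring "fst S" "fst T" f by (rule ralg_hom_cring[OF f S T])
  have "mat_map f (mat_map (snd S) g) = mat_map (snd T) g"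
    unfolding mat_map_comp by (rule mat_map_cong[of _ R]) (use g f in \<open>simp_all add: ralg_hom_struct\<close>)
  then show "mat_mul (fst T) (res (stack_pt c) S T f p) (mat_map (snd T) g) =
      res (stack_pt c') S T f (mat_mul (fst S) p (mat_map (snd S) g))"
    using p g by (simp add: f.mat_map_mul)
qed

text \<open>An equivariant map between trivial torsors is right multiplication by the image of 1. By
  naturality this matrix is determined by its value over the copy of R, the initial test ring, and
  so comes from G(R).\<close>

lemma stack_pt_iso_matrix:
  fixes R :: "('r, 'm) ring_scheme" and \<iota> :: "'r \<Rightarrow> 'u" and \<beta> :: "('r, 'u) qmor"
  assumes R: "cring R" and inj: "inj_on \<iota> (carrier R)" and c: "c \<in> X_pts R" and c': "c' \<in> X_pts R"
    and \<beta>: "stack_iso R (stack_pt c) (stack_pt c') \<beta>"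
  obtains g where "g \<in> G_pts R" "X_act R g c' = c"
    "\<And>S p. S \<in> ralgs R \<Longrightarrow> p \<in> G_pts (fst S) \<Longrightarrow> \<beta> S p = mat_mul (fst S) p (mat_map (snd S) g)"
proof -
  interpret R: cring R by fact
  let ?I = "init_alg \<iota> R" and ?i = "inv_into (carrier R) \<iota>"
  have I: "?I \<in> ralgs R" by (rule init_alg_ralgs[OF R inj])
  have Ic: "cring (fst ?I)" by (rule ralgs_cring[OF I])
  interpret Ic: cring "fst ?I" by fact
  have fstI: "fst ?I = image_ring \<iota> R" "snd ?I = \<iota>" by (simp_all add: init_alg_def)
  interpret i: ring_hom_cring "fst ?I" R ?i
    using image_ring_inv_hom[OF R.ring_axioms inj] by (intro ring_hom_cringI2[OF Ic R]) (simp add: fstI)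
  interpret \<iota>: ring_hom_cring R "fst ?I" \<iota>
    using image_ring_hom[OF inj] by (intro ring_hom_cringI2[OF R Ic]) (simp add: fstI)
  define b where "b = \<beta> ?I (mat_one (fst ?I))"
  have b: "b \<in> G_pts (fst ?I)" using stack_isoD(2)[OF \<beta> I, of "mat_one (fst ?I)"] by (simp add: b_def)
  define g where "g = mat_map ?i b"
  have g: "g \<in> G_pts R" unfolding g_def using b by simp
  have bg: "mat_map \<iota> g = mat_map (\<lambda>x. x) b"
    unfolding g_def mat_map_comp
    by (rule mat_map_cong[OF Ic.G_pts_mats[OF b]]) (auto simp: fstI image_ring_carrier f_inv_into_f)
  then have bg: "mat_map \<iota> g = b" by (simp add: mat_map_def)
  have eq: "\<beta> S p = mat_mul (fst S) p (mat_map (snd S) g)" if S: "S \<in> ralgs R" and p: "p \<in> G_pts (fst S)" for S p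
  proof -
    interpret S: cring "fst S" by (rule ralgs_cring[OF S])
    have h: "init_hom \<iota> R S \<in> ralg_hom R ?I S" by (rule init_hom_ralg_hom[OF R inj S])
    have "mat_map (init_hom \<iota> R S) (mat_one (fst ?I)) = mat_one (fst S)"
      by (rule ring_hom_cring.mat_map_one[OF ralg_hom_cring[OF h I S]])
    then have "\<beta> S (mat_one (fst S)) = mat_map (init_hom \<iota> R S) b"
      using stack_isoD(5)[OF \<beta> I _ S h, of "mat_one (fst ?I)"] by (simp add: b_def)
    also have "\<dots> = mat_map (snd S) g"
      unfolding bg[symmetric] mat_map_comp
      by (rule mat_map_cong[of _ R]) (use g inj in \<open>simp_all add: init_hom_def image_ring_carrier\<close>)
    finally show ?thesis
      using stack_isoD(4)[OF \<beta> S, of "mat_one (fst S)" p] p by simp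
  qed
  have "X_act (fst ?I) b (sconst_map \<iota> c') = X_act (fst ?I) (mat_one (fst ?I)) (sconst_map \<iota> c)"
    using stack_isoD(3)[OF \<beta> I, of "mat_one (fst ?I)"] Ic.G_pts_one by (simp add: b_def fstI)
  then have "sconst_map \<iota> (X_act R g c') = sconst_map \<iota> c"
    using c c' g by (simp add: \<iota>.sconst_map_X_act bg Ic.X_act_one)
  then have e: "\<iota> (X_act R g c' i j k) = \<iota> (c i j k)" for i j k by (metis sconst_map_def)
  have cs: "c \<in> sconsts R" "X_act R g c' \<in> sconsts R" using c c' g by simp_all
  have "X_act R g c' = c"
    by (intro ext) (rule inj_onD[OF inj e sconsts_carrier[OF cs(2)] sconsts_carrier[OF cs(1)]])
  then show thesis using that g eq by blast
qed

section \<open>Tangent vectors as classes of deformations\<close>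

locale universe =
  fixes K :: "('k, 'm) ring_scheme" and \<iota> :: "'k \<Rightarrow> 'u"
  assumes K: "field K" and inf: "infinite (UNIV :: 'u set)" and inj: "inj_on \<iota> (carrier K)"
begin

sublocale K: field K by (rule K)

lemma D_embedding: obtains \<iota>' :: "'k \<times> 'k \<Rightarrow> 'u" where "inj_on \<iota>' (carrier (dual_numbers K))"
proof -
  obtain pr :: "'u \<times> 'u \<Rightarrow> 'u" where pr: "inj pr" using infinite_pairing[OF inf] .
  have "inj_on (\<lambda>(a, b). pr (\<iota> a, \<iota> b)) (carrier (dual_numbers K))"
    by (rule inj_onI) (auto simp: inj_eq[OF pr] inj_on_eq_iff[OF inj])
  then show thesis by (rule that)
qed

lemma D2_embedding: obtains \<iota>' :: "'k \<times> 'k \<times> 'k \<Rightarrow> 'u" where "inj_on \<iota>' (carrier (dual_numbers2 K))"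
proof -
  obtain pr :: "'u \<times> 'u \<Rightarrow> 'u" where pr: "inj pr" using infinite_pairing[OF inf] .
  have "inj_on (\<lambda>(a, b, c). pr (\<iota> a, pr (\<iota> b, \<iota> c))) (carrier (dual_numbers2 K))"
    by (rule inj_onI) (auto simp: inj_eq[OF pr] inj_on_eq_iff[OF inj])
  then show thesis by (rule that)
qed

lemma deformation_stack_objs:
  assumes "c' \<in> X_pts (dual_numbers K)" shows "(stack_pt c' :: ('k \<times> 'k, 'u) qobj) \<in> stack_objs (dual_numbers K)"
proof -
  obtain \<iota>' :: "'k \<times> 'k \<Rightarrow> 'u" where "inj_on \<iota>' (carrier (dual_numbers K))" by (rule D_embedding)
  then show ?thesis using stack_pt_stack_objs[OF K.dual_numbers_cring _ inf assms] by blast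
qed

lemma deformation_tan_pair:
  assumes "c' \<in> deformations K c"
  shows "(stack_pt c' :: ('k \<times> 'k, 'u) qobj, \<lambda>S p. p) \<in> tan_pairs K (stack_pt c)"
  using assms deformation_stack_objs[of c'] stack_iso_id[of K "stack_pt c :: ('k, 'u) qobj"]
  by (simp add: tan_pairs_iff deformations_def pull_stack_pt)

lemma tan_class_eq_iff:
  fixes x :: "('k, 'u) qobj"
  assumes "(\<tau>, \<alpha>) \<in> tan_pairs K x" "(\<tau>', \<alpha>') \<in> tan_pairs K x"
  shows "tan_class K x \<tau> \<alpha> = tan_class K x \<tau>' \<alpha>' \<longleftrightarrow> ((\<tau>, \<alpha>), (\<tau>', \<alpha>')) \<in> tan_rel K x"
  unfolding tan_class_def using eq_equiv_class_iff[OF tan_rel_equiv[OF K.cring_axioms] assms] .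

text \<open>The isomorphisms are right translations by elements g of G(K[\<epsilon>]). Compatibility
  with the two identity markings, evaluated at 1, says that g reduces to 1 modulo
  \<epsilon>.\<close>

lemma def_class_eq_iff:
  assumes c: "c \<in> X_pts K" and c1: "c1 \<in> deformations K c" and c2: "c2 \<in> deformations K c"
  shows "(def_class K c c1 :: ('k, 'u) tvec) = def_class K c c2 \<longleftrightarrow>
    (\<exists>g\<in>G_pts (dual_numbers K). mat_map fst g = mat_one K \<and> X_act (dual_numbers K) g c2 = c1)"
    (is "_ \<longleftrightarrow> ?r")
proof -
  interpret D: cring "dual_numbers K" by (rule K.dual_numbers_cring)
  have X: "c1 \<in> X_pts (dual_numbers K)" "c2 \<in> X_pts (dual_numbers K)" using c1 c2 by (simp_all add: deformations_def)
  note p = deformation_tan_pair[OF c1] deformation_tan_pair[OF c2]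
  show ?thesis
    unfolding def_class_def tan_class_eq_iff[OF p]
  proof
    assume "((stack_pt c1 :: ('k \<times> 'k, 'u) qobj, \<lambda>S p. p), stack_pt c2, \<lambda>S p. p) \<in> tan_rel K (stack_pt c)"
    then obtain \<beta> where \<beta>: "stack_iso (dual_numbers K) (stack_pt c1 :: ('k \<times> 'k, 'u) qobj) (stack_pt c2) \<beta>"
      and b: "\<And>S p. S \<in> ralgs K \<Longrightarrow> p \<in> sec (stack_pt c) S \<Longrightarrow> p = \<beta> (along fst S) p"
      by (rule tan_relE) metis
    obtain \<iota>' :: "'k \<times> 'k \<Rightarrow> 'u" where i': "inj_on \<iota>' (carrier (dual_numbers K))" by (rule D_embedding)
    obtain g where g: "g \<in> G_pts (dual_numbers K)" "X_act (dual_numbers K) g c2 = c1"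
      "\<And>S p. S \<in> ralgs (dual_numbers K) \<Longrightarrow> p \<in> G_pts (fst S) \<Longrightarrow> \<beta> S p = mat_mul (fst S) p (mat_map (snd S) g)"
      using stack_pt_iso_matrix[OF K.dual_numbers_cring i' X \<beta>] by metis
    let ?I = "init_alg \<iota> K"
    have I: "?I \<in> ralgs K" by (rule init_alg_ralgs[OF K.cring_axioms inj])
    interpret I: ring_hom_cring K "fst ?I" \<iota>
      using ralgs_hom[OF I] by (intro ring_hom_cringI2 K.cring_axioms ralgs_cring[OF I]) (simp add: init_alg_def)
    have I': "along fst ?I \<in> ralgs (dual_numbers K)" by (rule along_ralgs[OF K.dual_numbers_homs(1) I])
    interpret fst: ring_hom_cring "dual_numbers K" K fst
      by (rule ring_hom_cringI2[OF K.dual_numbers_cring K.cring_axioms K.dual_numbers_homs(1)])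
    have m: "mat_map fst g \<in> mats K" using g(1) by simp
    have "mat_one (fst ?I) = mat_map \<iota> (mat_map fst g)"
      using b[OF I, of "mat_one (fst ?I)"] g(3)[OF I', of "mat_one (fst ?I)"] m
      by (simp add: mat_map_comp[symmetric] init_alg_def[of \<iota> K, THEN arg_cong[of _ _ snd], simplified])
    then have e: "mat_map \<iota> (mat_map fst g) = mat_map \<iota> (mat_one K)" by (simp add: I.mat_map_one)
    have "\<iota> (mat_map fst g i j) = \<iota> (mat_one K i j)" for i j using fun_cong[OF fun_cong[OF e], of i j] by (simp add: mat_map_def)
    then have "mat_map fst g = mat_one K"
      by (intro ext) (rule inj_onD[OF inj _ mats_carrier[OF m] K.mat_one_carrier])
    with g show ?r by blast
  next
    assume ?r
    then obtain g where g: "g \<in> G_pts (dual_numbers K)" "mat_map fst g = mat_one K" "X_act (dual_numbers K) g c2 = c1" by blast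
    show "((stack_pt c1 :: ('k \<times> 'k, 'u) qobj, \<lambda>S p. p), stack_pt c2, \<lambda>S p. p) \<in> tan_rel K (stack_pt c)"
    proof (rule tan_relI[OF p right_translation_iso[OF K.dual_numbers_cring X g(1,3)]])
      fix S :: "('k, 'u) ralg" and p assume S: "S \<in> ralgs K" and p: "p \<in> sec (stack_pt c) S"
      interpret S: ring_hom_cring K "fst S" "snd S"
        by (rule ring_hom_cringI2[OF K.cring_axioms ralgs_cring[OF S] ralgs_hom[OF S]])
      have "mat_map (snd S \<circ> fst) g = mat_one (fst S)"
        unfolding mat_map_comp[symmetric] g(2) by (rule S.mat_map_one)
      then show "p = mat_mul (fst (along fst S)) p (mat_map (snd (along fst S)) g)" using p by simp
    qed
  qed
qed

text \<open>The trivialization \<beta> over R pulls back to K[\<epsilon>]. The pulled back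
  isomorphism identifies the class and also shows that the pullback is an object of the
  stack.\<close>

lemma tan_class_pull:
  fixes R :: "('r, 'n) ring_scheme" and \<tau> :: "('r, 'u) qobj"
  assumes R: "cring R" and c': "c' \<in> X_pts R" and \<pi>: "sconst_map \<pi> c' = c" and \<tau>: "pre_obj R \<tau>"
    and \<beta>: "stack_iso R (stack_pt c') \<tau> \<beta>"
    and \<alpha>: "\<And>S g. S \<in> ralgs K \<Longrightarrow> g \<in> G_pts (fst S) \<Longrightarrow> \<alpha> S g = \<beta> (along \<pi> S) g"
    and \<alpha>iso: "stack_iso K (stack_pt c) (pull \<pi> \<tau>) \<alpha>"
    and \<rho>: "\<rho> \<in> ring_hom R (dual_numbers K)" and \<rho>\<pi>: "fst \<circ> \<rho> = \<pi>"
  shows "sconst_map \<rho> c' \<in> deformations K c" "tan_class K (stack_pt c) (pull \<rho> \<tau>) \<alpha> = def_class K c (sconst_map \<rho> c')"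
    "(pull \<rho> \<tau>, \<alpha>) \<in> tan_pairs K (stack_pt c)"
proof -
  interpret \<rho>: ring_hom_cring R "dual_numbers K" \<rho> by (rule ring_hom_cringI2[OF R K.dual_numbers_cring \<rho>])
  show d: "sconst_map \<rho> c' \<in> deformations K c"
    using c' \<pi> by (simp add: deformations_def sconst_map_comp \<rho>\<pi>)
  have \<beta>': "stack_iso (dual_numbers K) (stack_pt (sconst_map \<rho> c')) (pull \<rho> \<tau>) (pull_mor \<rho> \<beta>)"
    using stack_iso_pull[OF \<rho> \<beta>] by (simp add: pull_stack_pt)
  have t: "pull \<rho> \<tau> \<in> stack_objs (dual_numbers K)"
    by (rule stack_objs_iso[OF deformation_stack_objs pre_obj_pull[OF \<rho> \<tau>] \<beta>']) (use d in \<open>simp add: deformations_def\<close>)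
  show p: "(pull \<rho> \<tau>, \<alpha>) \<in> tan_pairs K (stack_pt c)"
    using t \<alpha>iso by (simp add: tan_pairs_iff pull_pull \<rho>\<pi>)
  show "tan_class K (stack_pt c) (pull \<rho> \<tau>) \<alpha> = def_class K c (sconst_map \<rho> c')"
    unfolding def_class_def
  proof (subst eq_commute, subst tan_class_eq_iff[OF deformation_tan_pair[OF d] p], rule tan_relI[OF deformation_tan_pair[OF d] p \<beta>'])
    fix S :: "('k, 'u) ralg" and g assume "S \<in> ralgs K" "g \<in> sec (stack_pt c) S"
    then show "\<alpha> S g = pull_mor \<rho> \<beta> (along fst S) g"
      by (simp add: \<alpha> pull_mor_def along_along \<rho>\<pi>)
  qed
qed

lemma tan_pair_normal_form:
  fixes \<tau> :: "('k \<times> 'k, 'u) qobj"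
  assumes c: "c \<in> X_pts K" and p: "(\<tau>, \<alpha>) \<in> tan_pairs K (stack_pt c)"
  obtains c' \<beta> where "c' \<in> deformations K c" "stack_iso (dual_numbers K) (stack_pt c') \<tau> \<beta>"
    "\<And>S g. S \<in> ralgs K \<Longrightarrow> g \<in> G_pts (fst S) \<Longrightarrow> \<alpha> S g = \<beta> (along fst S) g"
    "tan_class K (stack_pt c) \<tau> \<alpha> = def_class K c c'"
proof -
  have t: "\<tau> \<in> stack_objs (dual_numbers K)" and \<alpha>: "stack_iso K (stack_pt c) (pull fst \<tau>) \<alpha>"
    using p by (simp_all add: tan_pairs_iff)
  obtain \<iota>' :: "'k \<times> 'k \<Rightarrow> 'u" where i': "inj_on \<iota>' (carrier (dual_numbers K))" by (rule D_embedding)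
  obtain c' \<beta> where c': "c' \<in> X_pts (dual_numbers K)" "sconst_map fst c' = c" and \<beta>: "stack_iso (dual_numbers K) (stack_pt c') \<tau> \<beta>"
    and a: "\<And>S g. S \<in> ralgs K \<Longrightarrow> g \<in> G_pts (fst S) \<Longrightarrow> \<alpha> S g = \<beta> (along fst S) g"
    using stack_obj_normal_form[OF K inj K.dual_numbers_cring i' K.dual_numbers_homs(1) t
        dual_numbers_lifts_points[OF K inf t] c \<alpha>] by metis
  have d: "c' \<in> deformations K c" using c' by (simp add: deformations_def)
  have "tan_class K (stack_pt c) \<tau> \<alpha> = def_class K c c'"
    unfolding def_class_def
    by (subst eq_commute, subst tan_class_eq_iff[OF deformation_tan_pair[OF d] p], rule tan_relI[OF deformation_tan_pair[OF d] p \<beta>])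
      (simp add: a)
  then show thesis using that d \<beta> a by blast
qed

lemma tangent_space_carrier:
  assumes c: "c \<in> X_pts K"
  shows "carrier (tangent_space K (stack_pt c :: ('k, 'u) qobj)) = def_class K c ` deformations K c"
proof -
  have "tan_pairs K (stack_pt c :: ('k, 'u) qobj) // tan_rel K (stack_pt c) = def_class K c ` deformations K c"
  proof (rule equalityI; rule subsetI)
    fix w assume "w \<in> tan_pairs K (stack_pt c :: ('k, 'u) qobj) // tan_rel K (stack_pt c)"
    then obtain \<tau> \<alpha> where p: "(\<tau>, \<alpha>) \<in> tan_pairs K (stack_pt c :: ('k, 'u) qobj)" and w: "w = tan_class K (stack_pt c) \<tau> \<alpha>"
      unfolding tan_class_def by (metis quotientE surj_pair)
    show "w \<in> def_class K c ` deformations K c"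
      by (rule tan_pair_normal_form[OF c p]) (use w in blast)
  next
    fix w :: "('k, 'u) tvec" assume "w \<in> def_class K c ` deformations K c"
    then show "w \<in> tan_pairs K (stack_pt c) // tan_rel K (stack_pt c)"
      unfolding def_class_def tan_class_def by (auto intro!: quotientI deformation_tan_pair)
  qed
  then show ?thesis by (simp add: tangent_space_def)
qed

text \<open>An object over the two-variable ring may be replaced by a trivial torsor with constants
  c', whose three pullbacks are computed by applying the ring homomorphisms to c'.\<close>

lemma tan_sum_iff:
  fixes u v w :: "('k, 'u) tvec"
  assumes c: "c \<in> X_pts K"
  shows "tan_sum K (stack_pt c) u v w \<longleftrightarrow> (\<exists>c'\<in>X_pts (dual_numbers2 K). sconst_map fst c' = c \<and>
     u = def_class K c (sconst_map (\<lambda>(a, b, c). (a, b)) c') \<and>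
     v = def_class K c (sconst_map (\<lambda>(a, b, c). (a, c)) c') \<and>
     w = def_class K c (sconst_map (\<lambda>(a, b, c). (a, b \<oplus>\<^bsub>K\<^esub> c)) c'))"
    (is "_ \<longleftrightarrow> ?r")
proof -
  note homs = K.dual_numbers2_homs
  have f: "fst \<circ> (\<lambda>(a, b, c). (a, b)) = fst" "fst \<circ> (\<lambda>(a, b, c). (a, c)) = fst"
    "fst \<circ> (\<lambda>(a, b, c). (a, b \<oplus>\<^bsub>K\<^esub> c)) = fst" by (auto simp: fun_eq_iff)
  obtain \<iota>' :: "'k \<times> 'k \<times> 'k \<Rightarrow> 'u" where i': "inj_on \<iota>' (carrier (dual_numbers2 K))" by (rule D2_embedding)
  show ?thesis
  proof
    assume "tan_sum K (stack_pt c) u v w"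
    then obtain \<sigma> \<alpha> where s: "\<sigma> \<in> stack_objs (dual_numbers2 K)" and \<alpha>: "stack_iso K (stack_pt c) (pull fst \<sigma>) \<alpha>"
      and uvw: "u = tan_class K (stack_pt c) (pull (\<lambda>(a, b, c). (a, b)) \<sigma>) \<alpha>"
        "v = tan_class K (stack_pt c) (pull (\<lambda>(a, b, c). (a, c)) \<sigma>) \<alpha>"
        "w = tan_class K (stack_pt c) (pull (\<lambda>(a, b, c). (a, b \<oplus>\<^bsub>K\<^esub> c)) \<sigma>) \<alpha>"
      unfolding tan_sum_def by blast
    obtain c' \<beta> where c': "c' \<in> X_pts (dual_numbers2 K)" "sconst_map fst c' = c"
      and \<beta>: "stack_iso (dual_numbers2 K) (stack_pt c') \<sigma> \<beta>"
      and a: "\<And>S g. S \<in> ralgs K \<Longrightarrow> g \<in> G_pts (fst S) \<Longrightarrow> \<alpha> S g = \<beta> (along fst S) g"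
      using stack_obj_normal_form[OF K inj K.dual_numbers2_cring i' homs(1) s
        dual_numbers2_lifts_points[OF K inf s] c \<alpha>] by metis
    have pull: "tan_class K (stack_pt c) (pull \<rho> \<sigma>) \<alpha> = def_class K c (sconst_map \<rho> c')"
      if "\<rho> \<in> ring_hom (dual_numbers2 K) (dual_numbers K)" "fst \<circ> \<rho> = fst" for \<rho>
      by (rule tan_class_pull(2)[OF K.dual_numbers2_cring c' stack_objs_pre[OF s] \<beta> _ \<alpha> that]) (rule a)
    show ?r
      using c' uvw pull[OF homs(3) f(1)] pull[OF homs(4) f(2)] pull[OF homs(5) f(3)] by blast
  next
    assume ?r
    then obtain c' where c': "c' \<in> X_pts (dual_numbers2 K)" "sconst_map fst c' = c"
      and uvw: "u = def_class K c (sconst_map (\<lambda>(a, b, c). (a, b)) c')"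
        "v = def_class K c (sconst_map (\<lambda>(a, b, c). (a, c)) c')"
        "w = def_class K c (sconst_map (\<lambda>(a, b, c). (a, b \<oplus>\<^bsub>K\<^esub> c)) c')" by blast
    have s: "(stack_pt c' :: ('k \<times> 'k \<times> 'k, 'u) qobj) \<in> stack_objs (dual_numbers2 K)"
      by (rule stack_pt_stack_objs[OF K.dual_numbers2_cring i' inf c'(1)])
    show "tan_sum K (stack_pt c) u v w"
      unfolding tan_sum_def
      by (intro bexI[OF _ s] exI[of _ "\<lambda>S p. p"]) (simp add: uvw pull_stack_pt c' stack_iso_id def_class_def)
  qed
qed

text \<open>Rescaling gives the same result for every pair in the class, by the isomorphism that
  relates the pair to the trivial torsor. So the union in the definition is a single class.\<close>

lemma tan_smult_def_class:
  assumes c: "c \<in> X_pts K" and c': "c' \<in> deformations K c" and a: "a \<in> carrier K"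
  shows "a \<odot>\<^bsub>tangent_space K (stack_pt c :: ('k, 'u) qobj)\<^esub> def_class K c c' =
    def_class K c (sconst_map (\<lambda>(b, d). (b, a \<otimes>\<^bsub>K\<^esub> d)) c')"
proof -
  let ?\<rho> = "\<lambda>(b, d). (b, a \<otimes>\<^bsub>K\<^esub> d)"
  have X: "c' \<in> X_pts (dual_numbers K)" "sconst_map fst c' = c" using c' by (simp_all add: deformations_def)
  have f: "fst \<circ> ?\<rho> = fst" by (auto simp: fun_eq_iff)
  have "tan_class K (stack_pt c) (pull ?\<rho> \<tau>) \<alpha> = def_class K c (sconst_map ?\<rho> c')"
    if "(\<tau>, \<alpha>) \<in> (def_class K c c' :: ('k, 'u) tvec)" for \<tau> \<alpha>
  proof -
    have "((stack_pt c', \<lambda>S p. p), (\<tau>, \<alpha>)) \<in> tan_rel K (stack_pt c)"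
      using that by (simp add: def_class_def tan_class_def)
    then obtain \<beta> where \<beta>: "(\<tau>, \<alpha>) \<in> tan_pairs K (stack_pt c)" "stack_iso (dual_numbers K) (stack_pt c') \<tau> \<beta>"
      "\<And>S p. S \<in> ralgs K \<Longrightarrow> p \<in> sec (stack_pt c) S \<Longrightarrow> \<alpha> S p = \<beta> (along fst S) p"
      by (rule tan_relE) metis
    have t: "pre_obj (dual_numbers K) \<tau>" and \<alpha>: "stack_iso K (stack_pt c) (pull fst \<tau>) \<alpha>"
      using \<beta>(1) by (simp_all add: tan_pairs_iff stack_objs_pre)
    show ?thesis
      by (rule tan_class_pull(2)[OF K.dual_numbers_cring X t \<beta>(2) _ \<alpha> K.dual_numbers_homs(3)[OF a] f]) (simp add: \<beta>(3))
  qed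
  moreover have "(stack_pt c', \<lambda>S p. p) \<in> (def_class K c c' :: ('k, 'u) tvec)"
    using equiv_class_self[OF tan_rel_equiv[OF K.cring_axioms] deformation_tan_pair[OF c']]
    by (simp add: def_class_def tan_class_def)
  ultimately have "(\<Union>(\<tau>, \<alpha>)\<in>(def_class K c c' :: ('k, 'u) tvec). tan_class K (stack_pt c) (pull ?\<rho> \<tau>) \<alpha>)
      = def_class K c (sconst_map ?\<rho> c')" by blast
  then show ?thesis by (simp add: tangent_space_def)
qed

text \<open>Right translation by the constant lift of g is an isomorphism over K[\<epsilon>] that
  restricts to \<gamma> over K. It identifies d' with the identity marking and c' with the marking
  \<gamma>.\<close>

lemma tan_map_def_class:
  fixes \<gamma> :: "('k, 'u) qmor"
  assumes c: "c \<in> X_pts K" and c': "c' \<in> deformations K c" and d: "d \<in> X_pts K" and d': "d' \<in> deformations K d"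
    and g: "g \<in> G_pts K" and e: "X_act K g c = d" and e': "X_act (dual_numbers K) (mat_map (\<lambda>a. (a, \<zero>\<^bsub>K\<^esub>)) g) c' = d'"
    and \<gamma>: "\<gamma> = (\<lambda>S p. mat_mul (fst S) p (mat_map (snd S) g))"
  shows "tan_map K (stack_pt d) \<gamma> (def_class K c c') = def_class K d d'"
proof -
  have X: "c' \<in> X_pts (dual_numbers K)" "d' \<in> X_pts (dual_numbers K)" using c' d' by (simp_all add: deformations_def)
  interpret j: ring_hom_cring K "dual_numbers K" "\<lambda>a. (a, \<zero>\<^bsub>K\<^esub>)"
    by (rule ring_hom_cringI2[OF K.cring_axioms K.dual_numbers_cring K.dual_numbers_homs(2)])
  have g': "mat_map (\<lambda>a. (a, \<zero>\<^bsub>K\<^esub>)) g \<in> G_pts (dual_numbers K)" using g by simp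
  have \<gamma>i: "stack_iso K (stack_pt d) (stack_pt c) \<gamma>"
    unfolding \<gamma> by (rule right_translation_iso[OF K.cring_axioms d c g e])
  note \<delta> = right_translation_iso[OF K.dual_numbers_cring X(2,1) g' e']
  have "tan_class K (stack_pt d) \<tau> (\<lambda>S p. \<alpha> S (\<gamma> S p)) = def_class K d d'"
    if "(\<tau>, \<alpha>) \<in> (def_class K c c' :: ('k, 'u) tvec)" for \<tau> \<alpha>
  proof -
    have "((stack_pt c', \<lambda>S p. p), (\<tau>, \<alpha>)) \<in> tan_rel K (stack_pt c)"
      using that by (simp add: def_class_def tan_class_def)
    then obtain \<beta> where \<beta>: "(\<tau>, \<alpha>) \<in> tan_pairs K (stack_pt c)" "stack_iso (dual_numbers K) (stack_pt c') \<tau> \<beta>"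
      "\<And>S p. S \<in> ralgs K \<Longrightarrow> p \<in> sec (stack_pt c) S \<Longrightarrow> \<alpha> S p = \<beta> (along fst S) p"
      by (rule tan_relE) metis
    have p: "(\<tau>, \<lambda>S p. \<alpha> S (\<gamma> S p)) \<in> tan_pairs K (stack_pt d)"
      using \<beta>(1) stack_iso_trans[OF \<gamma>i] by (simp add: tan_pairs_iff)
    have "((stack_pt d', \<lambda>S p. p), (\<tau>, \<lambda>S p. \<alpha> S (\<gamma> S p))) \<in> tan_rel K (stack_pt d)"
    proof (rule tan_relI[OF deformation_tan_pair[OF d'] p stack_iso_trans[OF \<delta> \<beta>(2)]])
      fix S :: "('k, 'u) ralg" and q assume S: "S \<in> ralgs K" and q: "q \<in> sec (stack_pt d) S"
      have "mat_map (snd S \<circ> fst) (mat_map (\<lambda>a. (a, \<zero>\<^bsub>K\<^esub>)) g) = mat_map (snd S) g"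
        by (simp add: mat_map_comp comp_def)
      then have "mat_mul (fst (along fst S)) q (mat_map (snd (along fst S)) (mat_map (\<lambda>a. (a, \<zero>\<^bsub>K\<^esub>)) g)) = \<gamma> S q"
        by (simp add: \<gamma>)
      then show "\<alpha> S (\<gamma> S q) = \<beta> (along fst S) (mat_mul (fst (along fst S)) q
          (mat_map (snd (along fst S)) (mat_map (\<lambda>a. (a, \<zero>\<^bsub>K\<^esub>)) g)))"
        using \<beta>(3)[OF S] stack_isoD(2)[OF \<gamma>i S q] by simp
    qed
    then show ?thesis
      using tan_class_eq_iff[OF deformation_tan_pair[OF d'] p] by (simp add: def_class_def)
  qed
  moreover have "(stack_pt c', \<lambda>S p. p) \<in> (def_class K c c' :: ('k, 'u) tvec)"
    using equiv_class_self[OF tan_rel_equiv[OF K.cring_axioms] deformation_tan_pair[OF c']]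
    by (simp add: def_class_def tan_class_def)
  ultimately show ?thesis unfolding tan_map_def by blast
qed

end

section \<open>Invertible matrices and Frobenius forms over square-zero extensions\<close>

text \<open>The inverse over S, lifted entrywise by i, is a right inverse of g up to an error in the
  square-zero kernel, and the error can be corrected. The same argument for the transpose gives a
  left inverse.\<close>

lemma lift_mat_inverse:
  assumes R: "cring R" and S: "cring S" and \<pi>: "\<pi> \<in> ring_hom R S" and i: "i \<in> ring_hom S R"
    and \<pi>i: "\<And>s. s \<in> carrier S \<Longrightarrow> \<pi> (i s) = s"
    and sq: "\<And>x y. \<lbrakk>x \<in> carrier R; y \<in> carrier R; \<pi> x = \<zero>\<^bsub>S\<^esub>; \<pi> y = \<zero>\<^bsub>S\<^esub>\<rbrakk> \<Longrightarrow> x \<otimes>\<^bsub>R\<^esub> y = \<zero>\<^bsub>R\<^esub>"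
    and g: "g \<in> mats R" and k: "mat_inverse S (mat_map \<pi> g) k"
  shows "\<exists>k'. mat_inverse R g k'"
proof -
  interpret R: cring R by fact
  interpret S: cring S by fact
  interpret \<pi>: ring_hom_cring R S \<pi> by (rule ring_hom_cringI2[OF R S \<pi>])
  interpret i: ring_hom_cring S R i by (rule ring_hom_cringI2[OF S R i])
  have right: "\<exists>r\<in>mats R. mat_mul R g r = mat_one R"
    if g: "g \<in> mats R" and k: "k \<in> mats S" "mat_mul S (mat_map \<pi> g) k = mat_one S" for g k
  proof -
    define h where "h = mat_map i k"
    have h: "h \<in> mats R" using k by (simp add: h_def)
    have gh: "mat_mul R g h \<in> mats R" using g h by simp
    have \<pi>h: "mat_map \<pi> h = k" using k by (intro ext) (simp add: h_def mat_map_def \<pi>i)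
    define n where "n = (\<lambda>p q. mat_mul R g h p q \<oplus>\<^bsub>R\<^esub> \<ominus>\<^bsub>R\<^esub> mat_one R p q)"
    have n: "n \<in> mats R"
      using gh by (intro matsI) (simp_all add: n_def mats_outside mats_outside[OF R.mat_one_mats])
    have \<pi>n: "\<pi> (n p q) = \<zero>\<^bsub>S\<^esub>" for p q
    proof -
      have "mat_map \<pi> (mat_mul R g h) = mat_one S" using g h k \<pi>h by (simp add: \<pi>.mat_map_mul)
      then have "\<pi> (mat_mul R g h p q) = mat_one S p q" by (metis mat_map_def)
      moreover have "\<pi> (mat_one R p q) = mat_one S p q" using \<pi>.mat_map_one by (metis mat_map_def)
      ultimately show ?thesis using gh by (simp add: n_def S.r_neg)
    qed
    show ?thesis
    proof (rule R.mat_right_inverse_nilpotent[OF g h n])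
      show "mat_mul R g h p q = mat_one R p q \<oplus>\<^bsub>R\<^esub> n p q" for p q
        using gh by (simp add: n_def R.a_comm[of "mat_mul R g h p q"] R.r_neg2)
      show "n a b \<otimes>\<^bsub>R\<^esub> n p q = \<zero>\<^bsub>R\<^esub>" for a b p q using n \<pi>n by (simp add: sq)
    qed
  qed
  have km: "k \<in> mats S" using k by (simp add: mat_inverse_def)
  obtain r where r: "r \<in> mats R" "mat_mul R g r = mat_one R"
    using right[OF g km] k by (auto simp: mat_inverse_def)
  have "mat_inverse S (mat_transpose (mat_map \<pi> g)) (mat_transpose k)"
    using g k by (simp add: S.mat_inverse_transpose)
  moreover have "mat_transpose (mat_map \<pi> g) = mat_map \<pi> (mat_transpose g)"
    by (simp add: mat_transpose_def mat_map_def)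
  ultimately obtain l where l: "l \<in> mats R" "mat_mul R (mat_transpose g) l = mat_one R"
    using right[of "mat_transpose g" "mat_transpose k"] g km by (auto simp: mat_inverse_def)
  have "mat_mul R (mat_transpose l) (mat_transpose (mat_transpose g)) = mat_transpose (mat_mul R (mat_transpose g) l)"
    using l g by (intro R.mat_transpose_mul) simp_all
  moreover have "mat_transpose (mat_transpose g) = g" by (simp add: mat_transpose_def)
  ultimately have l': "mat_mul R (mat_transpose l) g = mat_one R" by (simp add: l R.mat_transpose_one)
  have "mat_transpose l = r"
    by (rule R.mat_left_right_inverse[OF g _ r(1) l' r(2)]) (use l in simp)
  then show ?thesis using l' r by (auto simp: mat_inverse_def)
qed

text \<open>Over \<open>R\<close>, a pairing is given by \<open>\<langle>a, b\<rangle> = \<lambda> (a b)\<close> for the constant lift of the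
  functional \<open>\<lambda> = \<langle>1, -\<rangle>\<close>.\<close>

lemma lift_X_pts:
  assumes R: "cring R" and S: "cring S" and \<pi>: "\<pi> \<in> ring_hom R S" and i: "i \<in> ring_hom S R"
    and \<pi>i: "\<And>s. s \<in> carrier S \<Longrightarrow> \<pi> (i s) = s"
    and sq: "\<And>x y. \<lbrakk>x \<in> carrier R; y \<in> carrier R; \<pi> x = \<zero>\<^bsub>S\<^esub>; \<pi> y = \<zero>\<^bsub>S\<^esub>\<rbrakk> \<Longrightarrow> x \<otimes>\<^bsub>R\<^esub> y = \<zero>\<^bsub>R\<^esub>"
    and c: "c \<in> sconsts R" and u: "unit_consts R c" and a: "assoc_consts R c"
    and X: "sconst_map \<pi> c \<in> X_pts S"
  shows "c \<in> X_pts R"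
proof -
  interpret R: cring R by fact
  interpret S: cring S by fact
  interpret \<pi>: ring_hom_cring R S \<pi> by (rule ring_hom_cringI2[OF R S \<pi>])
  interpret i: ring_hom_cring S R i by (rule ring_hom_cringI2[OF S R i])
  define d where "d = sconst_map \<pi> c"
  have d: "d \<in> sconsts S" "unit_consts S d" using X by (simp_all add: X_pts_iff d_def)
  obtain h where h: "frob_form S d h" using X by (auto simp: X_pts_iff d_def)
  have hm: "h \<in> mats S" and hdeg: "\<And>i j. bdeg i + bdeg j \<noteq> 4 \<Longrightarrow> h i j = \<zero>\<^bsub>S\<^esub>"
    using h unfolding frob_form_def by blast+
  \<comment> \<open>The Frobenius identity with first argument 1 reads h(1, a b) = h(a, b), so the
    first row of h determines h.\<close>
  have h_eq: "h j l = (\<Oplus>\<^bsub>S\<^esub>k\<in>{..<16}. d j l k \<otimes>\<^bsub>S\<^esub> h 0 k)" if "j < 16" "l < 16" for j l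
  proof -
    have "(\<Oplus>\<^bsub>S\<^esub>k\<in>{..<16}. d j l k \<otimes>\<^bsub>S\<^esub> h 0 k) = (\<Oplus>\<^bsub>S\<^esub>k\<in>{..<16}. d 0 j k \<otimes>\<^bsub>S\<^esub> h k l)"
      using h[unfolded frob_form_def, THEN conjunct2, THEN conjunct2, THEN conjunct2, rule_format, of 0 j l] that by simp
    also have "\<dots> = (\<Oplus>\<^bsub>S\<^esub>k\<in>{..<16}. mat_one S j k \<otimes>\<^bsub>S\<^esub> h k l)" using d(2) by (simp add: unit_consts_def)
    also have "\<dots> = h j l" using that hm by (simp add: S.finsum_mat_one)
    finally show ?thesis by simp
  qed
  define ll where "ll = (\<lambda>k. i (h 0 k))"
  have ll: "ll k \<in> carrier R" for k using hm by (simp add: ll_def)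
  define H where "H = (\<lambda>p q. \<Oplus>\<^bsub>R\<^esub>k\<in>{..<16}. c p q k \<otimes>\<^bsub>R\<^esub> ll k)"
  have cc: "c p q k \<in> carrier R" for p q k using c by (rule sconsts_carrier)
  have H: "H \<in> mats R"
    by (rule matsI) (auto simp: H_def cc ll sconsts_outside[OF c] intro!: R.finsum_zeroI)
  \<comment> \<open>H is built over R by the formula that h satisfies over S. Since it reduces to h,
    it is invertible.\<close>
  have "mat_map \<pi> H = h"
  proof (rule mats_eqI)
    fix p q :: nat assume pq: "p < 16" "q < 16"
    have "\<pi> (H p q) = (\<Oplus>\<^bsub>S\<^esub>k\<in>{..<16}. d p q k \<otimes>\<^bsub>S\<^esub> h 0 k)"
      using hm by (simp add: H_def cc ll d_def sconst_map_def Pi_def comp_def) (simp add: ll_def \<pi>i)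
    then show "mat_map \<pi> H p q = h p q" using h_eq[OF pq] by (simp add: mat_map_def)
  qed (use H hm in simp_all)
  then have inv: "\<exists>h'. mat_inverse R H h'"
    using h lift_mat_inverse[OF R S \<pi> i \<pi>i sq H] unfolding frob_form_def by blast
  have deg: "H p q = \<zero>\<^bsub>R\<^esub>" if pq: "bdeg p + bdeg q \<noteq> 4" for p q
    unfolding H_def
  proof (rule R.finsum_zeroI)
    fix k
    show "c p q k \<otimes>\<^bsub>R\<^esub> ll k = \<zero>\<^bsub>R\<^esub>"
      using sconsts_bdeg[OF c, of k p q] hdeg[of 0 k] pq cc ll
      by (cases "bdeg k = bdeg p + bdeg q") (simp_all add: ll_def)
  qed
  have Lin: "linear_form R (\<lambda>x. \<Oplus>\<^bsub>R\<^esub>k\<in>{..<16}. x k \<otimes>\<^bsub>R\<^esub> ll k)"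
    by (rule R.linear_form_comb') (simp_all add: ll R.linear_form_coord)
  have one: "(\<Oplus>\<^bsub>R\<^esub>k\<in>{..<16}. mulv R c x (mat_one R j) k \<otimes>\<^bsub>R\<^esub> ll k) = (\<Oplus>\<^bsub>R\<^esub>p\<in>{..<16}. x p \<otimes>\<^bsub>R\<^esub> H p j)"
    "(\<Oplus>\<^bsub>R\<^esub>k\<in>{..<16}. mulv R c (mat_one R j) x k \<otimes>\<^bsub>R\<^esub> ll k) = (\<Oplus>\<^bsub>R\<^esub>p\<in>{..<16}. x p \<otimes>\<^bsub>R\<^esub> H j p)"
    if x: "x \<in> vecs R" and j: "j < 16" for x j
  proof -
    have l: "linear_form R (\<lambda>x. \<Oplus>\<^bsub>R\<^esub>k\<in>{..<16}. mulv R c x (mat_one R j) k \<otimes>\<^bsub>R\<^esub> ll k)"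
      "linear_form R (\<lambda>x. \<Oplus>\<^bsub>R\<^esub>k\<in>{..<16}. mulv R c (mat_one R j) x k \<otimes>\<^bsub>R\<^esub> ll k)"
      using c by (intro R.linear_form_comb'; simp add: ll R.mulv_linear_left R.mulv_linear_right)+
    show "(\<Oplus>\<^bsub>R\<^esub>k\<in>{..<16}. mulv R c x (mat_one R j) k \<otimes>\<^bsub>R\<^esub> ll k) = (\<Oplus>\<^bsub>R\<^esub>p\<in>{..<16}. x p \<otimes>\<^bsub>R\<^esub> H p j)"
      unfolding R.linear_form_expand[OF l(1) x]
      using x j H c by (intro R.finsum_eqI) (simp_all add: R.mulv_mat_one H_def[symmetric] H_def[THEN fun_cong, THEN fun_cong, symmetric])
    show "(\<Oplus>\<^bsub>R\<^esub>k\<in>{..<16}. mulv R c (mat_one R j) x k \<otimes>\<^bsub>R\<^esub> ll k) = (\<Oplus>\<^bsub>R\<^esub>p\<in>{..<16}. x p \<otimes>\<^bsub>R\<^esub> H j p)"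
      unfolding R.linear_form_expand[OF l(2) x]
      using x j H c by (intro R.finsum_eqI) (simp_all add: R.mulv_mat_one H_def[THEN fun_cong, THEN fun_cong, symmetric])
  qed
  have "(\<Oplus>\<^bsub>R\<^esub>k\<in>{..<16}. c q l k \<otimes>\<^bsub>R\<^esub> H p k) = (\<Oplus>\<^bsub>R\<^esub>k\<in>{..<16}. c p q k \<otimes>\<^bsub>R\<^esub> H k l)"
    if "p < 16" "q < 16" "l < 16" for p q l
  proof -
    \<comment> \<open>Both sides of the Frobenius identity for H apply the functional
      \<open>ll\<close> to the product of e_p, e_q and e_l, so the identity is an instance of
      associativity.\<close>
    have "mulv R c (c p q) (mat_one R l) = mulv R c (mat_one R p) (c q l)"
      using a that by (simp add: R.assoc_consts_iff[OF c])
    then show ?thesis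
      using one(1)[of "c p q" l] one(2)[of "c q l" p] that c by (simp add: sconsts_vecs)
  qed
  then have "frob_form R c H" using H inv deg by (simp add: frob_form_def)
  then show ?thesis using c u a by (auto simp: X_pts_iff)
qed

section \<open>Linear algebra over a field\<close>

lemma (in field) homogeneous_system:
  fixes M :: "nat \<Rightarrow> 'i \<Rightarrow> 'a"
  assumes "finite J" "card J > n" "\<And>i j. M i j \<in> carrier R"
  shows "\<exists>x. (\<forall>j. x j \<in> carrier R) \<and> (\<exists>j\<in>J. x j \<noteq> \<zero>) \<and> (\<forall>i<n. (\<Oplus>j\<in>J. M i j \<otimes> x j) = \<zero>)"
  using assms
proof (induction n arbitrary: J M)
  case 0
  then have "J \<noteq> {}" by auto
  then show ?case by (intro exI[of _ "\<lambda>_. \<one>"]) auto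
next
  case (Suc n)
  show ?case
  proof (cases "\<forall>j\<in>J. M n j = \<zero>")
    case True
    obtain x where x: "\<forall>j. x j \<in> carrier R" "\<exists>j\<in>J. x j \<noteq> \<zero>" "\<forall>i<n. (\<Oplus>j\<in>J. M i j \<otimes> x j) = \<zero>"
      using Suc.IH[of J M] Suc.prems by auto
    have "(\<Oplus>j\<in>J. M n j \<otimes> x j) = \<zero>" using True x by (intro finsum_zeroI) simp
    then show ?thesis using x by (auto simp: less_Suc_eq)
  next
    case False
    then obtain p where p: "p \<in> J" "M n p \<noteq> \<zero>" by blast
    then have pu: "M n p \<in> Units R" using field_Units Suc.prems(3) by simp
    define v where "v = inv (M n p)"
    have v: "v \<in> carrier R" "M n p \<otimes> v = \<one>" using pu by (simp_all add: v_def)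
    \<comment> \<open>The last equation has a nonzero coefficient at p and is used to eliminate that
      unknown. This leaves n equations in more than n unknowns.\<close>
    define N where "N = (\<lambda>i j. M i j \<ominus> M i p \<otimes> v \<otimes> M n j)"
    have N: "N i j \<in> carrier R" for i j using Suc.prems(3) v by (simp add: N_def)
    obtain x where x: "\<forall>j. x j \<in> carrier R" "\<exists>j\<in>J - {p}. x j \<noteq> \<zero>" "\<forall>i<n. (\<Oplus>j\<in>J - {p}. N i j \<otimes> x j) = \<zero>"
    proof -
      have "card (J - {p}) > n" using Suc.prems p by (simp add: card_Diff_singleton)
      then show thesis using Suc.IH[of "J - {p}" N] Suc.prems(1) N that by auto
    qed
    have xc: "x j \<in> carrier R" for j using x(1) by blast
    define s where "s = (\<Oplus>j\<in>J - {p}. M n j \<otimes> x j)"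
    have s: "s \<in> carrier R" using Suc.prems(3) xc by (simp add: s_def)
    \<comment> \<open>The eliminated unknown takes the value that the last equation forces: s is the
      rest of that equation and v the inverse of its coefficient at p.\<close>
    define y where "y = x(p := \<ominus> (v \<otimes> s))"
    have yc: "y j \<in> carrier R" for j using xc v s by (simp add: y_def)
    have split: "(\<Oplus>j\<in>J. M i j \<otimes> y j) = M i p \<otimes> \<ominus> (v \<otimes> s) \<oplus> (\<Oplus>j\<in>J - {p}. M i j \<otimes> x j)" for i
    proof -
      have "(\<Oplus>j\<in>insert p (J - {p}). M i j \<otimes> y j) = M i p \<otimes> y p \<oplus> (\<Oplus>j\<in>J - {p}. M i j \<otimes> y j)"
        using Suc.prems yc by (intro finsum_insert) auto
      moreover have "(\<Oplus>j\<in>J - {p}. M i j \<otimes> y j) = (\<Oplus>j\<in>J - {p}. M i j \<otimes> x j)"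
        using Suc.prems xc by (intro finsum_eqI) (auto simp: y_def)
      ultimately show ?thesis using p by (simp add: insert_absorb y_def)
    qed
    have "(\<Oplus>j\<in>J. M i j \<otimes> y j) = \<zero>" if i: "i < Suc n" for i
    proof (cases "i = n")
      case True
      have "M n p \<otimes> \<ominus> (v \<otimes> s) = \<ominus> s"
        using v s Suc.prems(3) by (simp add: r_minus m_assoc[symmetric])
      then show ?thesis using s True by (simp add: split s_def[symmetric] l_neg)
    next
      case False
      then have "i < n" using i by simp
      have "\<zero> = (\<Oplus>j\<in>J - {p}. N i j \<otimes> x j)" using x(3) \<open>i < n\<close> by simp
      also have "\<dots> = (\<Oplus>j\<in>J - {p}. M i j \<otimes> x j \<oplus> \<ominus> (M i p \<otimes> v) \<otimes> (M n j \<otimes> x j))"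
        using Suc.prems(3) xc v
        by (intro finsum_eqI) (simp_all add: N_def a_minus_def l_distr l_minus m_assoc)
      also have "\<dots> = (\<Oplus>j\<in>J - {p}. M i j \<otimes> x j) \<oplus> \<ominus> (M i p \<otimes> v) \<otimes> s"
        using Suc.prems(1,3) xc v unfolding s_def
        by (subst finsum_addf) (simp_all add: finsum_rdistr)
      also have "\<ominus> (M i p \<otimes> v) \<otimes> s = M i p \<otimes> \<ominus> (v \<otimes> s)"
        using Suc.prems(3) v s by (simp add: l_minus r_minus m_assoc)
      finally show ?thesis
        using Suc.prems(3) xc v s by (simp add: split a_comm)
    qed
    moreover have "\<exists>j\<in>J. y j \<noteq> \<zero>" using x(2) by (auto simp: y_def)
    ultimately show ?thesis using yc by (intro exI[of _ y]) blast
  qed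
qed

text \<open>An injective g admits a solution of g x = b for every b, and so a right inverse k. From
  g k = 1 it follows that k is injective as well; its right inverse must then be g.\<close>

lemma (in field) mat_inverse_exists:
  assumes g: "g \<in> mats R" and nd: "\<And>x. x \<in> vecs R \<Longrightarrow> (\<And>i. mat_vec R g x i = \<zero>) \<Longrightarrow> x = (\<lambda>_. \<zero>)"
  shows "\<exists>k. mat_inverse R g k"
proof -
  have right: "\<exists>k\<in>mats R. mat_mul R g k = mat_one R"
    if g: "g \<in> mats R" and nd: "\<And>x. x \<in> vecs R \<Longrightarrow> (\<And>i. mat_vec R g x i = \<zero>) \<Longrightarrow> x = (\<lambda>_. \<zero>)" for g
  proof -
    have solve: "\<exists>x\<in>vecs R. mat_vec R g x = b" if b: "b \<in> vecs R" for b
    proof -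
      \<comment> \<open>The vector b is added as a column with index 16, so that there are 16
        equations in 17 unknowns. By injectivity a nonzero solution has a nonzero entry at 16, and
        dividing by its negative solves g z = b.\<close>
      define M where "M = (\<lambda>i j. if j = (16::nat) then b i else g i j)"
      have M: "M i j \<in> carrier R" for i j using g b by (simp add: M_def)
      obtain x where x: "\<forall>j. x j \<in> carrier R" "\<exists>j\<in>{..16}. x j \<noteq> \<zero>" "\<forall>i<16. (\<Oplus>j\<in>{..16}. M i j \<otimes> x j) = \<zero>"
        using homogeneous_system[of "{..16::nat}" 16 M] M by auto
      have xc: "x j \<in> carrier R" for j using x(1) by blast
      define y where "y = (\<lambda>j. if j < 16 then x j else \<zero>)"
      have y: "y \<in> vecs R" using xc by (intro vecsI) (simp_all add: y_def)
      have eq: "b i \<otimes> x 16 \<oplus> mat_vec R g y i = \<zero>" for i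
      proof (cases "i < 16")
        case True
        have "(\<Oplus>j\<in>{..16}. M i j \<otimes> x j) = (\<Oplus>j\<in>insert 16 {..<16}. M i j \<otimes> x j)"
          by (rule arg_cong[of _ _ "finsum R (\<lambda>j. M i j \<otimes> x j)"]) auto
        also have "\<dots> = M i 16 \<otimes> x 16 \<oplus> (\<Oplus>j\<in>{..<16}. M i j \<otimes> x j)"
          using M xc by (intro finsum_insert) auto
        also have "(\<Oplus>j\<in>{..<16}. M i j \<otimes> x j) = mat_vec R g y i"
          unfolding mat_vec_def using g y xc by (intro finsum_eqI) (auto simp: M_def y_def)
        finally show ?thesis using x(3) True by (simp add: M_def)
      next
        case False
        then show ?thesis
          using b xc vecs_outside[OF b, of i] vecs_outside[OF mat_vec_vecs[OF g y], of i] by (simp add: not_less)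
      qed
      have "x 16 \<noteq> \<zero>"
      proof
        assume z: "x 16 = \<zero>"
        have "mat_vec R g y i = \<zero>" for i using eq[of i] z b vecs_carrier[OF mat_vec_vecs[OF g y]] by simp
        then have "y = (\<lambda>_. \<zero>)" using nd y by blast
        then have "x j = \<zero>" if "j \<le> 16" for j using z that unfolding y_def by (metis le_neq_implies_less)
        then show False using x(2) by auto
      qed
      then have u: "x 16 \<in> Units R" using field_Units xc by simp
      define w where "w = \<ominus> (inv (x 16))"
      have w: "w \<in> carrier R" "x 16 \<otimes> w = \<ominus> \<one>" using u xc by (simp_all add: w_def r_minus)
      define z where "z = (\<lambda>j. y j \<otimes> w)"
      have zv: "z \<in> vecs R" using y w by (intro vecsI) (simp_all add: z_def vecs_outside[OF y])
      have "mat_vec R g z i = b i" for i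
      proof -
        have mc: "mat_vec R g y i \<in> carrier R" using vecs_carrier[OF mat_vec_vecs[OF g y]] .
        have "mat_vec R g z i = mat_vec R g y i \<otimes> w"
          unfolding mat_vec_def z_def using g y w
          by (subst finsum_ldistr) (auto simp: m_assoc intro!: finsum_eqI)
        also have "mat_vec R g y i = \<ominus> (b i \<otimes> x 16)"
          using eq[of i] b xc mc by (simp add: minus_equality add.m_comm minus_equality[symmetric])
        also have "\<ominus> (b i \<otimes> x 16) \<otimes> w = b i"
          using b xc w by (simp add: l_minus m_assoc r_minus)
        finally show ?thesis .
      qed
      then show ?thesis using zv by auto
    qed
    have "\<forall>j. \<exists>x\<in>vecs R. mat_vec R g x = mat_one R j" using solve by simp
    then obtain f where f: "\<And>j. f j \<in> vecs R" "\<And>j. mat_vec R g (f j) = mat_one R j" by metis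
    define k where "k = (\<lambda>i j. if j < 16 then f j i else \<zero>)"
    have k: "k \<in> mats R" using f(1) by (intro matsI) (auto simp: k_def vecs_outside)
    have "mat_mul R g k = mat_one R"
    proof (rule mats_eqI[of _ R])
      fix i j :: nat assume "i < 16" "j < 16"
      then have "mat_mul R g k i j = mat_vec R g (f j) i" by (simp add: mat_mul_def mat_vec_def k_def)
      then show "mat_mul R g k i j = mat_one R i j" by (simp add: f mat_one_sym)
    qed (use g k in simp_all)
    then show ?thesis using k by blast
  qed
  obtain k where k: "k \<in> mats R" "mat_mul R g k = mat_one R" using right[OF g nd] by blast
  have "x = (\<lambda>_. \<zero>)" if x: "x \<in> vecs R" "\<And>i. mat_vec R k x i = \<zero>" for x
  proof -
    have "mat_vec R k x = (\<lambda>_. \<zero>)" using x(2) by blast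
    have "x = mat_vec R (mat_mul R g k) x" using k x by (simp add: mat_one_vec)
    also have "\<dots> = mat_vec R g (\<lambda>_. \<zero>)" by (simp only: mat_vec_mul[OF g k(1) x(1)] \<open>mat_vec R k x = (\<lambda>_. \<zero>)\<close>)
    also have "\<dots> = (\<lambda>_. \<zero>)" using g unfolding mat_vec_def by (intro ext finsum_zeroI) simp
    finally show ?thesis .
  qed
  then obtain k' where k': "k' \<in> mats R" "mat_mul R k k' = mat_one R" using right[OF k(1)] by blast
  have "g = k'" by (rule mat_left_right_inverse[OF k(1) g k'(1) k(2) k'(2)])
  then show ?thesis using k k' by (auto simp: mat_inverse_def)
qed

section \<open>Graded algebras in coordinates\<close>

locale based_algebra =
  fixes K :: "('k, 'm) ring_scheme" and A :: "('k, 'a) module" (structure) and gr :: "nat \<Rightarrow> 'a set" and e :: "nat \<Rightarrow> 'a"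
  assumes frob: "frobenius_algebra4 K A gr" and basis: "homogeneous_basis K A gr e"
begin

lemma field_K: "field K" and ring_A: "ring A" and module_A: "module K A"
  using frob by (simp_all add: frobenius_algebra4_def graded_algebra_def)

sublocale K: field K by (rule field_K)
sublocale A: ring A by (rule ring_A)
sublocale M: module K A by (rule module_A)

lemma smult_mult:
  assumes "k \<in> carrier K" "a \<in> carrier A" "b \<in> carrier A"
  shows "(k \<odot> a) \<otimes> b = k \<odot> (a \<otimes> b)" "a \<otimes> (k \<odot> b) = k \<odot> (a \<otimes> b)"
proof -
  have "k \<odot> (a \<otimes> b) = (k \<odot> a) \<otimes> b \<and> k \<odot> (a \<otimes> b) = a \<otimes> (k \<odot> b)"
    using frob assms unfolding frobenius_algebra4_def graded_algebra_def by blast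
  then show "(k \<odot> a) \<otimes> b = k \<odot> (a \<otimes> b)" "a \<otimes> (k \<odot> b) = k \<odot> (a \<otimes> b)"
    by (rule conjE, simp)+
qed

lemma gr_submodule: "submodule (gr i) K A"
  using frob by (simp add: frobenius_algebra4_def graded_algebra_def)

lemma gr_carrier: "a \<in> gr i \<Longrightarrow> a \<in> carrier A"
  using M.submoduleE(1)[OF gr_submodule] by blast

lemma gr_zero: "\<zero> \<in> gr i"
  using subgroup.one_closed[OF submodule.axioms(1)[OF gr_submodule]] by simp

lemma gr_add: "a \<in> gr i \<Longrightarrow> b \<in> gr i \<Longrightarrow> a \<oplus> b \<in> gr i"
  using subgroup.m_closed[OF submodule.axioms(1)[OF gr_submodule]] by simp

lemma gr_smult: "k \<in> carrier K \<Longrightarrow> a \<in> gr i \<Longrightarrow> k \<odot> a \<in> gr i"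
  using submodule.smult_closed[OF gr_submodule] by simp

lemma gr_one: "\<one> \<in> gr 0"
  using frob by (simp add: frobenius_algebra4_def graded_algebra_def)

lemma gr_mult: "a \<in> gr i \<Longrightarrow> b \<in> gr j \<Longrightarrow> a \<otimes> b \<in> gr (i + j)"
  using frob by (simp add: frobenius_algebra4_def graded_algebra_def)

lemma e_0: "e 0 = \<one>" and e_gr: "i < 16 \<Longrightarrow> e i \<in> gr (bdeg i)"
  using basis by (simp_all add: homogeneous_basis_def)

lemma e_carrier: "i < 16 \<Longrightarrow> e i \<in> carrier A"
  using e_gr gr_carrier by blast

abbreviation co :: "'a \<Rightarrow> nat \<Rightarrow> 'k" where "co \<equiv> coords K A e"

definition vec :: "(nat \<Rightarrow> 'k) \<Rightarrow> 'a" where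
  "vec x = (\<Oplus>k\<in>{..<16}. x k \<odot> e k)"

lemma basis_expansion_iff: "basis_expansion K A e a x \<longleftrightarrow> x \<in> vecs K \<and> a = vec x"
  unfolding basis_expansion_def vecs_def vec_def by blast

lemma vec_carrier: "x \<in> vecs K \<Longrightarrow> vec x \<in> carrier A"
  unfolding vec_def by (intro A.finsum_closed) (simp add: e_carrier)

lemma co_props: assumes "a \<in> carrier A" shows "co a \<in> vecs K" "vec (co a) = a"
proof -
  have "\<exists>!x. basis_expansion K A e a x" using basis assms by (simp add: homogeneous_basis_def)
  from theI'[OF this] show "co a \<in> vecs K" "vec (co a) = a" by (simp_all add: coords_def basis_expansion_iff)
qed

lemma co_vec: assumes "x \<in> vecs K" shows "co (vec x) = x"
proof -
  have "\<exists>!y. basis_expansion K A e (vec x) y" using basis vec_carrier[OF assms] by (simp add: homogeneous_basis_def)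
  then show ?thesis unfolding coords_def by (rule the1_equality) (simp add: basis_expansion_iff assms)
qed

lemma co_eqI: "a \<in> carrier A \<Longrightarrow> b \<in> carrier A \<Longrightarrow> (\<And>k. co a k = co b k) \<Longrightarrow> a = b"
  by (metis co_props(2) ext)

lemma co_carrier: "a \<in> carrier A \<Longrightarrow> co a k \<in> carrier K"
  using co_props(1) by simp

lemma co_outside: "a \<in> carrier A \<Longrightarrow> 16 \<le> k \<Longrightarrow> co a k = \<zero>\<^bsub>K\<^esub>"
  using co_props(1) by (rule vecs_outside)

lemma co_add:
  assumes "a \<in> carrier A" "b \<in> carrier A" shows "co (a \<oplus> b) k = co a k \<oplus>\<^bsub>K\<^esub> co b k"
proof -
  let ?z = "\<lambda>k. co a k \<oplus>\<^bsub>K\<^esub> co b k"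
  have z: "?z \<in> vecs K" using assms by (intro vecsI) (simp_all add: co_carrier co_outside)
  have "vec ?z = (\<Oplus>k\<in>{..<16}. co a k \<odot> e k \<oplus> co b k \<odot> e k)"
    unfolding vec_def using assms
    by (intro A.finsum_cong') (simp_all add: co_carrier e_carrier M.smult_l_distr)
  also have "\<dots> = vec (co a) \<oplus> vec (co b)"
    unfolding vec_def using assms by (intro A.finsum_addf) (auto simp: co_carrier e_carrier)
  finally have "vec ?z = a \<oplus> b" using assms by (simp add: co_props)
  then show ?thesis using co_vec[OF z] by (metis)
qed

lemma co_smult:
  assumes "c \<in> carrier K" "a \<in> carrier A" shows "co (c \<odot> a) k = c \<otimes>\<^bsub>K\<^esub> co a k"
proof -
  let ?z = "\<lambda>k. c \<otimes>\<^bsub>K\<^esub> co a k"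
  have z: "?z \<in> vecs K" using assms by (intro vecsI) (simp_all add: co_carrier co_outside)
  have "vec ?z = (\<Oplus>k\<in>{..<16}. c \<odot> (co a k \<odot> e k))"
    unfolding vec_def using assms
    by (intro A.finsum_cong') (simp_all add: co_carrier e_carrier M.smult_assoc1)
  also have "\<dots> = c \<odot> vec (co a)"
    unfolding vec_def using assms by (subst M.finsum_smult_ldistr) (auto simp: co_carrier e_carrier)
  finally have "vec ?z = c \<odot> a" using assms by (simp add: co_props)
  then show ?thesis using co_vec[OF z] by (metis)
qed

lemma co_zero: "co \<zero> k = \<zero>\<^bsub>K\<^esub>"
  using co_smult[of "\<zero>\<^bsub>K\<^esub>" "\<zero>" k] co_carrier[of "\<zero>" k] by simp

lemma co_finsum:
  assumes "finite I" "\<And>i. i \<in> I \<Longrightarrow> f i \<in> carrier A"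
  shows "co (\<Oplus>i\<in>I. f i) k = (\<Oplus>\<^bsub>K\<^esub>i\<in>I. co (f i) k)"
  using assms
proof (induction I rule: finite_induct)
  case empty
  then show ?case by (simp add: co_zero)
next
  case (insert i I)
  have "(\<Oplus>i\<in>insert i I. f i) = f i \<oplus> (\<Oplus>i\<in>I. f i)"
    using insert by (intro A.finsum_insert) auto
  moreover have "(\<Oplus>\<^bsub>K\<^esub>i\<in>insert i I. co (f i) k) = co (f i) k \<oplus>\<^bsub>K\<^esub> (\<Oplus>\<^bsub>K\<^esub>i\<in>I. co (f i) k)"
    using insert by (intro K.finsum_insert) (auto simp: co_carrier)
  ultimately show ?case
    using insert co_add[of "f i" "\<Oplus>i\<in>I. f i" k] by simp
qed

lemma co_e: assumes "i < 16" shows "co (e i) = mat_one K i"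
proof -
  have "vec (mat_one K i) = (\<Oplus>k\<in>{..<16}. if i = k then e k else \<zero>)"
    unfolding vec_def by (intro A.finsum_cong') (auto simp: mat_one_def e_carrier)
  also have "\<dots> = e i" using assms by (intro A.add.finprod_singleton) (auto simp: e_carrier)
  finally show ?thesis using co_vec[of "mat_one K i"] by simp
qed

lemma co_one: "co \<one> = mat_one K 0"
  using co_e[of 0] by (simp add: e_0)

lemma functional_expand:
  assumes F: "\<And>a. a \<in> carrier A \<Longrightarrow> F a \<in> carrier K"
      "\<And>a b. a \<in> carrier A \<Longrightarrow> b \<in> carrier A \<Longrightarrow> F (a \<oplus> b) = F a \<oplus>\<^bsub>K\<^esub> F b"
      "\<And>k a. k \<in> carrier K \<Longrightarrow> a \<in> carrier A \<Longrightarrow> F (k \<odot> a) = k \<otimes>\<^bsub>K\<^esub> F a"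
    and b: "b \<in> carrier A"
  shows "F b = (\<Oplus>\<^bsub>K\<^esub>k\<in>{..<16}. co b k \<otimes>\<^bsub>K\<^esub> F (e k))"
proof -
  have fs: "F (\<Oplus>k\<in>I. f k) = (\<Oplus>\<^bsub>K\<^esub>k\<in>I. F (f k))" if "finite I" "\<And>k. k \<in> I \<Longrightarrow> f k \<in> carrier A" for f and I :: "nat set"
    using that
  proof (induction I rule: finite_induct)
    case empty
    have "F \<zero> = \<zero>\<^bsub>K\<^esub>" using F(3)[of "\<zero>\<^bsub>K\<^esub>" "\<zero>"] F(1)[of "\<zero>"] by simp
    then show ?case by simp
  next
    case (insert i I)
    have "(\<Oplus>k\<in>insert i I. f k) = f i \<oplus> (\<Oplus>k\<in>I. f k)"
      using insert by (intro A.finsum_insert) auto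
    moreover have "(\<Oplus>\<^bsub>K\<^esub>k\<in>insert i I. F (f k)) = F (f i) \<oplus>\<^bsub>K\<^esub> (\<Oplus>\<^bsub>K\<^esub>k\<in>I. F (f k))"
      using insert F(1) by (intro K.finsum_insert) auto
    ultimately show ?case using insert F(2) by simp
  qed
  have "F (vec (co b)) = (\<Oplus>\<^bsub>K\<^esub>k\<in>{..<16}. F (co b k \<odot> e k))"
    unfolding vec_def by (rule fs) (use b in \<open>simp_all add: co_carrier e_carrier\<close>)
  also have "\<dots> = (\<Oplus>\<^bsub>K\<^esub>k\<in>{..<16}. co b k \<otimes>\<^bsub>K\<^esub> F (e k))"
    using b F by (intro K.finsum_eqI) (simp_all add: co_carrier e_carrier)
  finally show ?thesis using b by (simp add: co_props)
qed

definition linear :: "('a \<Rightarrow> 'a) \<Rightarrow> bool" where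
  "linear L \<longleftrightarrow> (\<forall>a\<in>carrier A. L a \<in> carrier A) \<and>
     (\<forall>a\<in>carrier A. \<forall>b\<in>carrier A. L (a \<oplus> b) = L a \<oplus> L b) \<and>
     (\<forall>k\<in>carrier K. \<forall>a\<in>carrier A. L (k \<odot> a) = k \<odot> L a)"

lemma linearI:
  "\<lbrakk>\<And>a. a \<in> carrier A \<Longrightarrow> L a \<in> carrier A;
    \<And>a b. \<lbrakk>a \<in> carrier A; b \<in> carrier A\<rbrakk> \<Longrightarrow> L (a \<oplus> b) = L a \<oplus> L b;
    \<And>k a. \<lbrakk>k \<in> carrier K; a \<in> carrier A\<rbrakk> \<Longrightarrow> L (k \<odot> a) = k \<odot> L a\<rbrakk> \<Longrightarrow> linear L"
  by (simp add: linear_def)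

lemma linear_closed: "linear L \<Longrightarrow> a \<in> carrier A \<Longrightarrow> L a \<in> carrier A"
  by (simp add: linear_def)

lemma linear_finsum:
  assumes L: "linear L" and "finite I" "\<And>i. i \<in> I \<Longrightarrow> f i \<in> carrier A"
  shows "L (\<Oplus>i\<in>I. f i) = (\<Oplus>i\<in>I. L (f i))"
  using assms(2,3)
proof (induction I rule: finite_induct)
  case empty
  have "L (\<zero>\<^bsub>K\<^esub> \<odot> \<zero>) = \<zero>\<^bsub>K\<^esub> \<odot> L \<zero>"
    using L K.zero_closed A.zero_closed unfolding linear_def by blast
  then show ?case using linear_closed[OF L, of "\<zero>"] by simp
next
  case (insert i I)
  have "(\<Oplus>i\<in>insert i I. f i) = f i \<oplus> (\<Oplus>i\<in>I. f i)"
    using insert by (intro A.finsum_insert) auto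
  moreover have "(\<Oplus>i\<in>insert i I. L (f i)) = L (f i) \<oplus> (\<Oplus>i\<in>I. L (f i))"
    using insert linear_closed[OF L] by (intro A.finsum_insert) auto
  moreover have "L (f i \<oplus> (\<Oplus>i\<in>I. f i)) = L (f i) \<oplus> L (\<Oplus>i\<in>I. f i)"
    using L insert by (simp add: linear_def)
  ultimately show ?case using insert by simp
qed

lemma co_linear:
  assumes L: "linear L" and a: "a \<in> carrier A"
  shows "co (L a) m = (\<Oplus>\<^bsub>K\<^esub>i\<in>{..<16}. co a i \<otimes>\<^bsub>K\<^esub> co (L (e i)) m)"
proof -
  have "L a = L (\<Oplus>i\<in>{..<16}. co a i \<odot> e i)" using co_props(2)[OF a] by (simp add: vec_def)
  also have "\<dots> = (\<Oplus>i\<in>{..<16}. L (co a i \<odot> e i))"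
    using a by (intro linear_finsum[OF L]) (auto simp: co_carrier e_carrier)
  also have "\<dots> = (\<Oplus>i\<in>{..<16}. co a i \<odot> L (e i))"
    using L a by (intro A.finsum_cong') (auto simp: linear_def co_carrier e_carrier)
  also have "co \<dots> m = (\<Oplus>\<^bsub>K\<^esub>i\<in>{..<16}. co (co a i \<odot> L (e i)) m)"
    using a linear_closed[OF L] by (intro co_finsum) (auto simp: co_carrier e_carrier)
  also have "\<dots> = (\<Oplus>\<^bsub>K\<^esub>i\<in>{..<16}. co a i \<otimes>\<^bsub>K\<^esub> co (L (e i)) m)"
    using a linear_closed[OF L] by (intro K.finsum_eqI) (auto simp: co_carrier e_carrier co_smult)
  finally show ?thesis .
qed

lemma linear_eqI:
  assumes L: "linear L" and M: "linear M" and eq: "\<And>i. i < 16 \<Longrightarrow> L (e i) = M (e i)" and a: "a \<in> carrier A"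
  shows "L a = M a"
proof (rule co_eqI)
  show "co (L a) k = co (M a) k" for k
    unfolding co_linear[OF L a] co_linear[OF M a]
    using a eq linear_closed[OF M] by (intro K.finsum_eqI) (auto simp: co_carrier e_carrier)
qed (use a linear_closed L M in simp_all)

lemma vec_add: "x \<in> vecs K \<Longrightarrow> y \<in> vecs K \<Longrightarrow> (\<And>k. z k = x k \<oplus>\<^bsub>K\<^esub> y k) \<Longrightarrow> vec z = vec x \<oplus> vec y"
proof -
  assume *: "x \<in> vecs K" "y \<in> vecs K" "\<And>k. z k = x k \<oplus>\<^bsub>K\<^esub> y k"
  then have z: "z \<in> vecs K" by (intro vecsI) (simp_all add: vecs_outside)
  show ?thesis by (rule co_eqI) (simp_all add: * z co_vec vec_carrier co_add)
qed

lemma vec_smult: "x \<in> vecs K \<Longrightarrow> c \<in> carrier K \<Longrightarrow> (\<And>k. z k = c \<otimes>\<^bsub>K\<^esub> x k) \<Longrightarrow> vec z = c \<odot> vec x"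
proof -
  assume *: "x \<in> vecs K" "c \<in> carrier K" "\<And>k. z k = c \<otimes>\<^bsub>K\<^esub> x k"
  then have z: "z \<in> vecs K" by (intro vecsI) (simp_all add: vecs_outside)
  show ?thesis by (rule co_eqI) (simp_all add: * z co_vec vec_carrier co_smult)
qed

lemma gr_finsum: "finite I \<Longrightarrow> (\<And>i. i \<in> I \<Longrightarrow> f i \<in> gr d) \<Longrightarrow> (\<Oplus>i\<in>I. f i) \<in> gr d"
proof (induction I rule: finite_induct)
  case empty
  then show ?case by (simp add: gr_zero)
next
  case (insert i I)
  then have "(\<Oplus>i\<in>insert i I. f i) = f i \<oplus> (\<Oplus>i\<in>I. f i)"
    by (intro A.finsum_insert) (auto intro: gr_carrier)
  then show ?case using insert by (simp add: gr_add)
qed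

text \<open>The prescribed dimension is a binomial coefficient that vanishes for d > 4.\<close>

lemma gr_large: assumes "d > 4" shows "gr d = {\<zero>}"
proof -
  have "ring.dimension A (4 choose d) ((\<lambda>k. k \<odot> \<one>) ` carrier K) (gr d)"
    using frob by (simp add: frobenius_algebra4_def hilbert_1t4_def)
  moreover have "4 choose d = 0" using assms by simp
  ultimately have "A.dimension 0 ((\<lambda>k. k \<odot> \<one>) ` carrier K) (gr d)" by simp
  then show ?thesis by (cases rule: A.dimension.cases) simp_all
qed

lemma bdeg_le: "i < 16 \<Longrightarrow> bdeg i \<le> 4"
  by (simp add: bdeg_def)

text \<open>A homogeneous element involves only basis elements of its own degree. This rests on the
  uniqueness of the decomposition into homogeneous components.\<close>

lemma gr_iff_co: "a \<in> gr d \<longleftrightarrow> a \<in> carrier A \<and> (\<forall>k<16. bdeg k \<noteq> d \<longrightarrow> co a k = \<zero>\<^bsub>K\<^esub>)"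
proof
  assume a: "a \<in> carrier A \<and> (\<forall>k<16. bdeg k \<noteq> d \<longrightarrow> co a k = \<zero>\<^bsub>K\<^esub>)"
  have "vec (co a) \<in> gr d"
    unfolding vec_def
  proof (intro gr_finsum)
    fix k assume "k \<in> {..<16::nat}"
    then have k: "k < 16" by simp
    show "co a k \<odot> e k \<in> gr d"
    proof (cases "bdeg k = d")
      case True
      then show ?thesis using gr_smult[OF co_carrier e_gr[OF k]] a by simp
    next
      case False
      then show ?thesis using a k e_carrier[OF k] by (simp add: gr_zero)
    qed
  qed simp
  then show "a \<in> gr d" using a by (simp add: co_props)
next
  assume a: "a \<in> gr d"
  then have ac: "a \<in> carrier A" by (rule gr_carrier)
  show "a \<in> carrier A \<and> (\<forall>k<16. bdeg k \<noteq> d \<longrightarrow> co a k = \<zero>\<^bsub>K\<^esub>)"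
  proof (cases "d > 4")
    case True
    then show ?thesis using a ac by (simp add: gr_large co_zero)
  next
    case False
    \<comment> \<open>The vector \<open>x i\<close> collects the coordinates of a that belong to
      degree i.\<close>
    define x where "x i k = (if bdeg k = i then co a k else \<zero>\<^bsub>K\<^esub>)" for i k
    have x: "x i \<in> vecs K" for i using ac by (intro vecsI) (simp_all add: x_def co_carrier co_outside)
    have y: "vec (x i) \<in> gr i" for i
      unfolding vec_def
    proof (intro gr_finsum)
      fix k assume "k \<in> {..<16::nat}"
      then have k: "k < 16" by simp
      show "x i k \<odot> e k \<in> gr i"
        using gr_smult[OF co_carrier[OF ac] e_gr[OF k]] e_carrier[OF k] by (auto simp: x_def gr_zero)
    qed simp
    have "a = (\<Oplus>i\<in>{..4}. vec (x i))"
    proof (rule co_eqI[OF ac])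
      show "(\<Oplus>i\<in>{..4}. vec (x i)) \<in> carrier A" using x by (simp add: vec_carrier)
      fix k
      have "co (\<Oplus>i\<in>{..4}. vec (x i)) k = (\<Oplus>\<^bsub>K\<^esub>i\<in>{..4}. if bdeg k = i then co a k else \<zero>\<^bsub>K\<^esub>)"
        using x by (simp add: co_finsum vec_carrier co_vec) (simp add: x_def)
      also have "\<dots> = co a k"
      proof (cases "k < 16")
        case True
        then show ?thesis using ac bdeg_le[OF True] by (intro K.add.finprod_singleton) (auto simp: co_carrier)
      next
        case False
        then have "co a k = \<zero>\<^bsub>K\<^esub>" using ac by (simp add: co_outside)
        then show ?thesis by (simp add: K.finsum_zeroI)
      qed
      finally show "co a k = co (\<Oplus>i\<in>{..4}. vec (x i)) k" ..
    qed
    then have e1: "a = (\<Oplus>i\<in>{..4}. (restrict (\<lambda>i. vec (x i)) {..4}) i)"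
      using x by (simp cong: A.finsum_cong add: vec_carrier)
    define z where "z = restrict (\<lambda>i. if d = i then a else \<zero>) {..4}"
    have "(\<Oplus>i\<in>{..4}. z i) = (\<Oplus>i\<in>{..4}. if d = i then a else \<zero>)"
      using ac by (intro A.finsum_cong') (auto simp: z_def)
    also have "\<dots> = a" using False ac by (intro A.add.finprod_singleton) auto
    finally have e2: "a = (\<Oplus>i\<in>{..4}. z i)" ..
    have u: "\<exists>!y. y \<in> (\<Pi>\<^sub>E i\<in>{..4}. gr i) \<and> a = (\<Oplus>i\<in>{..4}. y i)"
      using frob ac by (simp add: frobenius_algebra4_def hilbert_1t4_def)
    \<comment> \<open>The components read off from the basis, and the family with a in degree d and
      zero elsewhere, both decompose a. Hence they agree.\<close>
    have rz: "restrict (\<lambda>i. vec (x i)) {..4} = z"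
      by (rule ex1_unique[OF u]) (use e1 e2 y a in \<open>auto simp: z_def gr_zero\<close>)
    have "vec (x i) = \<zero>" if "i \<le> 4" "i \<noteq> d" for i
      using fun_cong[OF rz, of i] that by (simp add: z_def)
    then have "x (bdeg k) k = \<zero>\<^bsub>K\<^esub>" if "k < 16" "bdeg k \<noteq> d" for k
      using bdeg_le[OF that(1)] that(2) co_vec[OF x, of "bdeg k"] co_zero by metis
    then show ?thesis using ac by (simp add: x_def)
  qed
qed

section \<open>The structure constants of a Frobenius algebra lie in X_4\<close>

abbreviation sc :: "'k sconst" where "sc \<equiv> struct_consts K A e"

lemma sc_eq: "i < 16 \<Longrightarrow> j < 16 \<Longrightarrow> sc i j = co (e i \<otimes> e j)"
  by (rule ext) (simp add: struct_consts_def)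

text \<open>Preservation of degrees is part of the notion, so these maps are the degree-preserving
  2-cochains in curried form.\<close>

definition bilinear :: "('a \<Rightarrow> 'a \<Rightarrow> 'a) \<Rightarrow> bool" where
  "bilinear b \<longleftrightarrow> (\<forall>x\<in>carrier A. linear (b x)) \<and> (\<forall>y\<in>carrier A. linear (\<lambda>x. b x y)) \<and>
     (\<forall>i j. \<forall>x\<in>gr i. \<forall>y\<in>gr j. b x y \<in> gr (i + j))"

definition consts_of :: "('a \<Rightarrow> 'a \<Rightarrow> 'a) \<Rightarrow> 'k sconst" where
  "consts_of b = (\<lambda>i j k. if i < 16 \<and> j < 16 then co (b (e i) (e j)) k else \<zero>\<^bsub>K\<^esub>)"

lemma bilinear_mult: "bilinear (\<lambda>x y. x \<otimes> y)"
  unfolding bilinear_def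
  by (intro conjI ballI allI linearI) (simp_all add: A.l_distr A.r_distr smult_mult gr_mult)

lemma sc_consts_of: "sc = consts_of (\<lambda>x y. x \<otimes> y)"
  by (simp add: struct_consts_def consts_of_def)

lemma bilinear_linear:
  "bilinear b \<Longrightarrow> x \<in> carrier A \<Longrightarrow> linear (b x)" "bilinear b \<Longrightarrow> y \<in> carrier A \<Longrightarrow> linear (\<lambda>x. b x y)"
  by (simp_all add: bilinear_def)

lemma bilinear_closed: "bilinear b \<Longrightarrow> x \<in> carrier A \<Longrightarrow> y \<in> carrier A \<Longrightarrow> b x y \<in> carrier A"
  using linear_closed[OF bilinear_linear(1)] by blast

lemma consts_of_sconsts: assumes b: "bilinear b" shows "consts_of b \<in> sconsts K"
proof (rule sconstsI)
  show "consts_of b i j k \<in> carrier K" for i j k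
    using bilinear_closed[OF b] by (simp add: consts_of_def co_carrier e_carrier)
  show "consts_of b i j k = \<zero>\<^bsub>K\<^esub>" if "16 \<le> i \<or> 16 \<le> j \<or> 16 \<le> k" for i j k
    using that bilinear_closed[OF b] by (auto simp: consts_of_def e_carrier co_outside)
  show "consts_of b i j k = \<zero>\<^bsub>K\<^esub>" if d: "bdeg k \<noteq> bdeg i + bdeg j" for i j k
  proof (cases "i < 16 \<and> j < 16 \<and> k < 16")
    case True
    then have "b (e i) (e j) \<in> gr (bdeg i + bdeg j)" using b e_gr by (simp add: bilinear_def)
    then show ?thesis using True d by (simp add: consts_of_def gr_iff_co)
  next
    case False
    then show ?thesis using bilinear_closed[OF b] by (auto simp: consts_of_def e_carrier co_outside)
  qed
qed

lemma co_bilinear: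
  assumes b: "bilinear b" and x: "x \<in> carrier A" and y: "y \<in> carrier A"
  shows "co (b x y) = mulv K (consts_of b) (co x) (co y)"
proof
  fix k
  have "co (b x y) k = (\<Oplus>\<^bsub>K\<^esub>i\<in>{..<16}. co x i \<otimes>\<^bsub>K\<^esub> co (b (e i) y) k)"
    by (rule co_linear[OF bilinear_linear(2)[OF b y] x])
  also have "\<dots> = (\<Oplus>\<^bsub>K\<^esub>i\<in>{..<16}. co x i \<otimes>\<^bsub>K\<^esub> (\<Oplus>\<^bsub>K\<^esub>j\<in>{..<16}. co y j \<otimes>\<^bsub>K\<^esub> consts_of b i j k))"
  proof (rule K.finsum_eqI)
    fix i assume "i \<in> {..<16::nat}"
    then have i: "i < 16" by simp
    have "co (b (e i) y) k = (\<Oplus>\<^bsub>K\<^esub>j\<in>{..<16}. co y j \<otimes>\<^bsub>K\<^esub> co (b (e i) (e j)) k)"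
      by (rule co_linear[OF bilinear_linear(1)[OF b e_carrier[OF i]] y])
    also have "\<dots> = (\<Oplus>\<^bsub>K\<^esub>j\<in>{..<16}. co y j \<otimes>\<^bsub>K\<^esub> consts_of b i j k)"
      using i y bilinear_closed[OF b] by (intro K.finsum_eqI) (simp_all add: consts_of_def co_carrier e_carrier)
    finally show "co x i \<otimes>\<^bsub>K\<^esub> co (b (e i) y) k = co x i \<otimes>\<^bsub>K\<^esub> (\<Oplus>\<^bsub>K\<^esub>j\<in>{..<16}. co y j \<otimes>\<^bsub>K\<^esub> consts_of b i j k)" by simp
  qed (use x y sconsts_carrier[OF consts_of_sconsts[OF b]] in \<open>simp add: co_carrier\<close>)
  finally show "co (b x y) k = mulv K (consts_of b) (co x) (co y) k" by (simp add: mulv_def bil_def)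
qed

text \<open>The unit and associativity conditions are those of A in coordinates. For the pairing,
  nondegeneracy of h makes its Gram matrix injective on vectors, and hence invertible over the
  field.\<close>

lemma sc_X_pts: "sc \<in> X_pts K"
proof -
  have s: "sc \<in> sconsts K" unfolding sc_consts_of by (rule consts_of_sconsts[OF bilinear_mult])
  have m: "mulv K sc (co x) (co y) = co (x \<otimes> y)" if "x \<in> carrier A" "y \<in> carrier A" for x y
    unfolding sc_consts_of by (rule co_bilinear[OF bilinear_mult that, symmetric])
  have "unit_consts K sc"
    unfolding unit_consts_def
  proof (intro allI)
    fix j k
    show "sc 0 j k = mat_one K j k \<and> sc j 0 k = mat_one K j k"
    proof (cases "j < 16")
      case True
      then show ?thesis by (simp add: sc_eq e_0 e_carrier co_e)
    next
      case False
      then show ?thesis by (simp add: struct_consts_def mat_one_def)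
    qed
  qed
  moreover have "assoc_consts K sc"
    unfolding K.assoc_consts_iff[OF s]
    by (simp add: sc_eq e_carrier m A.m_assoc flip: co_e)
  moreover have "\<exists>h. frob_form K sc h"
  proof -
    obtain h where h: "frobenius_pairing K A gr h" using frob by (auto simp: frobenius_algebra4_def)
    note H = h[unfolded frobenius_pairing_def]
    have hc: "h a b \<in> carrier K" if "a \<in> carrier A" "b \<in> carrier A" for a b
      using H that by simp
    have hadd: "h (a \<oplus> b) c = h a c \<oplus>\<^bsub>K\<^esub> h b c" "h a (b \<oplus> c) = h a b \<oplus>\<^bsub>K\<^esub> h a c"
      if "a \<in> carrier A" "b \<in> carrier A" "c \<in> carrier A" for a b c
      using H[THEN conjunct2, THEN conjunct1] that by blast+
    have hsm: "h (k \<odot> a) b = k \<otimes>\<^bsub>K\<^esub> h a b" "h a (k \<odot> b) = k \<otimes>\<^bsub>K\<^esub> h a b"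
      if "k \<in> carrier K" "a \<in> carrier A" "b \<in> carrier A" for k a b
      using H[THEN conjunct2, THEN conjunct2, THEN conjunct1] that by blast+
    have hnd: "b = \<zero>" if "b \<in> carrier A" "\<And>a. a \<in> carrier A \<Longrightarrow> h a b = \<zero>\<^bsub>K\<^esub>" for b
      using H[THEN conjunct2, THEN conjunct2, THEN conjunct2, THEN conjunct2, THEN conjunct1] that by blast
    have hdeg: "h a b = \<zero>\<^bsub>K\<^esub>" if "i + j \<noteq> 4" "a \<in> gr i" "b \<in> gr j" for i j a b
      using H[THEN conjunct2, THEN conjunct2, THEN conjunct2, THEN conjunct2, THEN conjunct2, THEN conjunct1] that by blast
    have hfr: "h a (b \<otimes> c) = h (a \<otimes> b) c" if "a \<in> carrier A" "b \<in> carrier A" "c \<in> carrier A" for a b c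
      using H[THEN conjunct2, THEN conjunct2, THEN conjunct2, THEN conjunct2, THEN conjunct2, THEN conjunct2] that by blast
    define G where "G = (\<lambda>i j. if i < 16 \<and> j < 16 then h (e i) (e j) else \<zero>\<^bsub>K\<^esub>)"
    have G: "G \<in> mats K" by (rule matsI) (auto simp: G_def hc e_carrier)
    note expand = functional_expand
    have hl: "h (e i) b = (\<Oplus>\<^bsub>K\<^esub>k\<in>{..<16}. co b k \<otimes>\<^bsub>K\<^esub> G i k)" if "i < 16" "b \<in> carrier A" for i b
      by (subst expand[of "h (e i)"]) (use that in \<open>auto simp: hc hadd hsm e_carrier G_def co_carrier intro!: K.finsum_eqI\<close>)
    have hr: "h b (e i) = (\<Oplus>\<^bsub>K\<^esub>k\<in>{..<16}. co b k \<otimes>\<^bsub>K\<^esub> G k i)" if "i < 16" "b \<in> carrier A" for i b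
      by (subst expand[of "\<lambda>b. h b (e i)"]) (use that in \<open>auto simp: hc hadd hsm e_carrier G_def co_carrier intro!: K.finsum_eqI\<close>)
    have "\<exists>k. mat_inverse K G k"
    proof (rule K.mat_inverse_exists[OF G])
      fix x assume x: "x \<in> vecs K" and z: "\<And>i. mat_vec K G x i = \<zero>\<^bsub>K\<^esub>"
      have "h (e i) (vec x) = \<zero>\<^bsub>K\<^esub>" if "i < 16" for i
      proof -
        have "h (e i) (vec x) = (\<Oplus>\<^bsub>K\<^esub>k\<in>{..<16}. x k \<otimes>\<^bsub>K\<^esub> G i k)"
          using hl[OF that vec_carrier[OF x]] by (simp add: co_vec[OF x])
        also have "\<dots> = mat_vec K G x i"
          unfolding mat_vec_def using x G by (intro K.finsum_eqI) (simp_all add: K.m_comm)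
        finally show ?thesis using z by simp
      qed
      then have "h a (vec x) = \<zero>\<^bsub>K\<^esub>" if "a \<in> carrier A" for a
        by (subst expand[of "\<lambda>a. h a (vec x)"]) (use that x in \<open>auto simp: hc hadd hsm e_carrier vec_carrier co_carrier intro!: K.finsum_zeroI\<close>)
      then have "vec x = \<zero>" using hnd vec_carrier[OF x] by blast
      then show "x = (\<lambda>_. \<zero>\<^bsub>K\<^esub>)" using co_vec[OF x] co_zero by (metis ext)
    qed
    moreover have "G i j = \<zero>\<^bsub>K\<^esub>" if "bdeg i + bdeg j \<noteq> 4" for i j
      using hdeg[OF that] e_gr by (simp add: G_def)
    moreover have "(\<Oplus>\<^bsub>K\<^esub>k\<in>{..<16}. sc j l k \<otimes>\<^bsub>K\<^esub> G i k) = (\<Oplus>\<^bsub>K\<^esub>k\<in>{..<16}. sc i j k \<otimes>\<^bsub>K\<^esub> G k l)"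
      if "i < 16" "j < 16" "l < 16" for i j l
      using hfr[of "e i" "e j" "e l"] that by (simp add: sc_eq e_carrier flip: hl hr)
    ultimately show ?thesis using G by (auto simp: frob_form_def)
  qed
  ultimately show ?thesis using s by (simp add: X_pts_iff)
qed

end

section \<open>Structure constants over the dual numbers\<close>

text \<open>The structure constants c + \<epsilon> t; \<open>pairv\<close> and \<open>pairm\<close>
  do the same for vectors and matrices.\<close>

definition pairc :: "'k sconst \<Rightarrow> 'k sconst \<Rightarrow> ('k \<times> 'k) sconst" where
  "pairc c t = (\<lambda>i j k. (c i j k, t i j k))"

definition pairv :: "(nat \<Rightarrow> 'k) \<Rightarrow> (nat \<Rightarrow> 'k) \<Rightarrow> nat \<Rightarrow> 'k \<times> 'k" where
  "pairv x y = (\<lambda>k. (x k, y k))"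

definition pairm :: "'k mat \<Rightarrow> 'k mat \<Rightarrow> ('k \<times> 'k) mat" where
  "pairm g s = (\<lambda>i j. (g i j, s i j))"

lemma pairc_apply: "pairc c t i j = pairv (c i j) (t i j)"
  by (simp add: pairc_def pairv_def)

lemma pairv_eq_iff: "pairv x y = pairv x' y' \<longleftrightarrow> x = x' \<and> y = y'"
  by (auto simp: pairv_def fun_eq_iff)

lemma pairv_eq_pointwise: "pairv x y = pairv x' y' \<longleftrightarrow> x = x' \<and> (\<forall>k. y k = y' k)"
  by (auto simp: pairv_def fun_eq_iff)

lemma all_conj_distrib3: "(\<forall>i<n. \<forall>j<n. \<forall>l<n. P i j l \<and> (\<forall>m. Q i j l m)) \<longleftrightarrow>
    (\<forall>i<n. \<forall>j<n. \<forall>l<n. P i j l) \<and> (\<forall>i<n. \<forall>j<n. \<forall>l<n. \<forall>m. Q i j l m)" for n :: nat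
  by blast

lemma sconst_map_pairc: "sconst_map fst (pairc c t) = c"
  by (simp add: sconst_map_def pairc_def)

lemma pairc_surj: "sconst_map fst c = d \<Longrightarrow> c = pairc d (sconst_map snd c)"
  by (auto simp: sconst_map_def pairc_def)

lemma col_pairm: "col (pairm g s) i = pairv (col g i) (col s i)"
  by (simp add: col_def pairm_def pairv_def)

context cring
begin

abbreviation "DR \<equiv> dual_numbers R"

lemma dual_finsum:
  assumes "finite I" "\<And>i. i \<in> I \<Longrightarrow> f i \<in> carrier R" "\<And>i. i \<in> I \<Longrightarrow> g i \<in> carrier R"
  shows "(\<Oplus>\<^bsub>DR\<^esub>i\<in>I. (f i, g i)) = ((\<Oplus>i\<in>I. f i), (\<Oplus>i\<in>I. g i))"
proof -
  interpret D: cring DR by (rule dual_numbers_cring)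
  show ?thesis
    using assms
  proof (induction I rule: finite_induct)
    case (insert i I)
    have "(\<Oplus>\<^bsub>DR\<^esub>i\<in>insert i I. (f i, g i)) = (f i, g i) \<oplus>\<^bsub>DR\<^esub> (\<Oplus>\<^bsub>DR\<^esub>i\<in>I. (f i, g i))"
      using insert by (intro D.finsum_insert) auto
    moreover have "(\<Oplus>i\<in>insert i I. f i) = f i \<oplus> (\<Oplus>i\<in>I. f i)" "(\<Oplus>i\<in>insert i I. g i) = g i \<oplus> (\<Oplus>i\<in>I. g i)"
      using insert by (intro finsum_insert; auto)+
    ultimately show ?case using insert by simp
  qed simp
qed

lemma pairm_mats: "g \<in> mats R \<Longrightarrow> s \<in> mats R \<Longrightarrow> pairm g s \<in> mats DR"
  by (rule matsI) (auto simp: pairm_def mats_outside)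

lemma pairc_sconsts: "c \<in> sconsts R \<Longrightarrow> t \<in> sconsts R \<Longrightarrow> pairc c t \<in> sconsts DR"
  by (rule sconstsI) (auto simp: pairc_def sconsts_carrier sconsts_outside sconsts_bdeg)

lemma zero_vecs: "(\<lambda>_. \<zero>) \<in> vecs R"
  by (rule vecsI) simp_all

lemma mat_one_dual: "mat_one DR i = pairv (mat_one R i) (\<lambda>_. \<zero>)"
  by (rule ext) (simp add: mat_one_def pairv_def)

lemma mat_vec_pair:
  assumes "g \<in> mats R" "s \<in> mats R" "x \<in> vecs R" "y \<in> vecs R"
  shows "mat_vec DR (pairm g s) (pairv x y) = pairv (mat_vec R g x) (\<lambda>k. mat_vec R g y k \<oplus> mat_vec R s x k)"
proof
  fix k
  have "mat_vec DR (pairm g s) (pairv x y) k = (\<Oplus>\<^bsub>DR\<^esub>i\<in>{..<16}. (g k i \<otimes> x i, g k i \<otimes> y i \<oplus> s k i \<otimes> x i))"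
    by (simp add: mat_vec_def pairm_def pairv_def)
  also have "\<dots> = ((\<Oplus>i\<in>{..<16}. g k i \<otimes> x i), (\<Oplus>i\<in>{..<16}. g k i \<otimes> y i \<oplus> s k i \<otimes> x i))"
    using assms by (intro dual_finsum) simp_all
  also have "\<dots> = pairv (mat_vec R g x) (\<lambda>k. mat_vec R g y k \<oplus> mat_vec R s x k) k"
    using assms by (simp add: pairv_def mat_vec_def finsum_addf)
  finally show "mat_vec DR (pairm g s) (pairv x y) k = pairv (mat_vec R g x) (\<lambda>k. mat_vec R g y k \<oplus> mat_vec R s x k) k" .
qed

text \<open>The \<epsilon>-part follows the Leibniz rule for three factors: the constants, the left
  argument and the right argument.\<close>

lemma mulv_pair:
  assumes c: "c \<in> sconsts R" and t: "t \<in> sconsts R"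
    and v: "x \<in> vecs R" "x' \<in> vecs R" "y \<in> vecs R" "y' \<in> vecs R"
  shows "mulv DR (pairc c t) (pairv x x') (pairv y y') =
    pairv (mulv R c x y) (\<lambda>k. mulv R t x y k \<oplus> mulv R c x y' k \<oplus> mulv R c x' y k)"
proof
  fix k
  note cl = sconsts_carrier[OF c] sconsts_carrier[OF t] vecs_carrier[OF v(1)] vecs_carrier[OF v(2)]
    vecs_carrier[OF v(3)] vecs_carrier[OF v(4)]
  have inner: "(\<Oplus>\<^bsub>DR\<^esub>q\<in>{..<16}. pairv y y' q \<otimes>\<^bsub>DR\<^esub> pairc c t p q k) =
      ((\<Oplus>q\<in>{..<16}. y q \<otimes> c p q k), (\<Oplus>q\<in>{..<16}. y q \<otimes> t p q k) \<oplus> (\<Oplus>q\<in>{..<16}. y' q \<otimes> c p q k))" for p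
  proof -
    have "(\<Oplus>\<^bsub>DR\<^esub>q\<in>{..<16}. pairv y y' q \<otimes>\<^bsub>DR\<^esub> pairc c t p q k) =
        (\<Oplus>\<^bsub>DR\<^esub>q\<in>{..<16}. (y q \<otimes> c p q k, y q \<otimes> t p q k \<oplus> y' q \<otimes> c p q k))"
      by (simp add: pairv_def pairc_def)
    also have "\<dots> = ((\<Oplus>q\<in>{..<16}. y q \<otimes> c p q k), (\<Oplus>q\<in>{..<16}. y q \<otimes> t p q k \<oplus> y' q \<otimes> c p q k))"
      by (intro dual_finsum) (simp_all add: cl)
    finally show ?thesis by (simp add: finsum_addf cl)
  qed
  let ?u = "\<lambda>p. \<Oplus>q\<in>{..<16}. y q \<otimes> c p q k" and ?v = "\<lambda>p. \<Oplus>q\<in>{..<16}. y q \<otimes> t p q k"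
    and ?w = "\<lambda>p. \<Oplus>q\<in>{..<16}. y' q \<otimes> c p q k"
  have uvw: "?u p \<in> carrier R" "?v p \<in> carrier R" "?w p \<in> carrier R" for p by (simp_all add: cl)
  have "mulv DR (pairc c t) (pairv x x') (pairv y y') k =
      (\<Oplus>\<^bsub>DR\<^esub>p\<in>{..<16}. (x p \<otimes> ?u p, x p \<otimes> (?v p \<oplus> ?w p) \<oplus> x' p \<otimes> ?u p))"
    unfolding mulv_def bil_def inner by (simp add: pairv_def)
  also have "\<dots> = ((\<Oplus>p\<in>{..<16}. x p \<otimes> ?u p), (\<Oplus>p\<in>{..<16}. x p \<otimes> (?v p \<oplus> ?w p) \<oplus> x' p \<otimes> ?u p))"
    using uvw by (intro dual_finsum) (simp_all add: cl)
  also have "(\<Oplus>p\<in>{..<16}. x p \<otimes> (?v p \<oplus> ?w p) \<oplus> x' p \<otimes> ?u p) =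
      (\<Oplus>p\<in>{..<16}. (x p \<otimes> ?v p \<oplus> x p \<otimes> ?w p) \<oplus> x' p \<otimes> ?u p)"
    using uvw by (intro finsum_eqI) (simp_all add: cl r_distr)
  also have "\<dots> = (\<Oplus>p\<in>{..<16}. x p \<otimes> ?v p \<oplus> x p \<otimes> ?w p) \<oplus> (\<Oplus>p\<in>{..<16}. x' p \<otimes> ?u p)"
    using uvw by (intro finsum_addf) (simp_all add: cl)
  also have "(\<Oplus>p\<in>{..<16}. x p \<otimes> ?v p \<oplus> x p \<otimes> ?w p) = (\<Oplus>p\<in>{..<16}. x p \<otimes> ?v p) \<oplus> (\<Oplus>p\<in>{..<16}. x p \<otimes> ?w p)"
    using uvw by (intro finsum_addf) (simp_all add: cl)
  finally show "mulv DR (pairc c t) (pairv x x') (pairv y y') k =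
    pairv (mulv R c x y) (\<lambda>k. mulv R t x y k \<oplus> mulv R c x y' k \<oplus> mulv R c x' y k) k"
    by (simp add: mulv_def bil_def pairv_def)
qed

lemma mulv_zero:
  assumes "c \<in> sconsts R" "x \<in> vecs R"
  shows "mulv R c x (\<lambda>_. \<zero>) k = \<zero>" "mulv R c (\<lambda>_. \<zero>) x k = \<zero>"
proof -
  show "mulv R c (\<lambda>_. \<zero>) x k = \<zero>"
    unfolding mulv_def bil_def using assms by (intro finsum_zeroI) (simp add: sconsts_carrier)
  have "(\<Oplus>q\<in>{..<16}. \<zero> \<otimes> c p q k) = \<zero>" for p
    using assms by (intro finsum_zeroI) (simp add: sconsts_carrier)
  then show "mulv R c x (\<lambda>_. \<zero>) k = \<zero>"
    unfolding mulv_def bil_def using assms by (intro finsum_zeroI) simp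
qed

lemma dual_square_zero:
  "\<lbrakk>x \<in> carrier DR; y \<in> carrier DR; fst x = \<zero>; fst y = \<zero>\<rbrakk> \<Longrightarrow> x \<otimes>\<^bsub>DR\<^esub> y = \<zero>\<^bsub>DR\<^esub>"
  by (cases x; cases y) simp

lemma dual2_square_zero:
  "\<lbrakk>x \<in> carrier (dual_numbers2 R); y \<in> carrier (dual_numbers2 R); fst x = \<zero>; fst y = \<zero>\<rbrakk>
    \<Longrightarrow> x \<otimes>\<^bsub>dual_numbers2 R\<^esub> y = \<zero>\<^bsub>dual_numbers2 R\<^esub>"
  by (cases x; cases y) auto

text \<open>The constant part is associativity of c. In the \<epsilon>-part t replaces either the
  outer or the inner product on each side, which is the cocycle condition on basis vectors.\<close>

lemma assoc_consts_pairc: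
  assumes c: "c \<in> sconsts R" and t: "t \<in> sconsts R"
  shows "assoc_consts DR (pairc c t) \<longleftrightarrow> assoc_consts R c \<and>
    (\<forall>i<16. \<forall>j<16. \<forall>l<16. \<forall>m. mulv R t (c i j) (mat_one R l) m \<oplus> mulv R c (t i j) (mat_one R l) m =
       mulv R t (mat_one R i) (c j l) m \<oplus> mulv R c (mat_one R i) (t j l) m)"
proof -
  interpret D: cring DR by (rule dual_numbers_cring)
  have v: "c i j \<in> vecs R" "t i j \<in> vecs R" for i j using c t by (simp_all add: sconsts_vecs)
  have cl: "mulv R d x y m \<in> carrier R" if "d \<in> sconsts R" "x \<in> vecs R" "y \<in> vecs R" for d x y m
    using vecs_carrier[OF mulv_vecs[OF that]] .
  have 1: "mulv DR (pairc c t) (pairc c t i j) (mat_one DR l) =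
      pairv (mulv R c (c i j) (mat_one R l)) (\<lambda>m. mulv R t (c i j) (mat_one R l) m \<oplus> mulv R c (t i j) (mat_one R l) m)" for i j l
    unfolding pairc_apply mat_one_dual mulv_pair[OF c t v mat_one_vecs zero_vecs]
    using c t v by (simp add: mulv_zero cl)
  have 2: "mulv DR (pairc c t) (mat_one DR i) (pairc c t j l) =
      pairv (mulv R c (mat_one R i) (c j l)) (\<lambda>m. mulv R t (mat_one R i) (c j l) m \<oplus> mulv R c (mat_one R i) (t j l) m)" for i j l
    unfolding pairc_apply mat_one_dual mulv_pair[OF c t mat_one_vecs zero_vecs v]
    using c t v by (simp add: mulv_zero cl)
  show ?thesis
    unfolding D.assoc_consts_iff[OF pairc_sconsts[OF c t]] assoc_consts_iff[OF c] 1 2 pairv_eq_pointwise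
    by (rule all_conj_distrib3)
qed

text \<open>A pairing for c + \<epsilon> t is supplied by \<open>lift_X_pts\<close>, so what remains
  are the \<epsilon>-parts of the unit law and of associativity.\<close>

lemma pairc_X_pts_iff:
  assumes c: "c \<in> X_pts R" and t: "t \<in> sconsts R"
  shows "pairc c t \<in> X_pts DR \<longleftrightarrow> (\<forall>j k. t 0 j k = \<zero> \<and> t j 0 k = \<zero>) \<and>
    (\<forall>i<16. \<forall>j<16. \<forall>l<16. \<forall>m. mulv R t (c i j) (mat_one R l) m \<oplus> mulv R c (t i j) (mat_one R l) m =
       mulv R t (mat_one R i) (c j l) m \<oplus> mulv R c (mat_one R i) (t j l) m)"
    (is "_ \<longleftrightarrow> ?u \<and> ?a")
proof -
  have c': "c \<in> sconsts R" "unit_consts R c" "assoc_consts R c" using c by (simp_all add: X_pts_iff)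
  have one: "mat_one DR j k = (mat_one R j k, \<zero>)" for j k by (simp add: mat_one_def)
  have c0: "c 0 j k = mat_one R j k" "c j 0 k = mat_one R j k" for j k
    using c'(2) unfolding unit_consts_def by blast+
  have u: "unit_consts DR (pairc c t) \<longleftrightarrow> ?u"
    by (simp only: unit_consts_def pairc_def one c0 prod.inject simp_thms)
  have a: "assoc_consts DR (pairc c t) \<longleftrightarrow> ?a"
    unfolding assoc_consts_pairc[OF c'(1) t] by (simp only: c'(3) simp_thms)
  show ?thesis
    unfolding u[symmetric] a[symmetric]
  proof
    assume *: "unit_consts DR (pairc c t) \<and> assoc_consts DR (pairc c t)"
    show "pairc c t \<in> X_pts DR"
    proof (rule lift_X_pts[OF dual_numbers_cring cring_axioms dual_numbers_homs(1,2) _ dual_square_zero pairc_sconsts[OF c'(1) t]])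
      show "sconst_map fst (pairc c t) \<in> X_pts R" using c by (simp only: sconst_map_pairc)
    qed (use * in simp_all)
  qed (simp add: X_pts_iff)
qed

lemma X_act_pairc_iff:
  assumes g: "pairm g s \<in> G_pts DR" and gs: "g \<in> mats R" "s \<in> mats R"
    and c: "c \<in> sconsts R" "t \<in> sconsts R" "c' \<in> sconsts R" "t' \<in> sconsts R"
  shows "X_act DR (pairm g s) (pairc c t) = pairc c' t' \<longleftrightarrow> (\<forall>i<16. \<forall>j<16.
     mat_vec R g (c i j) = mulv R c' (col g i) (col g j) \<and>
     (\<forall>k. mat_vec R g (t i j) k \<oplus> mat_vec R s (c i j) k =
        mulv R t' (col g i) (col g j) k \<oplus> mulv R c' (col g i) (col s j) k \<oplus> mulv R c' (col s i) (col g j) k))"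
proof -
  interpret D: cring DR by (rule dual_numbers_cring)
  show ?thesis
    unfolding D.X_act_eq_iff[OF g pairc_sconsts[OF c(1,2)] pairc_sconsts[OF c(3,4)]] pairc_apply[of c t] col_pairm
    using c gs by (simp add: mat_vec_pair mulv_pair sconsts_vecs pairv_eq_iff) (simp add: fun_eq_iff)
qed

text \<open>The matrix reduces to 1 modulo \<epsilon>, so it is invertible by
  \<open>lift_mat_inverse\<close>. The vanishing of \<open>s 0 0\<close> keeps the degree-0 block
  equal to 1.\<close>

lemma G_pts_one_plus:
  assumes s: "s \<in> mats R" and d: "\<And>i j. bdeg i \<noteq> bdeg j \<Longrightarrow> s i j = \<zero>" and s0: "s 0 0 = \<zero>"
  shows "pairm (mat_one R) s \<in> G_pts DR"
proof -
  interpret D: cring DR by (rule dual_numbers_cring)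
  have m: "pairm (mat_one R) s \<in> mats DR" using s by (simp add: pairm_mats)
  have "mat_map fst (pairm (mat_one R) s) = mat_one R" by (simp add: mat_map_def pairm_def)
  then have i: "mat_inverse R (mat_map fst (pairm (mat_one R) s)) (mat_one R)" by (simp only: mat_inverse_one)
  have "\<exists>k. mat_inverse DR (pairm (mat_one R) s) k"
    by (rule lift_mat_inverse[OF dual_numbers_cring cring_axioms dual_numbers_homs(1,2) _ dual_square_zero m i]) simp_all
  then obtain k where k: "mat_inverse DR (pairm (mat_one R) s) k" ..
  show ?thesis
  proof (rule D.G_ptsI[OF m _ _ k])
    fix i j assume ij: "bdeg i \<noteq> bdeg j"
    then have "mat_one R i j = \<zero>" by (auto simp: mat_one_def)
    then show "pairm (mat_one R) s i j = \<zero>\<^bsub>DR\<^esub>" using d[OF ij] by (simp add: pairm_def)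
  next
    show "pairm (mat_one R) s 0 0 = \<one>\<^bsub>DR\<^esub>" using s0 by (simp add: pairm_def mat_one_def)
  qed
qed

definition triplec :: "'a sconst \<Rightarrow> 'a sconst \<Rightarrow> 'a sconst \<Rightarrow> ('a \<times> 'a \<times> 'a) sconst" where
  "triplec c t t' = (\<lambda>i j k. (c i j k, t i j k, t' i j k))"

text \<open>An equation in the two-variable ring holds as soon as it holds under both projections to
  the dual numbers. This settles associativity, and \<open>lift_X_pts\<close> supplies the
  pairing.\<close>

lemma triplec_X_pts:
  assumes c: "c \<in> X_pts R" and t: "t \<in> sconsts R" "t' \<in> sconsts R"
    and X: "pairc c t \<in> X_pts DR" "pairc c t' \<in> X_pts DR"
  shows "triplec c t t' \<in> X_pts (dual_numbers2 R)"
proof (rule lift_X_pts[OF dual_numbers2_cring cring_axioms dual_numbers2_homs(1,2) _ dual2_square_zero])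
  let ?D = "dual_numbers2 R" and ?c = "triplec c t t'"
  have cs: "c \<in> sconsts R" using c by simp
  show s: "?c \<in> sconsts ?D"
    using cs t by (intro sconstsI) (auto simp: triplec_def sconsts_carrier sconsts_outside sconsts_bdeg)
  have u: "unit_consts DR (pairc c t)" "unit_consts DR (pairc c t')" using X by (simp_all add: X_pts_iff)
  have one: "mat_one ?D j k = (mat_one R j k, \<zero>, \<zero>)" for j k by (simp add: mat_one_def)
  show "unit_consts ?D ?c"
    using u by (simp add: unit_consts_def one triplec_def pairc_def mat_one_dual pairv_def)
  interpret D: cring ?D by (rule dual_numbers2_cring)
  interpret p: ring_hom_cring ?D DR "\<lambda>(a, b, c). (a, b)"
    by (rule ring_hom_cringI2[OF dual_numbers2_cring dual_numbers_cring dual_numbers2_homs(3)])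
  interpret q: ring_hom_cring ?D DR "\<lambda>(a, b, c). (a, c)"
    by (rule ring_hom_cringI2[OF dual_numbers2_cring dual_numbers_cring dual_numbers2_homs(4)])
  have m: "sconst_map (\<lambda>(a, b, c). (a, b)) ?c = pairc c t" "sconst_map (\<lambda>(a, b, c). (a, c)) ?c = pairc c t'"
    by (simp_all add: sconst_map_def triplec_def pairc_def)
  have a: "assoc_consts DR (pairc c t)" "assoc_consts DR (pairc c t')" using X by (simp_all add: X_pts_iff)
  show "assoc_consts ?D ?c"
    unfolding assoc_consts_def
  proof (intro allI impI)
    fix i j l n :: nat assume ijln: "i < 16" "j < 16" "l < 16" "n < 16"
    define x where "x = (\<Oplus>\<^bsub>?D\<^esub>k\<in>{..<16}. ?c i j k \<otimes>\<^bsub>?D\<^esub> ?c k l n)"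
    define y where "y = (\<Oplus>\<^bsub>?D\<^esub>k\<in>{..<16}. ?c j l k \<otimes>\<^bsub>?D\<^esub> ?c i k n)"
    have xy: "x \<in> carrier ?D" "y \<in> carrier ?D"
      unfolding x_def y_def by (intro D.finsum_closed funcsetI D.m_closed sconsts_carrier[OF s])+
    have "(\<lambda>(a, b, c). (a, b)) x = (\<lambda>(a, b, c). (a, b)) y"
    proof -
      have "(\<lambda>(a, b, c). (a, b)) x = (\<Oplus>\<^bsub>DR\<^esub>k\<in>{..<16}. sconst_map (\<lambda>(a, b, c). (a, b)) ?c i j k \<otimes>\<^bsub>DR\<^esub> sconst_map (\<lambda>(a, b, c). (a, b)) ?c k l n)"
        unfolding x_def sconst_map_def
        by (subst p.hom_finsum) (simp_all add: Pi_def comp_def sconsts_carrier[OF s] del: dual_numbers2_simps)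
      also have "\<dots> = (\<Oplus>\<^bsub>DR\<^esub>k\<in>{..<16}. sconst_map (\<lambda>(a, b, c). (a, b)) ?c j l k \<otimes>\<^bsub>DR\<^esub> sconst_map (\<lambda>(a, b, c). (a, b)) ?c i k n)"
        unfolding m using a(1) ijln by (simp add: assoc_consts_def)
      also have "\<dots> = (\<lambda>(a, b, c). (a, b)) y"
        unfolding y_def sconst_map_def
        by (subst p.hom_finsum) (simp_all add: Pi_def comp_def sconsts_carrier[OF s] del: dual_numbers2_simps)
      finally show ?thesis .
    qed
    moreover have "(\<lambda>(a, b, c). (a, c)) x = (\<lambda>(a, b, c). (a, c)) y"
    proof -
      have "(\<lambda>(a, b, c). (a, c)) x = (\<Oplus>\<^bsub>DR\<^esub>k\<in>{..<16}. sconst_map (\<lambda>(a, b, c). (a, c)) ?c i j k \<otimes>\<^bsub>DR\<^esub> sconst_map (\<lambda>(a, b, c). (a, c)) ?c k l n)"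
        unfolding x_def sconst_map_def
        by (subst q.hom_finsum) (simp_all add: Pi_def comp_def sconsts_carrier[OF s] del: dual_numbers2_simps)
      also have "\<dots> = (\<Oplus>\<^bsub>DR\<^esub>k\<in>{..<16}. sconst_map (\<lambda>(a, b, c). (a, c)) ?c j l k \<otimes>\<^bsub>DR\<^esub> sconst_map (\<lambda>(a, b, c). (a, c)) ?c i k n)"
        unfolding m using a(2) ijln by (simp add: assoc_consts_def)
      also have "\<dots> = (\<lambda>(a, b, c). (a, c)) y"
        unfolding y_def sconst_map_def
        by (subst q.hom_finsum) (simp_all add: Pi_def comp_def sconsts_carrier[OF s] del: dual_numbers2_simps)
      finally show ?thesis .
    qed
    ultimately have "x = y" by (cases x; cases y) simp
    then show "(\<Oplus>\<^bsub>?D\<^esub>k\<in>{..<16}. ?c i j k \<otimes>\<^bsub>?D\<^esub> ?c k l n) = (\<Oplus>\<^bsub>?D\<^esub>k\<in>{..<16}. ?c j l k \<otimes>\<^bsub>?D\<^esub> ?c i k n)"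
      by (simp add: x_def y_def)
  qed
  show "sconst_map fst ?c \<in> X_pts R" using c by (simp add: sconst_map_def triplec_def)
qed simp

end

context cring
begin

lemma linear_form_add:
  assumes L: "linear_form R L" and x: "x \<in> vecs R" and y: "y \<in> vecs R" and z: "\<And>k. z k = x k \<oplus> y k"
  shows "L z = L x \<oplus> L y"
proof -
  have zv: "z \<in> vecs R" using x y by (intro vecsI) (simp_all add: z vecs_outside)
  have c: "L (mat_one R i) \<in> carrier R" for i by (rule linear_form_closed[OF L]) simp
  have "L z = (\<Oplus>i\<in>{..<16}. x i \<otimes> L (mat_one R i) \<oplus> y i \<otimes> L (mat_one R i))"
    unfolding linear_form_expand[OF L zv] using x y c by (intro finsum_eqI) (simp_all add: z l_distr)
  also have "\<dots> = L x \<oplus> L y"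
    unfolding linear_form_expand[OF L x] linear_form_expand[OF L y] using x y c by (intro finsum_addf) simp_all
  finally show ?thesis .
qed

lemma linear_form_smult:
  assumes L: "linear_form R L" and x: "x \<in> vecs R" and a: "a \<in> carrier R" and z: "\<And>k. z k = a \<otimes> x k"
  shows "L z = a \<otimes> L x"
proof -
  have zv: "z \<in> vecs R" using x a by (intro vecsI) (simp_all add: z vecs_outside)
  have c: "L (mat_one R i) \<in> carrier R" for i by (rule linear_form_closed[OF L]) simp
  have "L z = (\<Oplus>i\<in>{..<16}. a \<otimes> (x i \<otimes> L (mat_one R i)))"
    unfolding linear_form_expand[OF L zv] using x a c by (intro finsum_eqI) (simp_all add: z m_assoc)
  also have "\<dots> = a \<otimes> L x"
    unfolding linear_form_expand[OF L x] using x a c by (intro finsum_rdistr[symmetric]) simp_all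
  finally show ?thesis .
qed

end

section \<open>Bilinear cocycles, and deformations of the product\<close>

context based_algebra
begin

lemma linear_add: "linear L \<Longrightarrow> linear M \<Longrightarrow> linear (\<lambda>x. L x \<oplus> M x)"
  by (rule linearI) (simp_all add: linear_def A.a_ac M.smult_r_distr)

lemma linear_smult: "k \<in> carrier K \<Longrightarrow> linear L \<Longrightarrow> linear (\<lambda>x. k \<odot> L x)"
  by (rule linearI) (simp_all add: linear_def M.smult_r_distr K.m_comm flip: M.smult_assoc1)

lemma linear_neg: "linear L \<Longrightarrow> linear (\<lambda>x. \<ominus> L x)"
  by (rule linearI) (simp_all add: linear_def A.minus_add M.smult_r_minus)

lemma linear_comp: "linear L \<Longrightarrow> linear M \<Longrightarrow> linear (\<lambda>x. L (M x))"
  by (rule linearI) (simp_all add: linear_def)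

lemma linear_zero: "linear (\<lambda>_. \<zero>)"
  by (rule linearI) simp_all

lemma linear_mult_left: "a \<in> carrier A \<Longrightarrow> linear (\<lambda>x. a \<otimes> x)"
  using bilinear_linear(1)[OF bilinear_mult] .

lemma linear_mult_right: "a \<in> carrier A \<Longrightarrow> linear (\<lambda>x. x \<otimes> a)"
  using bilinear_linear(2)[OF bilinear_mult] .

lemma linear_map_add: "linear L \<Longrightarrow> a \<in> carrier A \<Longrightarrow> b \<in> carrier A \<Longrightarrow> L (a \<oplus> b) = L a \<oplus> L b"
  by (simp add: linear_def)

lemma linear_map_smult: "linear L \<Longrightarrow> k \<in> carrier K \<Longrightarrow> a \<in> carrier A \<Longrightarrow> L (k \<odot> a) = k \<odot> L a"
  by (simp add: linear_def)

lemma bilinearI: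
  "\<lbrakk>\<And>x. x \<in> carrier A \<Longrightarrow> linear (b x); \<And>y. y \<in> carrier A \<Longrightarrow> linear (\<lambda>x. b x y);
    \<And>i j x y. \<lbrakk>x \<in> gr i; y \<in> gr j\<rbrakk> \<Longrightarrow> b x y \<in> gr (i + j)\<rbrakk> \<Longrightarrow> bilinear b"
  unfolding bilinear_def by blast

lemma bilinear_gr: "bilinear b \<Longrightarrow> x \<in> gr i \<Longrightarrow> y \<in> gr j \<Longrightarrow> b x y \<in> gr (i + j)"
  unfolding bilinear_def by blast

lemma bilinear_add: "bilinear b \<Longrightarrow> bilinear c \<Longrightarrow> bilinear (\<lambda>x y. b x y \<oplus> c x y)"
  by (rule bilinearI) (simp_all add: linear_add bilinear_linear bilinear_gr gr_add)

lemma bilinear_smult: "k \<in> carrier K \<Longrightarrow> bilinear b \<Longrightarrow> bilinear (\<lambda>x y. k \<odot> b x y)"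
  by (rule bilinearI) (simp_all add: linear_smult bilinear_linear bilinear_gr gr_smult)

lemma bilinear_zero: "bilinear (\<lambda>_ _. \<zero>)"
  by (rule bilinearI) (simp_all add: linear_zero gr_zero)

lemma bilinear_basis_eqI:
  assumes b: "\<And>x. x \<in> carrier A \<Longrightarrow> linear (b x)" "\<And>y. y \<in> carrier A \<Longrightarrow> linear (\<lambda>x. b x y)"
    and c: "\<And>x. x \<in> carrier A \<Longrightarrow> linear (c x)" "\<And>y. y \<in> carrier A \<Longrightarrow> linear (\<lambda>x. c x y)"
    and eq: "\<And>i j. i < 16 \<Longrightarrow> j < 16 \<Longrightarrow> b (e i) (e j) = c (e i) (e j)" and xy: "x \<in> carrier A" "y \<in> carrier A"
  shows "b x y = c x y"
proof (rule linear_eqI[OF b(2)[OF xy(2)] c(2)[OF xy(2)] _ xy(1)])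
  fix i :: nat assume i: "i < 16"
  show "b (e i) y = c (e i) y"
    by (rule linear_eqI[OF b(1)[OF e_carrier[OF i]] c(1)[OF e_carrier[OF i]] eq[OF i] xy(2)])
qed

text \<open>The Hochschild identity x b(y, z) - b(x y, z) + b(x, y z) - b(x, y) z = 0 with the
  negative terms moved to the other side. In this form it is the \<epsilon>-part of associativity of
  x y + \<epsilon> b(x, y).\<close>

definition bil_cocycle :: "('a \<Rightarrow> 'a \<Rightarrow> 'a) \<Rightarrow> bool" where
  "bil_cocycle b \<longleftrightarrow> (\<forall>x\<in>carrier A. \<forall>y\<in>carrier A. \<forall>z\<in>carrier A.
     b (x \<otimes> y) z \<oplus> b x y \<otimes> z = b x (y \<otimes> z) \<oplus> x \<otimes> b y z)"

lemma bil_cocycleD: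
  "bil_cocycle b \<Longrightarrow> x \<in> carrier A \<Longrightarrow> y \<in> carrier A \<Longrightarrow> z \<in> carrier A \<Longrightarrow>
     b (x \<otimes> y) z \<oplus> b x y \<otimes> z = b x (y \<otimes> z) \<oplus> x \<otimes> b y z"
  unfolding bil_cocycle_def by blast

lemma bil_cocycle_basisI:
  assumes b: "bilinear b"
    and eq: "\<And>i j l. \<lbrakk>i < 16; j < 16; l < 16\<rbrakk> \<Longrightarrow> b (e i \<otimes> e j) (e l) \<oplus> b (e i) (e j) \<otimes> e l =
      b (e i) (e j \<otimes> e l) \<oplus> e i \<otimes> b (e j) (e l)"
  shows "bil_cocycle b"
  unfolding bil_cocycle_def
proof (intro ballI)
  fix x y z assume v: "x \<in> carrier A" "y \<in> carrier A" "z \<in> carrier A"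
  note l1 = bilinear_linear(1)[OF b] and l2 = bilinear_linear(2)[OF b] and cl = bilinear_closed[OF b]
  note ml = linear_mult_left and mr = linear_mult_right
  have Z: "b (e i \<otimes> e j) z \<oplus> b (e i) (e j) \<otimes> z = b (e i) (e j \<otimes> z) \<oplus> e i \<otimes> b (e j) z"
    if ij: "i < 16" "j < 16" for i j
  proof (rule linear_eqI[of "\<lambda>z. b (e i \<otimes> e j) z \<oplus> b (e i) (e j) \<otimes> z"
        "\<lambda>z. b (e i) (e j \<otimes> z) \<oplus> e i \<otimes> b (e j) z"])
    note ec = e_carrier[OF ij(1)] e_carrier[OF ij(2)]
    show "linear (\<lambda>z. b (e i \<otimes> e j) z \<oplus> b (e i) (e j) \<otimes> z)"
      by (rule linear_add[OF l1 ml]) (use ec cl in simp_all)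
    show "linear (\<lambda>z. b (e i) (e j \<otimes> z) \<oplus> e i \<otimes> b (e j) z)"
      by (rule linear_add[OF linear_comp[OF l1 ml] linear_comp[OF ml l1]]) (use ec in simp_all)
  qed (use eq ij v in simp_all)
  show "b (x \<otimes> y) z \<oplus> b x y \<otimes> z = b x (y \<otimes> z) \<oplus> x \<otimes> b y z"
  proof (rule bilinear_basis_eqI[of "\<lambda>x y. b (x \<otimes> y) z \<oplus> b x y \<otimes> z" "\<lambda>x y. b x (y \<otimes> z) \<oplus> x \<otimes> b y z"])
    fix w assume w: "w \<in> carrier A"
    show "linear (\<lambda>y. b (w \<otimes> y) z \<oplus> b w y \<otimes> z)"
      by (rule linear_add[OF linear_comp[OF l2 ml] linear_comp[OF mr l1]]) (use w v in simp_all)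
    show "linear (\<lambda>x. b (x \<otimes> w) z \<oplus> b x w \<otimes> z)"
      by (rule linear_add[OF linear_comp[OF l2 mr] linear_comp[OF mr l2]]) (use w v in simp_all)
    show "linear (\<lambda>y. b w (y \<otimes> z) \<oplus> w \<otimes> b y z)"
      by (rule linear_add[OF linear_comp[OF l1 mr] linear_comp[OF ml l2]]) (use w v in simp_all)
    show "linear (\<lambda>x. b x (w \<otimes> z) \<oplus> x \<otimes> b w z)"
      by (rule linear_add[OF l2 mr]) (use w v cl in simp_all)
  qed (use Z v in simp_all)
qed

text \<open>The cocycle identity at (1, 1, x) and at (x, 1, 1) amounts to b(1, x) = b(1, 1) x and
  b(x, 1) = x b(1, 1).\<close>

lemma bil_cocycle_normalized:
  assumes b: "bilinear b" and c: "bil_cocycle b" and n: "b \<one> \<one> = \<zero>" and x: "x \<in> carrier A"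
  shows "b \<one> x = \<zero>" "b x \<one> = \<zero>"
proof -
  note cl = bilinear_closed[OF b]
  have "b \<one> x = b \<one> x \<oplus> b \<one> x"
    using bil_cocycleD[OF c, of "\<one>" "\<one>" x] x n cl by simp
  then show "b \<one> x = \<zero>" using cl[OF A.one_closed x] A.add.r_cancel_one' by metis
  have "b x \<one> \<oplus> b x \<one> = b x \<one>"
    using bil_cocycleD[OF c, of x "\<one>" "\<one>"] x n cl by simp
  then show "b x \<one> = \<zero>" using cl[OF x A.one_closed] A.add.r_cancel_one' by metis
qed

lemma sc_sconsts: "sc \<in> sconsts K"
  using sc_X_pts by simp

lemma mulv_sc: "x \<in> carrier A \<Longrightarrow> y \<in> carrier A \<Longrightarrow> mulv K sc (co x) (co y) = co (x \<otimes> y)"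
  unfolding sc_consts_of by (rule co_bilinear[OF bilinear_mult, symmetric])

lemma mulv_consts_of: "bilinear b \<Longrightarrow> x \<in> carrier A \<Longrightarrow> y \<in> carrier A \<Longrightarrow> mulv K (consts_of b) (co x) (co y) = co (b x y)"
  by (rule co_bilinear[symmetric])

lemma consts_of_eq: "i < 16 \<Longrightarrow> j < 16 \<Longrightarrow> consts_of b i j = co (b (e i) (e j))"
  by (rule ext) (simp add: consts_of_def)

lemma co_eq_iff: "a \<in> carrier A \<Longrightarrow> b \<in> carrier A \<Longrightarrow> (\<forall>k. co a k = co b k) \<longleftrightarrow> a = b"
  using co_eqI by blast

text \<open>The conditions of \<open>pairc_X_pts_iff\<close> are translated from coordinates to A.
  The unit condition asks that b vanish whenever one argument is 1, which for a cocycle comes down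
  to the value at (1, 1).\<close>

lemma deformation_iff:
  assumes b: "bilinear b"
  shows "pairc sc (consts_of b) \<in> X_pts (dual_numbers K) \<longleftrightarrow> bil_cocycle b \<and> b \<one> \<one> = \<zero>"
proof -
  note cl = bilinear_closed[OF b]
  let ?t = "consts_of b"
  have eq: "(\<forall>m. mulv K ?t (sc i j) (mat_one K l) m \<oplus>\<^bsub>K\<^esub> mulv K sc (?t i j) (mat_one K l) m =
       mulv K ?t (mat_one K i) (sc j l) m \<oplus>\<^bsub>K\<^esub> mulv K sc (mat_one K i) (?t j l) m) \<longleftrightarrow>
     b (e i \<otimes> e j) (e l) \<oplus> b (e i) (e j) \<otimes> e l = b (e i) (e j \<otimes> e l) \<oplus> e i \<otimes> b (e j) (e l)"
    if "i < 16" "j < 16" "l < 16" for i j l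
    using that b cl
    by (simp add: sc_eq consts_of_eq mulv_consts_of mulv_sc e_carrier flip: co_e)
      (simp add: e_carrier co_eq_iff flip: co_add)
  have u: "(\<forall>j k. ?t 0 j k = \<zero>\<^bsub>K\<^esub> \<and> ?t j 0 k = \<zero>\<^bsub>K\<^esub>) \<longleftrightarrow> b \<one> \<one> = \<zero>" if c: "bil_cocycle b"
  proof
    assume *: "\<forall>j k. ?t 0 j k = \<zero>\<^bsub>K\<^esub> \<and> ?t j 0 k = \<zero>\<^bsub>K\<^esub>"
    have "co (b \<one> \<one>) k = co \<zero> k" for k
      using *[rule_format, of 0 k] by (simp add: consts_of_def e_0 co_zero)
    then show "b \<one> \<one> = \<zero>" using cl by (intro co_eqI) simp_all
  next
    assume n: "b \<one> \<one> = \<zero>"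
    show "\<forall>j k. ?t 0 j k = \<zero>\<^bsub>K\<^esub> \<and> ?t j 0 k = \<zero>\<^bsub>K\<^esub>"
      using bil_cocycle_normalized[OF b c n] by (simp add: consts_of_def e_0 e_carrier co_zero)
  qed
  have "(\<forall>i<16. \<forall>j<16. \<forall>l<16. \<forall>m. mulv K ?t (sc i j) (mat_one K l) m \<oplus>\<^bsub>K\<^esub> mulv K sc (?t i j) (mat_one K l) m =
       mulv K ?t (mat_one K i) (sc j l) m \<oplus>\<^bsub>K\<^esub> mulv K sc (mat_one K i) (?t j l) m) \<longleftrightarrow> bil_cocycle b" (is "?L \<longleftrightarrow> _")
  proof
    assume ?L
    show "bil_cocycle b"
    proof (rule bil_cocycle_basisI[OF b])
      fix i j l :: nat assume ijl: "i < 16" "j < 16" "l < 16"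
      show "b (e i \<otimes> e j) (e l) \<oplus> b (e i) (e j) \<otimes> e l = b (e i) (e j \<otimes> e l) \<oplus> e i \<otimes> b (e j) (e l)"
        using \<open>?L\<close>[THEN spec, THEN mp, OF ijl(1), THEN spec, THEN mp, OF ijl(2), THEN spec, THEN mp, OF ijl(3)]
        by (simp only: eq[OF ijl])
    qed
  next
    assume c: "bil_cocycle b"
    show ?L
    proof (intro allI impI)
      fix i j l m :: nat assume ijl: "i < 16" "j < 16" "l < 16"
      have "\<forall>m. mulv K ?t (sc i j) (mat_one K l) m \<oplus>\<^bsub>K\<^esub> mulv K sc (?t i j) (mat_one K l) m =
       mulv K ?t (mat_one K i) (sc j l) m \<oplus>\<^bsub>K\<^esub> mulv K sc (mat_one K i) (?t j l) m"
        unfolding eq[OF ijl] using ijl by (intro bil_cocycleD[OF c] e_carrier)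
      then show "mulv K ?t (sc i j) (mat_one K l) m \<oplus>\<^bsub>K\<^esub> mulv K sc (?t i j) (mat_one K l) m =
       mulv K ?t (mat_one K i) (sc j l) m \<oplus>\<^bsub>K\<^esub> mulv K sc (mat_one K i) (?t j l) m" ..
    qed
  qed
  then show ?thesis
    unfolding K.pairc_X_pts_iff[OF sc_X_pts consts_of_sconsts[OF b]] using u by (simp only:) blast
qed

text \<open>The bilinear map with given structure constants. It recovers a cochain from the
  \<epsilon>-part of an arbitrary deformation.\<close>

definition bil_of :: "'k sconst \<Rightarrow> 'a \<Rightarrow> 'a \<Rightarrow> 'a" where
  "bil_of t x y = vec (mulv K t (co x) (co y))"

lemma bil_of_bilinear:
  assumes t: "t \<in> sconsts K"
  shows "bilinear (bil_of t)"
proof (rule bilinearI)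
  have mv: "mulv K t (co x) (co y) \<in> vecs K" if "x \<in> carrier A" "y \<in> carrier A" for x y
    using t that by (simp add: co_props)
  fix x assume x: "x \<in> carrier A"
  note l = K.mulv_linear_right[OF t co_props(1)[OF x]] and r = K.mulv_linear_left[OF t co_props(1)[OF x]]
  show "linear (bil_of t x)"
  proof (rule linearI)
    show "bil_of t x a \<in> carrier A" if "a \<in> carrier A" for a using mv[OF x that] by (simp add: bil_of_def vec_carrier)
    show "bil_of t x (a \<oplus> b) = bil_of t x a \<oplus> bil_of t x b" if ab: "a \<in> carrier A" "b \<in> carrier A" for a b
      unfolding bil_of_def
      by (rule vec_add[OF mv[OF x ab(1)] mv[OF x ab(2)]])
        (rule K.linear_form_add[OF l co_props(1)[OF ab(1)] co_props(1)[OF ab(2)] co_add[OF ab]])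
    show "bil_of t x (k \<odot> a) = k \<odot> bil_of t x a" if ka: "k \<in> carrier K" "a \<in> carrier A" for k a
      unfolding bil_of_def
      by (rule vec_smult[OF mv[OF x ka(2)] ka(1)])
        (rule K.linear_form_smult[OF l co_props(1)[OF ka(2)] ka(1) co_smult[OF ka]])
  qed
  show "linear (\<lambda>y. bil_of t y x)"
  proof (rule linearI)
    show "bil_of t a x \<in> carrier A" if "a \<in> carrier A" for a using mv[OF that x] by (simp add: bil_of_def vec_carrier)
    show "bil_of t (a \<oplus> b) x = bil_of t a x \<oplus> bil_of t b x" if ab: "a \<in> carrier A" "b \<in> carrier A" for a b
      unfolding bil_of_def
      by (rule vec_add[OF mv[OF ab(1) x] mv[OF ab(2) x]])
        (rule K.linear_form_add[OF r co_props(1)[OF ab(1)] co_props(1)[OF ab(2)] co_add[OF ab]])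
    show "bil_of t (k \<odot> a) x = k \<odot> bil_of t a x" if ka: "k \<in> carrier K" "a \<in> carrier A" for k a
      unfolding bil_of_def
      by (rule vec_smult[OF mv[OF ka(2) x] ka(1)])
        (rule K.linear_form_smult[OF r co_props(1)[OF ka(2)] ka(1) co_smult[OF ka]])
  qed
next
  fix i j x y assume x: "x \<in> gr i" and y: "y \<in> gr j"
  have xc: "x \<in> carrier A" "y \<in> carrier A" using x y gr_carrier by blast+
  have mv: "mulv K t (co x) (co y) \<in> vecs K" using t xc by (simp add: co_props)
  have "mulv K t (co x) (co y) k = \<zero>\<^bsub>K\<^esub>" if k: "bdeg k \<noteq> i + j" for k
  proof -
    have "co x p \<otimes>\<^bsub>K\<^esub> (co y q \<otimes>\<^bsub>K\<^esub> t p q k) = \<zero>\<^bsub>K\<^esub>" if "p < 16" "q < 16" for p q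
    proof -
      have "co x p = \<zero>\<^bsub>K\<^esub> \<or> co y q = \<zero>\<^bsub>K\<^esub> \<or> t p q k = \<zero>\<^bsub>K\<^esub>"
        using x y that k sconsts_bdeg[OF t, of k p q] unfolding gr_iff_co by metis
      then show ?thesis using xc t by (elim disjE) (simp_all add: co_carrier sconsts_carrier)
    qed
    then have "co x p \<otimes>\<^bsub>K\<^esub> (\<Oplus>\<^bsub>K\<^esub>q\<in>{..<16}. co y q \<otimes>\<^bsub>K\<^esub> t p q k) = \<zero>\<^bsub>K\<^esub>" if "p < 16" for p
      using that xc t by (subst K.finsum_rdistr) (auto simp: co_carrier sconsts_carrier intro!: K.finsum_zeroI)
    then show ?thesis unfolding mulv_def bil_def by (intro K.finsum_zeroI) simp
  qed
  then show "bil_of t x y \<in> gr (i + j)"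
    unfolding gr_iff_co bil_of_def using mv by (simp add: vec_carrier co_vec)
qed

lemma consts_of_bil_of: assumes t: "t \<in> sconsts K" shows "consts_of (bil_of t) = t"
proof (rule K.sconsts_eqI[OF consts_of_sconsts[OF bil_of_bilinear[OF t]] t])
  fix i j :: nat assume "i < 16" "j < 16"
  then show "consts_of (bil_of t) i j = t i j"
    using t by (simp add: consts_of_eq bil_of_def co_e K.mulv_mat_one co_vec sconsts_vecs)
qed

section \<open>Coboundaries and infinitesimal changes of basis\<close>

definition graded_linear :: "('a \<Rightarrow> 'a) \<Rightarrow> bool" where
  "graded_linear L \<longleftrightarrow> linear L \<and> (\<forall>i. \<forall>a\<in>gr i. L a \<in> gr i)"

text \<open>The Hochschild coboundary of the 1-cochain L, in curried form. It measures the failure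
  of L to be a derivation.\<close>

definition del :: "('a \<Rightarrow> 'a) \<Rightarrow> 'a \<Rightarrow> 'a \<Rightarrow> 'a" where
  "del L x y = x \<otimes> L y \<oplus> \<ominus> L (x \<otimes> y) \<oplus> L x \<otimes> y"

lemma gr_neg: "a \<in> gr i \<Longrightarrow> \<ominus> a \<in> gr i"
  using gr_smult[of "\<ominus>\<^bsub>K\<^esub> \<one>\<^bsub>K\<^esub>" a i] gr_carrier[of a i] by (simp add: M.smult_l_minus)

lemma del_linear:
  assumes L: "linear L" and x: "x \<in> carrier A"
  shows "linear (del L x)" "linear (\<lambda>y. del L y x)"
proof -
  note Lx = linear_closed[OF L x]
  show "linear (del L x)"
    unfolding del_def
    by (rule linear_add[OF linear_add[OF linear_comp[OF linear_mult_left[OF x] L]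
      linear_neg[OF linear_comp[OF L linear_mult_left[OF x]]]] linear_mult_left[OF Lx]])
  show "linear (\<lambda>y. del L y x)"
    unfolding del_def
    by (rule linear_add[OF linear_add[OF linear_mult_right[OF Lx]
      linear_neg[OF linear_comp[OF L linear_mult_right[OF x]]]] linear_comp[OF linear_mult_right[OF x] L]])
qed

lemma del_bilinear: assumes L: "graded_linear L" shows "bilinear (del L)"
proof (rule bilinearI)
  have l: "linear L" and g: "\<And>a i. a \<in> gr i \<Longrightarrow> L a \<in> gr i" using L by (auto simp: graded_linear_def)
  show "linear (del L x)" "linear (\<lambda>y. del L y x)" if "x \<in> carrier A" for x using del_linear[OF l that] .
  show "del L x y \<in> gr (i + j)" if "x \<in> gr i" "y \<in> gr j" for i j x y
    unfolding del_def using that by (intro gr_add gr_neg gr_mult g)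
qed

text \<open>This is d d = 0. On the left the two terms L(x y) z cancel, on the right the two terms x
  L(y z), and both sides become p - q + s + t.\<close>

lemma del_cocycle: assumes L: "linear L" shows "bil_cocycle (del L)"
  unfolding bil_cocycle_def
proof (intro ballI)
  fix x y z assume v: "x \<in> carrier A" "y \<in> carrier A" "z \<in> carrier A"
  note cl = linear_closed[OF L]
  define p where "p = x \<otimes> y \<otimes> L z"
  define q where "q = L (x \<otimes> y \<otimes> z)"
  define r where "r = L (x \<otimes> y) \<otimes> z"
  define s where "s = x \<otimes> L y \<otimes> z"
  define t where "t = L x \<otimes> y \<otimes> z"
  define w where "w = x \<otimes> L (y \<otimes> z)"
  have c: "p \<in> carrier A" "q \<in> carrier A" "r \<in> carrier A" "s \<in> carrier A" "t \<in> carrier A" "w \<in> carrier A"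
    using v cl by (simp_all add: p_def q_def r_def s_def t_def w_def)
  have "del L (x \<otimes> y) z \<oplus> del L x y \<otimes> z = (p \<oplus> \<ominus> q \<oplus> r) \<oplus> (s \<oplus> \<ominus> r \<oplus> t)"
    using v cl by (simp add: del_def p_def q_def r_def s_def t_def A.l_distr A.l_minus)
  also have "\<dots> = (p \<oplus> \<ominus> q) \<oplus> (s \<oplus> t) \<oplus> (r \<oplus> \<ominus> r)"
    using c by (simp add: A.a_ac del: A.r_neg)
  also have "\<dots> = (p \<oplus> \<ominus> q) \<oplus> (s \<oplus> t)" using c by (simp add: A.r_neg)
  finally have 1: "del L (x \<otimes> y) z \<oplus> del L x y \<otimes> z = (p \<oplus> \<ominus> q) \<oplus> (s \<oplus> t)" .
  have "del L x (y \<otimes> z) \<oplus> x \<otimes> del L y z = (w \<oplus> \<ominus> q \<oplus> t) \<oplus> (p \<oplus> \<ominus> w \<oplus> s)"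
    using v cl by (simp add: del_def p_def q_def w_def s_def t_def A.r_distr A.r_minus A.m_assoc)
  also have "\<dots> = (p \<oplus> \<ominus> q) \<oplus> (s \<oplus> t) \<oplus> (w \<oplus> \<ominus> w)"
    using c by (simp add: A.a_ac del: A.r_neg)
  also have "\<dots> = (p \<oplus> \<ominus> q) \<oplus> (s \<oplus> t)" using c by (simp add: A.r_neg)
  finally show "del L (x \<otimes> y) z \<oplus> del L x y \<otimes> z = del L x (y \<otimes> z) \<oplus> x \<otimes> del L y z"
    using 1 by simp
qed

text \<open>Of the three terms L 1, - L 1 and L 1 two cancel. So \<open>L \<one>\<close> is the
  amount by which the coboundary of L changes a value at (1, 1).\<close>

lemma del_one: "linear L \<Longrightarrow> del L \<one> \<one> = L \<one>"
  using linear_closed[of L "\<one>"] by (simp add: del_def A.r_neg)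

definition lin_mat :: "('a \<Rightarrow> 'a) \<Rightarrow> 'k mat" where
  "lin_mat L = (\<lambda>r j. if j < 16 then co (L (e j)) r else \<zero>\<^bsub>K\<^esub>)"

lemma lin_mat_mats: "linear L \<Longrightarrow> lin_mat L \<in> mats K"
  by (rule matsI) (auto simp: lin_mat_def co_carrier co_outside linear_closed e_carrier)

lemma lin_mat_col: "j < 16 \<Longrightarrow> col (lin_mat L) j = co (L (e j))"
  by (rule ext) (simp add: col_def lin_mat_def)

lemma lin_mat_vec:
  assumes L: "linear L" and x: "x \<in> carrier A" shows "mat_vec K (lin_mat L) (co x) = co (L x)"
proof
  fix k
  show "mat_vec K (lin_mat L) (co x) k = co (L x) k"
    unfolding mat_vec_def co_linear[OF L x] using x linear_closed[OF L]
    by (intro K.finsum_eqI) (simp_all add: lin_mat_def co_carrier e_carrier K.m_comm)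
qed

lemma lin_mat_bdeg: "graded_linear L \<Longrightarrow> bdeg i \<noteq> bdeg j \<Longrightarrow> lin_mat L i j = \<zero>\<^bsub>K\<^esub>"
proof -
  assume L: "graded_linear L" and ij: "bdeg i \<noteq> bdeg j"
  have l: "linear L" using L by (simp add: graded_linear_def)
  show ?thesis
  proof (cases "i < 16 \<and> j < 16")
    case True
    then have "L (e j) \<in> gr (bdeg j)" using L e_gr by (simp add: graded_linear_def)
    then show ?thesis using True ij by (simp add: lin_mat_def gr_iff_co)
  next
    case False
    then show ?thesis using mats_outside[OF lin_mat_mats[OF l], of i j] by (auto simp: not_less)
  qed
qed

text \<open>Multiplicativity of 1 + \<epsilon> L from x y + \<epsilon> b'(x, y) to x y + \<epsilon>
  b(x, y) has the \<epsilon>-part b'(x, y) + L(x y) = b(x, y) + x L(y) + L(x) y.\<close>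

lemma X_act_one_plus_iff:
  assumes L: "graded_linear L" and L1: "L \<one> = \<zero>" and b: "bilinear b" and b': "bilinear b'"
  shows "pairm (mat_one K) (lin_mat L) \<in> G_pts (dual_numbers K)"
    "X_act (dual_numbers K) (pairm (mat_one K) (lin_mat L)) (pairc sc (consts_of b')) = pairc sc (consts_of b) \<longleftrightarrow>
      (\<forall>x\<in>carrier A. \<forall>y\<in>carrier A. b' x y = b x y \<oplus> del L x y)"
proof -
  have l: "linear L" using L by (simp add: graded_linear_def)
  note Lc = linear_closed[OF l]
  show G: "pairm (mat_one K) (lin_mat L) \<in> G_pts (dual_numbers K)"
    by (rule K.G_pts_one_plus[OF lin_mat_mats[OF l] lin_mat_bdeg[OF L]]) (simp_all add: lin_mat_def e_0 L1 co_zero)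
  have eq: "(mat_vec K (mat_one K) (sc i j) = mulv K sc (col (mat_one K) i) (col (mat_one K) j) \<and>
     (\<forall>k. mat_vec K (mat_one K) (consts_of b' i j) k \<oplus>\<^bsub>K\<^esub> mat_vec K (lin_mat L) (sc i j) k =
        mulv K (consts_of b) (col (mat_one K) i) (col (mat_one K) j) k \<oplus>\<^bsub>K\<^esub>
        mulv K sc (col (mat_one K) i) (col (lin_mat L) j) k \<oplus>\<^bsub>K\<^esub> mulv K sc (col (lin_mat L) i) (col (mat_one K) j) k))
     \<longleftrightarrow> b' (e i) (e j) = b (e i) (e j) \<oplus> del L (e i) (e j)" (is "?l \<longleftrightarrow> _") if ij: "i < 16" "j < 16" for i j
  proof -
    note ec = e_carrier[OF ij(1)] e_carrier[OF ij(2)]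
    have "?l \<longleftrightarrow> (\<forall>k. co (b' (e i) (e j)) k \<oplus>\<^bsub>K\<^esub> co (L (e i \<otimes> e j)) k =
       co (b (e i) (e j)) k \<oplus>\<^bsub>K\<^esub> co (e i \<otimes> L (e j)) k \<oplus>\<^bsub>K\<^esub> co (L (e i) \<otimes> e j) k)"
      using ij ec b b' by (simp add: K.col_mat_one sc_eq consts_of_eq lin_mat_col K.mat_one_vec co_props lin_mat_vec[OF l]
        mulv_consts_of mulv_sc Lc bilinear_closed flip: co_e)
    also have "\<dots> \<longleftrightarrow> b' (e i) (e j) \<oplus> L (e i \<otimes> e j) =
        b (e i) (e j) \<oplus> e i \<otimes> L (e j) \<oplus> L (e i) \<otimes> e j"
      using ec b b' by (simp add: bilinear_closed Lc co_eq_iff flip: co_add)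
    also have "\<dots> \<longleftrightarrow> b' (e i) (e j) = b (e i) (e j) \<oplus> del L (e i) (e j)"
    proof -
      have "u \<oplus> w = v \<oplus> p \<oplus> q \<longleftrightarrow> u = v \<oplus> (p \<oplus> \<ominus> w \<oplus> q)"
        if c: "u \<in> carrier A" "v \<in> carrier A" "w \<in> carrier A" "p \<in> carrier A" "q \<in> carrier A" for u v w p q
      proof -
        have "v \<oplus> (p \<oplus> \<ominus> w \<oplus> q) \<oplus> w = v \<oplus> p \<oplus> q \<oplus> (\<ominus> w \<oplus> w)"
          using c by (simp add: A.a_ac del: A.r_neg A.l_neg)
        then have "v \<oplus> (p \<oplus> \<ominus> w \<oplus> q) \<oplus> w = v \<oplus> p \<oplus> q" using c by (simp add: A.l_neg)
        moreover have "u \<oplus> w = v \<oplus> (p \<oplus> \<ominus> w \<oplus> q) \<oplus> w \<longleftrightarrow> u = v \<oplus> (p \<oplus> \<ominus> w \<oplus> q)"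
          using c by (intro A.add.right_cancel) simp_all
        ultimately show ?thesis by simp
      qed
      then show ?thesis unfolding del_def using ec b b' by (simp add: bilinear_closed Lc)
    qed
    finally show ?thesis .
  qed
  have "(\<forall>i<16. \<forall>j<16. b' (e i) (e j) = b (e i) (e j) \<oplus> del L (e i) (e j)) \<longleftrightarrow>
      (\<forall>x\<in>carrier A. \<forall>y\<in>carrier A. b' x y = b x y \<oplus> del L x y)" (is "?e \<longleftrightarrow> ?a")
  proof
    assume ?e
    note bb = bilinear_add[OF b del_bilinear[OF L]]
    show ?a
    proof (intro ballI)
      fix x y assume xy: "x \<in> carrier A" "y \<in> carrier A"
      show "b' x y = b x y \<oplus> del L x y"
        by (rule bilinear_basis_eqI[OF bilinear_linear[OF b'] bilinear_linear[OF bb] _ xy]) (use \<open>?e\<close> in simp_all)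
    qed
  qed (simp add: e_carrier)
  then show "X_act (dual_numbers K) (pairm (mat_one K) (lin_mat L)) (pairc sc (consts_of b')) = pairc sc (consts_of b) \<longleftrightarrow>
      (\<forall>x\<in>carrier A. \<forall>y\<in>carrier A. b' x y = b x y \<oplus> del L x y)"
    unfolding K.X_act_pairc_iff[OF G K.mat_one_mats lin_mat_mats[OF l] sc_sconsts consts_of_sconsts[OF b'] sc_sconsts consts_of_sconsts[OF b]]
    using eq by simp
qed

text \<open>The \<epsilon>-part of an element of G(K[\<epsilon>]) is block diagonal. This turns it
  back into a degree-preserving linear map.\<close>

lemma lin_mat_surj:
  assumes s: "s \<in> mats K" and d: "\<And>i j. bdeg i \<noteq> bdeg j \<Longrightarrow> s i j = \<zero>\<^bsub>K\<^esub>"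
  obtains L where "graded_linear L" "lin_mat L = s"
proof -
  define L where "L x = vec (mat_vec K s (co x))" for x
  have sv: "mat_vec K s (co x) \<in> vecs K" if "x \<in> carrier A" for x using s that by (simp add: co_props)
  have lf: "linear_form K (\<lambda>x. mat_vec K s x k)" for k using s by (simp add: K.mat_vec_linear)
  have l: "linear L"
  proof (rule linearI)
    show "L a \<in> carrier A" if "a \<in> carrier A" for a using sv[OF that] by (simp add: L_def vec_carrier)
    show "L (a \<oplus> b) = L a \<oplus> L b" if ab: "a \<in> carrier A" "b \<in> carrier A" for a b
      unfolding L_def by (rule vec_add[OF sv[OF ab(1)] sv[OF ab(2)]])
        (rule K.linear_form_add[OF lf co_props(1)[OF ab(1)] co_props(1)[OF ab(2)] co_add[OF ab]])
    show "L (k \<odot> a) = k \<odot> L a" if ka: "k \<in> carrier K" "a \<in> carrier A" for k a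
      unfolding L_def by (rule vec_smult[OF sv[OF ka(2)] ka(1)])
        (rule K.linear_form_smult[OF lf co_props(1)[OF ka(2)] ka(1) co_smult[OF ka]])
  qed
  have "L a \<in> gr i" if a: "a \<in> gr i" for a i
  proof -
    have ac: "a \<in> carrier A" using a by (rule gr_carrier)
    have "mat_vec K s (co a) k = \<zero>\<^bsub>K\<^esub>" if k: "bdeg k \<noteq> i" for k
      unfolding mat_vec_def
    proof (rule K.finsum_zeroI)
      fix p assume "p \<in> {..<16::nat}"
      then have "s k p = \<zero>\<^bsub>K\<^esub> \<or> co a p = \<zero>\<^bsub>K\<^esub>" using a k d[of k p] unfolding gr_iff_co by auto
      then show "s k p \<otimes>\<^bsub>K\<^esub> co a p = \<zero>\<^bsub>K\<^esub>" using s ac by (elim disjE) (simp_all add: co_carrier)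
    qed
    then show ?thesis unfolding gr_iff_co L_def using sv[OF ac] by (simp add: vec_carrier co_vec)
  qed
  then have g: "graded_linear L" using l by (simp add: graded_linear_def)
  have "lin_mat L = s"
  proof (rule mats_eqI[OF lin_mat_mats[OF l] s])
    fix i j :: nat assume "i < 16" "j < 16"
    then show "lin_mat L i j = s i j"
      using s sv[OF e_carrier[of j]] by (simp add: lin_mat_def L_def co_vec) (simp add: co_e K.mat_vec_mat_one col_def)
  qed
  with g show thesis by (rule that)
qed

end

section \<open>Hochschild cocycles in degree 2\<close>

lemma tuples_1: "as \<in> tuples A 1 \<longleftrightarrow> (\<exists>x. as = [x] \<and> x \<in> carrier A)"
  by (auto simp: tuples_def length_Suc_conv)

lemma tuples_2: "as \<in> tuples A 2 \<longleftrightarrow> (\<exists>x y. as = [x, y] \<and> x \<in> carrier A \<and> y \<in> carrier A)"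
  by (auto simp: tuples_def length_Suc_conv numeral_2_eq_2)

lemma tuples_3: "as \<in> tuples A 3 \<longleftrightarrow> (\<exists>x y z. as = [x, y, z] \<and> x \<in> carrier A \<and> y \<in> carrier A \<and> z \<in> carrier A)"
  by (auto simp: tuples_def length_Suc_conv numeral_3_eq_3)

text \<open>The passage from a curried map to a cochain on lists. The result is extensional, so it
  is determined by its values on pairs of elements of A.\<close>

definition chain2 :: "('k, 'a) module \<Rightarrow> ('a \<Rightarrow> 'a \<Rightarrow> 'a) \<Rightarrow> 'a list \<Rightarrow> 'a" where
  "chain2 A b = (\<lambda>as\<in>tuples A 2. b (as ! 0) (as ! 1))"

lemma chain2_apply: "x \<in> carrier A \<Longrightarrow> y \<in> carrier A \<Longrightarrow> chain2 A b [x, y] = b x y"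
  by (simp add: chain2_def tuples_2)

lemma chain2_extensional: "chain2 A b \<in> extensional (tuples A 2)"
  by (simp add: chain2_def)

lemma chain2_eqI:
  assumes "\<phi> \<in> extensional (tuples A 2)" "\<psi> \<in> extensional (tuples A 2)"
    "\<And>x y. x \<in> carrier A \<Longrightarrow> y \<in> carrier A \<Longrightarrow> \<phi> [x, y] = \<psi> [x, y]"
  shows "\<phi> = \<psi>"
  by (rule extensionalityI[OF assms(1,2)]) (use assms(3) in \<open>auto simp: tuples_2\<close>)

lemma cochain_add_apply:
  "x \<in> carrier A \<Longrightarrow> y \<in> carrier A \<Longrightarrow> (\<phi> \<oplus>\<^bsub>cochain_module K A gr 2\<^esub> \<psi>) [x, y] = \<phi> [x, y] \<oplus>\<^bsub>A\<^esub> \<psi> [x, y]"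
  "\<phi> \<oplus>\<^bsub>cochain_module K A gr 2\<^esub> \<psi> \<in> extensional (tuples A 2)"
  by (simp_all add: cochain_module_def tuples_2)

lemma cochain_smult_apply:
  "x \<in> carrier A \<Longrightarrow> y \<in> carrier A \<Longrightarrow> (k \<odot>\<^bsub>cochain_module K A gr 2\<^esub> \<psi>) [x, y] = k \<odot>\<^bsub>A\<^esub> \<psi> [x, y]"
  "k \<odot>\<^bsub>cochain_module K A gr 2\<^esub> \<psi> \<in> extensional (tuples A 2)"
  by (simp_all add: cochain_module_def tuples_2)

lemma cochain_zero_apply:
  "x \<in> carrier A \<Longrightarrow> y \<in> carrier A \<Longrightarrow> \<zero>\<^bsub>cochain_module K A gr 2\<^esub> [x, y] = \<zero>\<^bsub>A\<^esub>"
  "\<zero>\<^bsub>cochain_module K A gr 2\<^esub> \<in> extensional (tuples A 2)"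
  by (simp_all add: cochain_module_def tuples_2)

context based_algebra
begin

lemma linear_cong: "linear L \<Longrightarrow> (\<And>x. x \<in> carrier A \<Longrightarrow> M x = L x) \<Longrightarrow> linear M"
  by (simp add: linear_def)

lemma bilinear_cong:
  assumes "bilinear b" "\<And>x y. x \<in> carrier A \<Longrightarrow> y \<in> carrier A \<Longrightarrow> c x y = b x y"
  shows "bilinear c"
proof (rule bilinearI)
  show "linear (c x)" if "x \<in> carrier A" for x
    by (rule linear_cong[OF bilinear_linear(1)[OF assms(1) that]]) (simp add: assms that)
  show "linear (\<lambda>x. c x y)" if "y \<in> carrier A" for y
    by (rule linear_cong[OF bilinear_linear(2)[OF assms(1) that]]) (simp add: assms that)
  show "c x y \<in> gr (i + j)" if "x \<in> gr i" "y \<in> gr j" for i j x y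
    using bilinear_gr[OF assms(1) that] assms(2) gr_carrier that by simp
qed

lemma cochains_2_iff:
  "\<phi> \<in> cochains K A gr 2 \<longleftrightarrow> \<phi> \<in> extensional (tuples A 2) \<and> bilinear (\<lambda>x y. \<phi> [x, y])"
proof
  assume p: "\<phi> \<in> cochains K A gr 2"
  have f: "\<phi> \<in> tuples A 2 \<rightarrow>\<^sub>E carrier A"
    and add: "\<And>as i a b. as \<in> tuples A 2 \<Longrightarrow> i < 2 \<Longrightarrow> a \<in> carrier A \<Longrightarrow> b \<in> carrier A \<Longrightarrow>
           \<phi> (as[i := a \<oplus> b]) = \<phi> (as[i := a]) \<oplus> \<phi> (as[i := b])"
    and sm: "\<And>as i k a. as \<in> tuples A 2 \<Longrightarrow> i < 2 \<Longrightarrow> k \<in> carrier K \<Longrightarrow> a \<in> carrier A \<Longrightarrow>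
           \<phi> (as[i := k \<odot> a]) = k \<odot> \<phi> (as[i := a])"
    and dg: "\<And>as ds. length as = 2 \<Longrightarrow> length ds = 2 \<Longrightarrow> (\<And>i. i < 2 \<Longrightarrow> as ! i \<in> gr (ds ! i)) \<Longrightarrow> \<phi> as \<in> gr (sum_list ds)"
    using p unfolding cochains_def by blast+
  have t: "[x, y] \<in> tuples A 2" if "x \<in> carrier A" "y \<in> carrier A" for x y using that by (simp add: tuples_2)
  have "bilinear (\<lambda>x y. \<phi> [x, y])"
  proof (rule bilinearI)
    fix x assume x: "x \<in> carrier A"
    show "linear (\<lambda>y. \<phi> [x, y])"
    proof (rule linearI)
      show "\<phi> [x, a] \<in> carrier A" if "a \<in> carrier A" for a using f t[OF x that] by blast
      \<comment> \<open>Additivity is applied to the list [x, x] with the entry at index 1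
        overwritten, which leaves x in the first place.\<close>
      show "\<phi> [x, a \<oplus> b] = \<phi> [x, a] \<oplus> \<phi> [x, b]" if "a \<in> carrier A" "b \<in> carrier A" for a b
        using add[OF t[OF x x], of 1 a b] that by simp
      show "\<phi> [x, k \<odot> a] = k \<odot> \<phi> [x, a]" if "k \<in> carrier K" "a \<in> carrier A" for k a
        using sm[OF t[OF x x], of 1 k a] that by simp
    qed
    show "linear (\<lambda>y. \<phi> [y, x])"
    proof (rule linearI)
      show "\<phi> [a, x] \<in> carrier A" if "a \<in> carrier A" for a using f t[OF that x] by blast
      show "\<phi> [a \<oplus> b, x] = \<phi> [a, x] \<oplus> \<phi> [b, x]" if "a \<in> carrier A" "b \<in> carrier A" for a b
        using add[OF t[OF x x], of 0 a b] that by simp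
      show "\<phi> [k \<odot> a, x] = k \<odot> \<phi> [a, x]" if "k \<in> carrier K" "a \<in> carrier A" for k a
        using sm[OF t[OF x x], of 0 k a] that by simp
    qed
  next
    fix i j x y assume *: "x \<in> gr i" "y \<in> gr j"
    have "[x, y] ! k \<in> gr ([i, j] ! k)" if "k < 2" for k
      using that * by (cases k) auto
    then show "\<phi> [x, y] \<in> gr (i + j)"
      using dg[of "[x, y]" "[i, j]"] by simp
  qed
  then show "\<phi> \<in> extensional (tuples A 2) \<and> bilinear (\<lambda>x y. \<phi> [x, y])" using f by (simp add: PiE_def)
next
  assume "\<phi> \<in> extensional (tuples A 2) \<and> bilinear (\<lambda>x y. \<phi> [x, y])"
  then have e: "\<phi> \<in> extensional (tuples A 2)" and b: "bilinear (\<lambda>x y. \<phi> [x, y])" by simp_all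
  note l = bilinear_linear(1)[OF b] and r = bilinear_linear(2)[OF b]
  show "\<phi> \<in> cochains K A gr 2"
    unfolding cochains_def mem_Collect_eq
  proof (intro conjI ballI allI impI)
    show "\<phi> \<in> tuples A 2 \<rightarrow>\<^sub>E carrier A"
      using e bilinear_closed[OF b] by (auto simp: PiE_def tuples_2)
  next
    fix as i a c assume "as \<in> tuples A 2" "i < (2::nat)" "a \<in> carrier A" "c \<in> carrier A"
    then show "\<phi> (as[i := a \<oplus> c]) = \<phi> (as[i := a]) \<oplus> \<phi> (as[i := c])"
      using linear_map_add[OF l] linear_map_add[OF r] by (auto simp: tuples_2 less_2_cases_iff)
  next
    fix as i k a assume "as \<in> tuples A 2" "i < (2::nat)" "k \<in> carrier K" "a \<in> carrier A"
    then show "\<phi> (as[i := k \<odot> a]) = k \<odot> \<phi> (as[i := a])"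
      using linear_map_smult[OF l] linear_map_smult[OF r] by (auto simp: tuples_2 less_2_cases_iff)
  next
    fix as and ds :: "nat list"
    assume *: "length as = 2 \<and> length ds = 2 \<and> (\<forall>i<2. as ! i \<in> gr (ds ! i))"
    then obtain x y d d' where xy: "as = [x, y]" "ds = [d, d']" by (auto simp: length_Suc_conv numeral_2_eq_2)
    have "x \<in> gr d" "y \<in> gr d'"
      using *[THEN conjunct2, THEN conjunct2, rule_format, of 0] *[THEN conjunct2, THEN conjunct2, rule_format, of 1] by (simp_all add: xy)
    then show "\<phi> as \<in> gr (sum_list ds)" using bilinear_gr[OF b] by (simp add: xy)
  qed
qed

lemma cochains_1_iff:
  "\<phi> \<in> cochains K A gr 1 \<longleftrightarrow> \<phi> \<in> extensional (tuples A 1) \<and> graded_linear (\<lambda>x. \<phi> [x])"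
proof
  assume p: "\<phi> \<in> cochains K A gr 1"
  note p' = p[unfolded cochains_def mem_Collect_eq]
  have f: "\<phi> \<in> tuples A 1 \<rightarrow>\<^sub>E carrier A"
    and add: "\<And>as i a b. as \<in> tuples A 1 \<Longrightarrow> i < 1 \<Longrightarrow> a \<in> carrier A \<Longrightarrow> b \<in> carrier A \<Longrightarrow>
           \<phi> (as[i := a \<oplus> b]) = \<phi> (as[i := a]) \<oplus> \<phi> (as[i := b])"
    and sm: "\<And>as i k a. as \<in> tuples A 1 \<Longrightarrow> i < 1 \<Longrightarrow> k \<in> carrier K \<Longrightarrow> a \<in> carrier A \<Longrightarrow>
           \<phi> (as[i := k \<odot> a]) = k \<odot> \<phi> (as[i := a])"
    and dg: "\<And>as ds. length as = 1 \<Longrightarrow> length ds = 1 \<Longrightarrow> (\<And>i. i < 1 \<Longrightarrow> as ! i \<in> gr (ds ! i)) \<Longrightarrow> \<phi> as \<in> gr (sum_list ds)"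
    using p'[THEN conjunct1] p'[THEN conjunct2, THEN conjunct1, rule_format]
      p'[THEN conjunct2, THEN conjunct2, THEN conjunct1, rule_format]
      p'[THEN conjunct2, THEN conjunct2, THEN conjunct2, rule_format, OF conjI[OF _ conjI]]
    by simp_all
  have t: "[x] \<in> tuples A 1" if "x \<in> carrier A" for x using that by (simp add: tuples_def)
  have "linear (\<lambda>x. \<phi> [x])"
  proof (rule linearI)
    show "\<phi> [a] \<in> carrier A" if "a \<in> carrier A" for a using f t[OF that] by blast
    show "\<phi> [a \<oplus> b] = \<phi> [a] \<oplus> \<phi> [b]" if "a \<in> carrier A" "b \<in> carrier A" for a b
      using add[OF t[OF that(1)], of 0 a b] that by simp
    show "\<phi> [k \<odot> a] = k \<odot> \<phi> [a]" if "k \<in> carrier K" "a \<in> carrier A" for k a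
      using sm[OF t[OF that(2)], of 0 k a] that by simp
  qed
  moreover have "\<phi> [a] \<in> gr i" if "a \<in> gr i" for a i using dg[of "[a]" "[i]"] that by simp
  ultimately show "\<phi> \<in> extensional (tuples A 1) \<and> graded_linear (\<lambda>x. \<phi> [x])"
    using f by (simp add: PiE_def graded_linear_def)
next
  assume "\<phi> \<in> extensional (tuples A 1) \<and> graded_linear (\<lambda>x. \<phi> [x])"
  then have e: "\<phi> \<in> extensional (tuples A 1)" and l: "linear (\<lambda>x. \<phi> [x])"
    and g: "\<And>a i. a \<in> gr i \<Longrightarrow> \<phi> [a] \<in> gr i" unfolding graded_linear_def by simp_all
  show "\<phi> \<in> cochains K A gr 1"
    unfolding cochains_def mem_Collect_eq
  proof (intro conjI ballI allI impI)
    show "\<phi> \<in> tuples A 1 \<rightarrow>\<^sub>E carrier A"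
    proof (rule PiE_I)
      fix as assume "as \<in> tuples A 1"
      then obtain x where "as = [x]" "x \<in> carrier A" unfolding tuples_1 by blast
      then show "\<phi> as \<in> carrier A" using linear_closed[OF l] by simp
    qed (rule extensional_arb[OF e])
  next
    fix as i a c assume *: "as \<in> tuples A 1" "i < (1::nat)" "a \<in> carrier A" "c \<in> carrier A"
    obtain x where "as = [x]" using *(1) unfolding tuples_1 by blast
    then show "\<phi> (as[i := a \<oplus> c]) = \<phi> (as[i := a]) \<oplus> \<phi> (as[i := c])"
      using linear_map_add[OF l] * by simp
  next
    fix as i k a assume *: "as \<in> tuples A 1" "i < (1::nat)" "k \<in> carrier K" "a \<in> carrier A"
    obtain x where "as = [x]" using *(1) unfolding tuples_1 by blast
    then show "\<phi> (as[i := k \<odot> a]) = k \<odot> \<phi> (as[i := a])"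
      using linear_map_smult[OF l] * by simp
  next
    fix as and ds :: "nat list"
    assume *: "length as = 1 \<and> length ds = 1 \<and> (\<forall>i<1. as ! i \<in> gr (ds ! i))"
    then obtain x d where "as = [x]" "ds = [d]" by (auto simp: length_Suc_conv)
    then show "\<phi> as \<in> gr (sum_list ds)" using * g by simp
  qed
qed

lemma hochschild_d_1:
  assumes "linear (\<lambda>x. \<psi> [x])"
  shows "hochschild_d A 1 \<psi> = chain2 A (del (\<lambda>x. \<psi> [x]))"
proof (rule chain2_eqI[OF _ chain2_extensional])
  show "hochschild_d A 1 \<psi> \<in> extensional (tuples A 2)" by (simp add: hochschild_d_def Suc_1[symmetric] del: Suc_1)
  fix x y assume xy: "x \<in> carrier A" "y \<in> carrier A"
  note cl = linear_closed[OF assms]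
  have s: "{..<Suc 0} = {0}" by auto
  have "[x, y] \<in> tuples A (Suc 1)" using xy by (simp add: tuples_def)
  then have "hochschild_d A 1 \<psi> [x, y] = x \<otimes> \<psi> [y] \<oplus> \<ominus> \<psi> [x \<otimes> y] \<oplus> \<psi> [x] \<otimes> y"
    using xy cl by (simp add: hochschild_d_def alt_def s)
  then show "hochschild_d A 1 \<psi> [x, y] = chain2 A (del (\<lambda>x. \<psi> [x])) [x, y]"
    using xy by (simp add: chain2_apply del_def)
qed

lemma hochschild_d_2:
  assumes b: "bilinear (\<lambda>x y. \<phi> [x, y])" and v: "x \<in> carrier A" "y \<in> carrier A" "z \<in> carrier A"
  shows "hochschild_d A 2 \<phi> [x, y, z] = x \<otimes> \<phi> [y, z] \<oplus>
    (\<phi> [x, y \<otimes> z] \<oplus> \<ominus> \<phi> [x \<otimes> y, z]) \<oplus> \<ominus> (\<phi> [x, y] \<otimes> z)"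
proof -
  note cl = bilinear_closed[OF b]
  have s: "{..<2::nat} = {1, 0}" by auto
  have "[x, y, z] \<in> tuples A (Suc 2)" using v by (simp add: tuples_def)
  then show ?thesis
    using v cl by (simp add: hochschild_d_def alt_def s)
qed

text \<open>The differential is an alternating sum of four terms. Moving the two negative ones to
  the other side gives \<open>bil_cocycle\<close>.\<close>

lemma cocycles_2_iff:
  "\<phi> \<in> cocycles K A gr 2 \<longleftrightarrow> \<phi> \<in> extensional (tuples A 2) \<and> bilinear (\<lambda>x y. \<phi> [x, y]) \<and> bil_cocycle (\<lambda>x y. \<phi> [x, y])"
proof (cases "\<phi> \<in> cochains K A gr 2")
  case True
  then have e: "\<phi> \<in> extensional (tuples A 2)" and b: "bilinear (\<lambda>x y. \<phi> [x, y])" by (simp_all add: cochains_2_iff)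
  note cl = bilinear_closed[OF b]
  have eq: "p \<oplus> (q \<oplus> \<ominus> r) \<oplus> \<ominus> s = \<zero> \<longleftrightarrow> r \<oplus> s = q \<oplus> p"
    if c: "p \<in> carrier A" "q \<in> carrier A" "r \<in> carrier A" "s \<in> carrier A" for p q r s
  proof -
    have "p \<oplus> (q \<oplus> \<ominus> r) \<oplus> \<ominus> s = (q \<oplus> p) \<ominus> (r \<oplus> s)"
      using c by (simp add: a_minus_def A.minus_add A.a_ac)
    also have "\<dots> = \<zero> \<longleftrightarrow> q \<oplus> p = r \<oplus> s" using c by (intro A.r_right_minus_eq) simp_all
    finally show ?thesis by auto
  qed
  have z: "\<zero>\<^bsub>cochain_module K A gr 3\<^esub> = (\<lambda>as\<in>tuples A 3. \<zero>)"
    by (simp add: cochain_module_def)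
  have d3: "hochschild_d A 2 \<phi> \<in> extensional (tuples A 3)"
    by (simp add: hochschild_d_def)
  have "hochschild_d A 2 \<phi> = (\<lambda>as\<in>tuples A 3. \<zero>) \<longleftrightarrow>
      (\<forall>x\<in>carrier A. \<forall>y\<in>carrier A. \<forall>z\<in>carrier A. hochschild_d A 2 \<phi> [x, y, z] = \<zero>)"
  proof
    assume *: "hochschild_d A 2 \<phi> = (\<lambda>as\<in>tuples A 3. \<zero>)"
    show "\<forall>x\<in>carrier A. \<forall>y\<in>carrier A. \<forall>z\<in>carrier A. hochschild_d A 2 \<phi> [x, y, z] = \<zero>"
      unfolding * by (simp add: tuples_3)
  next
    assume "\<forall>x\<in>carrier A. \<forall>y\<in>carrier A. \<forall>z\<in>carrier A. hochschild_d A 2 \<phi> [x, y, z] = \<zero>"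
    then show "hochschild_d A 2 \<phi> = (\<lambda>as\<in>tuples A 3. \<zero>)"
      by (intro extensionalityI[OF d3]) (auto simp: tuples_3)
  qed
  also have "\<dots> \<longleftrightarrow> bil_cocycle (\<lambda>x y. \<phi> [x, y])"
    unfolding bil_cocycle_def
  proof (intro ball_cong refl)
    fix x y z assume v: "x \<in> carrier A" "y \<in> carrier A" "z \<in> carrier A"
    show "hochschild_d A 2 \<phi> [x, y, z] = \<zero> \<longleftrightarrow>
      \<phi> [x \<otimes> y, z] \<oplus> \<phi> [x, y] \<otimes> z = \<phi> [x, y \<otimes> z] \<oplus> x \<otimes> \<phi> [y, z]"
      unfolding hochschild_d_2[OF b v] by (rule eq) (use v cl in simp_all)
  qed
  finally show ?thesis using True e b by (simp add: cocycles_def z)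
qed (auto simp: cocycles_def cochains_2_iff)

lemma coboundaries_2_iff: "\<phi> \<in> coboundaries K A gr 2 \<longleftrightarrow> (\<exists>L. graded_linear L \<and> \<phi> = chain2 A (del L))"
proof -
  have c: "coboundaries K A gr 2 = hochschild_d A 1 ` cochains K A gr 1"
    by (simp add: numeral_2_eq_2)
  show ?thesis
    unfolding c
  proof
    assume "\<phi> \<in> hochschild_d A 1 ` cochains K A gr 1"
    then obtain \<psi> where p: "\<psi> \<in> cochains K A gr 1" "\<phi> = hochschild_d A 1 \<psi>" by blast
    then have "graded_linear (\<lambda>x. \<psi> [x])" unfolding cochains_1_iff by blast
    then show "\<exists>L. graded_linear L \<and> \<phi> = chain2 A (del L)"
      using p(2) hochschild_d_1[of \<psi>] unfolding graded_linear_def by blast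
  next
    assume "\<exists>L. graded_linear L \<and> \<phi> = chain2 A (del L)"
    then obtain L where L: "graded_linear L" "\<phi> = chain2 A (del L)" by blast
    have l: "linear L" using L(1) by (simp add: graded_linear_def)
    define \<psi> where "\<psi> = (\<lambda>as\<in>tuples A 1. L (as ! 0))"
    have e: "\<psi> [x] = L x" if "x \<in> carrier A" for x
    proof -
      have "[x] \<in> tuples A 1" using that unfolding tuples_1 by blast
      then show ?thesis by (simp add: \<psi>_def del: One_nat_def)
    qed
    have l': "linear (\<lambda>x. \<psi> [x])" by (rule linear_cong[OF l e])
    have "graded_linear (\<lambda>x. \<psi> [x])"
      using L(1) l' gr_carrier by (simp add: graded_linear_def e)
    then have "\<psi> \<in> cochains K A gr 1" unfolding cochains_1_iff by (simp add: \<psi>_def)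
    moreover have "hochschild_d A 1 \<psi> = \<phi>"
      unfolding hochschild_d_1[OF l'] L(2)
      by (rule chain2_eqI[OF chain2_extensional chain2_extensional])
        (use linear_closed[OF l] in \<open>simp add: chain2_apply del_def e\<close>)
    ultimately show "\<phi> \<in> hochschild_d A 1 ` cochains K A gr 1" by blast
  qed
qed

section \<open>Cocycles modulo coboundaries as a vector space\<close>

abbreviation "C2 \<equiv> cochain_module K A gr 2"
abbreviation "Z2 \<equiv> cocycles K A gr 2"
abbreviation "B2 \<equiv> coboundaries K A gr 2"
abbreviation "hh \<equiv> hh_class K A gr 2"

lemma bil_cocycle_cong:
  assumes "bil_cocycle b" "\<And>x y. x \<in> carrier A \<Longrightarrow> y \<in> carrier A \<Longrightarrow> c x y = b x y"
  shows "bil_cocycle c"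
  using assms by (simp add: bil_cocycle_def)

lemma chain2_cocycle:
  assumes "bilinear b" "bil_cocycle b"
  shows "chain2 A b \<in> Z2"
  unfolding cocycles_2_iff
proof (intro conjI)
  show "bilinear (\<lambda>x y. chain2 A b [x, y])"
    by (rule bilinear_cong[OF assms(1)]) (rule chain2_apply)
  show "bil_cocycle (\<lambda>x y. chain2 A b [x, y])"
    by (rule bil_cocycle_cong[OF assms(2)]) (rule chain2_apply)
qed (rule chain2_extensional)

lemma Z2_D:
  assumes "\<phi> \<in> Z2"
  shows "\<phi> \<in> extensional (tuples A 2)" "bilinear (\<lambda>x y. \<phi> [x, y])" "bil_cocycle (\<lambda>x y. \<phi> [x, y])"
    "x \<in> carrier A \<Longrightarrow> y \<in> carrier A \<Longrightarrow> \<phi> [x, y] \<in> carrier A"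
  using assms bilinear_closed[of "\<lambda>x y. \<phi> [x, y]"] by (simp_all add: cocycles_2_iff)

lemma B2_Z2: "\<phi> \<in> B2 \<Longrightarrow> \<phi> \<in> Z2"
  using chain2_cocycle del_bilinear del_cocycle by (auto simp: coboundaries_2_iff graded_linear_def)

lemma Z2_add: assumes p: "\<phi> \<in> Z2" and q: "\<psi> \<in> Z2" shows "\<phi> \<oplus>\<^bsub>C2\<^esub> \<psi> \<in> Z2"
  unfolding cocycles_2_iff
proof (intro conjI cochain_add_apply(2))
  show "bilinear (\<lambda>x y. (\<phi> \<oplus>\<^bsub>C2\<^esub> \<psi>) [x, y])"
    by (rule bilinear_cong[OF bilinear_add[OF Z2_D(2)[OF p] Z2_D(2)[OF q]]]) (rule cochain_add_apply(1))
  have "bil_cocycle (\<lambda>x y. \<phi> [x, y] \<oplus> \<psi> [x, y])"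
    unfolding bil_cocycle_def
  proof (intro ballI)
    fix x y z assume v: "x \<in> carrier A" "y \<in> carrier A" "z \<in> carrier A"
    have ac: "a \<oplus> b \<oplus> (c \<oplus> d) = (a \<oplus> c) \<oplus> (b \<oplus> d)"
      if "a \<in> carrier A" "b \<in> carrier A" "c \<in> carrier A" "d \<in> carrier A" for a b c d
      using that by (simp add: A.a_ac)
    have "\<phi> [x \<otimes> y, z] \<oplus> \<psi> [x \<otimes> y, z] \<oplus> (\<phi> [x, y] \<oplus> \<psi> [x, y]) \<otimes> z =
       (\<phi> [x \<otimes> y, z] \<oplus> \<phi> [x, y] \<otimes> z) \<oplus> (\<psi> [x \<otimes> y, z] \<oplus> \<psi> [x, y] \<otimes> z)"
      using v Z2_D(4)[OF p] Z2_D(4)[OF q] by (simp add: A.l_distr ac)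
    also have "\<dots> = (\<phi> [x, y \<otimes> z] \<oplus> x \<otimes> \<phi> [y, z]) \<oplus> (\<psi> [x, y \<otimes> z] \<oplus> x \<otimes> \<psi> [y, z])"
      by (simp only: bil_cocycleD[OF Z2_D(3)[OF p] v] bil_cocycleD[OF Z2_D(3)[OF q] v])
    also have "\<dots> = \<phi> [x, y \<otimes> z] \<oplus> \<psi> [x, y \<otimes> z] \<oplus> x \<otimes> (\<phi> [y, z] \<oplus> \<psi> [y, z])"
      using v Z2_D(4)[OF p] Z2_D(4)[OF q] by (simp add: A.r_distr ac)
    finally show "\<phi> [x \<otimes> y, z] \<oplus> \<psi> [x \<otimes> y, z] \<oplus> (\<phi> [x, y] \<oplus> \<psi> [x, y]) \<otimes> z =
      \<phi> [x, y \<otimes> z] \<oplus> \<psi> [x, y \<otimes> z] \<oplus> x \<otimes> (\<phi> [y, z] \<oplus> \<psi> [y, z])" .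
  qed
  then show "bil_cocycle (\<lambda>x y. (\<phi> \<oplus>\<^bsub>C2\<^esub> \<psi>) [x, y])"
    by (rule bil_cocycle_cong) (rule cochain_add_apply(1))
qed

lemma Z2_smult: assumes k: "k \<in> carrier K" and p: "\<phi> \<in> Z2" shows "k \<odot>\<^bsub>C2\<^esub> \<phi> \<in> Z2"
  unfolding cocycles_2_iff
proof (intro conjI cochain_smult_apply(2))
  show "bilinear (\<lambda>x y. (k \<odot>\<^bsub>C2\<^esub> \<phi>) [x, y])"
    by (rule bilinear_cong[OF bilinear_smult[OF k Z2_D(2)[OF p]]]) (rule cochain_smult_apply(1))
  have "bil_cocycle (\<lambda>x y. k \<odot> \<phi> [x, y])"
    unfolding bil_cocycle_def
  proof (intro ballI)
    fix x y z assume v: "x \<in> carrier A" "y \<in> carrier A" "z \<in> carrier A"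
    have "k \<odot> (\<phi> [x \<otimes> y, z] \<oplus> \<phi> [x, y] \<otimes> z) = k \<odot> (\<phi> [x, y \<otimes> z] \<oplus> x \<otimes> \<phi> [y, z])"
      by (simp only: bil_cocycleD[OF Z2_D(3)[OF p] v])
    then show "k \<odot> \<phi> [x \<otimes> y, z] \<oplus> (k \<odot> \<phi> [x, y]) \<otimes> z =
      k \<odot> \<phi> [x, y \<otimes> z] \<oplus> x \<otimes> (k \<odot> \<phi> [y, z])"
      using v k Z2_D(4)[OF p] by (simp add: M.smult_r_distr smult_mult)
  qed
  then show "bil_cocycle (\<lambda>x y. (k \<odot>\<^bsub>C2\<^esub> \<phi>) [x, y])"
    by (rule bil_cocycle_cong) (rule cochain_smult_apply(1))
qed

lemma Z2_zero: "\<zero>\<^bsub>C2\<^esub> \<in> Z2"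
proof -
  have "\<zero>\<^bsub>C2\<^esub> = chain2 A (\<lambda>_ _. \<zero>)"
    by (rule chain2_eqI[OF cochain_zero_apply(2) chain2_extensional]) (simp add: cochain_zero_apply chain2_apply)
  moreover have "bil_cocycle (\<lambda>_ _. \<zero>)" by (simp add: bil_cocycle_def)
  ultimately show ?thesis using chain2_cocycle[OF bilinear_zero] by simp
qed

lemma del_add:
  assumes "linear L" "linear L'" "x \<in> carrier A" "y \<in> carrier A"
  shows "del (\<lambda>x. L x \<oplus> L' x) x y = del L x y \<oplus> del L' x y"
  using assms linear_closed[OF assms(1)] linear_closed[OF assms(2)]
  by (simp add: del_def A.l_distr A.r_distr A.minus_add A.a_ac)

lemma del_smult:
  assumes "linear L" "k \<in> carrier K" "x \<in> carrier A" "y \<in> carrier A"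
  shows "del (\<lambda>x. k \<odot> L x) x y = k \<odot> del L x y"
  using assms linear_closed[OF assms(1)]
  by (simp add: del_def smult_mult M.smult_r_distr M.smult_r_minus)

lemma B2_add: assumes "\<phi> \<in> B2" "\<psi> \<in> B2" shows "\<phi> \<oplus>\<^bsub>C2\<^esub> \<psi> \<in> B2"
proof -
  obtain L L' where L: "graded_linear L" "\<phi> = chain2 A (del L)" "graded_linear L'" "\<psi> = chain2 A (del L')"
    using assms by (auto simp: coboundaries_2_iff)
  have l: "linear L" "linear L'" using L by (simp_all add: graded_linear_def)
  have "graded_linear (\<lambda>x. L x \<oplus> L' x)" using L by (simp add: graded_linear_def linear_add gr_add)
  moreover have "\<phi> \<oplus>\<^bsub>C2\<^esub> \<psi> = chain2 A (del (\<lambda>x. L x \<oplus> L' x))"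
    by (rule chain2_eqI[OF cochain_add_apply(2) chain2_extensional])
      (simp add: cochain_add_apply chain2_apply L del_add[OF l])
  ultimately show ?thesis by (auto simp: coboundaries_2_iff)
qed

lemma B2_smult: assumes "k \<in> carrier K" "\<phi> \<in> B2" shows "k \<odot>\<^bsub>C2\<^esub> \<phi> \<in> B2"
proof -
  obtain L where L: "graded_linear L" "\<phi> = chain2 A (del L)" using assms by (auto simp: coboundaries_2_iff)
  have l: "linear L" using L by (simp add: graded_linear_def)
  have "graded_linear (\<lambda>x. k \<odot> L x)" using L assms by (simp add: graded_linear_def linear_smult gr_smult)
  moreover have "k \<odot>\<^bsub>C2\<^esub> \<phi> = chain2 A (del (\<lambda>x. k \<odot> L x))"
    by (rule chain2_eqI[OF cochain_smult_apply(2) chain2_extensional])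
      (simp add: cochain_smult_apply chain2_apply L del_smult[OF l assms(1)])
  ultimately show ?thesis by (auto simp: coboundaries_2_iff)
qed

text \<open>The cochain module with its carrier restricted to the cocycles. The coboundaries form a
  submodule of it, so the coset calculus of abelian groups applies to the classes.\<close>

definition Z2_module :: "('k, 'a list \<Rightarrow> 'a) module" where
  "Z2_module = C2\<lparr>carrier := Z2\<rparr>"

lemma Z2_module_simps [simp]:
  "carrier Z2_module = Z2" "\<phi> \<oplus>\<^bsub>Z2_module\<^esub> \<psi> = \<phi> \<oplus>\<^bsub>C2\<^esub> \<psi>" "\<zero>\<^bsub>Z2_module\<^esub> = \<zero>\<^bsub>C2\<^esub>"
  "k \<odot>\<^bsub>Z2_module\<^esub> \<phi> = k \<odot>\<^bsub>C2\<^esub> \<phi>"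
  by (simp_all add: Z2_module_def)

lemma Z2_eqI:
  assumes "\<phi> \<in> Z2" "\<psi> \<in> Z2" "\<And>x y. x \<in> carrier A \<Longrightarrow> y \<in> carrier A \<Longrightarrow> \<phi> [x, y] = \<psi> [x, y]"
  shows "\<phi> = \<psi>"
  using chain2_eqI[OF Z2_D(1)[OF assms(1)] Z2_D(1)[OF assms(2)] assms(3)] .

lemma Z2_module: "module K Z2_module"
proof (rule moduleI)
  note ap = cochain_add_apply(1) cochain_smult_apply(1) cochain_zero_apply(1)
  note cl = Z2_add Z2_smult Z2_zero
  show "abelian_group Z2_module"
  proof (rule abelian_groupI)
    fix \<phi> assume p: "\<phi> \<in> carrier Z2_module"
    show "\<exists>\<psi>\<in>carrier Z2_module. \<psi> \<oplus>\<^bsub>Z2_module\<^esub> \<phi> = \<zero>\<^bsub>Z2_module\<^esub>"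
    proof
      \<comment> \<open>The additive inverse is realized as the multiple by -1, which is already
        known to be a cocycle.\<close>
      show n: "(\<ominus>\<^bsub>K\<^esub> \<one>\<^bsub>K\<^esub>) \<odot>\<^bsub>C2\<^esub> \<phi> \<in> carrier Z2_module" using p by (simp add: Z2_smult)
      show "((\<ominus>\<^bsub>K\<^esub> \<one>\<^bsub>K\<^esub>) \<odot>\<^bsub>C2\<^esub> \<phi>) \<oplus>\<^bsub>Z2_module\<^esub> \<phi> = \<zero>\<^bsub>Z2_module\<^esub>"
        using p n by (simp, intro Z2_eqI) (simp_all add: cl ap Z2_D(4) M.smult_l_minus A.l_neg)
    qed
  next
    fix \<phi> \<psi> \<chi> assume *: "\<phi> \<in> carrier Z2_module" "\<psi> \<in> carrier Z2_module" "\<chi> \<in> carrier Z2_module"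
    then show "\<phi> \<oplus>\<^bsub>Z2_module\<^esub> \<psi> \<oplus>\<^bsub>Z2_module\<^esub> \<chi> = \<phi> \<oplus>\<^bsub>Z2_module\<^esub> (\<psi> \<oplus>\<^bsub>Z2_module\<^esub> \<chi>)"
      by (simp, intro Z2_eqI) (simp_all add: cl ap Z2_D(4) A.a_assoc)
  next
    fix \<phi> \<psi> assume *: "\<phi> \<in> carrier Z2_module" "\<psi> \<in> carrier Z2_module"
    then show "\<phi> \<oplus>\<^bsub>Z2_module\<^esub> \<psi> = \<psi> \<oplus>\<^bsub>Z2_module\<^esub> \<phi>"
      by (simp, intro Z2_eqI) (simp_all add: cl ap Z2_D(4) A.a_comm)
  next
    fix \<phi> assume *: "\<phi> \<in> carrier Z2_module"
    then show "\<zero>\<^bsub>Z2_module\<^esub> \<oplus>\<^bsub>Z2_module\<^esub> \<phi> = \<phi>"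
      by (simp, intro Z2_eqI) (simp_all add: cl ap Z2_D(4))
  qed (simp_all add: cl)
  fix a b \<phi> assume *: "a \<in> carrier K" "b \<in> carrier K" "\<phi> \<in> carrier Z2_module"
  show "(a \<oplus>\<^bsub>K\<^esub> b) \<odot>\<^bsub>Z2_module\<^esub> \<phi> = a \<odot>\<^bsub>Z2_module\<^esub> \<phi> \<oplus>\<^bsub>Z2_module\<^esub> b \<odot>\<^bsub>Z2_module\<^esub> \<phi>"
    using * by (simp, intro Z2_eqI) (simp_all add: cl ap Z2_D(4) M.smult_l_distr)
  show "(a \<otimes>\<^bsub>K\<^esub> b) \<odot>\<^bsub>Z2_module\<^esub> \<phi> = a \<odot>\<^bsub>Z2_module\<^esub> (b \<odot>\<^bsub>Z2_module\<^esub> \<phi>)"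
    using * by (simp, intro Z2_eqI) (simp_all add: cl ap Z2_D(4) M.smult_assoc1)
next
  note cl = Z2_add Z2_smult Z2_zero
  note ap = cochain_add_apply(1) cochain_smult_apply(1) cochain_zero_apply(1)
  fix a \<phi> \<psi> assume *: "a \<in> carrier K" "\<phi> \<in> carrier Z2_module" "\<psi> \<in> carrier Z2_module"
  show "a \<odot>\<^bsub>Z2_module\<^esub> (\<phi> \<oplus>\<^bsub>Z2_module\<^esub> \<psi>) = a \<odot>\<^bsub>Z2_module\<^esub> \<phi> \<oplus>\<^bsub>Z2_module\<^esub> a \<odot>\<^bsub>Z2_module\<^esub> \<psi>"
    using * by (simp, intro Z2_eqI) (simp_all add: cl ap Z2_D(4) M.smult_r_distr)
next
  note cl = Z2_add Z2_smult Z2_zero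
  note ap = cochain_add_apply(1) cochain_smult_apply(1) cochain_zero_apply(1)
  fix \<phi> assume *: "\<phi> \<in> carrier Z2_module"
  show "\<one>\<^bsub>K\<^esub> \<odot>\<^bsub>Z2_module\<^esub> \<phi> = \<phi>"
    using * by (simp, intro Z2_eqI) (simp_all add: cl ap Z2_D(4))
next
  fix a \<phi> assume *: "a \<in> carrier K" "\<phi> \<in> carrier Z2_module"
  show "a \<odot>\<^bsub>Z2_module\<^esub> \<phi> \<in> carrier Z2_module" using * by (simp add: Z2_smult)
qed (rule K.cring_axioms)

sublocale Z2: module K Z2_module by (rule Z2_module)

lemma B2_submodule: "submodule B2 K Z2_module"
proof (rule Z2.submoduleI)
  show "B2 \<subseteq> carrier Z2_module" using B2_Z2 by auto
  have "graded_linear (\<lambda>_. \<zero>)" by (simp add: graded_linear_def linear_zero gr_zero)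
  moreover have "\<zero>\<^bsub>C2\<^esub> = chain2 A (del (\<lambda>_. \<zero>))"
    by (rule chain2_eqI[OF cochain_zero_apply(2) chain2_extensional]) (simp add: cochain_zero_apply chain2_apply del_def)
  ultimately show "\<zero>\<^bsub>Z2_module\<^esub> \<in> B2" by (auto simp: coboundaries_2_iff)
  show "\<ominus>\<^bsub>Z2_module\<^esub> a \<in> B2" if a: "a \<in> B2" for a
  proof -
    have "(\<ominus>\<^bsub>K\<^esub> \<one>\<^bsub>K\<^esub>) \<odot>\<^bsub>Z2_module\<^esub> a = \<ominus>\<^bsub>Z2_module\<^esub> a"
      using Z2.smult_l_minus[of "\<one>\<^bsub>K\<^esub>" a] B2_Z2[OF a] Z2.smult_one[of a] by (simp del: Z2_module_simps(4))
    then show ?thesis using B2_smult[OF _ a, of "\<ominus>\<^bsub>K\<^esub> \<one>\<^bsub>K\<^esub>"] by simp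
  qed
qed (simp_all add: B2_add B2_smult)

sublocale B2: abelian_subgroup B2 Z2_module
proof (rule abelian_subgroupI3)
  show "additive_subgroup B2 Z2_module"
    by (rule additive_subgroup.intro[OF submodule.axioms(1)[OF B2_submodule]])
qed (rule Z2.M.abelian_group_axioms)

text \<open>A coset depends only on the addition, so it is the same set whether formed among all
  cochains or among the cocycles.\<close>

lemma hh_coset: "hh \<phi> = B2 +>\<^bsub>Z2_module\<^esub> \<phi>"
  by (simp add: hh_class_def a_r_coset_def')

lemma hh_mem_iff: "\<psi> \<in> hh \<phi> \<longleftrightarrow> (\<exists>b\<in>B2. \<psi> = b \<oplus>\<^bsub>C2\<^esub> \<phi>)"
  unfolding hh_class_def a_r_coset_def' by blast

lemma hh_eq_iff: "\<phi> \<in> Z2 \<Longrightarrow> \<psi> \<in> Z2 \<Longrightarrow> hh \<phi> = hh \<psi> \<longleftrightarrow> (\<exists>b\<in>B2. \<psi> = b \<oplus>\<^bsub>C2\<^esub> \<phi>)"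
proof
  assume *: "\<phi> \<in> Z2" "\<psi> \<in> Z2" "hh \<phi> = hh \<psi>"
  have "\<psi> \<in> hh \<psi>" unfolding hh_coset using *(2) by (intro B2.a_rcos_self) simp
  then show "\<exists>b\<in>B2. \<psi> = b \<oplus>\<^bsub>C2\<^esub> \<phi>" using *(3) hh_mem_iff by blast
next
  assume *: "\<phi> \<in> Z2" "\<exists>b\<in>B2. \<psi> = b \<oplus>\<^bsub>C2\<^esub> \<phi>"
  then have "\<psi> \<in> B2 +>\<^bsub>Z2_module\<^esub> \<phi>" using hh_mem_iff hh_coset by blast
  then show "hh \<phi> = hh \<psi>"
    unfolding hh_coset using *(1) by (intro B2.a_repr_independence') simp_all
qed

lemma hh_self: "\<phi> \<in> Z2 \<Longrightarrow> \<phi> \<in> hh \<phi>"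
  unfolding hh_coset by (intro B2.a_rcos_self) simp

lemma hh_mem: "\<phi> \<in> Z2 \<Longrightarrow> \<psi> \<in> hh \<phi> \<Longrightarrow> \<psi> \<in> Z2 \<and> hh \<psi> = hh \<phi>"
proof -
  assume *: "\<phi> \<in> Z2" "\<psi> \<in> hh \<phi>"
  then obtain b where b: "b \<in> B2" "\<psi> = b \<oplus>\<^bsub>C2\<^esub> \<phi>" unfolding hh_mem_iff by blast
  then have "\<psi> \<in> Z2" using Z2_add[OF B2_Z2[OF b(1)] *(1)] by simp
  then show ?thesis using hh_eq_iff[OF *(1)] b by blast
qed

lemma HH0_simps:
  "carrier (HH0 K A gr 2) = hh ` Z2" "\<zero>\<^bsub>HH0 K A gr 2\<^esub> = B2"
  by (simp_all add: HH0_def)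

lemma HH0_add: "\<phi> \<in> Z2 \<Longrightarrow> \<psi> \<in> Z2 \<Longrightarrow> hh \<phi> \<oplus>\<^bsub>HH0 K A gr 2\<^esub> hh \<psi> = hh (\<phi> \<oplus>\<^bsub>C2\<^esub> \<psi>)"
proof -
  assume *: "\<phi> \<in> Z2" "\<psi> \<in> Z2"
  have "hh \<phi> \<oplus>\<^bsub>HH0 K A gr 2\<^esub> hh \<psi> = (B2 +>\<^bsub>Z2_module\<^esub> \<phi>) <+>\<^bsub>Z2_module\<^esub> (B2 +>\<^bsub>Z2_module\<^esub> \<psi>)"
    by (simp add: HH0_def hh_coset set_add_def')
  also have "\<dots> = B2 +>\<^bsub>Z2_module\<^esub> (\<phi> \<oplus>\<^bsub>Z2_module\<^esub> \<psi>)"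
    using * by (intro B2.a_rcos_sum) simp_all
  finally show ?thesis by (simp add: hh_coset)
qed

text \<open>Scalars preserve coboundaries, so all members of a class contribute the same coset to
  the union in the definition.\<close>

lemma HH0_smult: assumes k: "k \<in> carrier K" and p: "\<phi> \<in> Z2" shows "k \<odot>\<^bsub>HH0 K A gr 2\<^esub> hh \<phi> = hh (k \<odot>\<^bsub>C2\<^esub> \<phi>)"
proof -
  have eq: "hh (k \<odot>\<^bsub>C2\<^esub> \<psi>) = hh (k \<odot>\<^bsub>C2\<^esub> \<phi>)" if q: "\<psi> \<in> hh \<phi>" for \<psi>
  proof -
    obtain b where b: "b \<in> B2" "\<psi> = b \<oplus>\<^bsub>C2\<^esub> \<phi>" using q unfolding hh_mem_iff by blast
    have "k \<odot>\<^bsub>C2\<^esub> \<psi> = (k \<odot>\<^bsub>C2\<^esub> b) \<oplus>\<^bsub>C2\<^esub> (k \<odot>\<^bsub>C2\<^esub> \<phi>)"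
      using Z2.smult_r_distr[OF k, of b \<phi>] b B2_Z2 p by simp
    then show ?thesis
      using hh_eq_iff[OF Z2_smult[OF k p], of "k \<odot>\<^bsub>C2\<^esub> \<psi>"] B2_smult[OF k b(1)] hh_mem[OF p q] Z2_smult[OF k] by metis
  qed
  have "k \<odot>\<^bsub>HH0 K A gr 2\<^esub> hh \<phi> = (\<Union>\<psi>\<in>hh \<phi>. hh (k \<odot>\<^bsub>C2\<^esub> \<psi>))" by (simp add: HH0_def)
  also have "\<dots> = (\<Union>\<psi>\<in>hh \<phi>. hh (k \<odot>\<^bsub>C2\<^esub> \<phi>))" by (rule SUP_cong[OF refl]) (rule eq)
  also have "\<dots> = hh (k \<odot>\<^bsub>C2\<^esub> \<phi>)" using hh_self[OF p] unfolding UN_constant by (simp only: empty_iff if_False split: if_split) blast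
  finally show ?thesis .
qed

lemma hh_zero: "hh \<zero>\<^bsub>C2\<^esub> = B2"
proof -
  have "B2 +>\<^bsub>Z2_module\<^esub> \<zero>\<^bsub>Z2_module\<^esub> = B2" using B2.a_subset by (intro Z2.M.a_coset_add_zero) simp
  then show ?thesis by (simp add: hh_coset)
qed

lemma HH0_module: "module K (HH0 K A gr 2)"
proof (rule moduleI)
  let ?H = "HH0 K A gr 2"
  have ex: "\<exists>\<phi>\<in>Z2. u = hh \<phi>" if "u \<in> carrier ?H" for u using that by (auto simp: HH0_simps)
  have in_H: "hh \<phi> \<in> carrier ?H" if "\<phi> \<in> Z2" for \<phi> using that by (simp add: HH0_simps)
  note cl = Z2_add Z2_smult Z2_zero
  note ax = Z2.M.a_assoc[simplified] Z2.M.a_comm[simplified]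
  have z: "\<zero>\<^bsub>?H\<^esub> = hh \<zero>\<^bsub>C2\<^esub>" by (simp add: HH0_simps hh_zero)
  show "abelian_group ?H"
  proof (rule abelian_groupI)
    fix u v assume "u \<in> carrier ?H" "v \<in> carrier ?H"
    then obtain \<phi> \<psi> where p: "\<phi> \<in> Z2" "u = hh \<phi>" "\<psi> \<in> Z2" "v = hh \<psi>" using ex by metis
    show "u \<oplus>\<^bsub>?H\<^esub> v \<in> carrier ?H" using p by (simp add: HH0_add in_H cl)
    show "u \<oplus>\<^bsub>?H\<^esub> v = v \<oplus>\<^bsub>?H\<^esub> u" using p by (simp add: HH0_add ax)
  next
    fix u v w assume "u \<in> carrier ?H" "v \<in> carrier ?H" "w \<in> carrier ?H"
    then obtain \<phi> \<psi> \<chi> where p: "\<phi> \<in> Z2" "u = hh \<phi>" "\<psi> \<in> Z2" "v = hh \<psi>" "\<chi> \<in> Z2" "w = hh \<chi>" using ex by metis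
    show "u \<oplus>\<^bsub>?H\<^esub> v \<oplus>\<^bsub>?H\<^esub> w = u \<oplus>\<^bsub>?H\<^esub> (v \<oplus>\<^bsub>?H\<^esub> w)" using p by (simp add: HH0_add cl ax(1))
  next
    fix u assume "u \<in> carrier ?H"
    then obtain \<phi> where p: "\<phi> \<in> Z2" "u = hh \<phi>" using ex by metis
    show "\<zero>\<^bsub>?H\<^esub> \<oplus>\<^bsub>?H\<^esub> u = u" using p Z2.M.l_zero[of \<phi>] by (simp add: z HH0_add cl)
    have n: "\<ominus>\<^bsub>Z2_module\<^esub> \<phi> \<in> Z2" using Z2.M.a_inv_closed[of \<phi>] p by simp
    have "hh (\<ominus>\<^bsub>Z2_module\<^esub> \<phi>) \<oplus>\<^bsub>?H\<^esub> u = \<zero>\<^bsub>?H\<^esub>"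
      using p n Z2.M.l_neg[of \<phi>] by (simp add: HH0_add z)
    then show "\<exists>y\<in>carrier ?H. y \<oplus>\<^bsub>?H\<^esub> u = \<zero>\<^bsub>?H\<^esub>" using in_H[OF n] by blast
  next
    show "\<zero>\<^bsub>?H\<^esub> \<in> carrier ?H" by (simp add: z in_H cl)
  qed
  show "\<one>\<^bsub>K\<^esub> \<odot>\<^bsub>?H\<^esub> u = u" if u: "u \<in> carrier ?H" for u
  proof -
    obtain \<phi> where p: "\<phi> \<in> Z2" "u = hh \<phi>" using u ex by metis
    then show ?thesis using Z2.smult_one[of \<phi>] by (simp add: HH0_smult cl)
  qed
  show "a \<odot>\<^bsub>?H\<^esub> u \<in> carrier ?H" if a: "a \<in> carrier K" and u: "u \<in> carrier ?H" for a u
  proof -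
    obtain \<phi> where p: "\<phi> \<in> Z2" "u = hh \<phi>" using u ex by metis
    then show ?thesis using a by (simp add: HH0_smult in_H cl)
  qed
  show "a \<odot>\<^bsub>?H\<^esub> (u \<oplus>\<^bsub>?H\<^esub> v) = a \<odot>\<^bsub>?H\<^esub> u \<oplus>\<^bsub>?H\<^esub> a \<odot>\<^bsub>?H\<^esub> v"
    if a: "a \<in> carrier K" and uv: "u \<in> carrier ?H" "v \<in> carrier ?H" for a u v
  proof -
    obtain \<phi> \<psi> where p: "\<phi> \<in> Z2" "u = hh \<phi>" "\<psi> \<in> Z2" "v = hh \<psi>" using uv ex by metis
    then show ?thesis
      using a Z2.smult_r_distr[OF a, of \<phi> \<psi>] by (simp add: HH0_smult HH0_add cl)
  qed
  fix a b u assume ab: "a \<in> carrier K" "b \<in> carrier K" and u: "u \<in> carrier ?H"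
  obtain \<phi> where p: "\<phi> \<in> Z2" "u = hh \<phi>" using u ex by metis
  show "(a \<oplus>\<^bsub>K\<^esub> b) \<odot>\<^bsub>?H\<^esub> u = a \<odot>\<^bsub>?H\<^esub> u \<oplus>\<^bsub>?H\<^esub> b \<odot>\<^bsub>?H\<^esub> u"
    using p ab Z2.smult_l_distr[OF ab, of \<phi>] by (simp add: HH0_smult HH0_add cl)
  show "(a \<otimes>\<^bsub>K\<^esub> b) \<odot>\<^bsub>?H\<^esub> u = a \<odot>\<^bsub>?H\<^esub> (b \<odot>\<^bsub>?H\<^esub> u)"
    using p ab Z2.smult_assoc1[OF ab, of \<phi>] by (simp add: HH0_smult cl)
qed (rule K.cring_axioms)

text \<open>The correcting 1-cochain preserves degrees because \<phi> does: the value \<phi>(1, 1)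
  has degree 0, so left multiplication by it keeps each piece. By \<open>del_one\<close> its
  coboundary changes the value at (1, 1) by exactly the right amount.\<close>

lemma normalized_representative:
  assumes p: "\<phi> \<in> Z2"
  obtains \<psi> where "\<psi> \<in> hh \<phi>" "\<psi> \<in> Z2" "\<psi> [\<one>, \<one>] = \<zero>" "hh \<psi> = hh \<phi>"
proof -
  define a where "a = \<ominus> \<phi> [\<one>, \<one>]"
  have a0: "a \<in> gr 0" unfolding a_def using bilinear_gr[OF Z2_D(2)[OF p] gr_one gr_one] by (simp add: gr_neg)
  then have a: "a \<in> carrier A" by (rule gr_carrier)
  define L where "L = (\<lambda>x. a \<otimes> x)"
  have l: "linear L" unfolding L_def by (rule linear_mult_left[OF a])
  have L: "graded_linear L" using l gr_mult[OF a0] by (simp add: graded_linear_def L_def)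
  define \<psi> where "\<psi> = chain2 A (del L) \<oplus>\<^bsub>C2\<^esub> \<phi>"
  have "chain2 A (del L) \<in> B2" using L by (auto simp: coboundaries_2_iff)
  then have m: "\<psi> \<in> hh \<phi>" unfolding hh_mem_iff \<psi>_def by blast
  have "\<psi> [\<one>, \<one>] = a \<oplus> \<phi> [\<one>, \<one>]"
    using a by (simp add: \<psi>_def cochain_add_apply chain2_apply del_one[OF l]) (simp add: L_def)
  also have "\<dots> = \<zero>" using Z2_D(4)[OF p] by (simp add: a_def A.l_neg)
  finally show thesis using that m hh_mem[OF p m] by blast
qed

end

section \<open>The isomorphism from Hochschild cohomology to the tangent space\<close>

text \<open>The addition of the tangent space is given by a description and not visibly a group
  operation. Its axioms are carried over from cohomology along the bijection.\<close>

lemma module_transport: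
  assumes M: "module K M" and f: "bij_betw f (carrier M) (carrier N)"
    and add: "\<And>u v. u \<in> carrier M \<Longrightarrow> v \<in> carrier M \<Longrightarrow> f (u \<oplus>\<^bsub>M\<^esub> v) = f u \<oplus>\<^bsub>N\<^esub> f v"
    and smult: "\<And>k u. k \<in> carrier K \<Longrightarrow> u \<in> carrier M \<Longrightarrow> f (k \<odot>\<^bsub>M\<^esub> u) = k \<odot>\<^bsub>N\<^esub> f u"
    and zero: "f \<zero>\<^bsub>M\<^esub> = \<zero>\<^bsub>N\<^esub>"
  shows "module K N"
proof -
  interpret M: module K M by fact
  have ex: "\<exists>u\<in>carrier M. w = f u" if "w \<in> carrier N" for w using that f unfolding bij_betw_def by blast
  have cl: "f u \<in> carrier N" if "u \<in> carrier M" for u using that f unfolding bij_betw_def by blast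
  have ag: "abelian_group N"
  proof (rule abelian_groupI)
    show "\<zero>\<^bsub>N\<^esub> \<in> carrier N" unfolding zero[symmetric] by (rule cl) simp
  next
    fix x y assume "x \<in> carrier N" "y \<in> carrier N"
    then obtain u v where p: "u \<in> carrier M" "x = f u" "v \<in> carrier M" "y = f v" using ex by metis
    show "x \<oplus>\<^bsub>N\<^esub> y \<in> carrier N" using p by (simp add: cl flip: add)
    show "x \<oplus>\<^bsub>N\<^esub> y = y \<oplus>\<^bsub>N\<^esub> x" using p M.a_comm[of u v] by (simp flip: add)
  next
    fix x y z assume "x \<in> carrier N" "y \<in> carrier N" "z \<in> carrier N"
    then obtain u v w where p: "u \<in> carrier M" "x = f u" "v \<in> carrier M" "y = f v" "w \<in> carrier M" "z = f w" using ex by metis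
    then show "x \<oplus>\<^bsub>N\<^esub> y \<oplus>\<^bsub>N\<^esub> z = x \<oplus>\<^bsub>N\<^esub> (y \<oplus>\<^bsub>N\<^esub> z)" by (simp add: M.a_assoc flip: add)
  next
    fix x assume "x \<in> carrier N"
    then obtain u where p: "u \<in> carrier M" "x = f u" using ex by metis
    show "\<zero>\<^bsub>N\<^esub> \<oplus>\<^bsub>N\<^esub> x = x" using p by (simp flip: add zero)
    show "\<exists>y\<in>carrier N. y \<oplus>\<^bsub>N\<^esub> x = \<zero>\<^bsub>N\<^esub>"
      using p by (intro bexI[of _ "f (\<ominus>\<^bsub>M\<^esub> u)"]) (simp_all add: cl M.l_neg flip: add zero)
  qed
  show ?thesis
  proof (rule moduleI[OF M.is_cring ag])
    fix a x assume "a \<in> carrier K" "x \<in> carrier N"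
    moreover from this obtain u where "u \<in> carrier M" "x = f u" using ex by metis
    ultimately show "a \<odot>\<^bsub>N\<^esub> x \<in> carrier N" by (simp add: cl flip: smult)
  next
    fix a b x assume *: "a \<in> carrier K" "b \<in> carrier K" "x \<in> carrier N"
    then obtain u where p: "u \<in> carrier M" "x = f u" using ex by metis
    show "(a \<oplus>\<^bsub>K\<^esub> b) \<odot>\<^bsub>N\<^esub> x = a \<odot>\<^bsub>N\<^esub> x \<oplus>\<^bsub>N\<^esub> b \<odot>\<^bsub>N\<^esub> x"
      using p * by (simp add: M.smult_l_distr flip: add smult)
    show "(a \<otimes>\<^bsub>K\<^esub> b) \<odot>\<^bsub>N\<^esub> x = a \<odot>\<^bsub>N\<^esub> (b \<odot>\<^bsub>N\<^esub> x)"
      using p * by (simp add: M.smult_assoc1 flip: smult)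
  next
    fix a x y assume *: "a \<in> carrier K" "x \<in> carrier N" "y \<in> carrier N"
    then obtain u v where p: "u \<in> carrier M" "x = f u" "v \<in> carrier M" "y = f v" using ex by metis
    show "a \<odot>\<^bsub>N\<^esub> (x \<oplus>\<^bsub>N\<^esub> y) = a \<odot>\<^bsub>N\<^esub> x \<oplus>\<^bsub>N\<^esub> a \<odot>\<^bsub>N\<^esub> y"
      using p * by (simp add: M.smult_r_distr flip: add smult)
  next
    fix x assume "x \<in> carrier N"
    then obtain u where "u \<in> carrier M" "x = f u" using ex by metis
    then show "\<one>\<^bsub>K\<^esub> \<odot>\<^bsub>N\<^esub> x = x" by (simp flip: smult)
  qed
qed

text \<open>A normalized cocycle is chosen in the class because these are the ones whose deformed
  constants satisfy the unit law. By \<open>tv_eq_iff\<close> the tangent vector is the same for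
  each choice.\<close>

definition hh_to_tan ::
  "('k, 'm) ring_scheme \<Rightarrow> ('k, 'a) module \<Rightarrow> (nat \<Rightarrow> 'a set) \<Rightarrow> (nat \<Rightarrow> 'a) \<Rightarrow>
     ('a list \<Rightarrow> 'a) set \<Rightarrow> ('k, 'u) tvec" where
  "hh_to_tan K A gr e u = tan_class K (alg_pt K A e)
     (stack_pt (deformed_consts K A e
        (SOME \<phi>. \<phi> \<in> u \<and> \<phi> \<in> cocycles K A gr 2 \<and> \<phi> [\<one>\<^bsub>A\<^esub>, \<one>\<^bsub>A\<^esub>] = \<zero>\<^bsub>A\<^esub>))) (\<lambda>S p. p)"

context based_algebra
begin

abbreviation "dc \<equiv> deformed_consts K A e"

lemma deformed_consts_pairc: "dc \<phi> = pairc sc (consts_of (\<lambda>x y. \<phi> [x, y]))"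
  by (simp add: deformed_consts_def pairc_def consts_of_def)

definition normalized :: "('a list \<Rightarrow> 'a) \<Rightarrow> bool" where
  "normalized \<phi> \<longleftrightarrow> \<phi> \<in> Z2 \<and> \<phi> [\<one>, \<one>] = \<zero>"

lemma normalizedD: "normalized \<phi> \<Longrightarrow> \<phi> \<in> Z2" "normalized \<phi> \<Longrightarrow> \<phi> [\<one>, \<one>] = \<zero>"
  by (simp_all add: normalized_def)

lemma deformed_consts_deformation: "normalized \<phi> \<Longrightarrow> dc \<phi> \<in> deformations K sc"
  using deformation_iff[OF Z2_D(2)] Z2_D(3)
  by (simp add: normalized_def deformations_def deformed_consts_pairc sconst_map_pairc)

text \<open>The \<epsilon>-part of c respects degrees and is thus the table of a bilinear map.
  Membership of c in X_4 makes this map a normalized cocycle.\<close>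

lemma deformation_is_deformed_consts:
  assumes c: "c \<in> deformations K sc"
  obtains \<phi> where "normalized \<phi>" "dc \<phi> = c"
proof -
  have cX: "c \<in> X_pts (dual_numbers K)" and cf: "sconst_map fst c = sc" using c by (simp_all add: deformations_def)
  define t where "t = sconst_map snd c"
  have cs: "c \<in> sconsts (dual_numbers K)" using cX by simp
  have t: "t \<in> sconsts K"
    unfolding sconsts_def mem_Collect_eq
  proof (intro conjI allI impI)
    fix i j k
    have "c i j k \<in> carrier (dual_numbers K)" by (rule sconsts_carrier[OF cs])
    then show "t i j k \<in> carrier K" by (auto simp: t_def sconst_map_def)
  next
    fix i j k assume "\<not> (i < 16 \<and> j < 16 \<and> k < 16 \<and> bdeg k = bdeg i + bdeg j)"
    then have "c i j k = \<zero>\<^bsub>dual_numbers K\<^esub>" using cX unfolding X_pts_def by blast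
    then show "t i j k = \<zero>\<^bsub>K\<^esub>" by (simp add: t_def sconst_map_def)
  qed
  define b where "b = bil_of t"
  have b: "bilinear b" "consts_of b = t" unfolding b_def by (rule bil_of_bilinear[OF t], rule consts_of_bil_of[OF t])
  have ce: "c = pairc sc (consts_of b)" unfolding b(2) t_def by (rule pairc_surj[OF cf])
  have bc: "bil_cocycle b" "b \<one> \<one> = \<zero>" using deformation_iff[OF b(1)] cX unfolding ce by blast+
  have "normalized (chain2 A b)"
    using chain2_cocycle[OF b(1) bc(1)] bc(2) by (simp add: normalized_def chain2_apply)
  moreover have "dc (chain2 A b) = c"
    unfolding ce deformed_consts_pairc
    by (intro arg_cong2[where f = pairc] refl ext) (simp add: consts_of_def chain2_apply e_carrier)
  ultimately show thesis by (rule that)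
qed

lemma deformed_consts_apply:
  "dc \<phi> i j k = (sc i j k, if i < 16 \<and> j < 16 then co (\<phi> [e i, e j]) k else \<zero>\<^bsub>K\<^esub>)"
  by (simp add: deformed_consts_def)

lemma normalized_add: "normalized \<phi> \<Longrightarrow> normalized \<psi> \<Longrightarrow> normalized (\<phi> \<oplus>\<^bsub>C2\<^esub> \<psi>)"
  by (simp add: normalized_def Z2_add cochain_add_apply)

lemma normalized_smult: "k \<in> carrier K \<Longrightarrow> normalized \<phi> \<Longrightarrow> normalized (k \<odot>\<^bsub>C2\<^esub> \<phi>)"
  by (simp add: normalized_def Z2_smult cochain_smult_apply)

lemma normalized_zero: "normalized \<zero>\<^bsub>C2\<^esub>"
  by (simp add: normalized_def Z2_zero cochain_zero_apply)

lemma deformed_consts_add: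
  assumes "normalized \<phi>" "normalized \<psi>"
  shows "dc (\<phi> \<oplus>\<^bsub>C2\<^esub> \<psi>) i j k = (sc i j k, snd (dc \<phi> i j k) \<oplus>\<^bsub>K\<^esub> snd (dc \<psi> i j k))"
  using Z2_D(4)[OF normalizedD(1)[OF assms(1)]] Z2_D(4)[OF normalizedD(1)[OF assms(2)]]
  by (simp add: deformed_consts_apply cochain_add_apply e_carrier co_add)

lemma deformed_consts_smult:
  assumes "normalized \<phi>" "a \<in> carrier K"
  shows "dc (a \<odot>\<^bsub>C2\<^esub> \<phi>) i j k = (sc i j k, a \<otimes>\<^bsub>K\<^esub> snd (dc \<phi> i j k))"
  using Z2_D(4)[OF normalizedD(1)[OF assms(1)]] assms(2)
  by (simp add: deformed_consts_apply cochain_smult_apply e_carrier co_smult)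

lemma deformed_consts_zero: "dc \<zero>\<^bsub>C2\<^esub> i j k = (sc i j k, \<zero>\<^bsub>K\<^esub>)"
  by (simp add: deformed_consts_apply cochain_zero_apply e_carrier co_zero)

lemma HH0_normalized:
  assumes "u \<in> carrier (HH0 K A gr 2)" obtains \<phi> where "normalized \<phi>" "u = hh \<phi>"
proof -
  obtain \<phi> where p: "\<phi> \<in> Z2" "u = hh \<phi>" using assms unfolding HH0_simps by blast
  obtain \<psi> where "\<psi> \<in> Z2" "\<psi> [\<one>, \<one>] = \<zero>" "hh \<psi> = hh \<phi>" by (rule normalized_representative[OF p(1)])
  then show thesis using that p(2) by (simp add: normalized_def)
qed

end

section \<open>The comparison at one algebra\<close>

locale algebra_point = based_algebra K A gr e + universe K \<iota>
  for K :: "('k, 'm) ring_scheme" and A :: "('k, 'a) module" (structure) and gr e and \<iota> :: "'k \<Rightarrow> 'u"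
begin

abbreviation tv :: "('a list \<Rightarrow> 'a) \<Rightarrow> ('k, 'u) tvec" where
  "tv \<phi> \<equiv> def_class K sc (dc \<phi>)"

abbreviation T :: "('k, ('k, 'u) tvec) module" where
  "T \<equiv> tangent_space K (alg_pt K A e)"

text \<open>Equal tangent vectors are related by a matrix in G(K[\<epsilon>]) of the form 1 +
  \<epsilon> L, which changes the cocycle by the coboundary of L. The delicate point in both
  directions is that L 1 = 0: it comes from the shape of G in one, and from the normalization of the
  two cocycles in the other.\<close>

lemma tv_eq_iff:
  assumes p: "normalized \<phi>" and q: "normalized \<psi>"
  shows "tv \<phi> = tv \<psi> \<longleftrightarrow> hh \<phi> = hh \<psi>"
proof -
  note pZ = normalizedD(1)[OF p] and qZ = normalizedD(1)[OF q]
  let ?D = "dual_numbers K"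
  interpret D: cring ?D by (rule K.dual_numbers_cring)
  have crit: "pairm (mat_one K) (lin_mat L) \<in> G_pts ?D"
      "X_act ?D (pairm (mat_one K) (lin_mat L)) (dc \<psi>) = dc \<phi> \<longleftrightarrow> \<psi> = chain2 A (del L) \<oplus>\<^bsub>C2\<^esub> \<phi>"
    if L: "graded_linear L" "L \<one> = \<zero>" for L
  proof -
    show "pairm (mat_one K) (lin_mat L) \<in> G_pts ?D" by (rule X_act_one_plus_iff(1)[OF L Z2_D(2)[OF pZ] Z2_D(2)[OF qZ]])
    have l: "bilinear (del L)" by (rule del_bilinear[OF L(1)])
    have "X_act ?D (pairm (mat_one K) (lin_mat L)) (dc \<psi>) = dc \<phi> \<longleftrightarrow>
        (\<forall>x\<in>carrier A. \<forall>y\<in>carrier A. \<psi> [x, y] = \<phi> [x, y] \<oplus> del L x y)"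
      unfolding deformed_consts_pairc by (rule X_act_one_plus_iff(2)[OF L Z2_D(2)[OF pZ] Z2_D(2)[OF qZ]])
    also have "\<dots> \<longleftrightarrow> (\<forall>x\<in>carrier A. \<forall>y\<in>carrier A. \<psi> [x, y] = (chain2 A (del L) \<oplus>\<^bsub>C2\<^esub> \<phi>) [x, y])"
      using Z2_D(4)[OF pZ] bilinear_closed[OF l] by (simp add: cochain_add_apply chain2_apply A.a_comm)
    also have "\<dots> \<longleftrightarrow> \<psi> = chain2 A (del L) \<oplus>\<^bsub>C2\<^esub> \<phi>"
      using chain2_eqI[OF Z2_D(1)[OF qZ] cochain_add_apply(2)] by blast
    finally show "X_act ?D (pairm (mat_one K) (lin_mat L)) (dc \<psi>) = dc \<phi> \<longleftrightarrow> \<psi> = chain2 A (del L) \<oplus>\<^bsub>C2\<^esub> \<phi>" .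
  qed
  show ?thesis
    unfolding def_class_eq_iff[OF sc_X_pts deformed_consts_deformation[OF p] deformed_consts_deformation[OF q]]
      hh_eq_iff[OF pZ qZ]
  proof
    assume "\<exists>g\<in>G_pts ?D. mat_map fst g = mat_one K \<and> X_act ?D g (dc \<psi>) = dc \<phi>"
    then obtain g where g: "g \<in> G_pts ?D" "mat_map fst g = mat_one K" "X_act ?D g (dc \<psi>) = dc \<phi>" by blast
    define s where "s = mat_map snd g"
    have gs: "g = pairm (mat_one K) s" unfolding g(2)[symmetric] s_def by (simp add: pairm_def mat_map_def)
    have s: "s \<in> mats K"
      unfolding mats_def mem_Collect_eq
    proof (intro conjI allI impI)
      fix i j :: nat
      have "g i j \<in> carrier ?D" using D.G_pts_mats[OF g(1)] by (rule mats_carrier)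
      then show "s i j \<in> carrier K" by (auto simp: s_def mat_map_def)
    next
      fix i j :: nat assume "\<not> (i < 16 \<and> j < (16::nat))"
      then have "g i j = \<zero>\<^bsub>?D\<^esub>" using D.G_pts_mats[OF g(1)] unfolding mats_def by blast
      then show "s i j = \<zero>\<^bsub>K\<^esub>" by (simp add: s_def mat_map_def)
    qed
    have sd: "s i j = \<zero>\<^bsub>K\<^esub>" if "bdeg i \<noteq> bdeg j" for i j
      using D.G_pts_block[OF g(1) that] by (simp add: s_def mat_map_def)
    have s0: "s 0 0 = \<zero>\<^bsub>K\<^esub>" using D.G_pts_00[OF g(1)] by (simp add: s_def mat_map_def)
    obtain L where L: "graded_linear L" "lin_mat L = s" using lin_mat_surj[OF s sd] by blast
    \<comment> \<open>The coordinates of \<open>L \<one>\<close> form column 0 of s. It vanishes at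
      index 0 because \<open>g 0 0\<close> is 1, and elsewhere by degree.\<close>
    have L1: "L \<one> = \<zero>"
    proof (rule co_eqI)
      show "L \<one> \<in> carrier A" using L(1) by (simp add: graded_linear_def linear_closed)
      fix k
      have "co (L \<one>) k = s k 0" unfolding L(2)[symmetric] by (simp add: lin_mat_def e_0)
      also have "\<dots> = \<zero>\<^bsub>K\<^esub>" using s0 sd[of k 0] by (cases "k = 0") simp_all
      finally show "co (L \<one>) k = co \<zero> k" by (simp add: co_zero)
    qed simp
    have "\<psi> = chain2 A (del L) \<oplus>\<^bsub>C2\<^esub> \<phi>" using crit(2)[OF L(1) L1] g(3) unfolding gs L(2) by blast
    then show "\<exists>b\<in>B2. \<psi> = b \<oplus>\<^bsub>C2\<^esub> \<phi>" using L(1) coboundaries_2_iff by blast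
  next
    assume "\<exists>b\<in>B2. \<psi> = b \<oplus>\<^bsub>C2\<^esub> \<phi>"
    then obtain b where b: "b \<in> B2" "\<psi> = b \<oplus>\<^bsub>C2\<^esub> \<phi>" ..
    obtain L where L: "graded_linear L" and bL: "b = chain2 A (del L)" using b(1) unfolding coboundaries_2_iff by (elim exE conjE)
    note e = b(2)[unfolded bL]
    have l: "linear L" using L by (simp add: graded_linear_def)
    \<comment> \<open>The cocycle \<phi> vanishes at (1, 1), so the value of \<psi> there is that of
      the coboundary.\<close>
    have "\<psi> [\<one>, \<one>] = L \<one>"
      using normalizedD(2)[OF p] linear_closed[OF l] unfolding e
      by (simp add: cochain_add_apply chain2_apply del_one[OF l])
    then have L1: "L \<one> = \<zero>" using normalizedD(2)[OF q] by simp
    have f: "mat_map fst (pairm (mat_one K) (lin_mat L)) = mat_one K" by (simp add: mat_map_def pairm_def)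
    show "\<exists>g\<in>G_pts ?D. mat_map fst g = mat_one K \<and> X_act ?D g (dc \<psi>) = dc \<phi>"
      using crit(2)[OF L L1] f e by (intro bexI[OF _ crit(1)[OF L L1]]) simp
  qed
qed

lemma hh_to_tan_hh: assumes p: "normalized \<phi>" shows "hh_to_tan K A gr e (hh \<phi>) = tv \<phi>"
proof -
  let ?P = "\<lambda>\<psi>. \<psi> \<in> hh \<phi> \<and> \<psi> \<in> Z2 \<and> \<psi> [\<one>, \<one>] = \<zero>"
  have "?P (SOME \<psi>. ?P \<psi>)" by (rule someI[of ?P \<phi>]) (use p hh_self in \<open>simp add: normalized_def\<close>)
  then have "normalized (SOME \<psi>. ?P \<psi>)" "hh (SOME \<psi>. ?P \<psi>) = hh \<phi>"
    using hh_mem[OF normalizedD(1)[OF p]] by (simp_all add: normalized_def)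
  then have "tv (SOME \<psi>. ?P \<psi>) = tv \<phi>" using tv_eq_iff[OF _ p] by simp
  then show ?thesis by (simp add: hh_to_tan_def alg_pt_def def_class_def)
qed

lemma T_carrier: "carrier T = tv ` {\<phi>. normalized \<phi>}"
proof -
  have "carrier T = def_class K sc ` deformations K sc" unfolding alg_pt_def by (rule tangent_space_carrier[OF sc_X_pts])
  also have "deformations K sc = dc ` {\<phi>. normalized \<phi>}"
    using deformed_consts_deformation deformation_is_deformed_consts by blast
  finally show ?thesis by (simp add: image_image)
qed

lemma hh_add_cong:
  assumes "\<phi> \<in> Z2" "\<psi> \<in> Z2" "\<phi>' \<in> Z2" "\<psi>' \<in> Z2" "hh \<phi> = hh \<phi>'" "hh \<psi> = hh \<psi>'"
  shows "hh (\<phi> \<oplus>\<^bsub>C2\<^esub> \<psi>) = hh (\<phi>' \<oplus>\<^bsub>C2\<^esub> \<psi>')"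
  using assms by (simp flip: HH0_add)

text \<open>The deformation with \<phi> as coefficient of \<epsilon>1 and \<psi> as coefficient of
  \<epsilon>2 is a witness for the sum. Any other witness has coefficients in the same two classes,
  so its sum is in the same class; this makes the description of the sum unique.\<close>

lemma T_add:
  assumes p: "normalized \<phi>" and q: "normalized \<psi>"
  shows "tv \<phi> \<oplus>\<^bsub>T\<^esub> tv \<psi> = tv (\<phi> \<oplus>\<^bsub>C2\<^esub> \<psi>)"
proof -
  let ?D = "dual_numbers K"
  have fst_dc: "fst (dc \<chi> i j k) = sc i j k" for \<chi> i j k by (simp add: deformed_consts_apply)
  have "(THE w. tan_sum K (stack_pt sc) (tv \<phi>) (tv \<psi>) w) = tv (\<phi> \<oplus>\<^bsub>C2\<^esub> \<psi>)"
  proof (rule the_equality)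
    define c :: "('k \<times> 'k \<times> 'k) sconst" where "c = K.triplec sc (consts_of (\<lambda>x y. \<phi> [x, y])) (consts_of (\<lambda>x y. \<psi> [x, y]))"
    have X: "c \<in> X_pts (dual_numbers2 K)"
      unfolding c_def
    proof (rule K.triplec_X_pts[OF sc_X_pts])
      show "consts_of (\<lambda>x y. \<phi> [x, y]) \<in> sconsts K" "consts_of (\<lambda>x y. \<psi> [x, y]) \<in> sconsts K"
        using p q by (simp_all add: normalized_def Z2_D(2) consts_of_sconsts)
      show "pairc sc (consts_of (\<lambda>x y. \<phi> [x, y])) \<in> X_pts ?D" "pairc sc (consts_of (\<lambda>x y. \<psi> [x, y])) \<in> X_pts ?D"
        using deformed_consts_deformation[OF p] deformed_consts_deformation[OF q]
        by (simp_all add: deformations_def deformed_consts_pairc)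
    qed
    have "c i j k = (sc i j k, snd (dc \<phi> i j k), snd (dc \<psi> i j k))" for i j k
      by (simp add: c_def K.triplec_def deformed_consts_pairc pairc_def)
    then have m: "sconst_map fst c = sc" "sconst_map (\<lambda>(a, b, c). (a, b)) c = dc \<phi>"
        "sconst_map (\<lambda>(a, b, c). (a, c)) c = dc \<psi>" "sconst_map (\<lambda>(a, b, c). (a, b \<oplus>\<^bsub>K\<^esub> c)) c = dc (\<phi> \<oplus>\<^bsub>C2\<^esub> \<psi>)"
      by (simp_all add: sconst_map_def fun_eq_iff deformed_consts_add[OF p q] prod_eq_iff fst_dc split_def)
    show "tan_sum K (stack_pt sc) (tv \<phi>) (tv \<psi>) (tv (\<phi> \<oplus>\<^bsub>C2\<^esub> \<psi>))"
      unfolding tan_sum_iff[OF sc_X_pts] using X m by (intro bexI[of _ c]) simp_all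
  next
    fix w assume "tan_sum K (stack_pt sc) (tv \<phi>) (tv \<psi>) w"
    then obtain c where c: "c \<in> X_pts (dual_numbers2 K)" "sconst_map fst c = sc"
      and u: "tv \<phi> = def_class K sc (sconst_map (\<lambda>(a, b, c). (a, b)) c)"
      and v: "tv \<psi> = def_class K sc (sconst_map (\<lambda>(a, b, c). (a, c)) c)"
      and w: "w = def_class K sc (sconst_map (\<lambda>(a, b, c). (a, b \<oplus>\<^bsub>K\<^esub> c)) c)"
      unfolding tan_sum_iff[OF sc_X_pts] by blast
    interpret p: ring_hom_cring "dual_numbers2 K" ?D "\<lambda>(a, b, c). (a, b)"
      by (rule ring_hom_cringI2[OF K.dual_numbers2_cring K.dual_numbers_cring K.dual_numbers2_homs(3)])
    interpret q: ring_hom_cring "dual_numbers2 K" ?D "\<lambda>(a, b, c). (a, c)"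
      by (rule ring_hom_cringI2[OF K.dual_numbers2_cring K.dual_numbers_cring K.dual_numbers2_homs(4)])
    have cf: "fst (c i j k) = sc i j k" for i j k using c(2) by (simp add: sconst_map_def fun_eq_iff)
    have d: "sconst_map (\<lambda>(a, b, c). (a, b)) c \<in> deformations K sc" "sconst_map (\<lambda>(a, b, c). (a, c)) c \<in> deformations K sc"
      unfolding deformations_def
      using p.sconst_map_X_pts[OF c(1)] q.sconst_map_X_pts[OF c(1)] cf by (simp_all add: sconst_map_def split_def)
    obtain \<phi>' where p': "normalized \<phi>'" "dc \<phi>' = sconst_map (\<lambda>(a, b, c). (a, b)) c" by (rule deformation_is_deformed_consts[OF d(1)])
    obtain \<psi>' where q': "normalized \<psi>'" "dc \<psi>' = sconst_map (\<lambda>(a, b, c). (a, c)) c" by (rule deformation_is_deformed_consts[OF d(2)])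
    have "sconst_map (\<lambda>(a, b, c). (a, b \<oplus>\<^bsub>K\<^esub> c)) c = dc (\<phi>' \<oplus>\<^bsub>C2\<^esub> \<psi>')"
      by (intro ext) (simp add: deformed_consts_add[OF p'(1) q'(1)] p'(2) q'(2) sconst_map_def split_def cf)
    then have w': "w = tv (\<phi>' \<oplus>\<^bsub>C2\<^esub> \<psi>')" using w by simp
    have "hh \<phi> = hh \<phi>'" "hh \<psi> = hh \<psi>'"
      using u v tv_eq_iff[OF p p'(1)] tv_eq_iff[OF q q'(1)] unfolding p'(2) q'(2) by simp_all
    then have "hh (\<phi> \<oplus>\<^bsub>C2\<^esub> \<psi>) = hh (\<phi>' \<oplus>\<^bsub>C2\<^esub> \<psi>')" using p q p'(1) q'(1) by (intro hh_add_cong normalizedD)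
    then show "w = tv (\<phi> \<oplus>\<^bsub>C2\<^esub> \<psi>)"
      unfolding w' using tv_eq_iff[OF normalized_add[OF p q] normalized_add[OF p'(1) q'(1)]] by simp
  qed
  then show ?thesis by (simp add: tangent_space_def alg_pt_def)
qed

lemma T_smult:
  assumes a: "a \<in> carrier K" and p: "normalized \<phi>"
  shows "a \<odot>\<^bsub>T\<^esub> tv \<phi> = tv (a \<odot>\<^bsub>C2\<^esub> \<phi>)"
proof -
  have "sconst_map (\<lambda>(b, d). (b, a \<otimes>\<^bsub>K\<^esub> d)) (dc \<phi>) = dc (a \<odot>\<^bsub>C2\<^esub> \<phi>)"
    by (intro ext) (simp add: deformed_consts_smult[OF p a] sconst_map_def split_def, simp add: deformed_consts_apply)
  then show ?thesis
    unfolding alg_pt_def using tan_smult_def_class[OF sc_X_pts deformed_consts_deformation[OF p] a] by simp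
qed

lemma T_zero: "\<zero>\<^bsub>T\<^esub> = tv \<zero>\<^bsub>C2\<^esub>"
proof -
  have "sconst_map (\<lambda>a. (a, \<zero>\<^bsub>K\<^esub>)) sc = dc \<zero>\<^bsub>C2\<^esub>"
    by (intro ext) (simp add: deformed_consts_zero sconst_map_def)
  then show ?thesis by (simp add: tangent_space_def alg_pt_def def_class_def pull_stack_pt)
qed

text \<open>On normalized representatives the map sends \<phi> to the class of its deformation, and
  normalized cocycles are closed under sums and multiples. So linearity is checked on
  representatives.\<close>

lemma hh_to_tan_iso: "hh_to_tan K A gr e \<in> module_iso K (HH0 K A gr 2) T"
proof -
  let ?H = "HH0 K A gr 2" and ?f = "hh_to_tan K A gr e :: _ \<Rightarrow> ('k, 'u) tvec"
  have H: "hh \<phi> \<in> carrier ?H" if "normalized \<phi>" for \<phi> using normalizedD(1)[OF that] by (simp add: HH0_simps)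
  have bij: "bij_betw ?f (carrier ?H) (carrier T)"
  proof (rule bij_betw_imageI)
    show "inj_on ?f (carrier ?H)"
    proof (rule inj_onI)
      fix u v assume *: "u \<in> carrier ?H" "v \<in> carrier ?H" "?f u = ?f v"
      obtain \<phi> where p: "normalized \<phi>" "u = hh \<phi>" by (rule HH0_normalized[OF *(1)])
      obtain \<psi> where q: "normalized \<psi>" "v = hh \<psi>" by (rule HH0_normalized[OF *(2)])
      show "u = v" using *(3) tv_eq_iff[OF p(1) q(1)] p q by (simp add: hh_to_tan_hh)
    qed
    show "?f ` carrier ?H = carrier T"
      unfolding T_carrier
    proof (intro equalityI subsetI)
      fix w assume "w \<in> ?f ` carrier ?H"
      then obtain u where u: "u \<in> carrier ?H" "w = ?f u" by blast
      obtain \<phi> where p: "normalized \<phi>" "u = hh \<phi>" by (rule HH0_normalized[OF u(1)])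
      show "w \<in> tv ` {\<phi>. normalized \<phi>}" using p u by (simp add: hh_to_tan_hh)
    next
      fix w assume "w \<in> tv ` {\<phi>. normalized \<phi>}"
      then obtain \<phi> where "normalized \<phi>" "w = tv \<phi>" by blast
      then have "w = ?f (hh \<phi>)" "hh \<phi> \<in> carrier ?H" using H by (simp_all add: hh_to_tan_hh)
      then show "w \<in> ?f ` carrier ?H" by blast
    qed
  qed
  have add: "?f (u \<oplus>\<^bsub>?H\<^esub> v) = ?f u \<oplus>\<^bsub>T\<^esub> ?f v" if u: "u \<in> carrier ?H" and v: "v \<in> carrier ?H" for u v
  proof -
    obtain \<phi> where p: "normalized \<phi>" "u = hh \<phi>" by (rule HH0_normalized[OF u])
    obtain \<psi> where q: "normalized \<psi>" "v = hh \<psi>" by (rule HH0_normalized[OF v])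
    show ?thesis
      unfolding p(2) q(2) HH0_add[OF normalizedD(1)[OF p(1)] normalizedD(1)[OF q(1)]]
        hh_to_tan_hh[OF p(1)] hh_to_tan_hh[OF q(1)] hh_to_tan_hh[OF normalized_add[OF p(1) q(1)]]
      by (rule T_add[OF p(1) q(1), symmetric])
  qed
  have smult: "?f (k \<odot>\<^bsub>?H\<^esub> u) = k \<odot>\<^bsub>T\<^esub> ?f u" if k: "k \<in> carrier K" and u: "u \<in> carrier ?H" for k u
  proof -
    obtain \<phi> where p: "normalized \<phi>" "u = hh \<phi>" by (rule HH0_normalized[OF u])
    show ?thesis
      unfolding p(2) HH0_smult[OF k normalizedD(1)[OF p(1)]]
        hh_to_tan_hh[OF p(1)] hh_to_tan_hh[OF normalized_smult[OF k p(1)]]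
      by (rule T_smult[OF k p(1), symmetric])
  qed
  have zero: "?f \<zero>\<^bsub>?H\<^esub> = \<zero>\<^bsub>T\<^esub>"
    unfolding HH0_simps(2) hh_zero[symmetric] T_zero by (rule hh_to_tan_hh[OF normalized_zero])
  have "module K T" by (rule module_transport[OF HH0_module bij add smult zero])
  then show ?thesis using HH0_module bij add smult unfolding module_iso_def by blast
qed

end

section \<open>Naturality\<close>

lemma graded_alg_iso_inv:
  assumes A: "ring A" and M: "module K A" and gr: "\<And>a i. a \<in> gr i \<Longrightarrow> a \<in> carrier A"
    and f: "graded_alg_iso K A gr B gr' f"
  shows "graded_alg_iso K B gr' A gr (inv_into (carrier A) f)"
proof -
  interpret A: ring A by (rule A)
  interpret M: module K A by (rule M)
  let ?h = "inv_into (carrier A) f"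
  have r: "f \<in> ring_hom A B" and bij: "bij_betw f (carrier A) (carrier B)"
    and s: "\<forall>k\<in>carrier K. \<forall>a\<in>carrier A. f (k \<odot>\<^bsub>A\<^esub> a) = k \<odot>\<^bsub>B\<^esub> f a"
    and g: "\<forall>i. f ` gr i = gr' i" using f unfolding graded_alg_iso_def by simp_all
  have hf: "?h (f x) = x" if "x \<in> carrier A" for x using that bij by (simp add: bij_betw_def)
  have ex: "\<exists>x\<in>carrier A. y = f x" if "y \<in> carrier B" for y using that bij unfolding bij_betw_def by blast
  have "?h \<in> ring_hom B A"
  proof (rule ring_hom_memI)
    show "?h \<one>\<^bsub>B\<^esub> = \<one>\<^bsub>A\<^esub>" using hf[of "\<one>\<^bsub>A\<^esub>"] by (simp add: ring_hom_one[OF r])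
    show "?h x \<in> carrier A" if "x \<in> carrier B" for x using ex[OF that] hf by auto
  next
    fix x y assume "x \<in> carrier B" "y \<in> carrier B"
    then obtain a b where ab: "a \<in> carrier A" "x = f a" "b \<in> carrier A" "y = f b" using ex by metis
    show "?h (x \<otimes>\<^bsub>B\<^esub> y) = ?h x \<otimes>\<^bsub>A\<^esub> ?h y" using ab by (simp add: hf flip: ring_hom_mult[OF r])
    show "?h (x \<oplus>\<^bsub>B\<^esub> y) = ?h x \<oplus>\<^bsub>A\<^esub> ?h y" using ab by (simp add: hf flip: ring_hom_add[OF r])
  qed
  moreover have "?h (k \<odot>\<^bsub>B\<^esub> y) = k \<odot>\<^bsub>A\<^esub> ?h y" if k: "k \<in> carrier K" and y: "y \<in> carrier B" for k y
  proof -
    obtain a where a: "a \<in> carrier A" "y = f a" using ex[OF y] ..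
    then have "k \<odot>\<^bsub>B\<^esub> y = f (k \<odot>\<^bsub>A\<^esub> a)" using s k by simp
    then show ?thesis using a k by (simp add: hf)
  qed
  moreover have "?h ` gr' i = gr i" for i
  proof -
    have "?h ` gr' i = (\<lambda>x. ?h (f x)) ` gr i" using g by (simp flip: image_image)
    also have "\<dots> = (\<lambda>x. x) ` gr i" by (rule image_cong[OF refl]) (rule hf[OF gr])
    finally show ?thesis by simp
  qed
  ultimately show ?thesis using bij_betw_inv_into[OF bij] by (simp add: graded_alg_iso_def)
qed

text \<open>The inverse h is a parameter and the assumptions are symmetric, so by \<open>sym\<close>
  every statement about f is available for h as well.\<close>

locale algebra_iso = A: based_algebra K A gr e + B: based_algebra K B gr' e'
  for K :: "('k, 'm) ring_scheme" and A :: "('k, 'a) module" and gr e and B :: "('k, 'b) module" and gr' e' +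
  fixes f :: "'a \<Rightarrow> 'b" and h :: "'b \<Rightarrow> 'a"
  assumes f: "graded_alg_iso K A gr B gr' f" and h: "graded_alg_iso K B gr' A gr h"
    and hf: "x \<in> carrier A \<Longrightarrow> h (f x) = x" and fh: "y \<in> carrier B \<Longrightarrow> f (h y) = y"
begin

lemma f_props [simp]:
  "x \<in> carrier A \<Longrightarrow> f x \<in> carrier B"
  "x \<in> carrier A \<Longrightarrow> y \<in> carrier A \<Longrightarrow> f (x \<oplus>\<^bsub>A\<^esub> y) = f x \<oplus>\<^bsub>B\<^esub> f y"
  "x \<in> carrier A \<Longrightarrow> y \<in> carrier A \<Longrightarrow> f (x \<otimes>\<^bsub>A\<^esub> y) = f x \<otimes>\<^bsub>B\<^esub> f y"
  "f \<one>\<^bsub>A\<^esub> = \<one>\<^bsub>B\<^esub>"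
  "k \<in> carrier K \<Longrightarrow> x \<in> carrier A \<Longrightarrow> f (k \<odot>\<^bsub>A\<^esub> x) = k \<odot>\<^bsub>B\<^esub> f x"
  "x \<in> gr i \<Longrightarrow> f x \<in> gr' i"
proof -
  have r: "f \<in> ring_hom A B" and s: "\<forall>k\<in>carrier K. \<forall>a\<in>carrier A. f (k \<odot>\<^bsub>A\<^esub> a) = k \<odot>\<^bsub>B\<^esub> f a"
    and g: "\<forall>i. f ` gr i = gr' i" using f unfolding graded_alg_iso_def by simp_all
  show "x \<in> carrier A \<Longrightarrow> f x \<in> carrier B" by (rule ring_hom_closed[OF r])
  show "x \<in> carrier A \<Longrightarrow> y \<in> carrier A \<Longrightarrow> f (x \<oplus>\<^bsub>A\<^esub> y) = f x \<oplus>\<^bsub>B\<^esub> f y" by (rule ring_hom_add[OF r])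
  show "x \<in> carrier A \<Longrightarrow> y \<in> carrier A \<Longrightarrow> f (x \<otimes>\<^bsub>A\<^esub> y) = f x \<otimes>\<^bsub>B\<^esub> f y" by (rule ring_hom_mult[OF r])
  show "f \<one>\<^bsub>A\<^esub> = \<one>\<^bsub>B\<^esub>" by (rule ring_hom_one[OF r])
  show "k \<in> carrier K \<Longrightarrow> x \<in> carrier A \<Longrightarrow> f (k \<odot>\<^bsub>A\<^esub> x) = k \<odot>\<^bsub>B\<^esub> f x" using s by blast
  show "x \<in> gr i \<Longrightarrow> f x \<in> gr' i" using g by blast
qed

lemma sym: "algebra_iso K B gr' e' A gr e h f"
  by unfold_locales (simp_all add: f h hf fh)

lemma h_props [simp]:
  "x \<in> carrier B \<Longrightarrow> h x \<in> carrier A"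
  "x \<in> carrier B \<Longrightarrow> y \<in> carrier B \<Longrightarrow> h (x \<oplus>\<^bsub>B\<^esub> y) = h x \<oplus>\<^bsub>A\<^esub> h y"
  "x \<in> carrier B \<Longrightarrow> y \<in> carrier B \<Longrightarrow> h (x \<otimes>\<^bsub>B\<^esub> y) = h x \<otimes>\<^bsub>A\<^esub> h y"
  "h \<one>\<^bsub>B\<^esub> = \<one>\<^bsub>A\<^esub>"
  "k \<in> carrier K \<Longrightarrow> x \<in> carrier B \<Longrightarrow> h (k \<odot>\<^bsub>B\<^esub> x) = k \<odot>\<^bsub>A\<^esub> h x"
  "x \<in> gr' i \<Longrightarrow> h x \<in> gr i"
  by (fact algebra_iso.f_props[OF sym])+

lemma f_neg: assumes x: "x \<in> carrier A" shows "f (\<ominus>\<^bsub>A\<^esub> x) = \<ominus>\<^bsub>B\<^esub> f x"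
proof -
  have "f ((\<ominus>\<^bsub>K\<^esub> \<one>\<^bsub>K\<^esub>) \<odot>\<^bsub>A\<^esub> x) = (\<ominus>\<^bsub>K\<^esub> \<one>\<^bsub>K\<^esub>) \<odot>\<^bsub>B\<^esub> f x" using x by simp
  then show ?thesis using x by (simp add: A.M.smult_l_minus B.M.smult_l_minus del: f_props(5))
qed

lemma f_zero: "f \<zero>\<^bsub>A\<^esub> = \<zero>\<^bsub>B\<^esub>"
  using f_props(5)[of "\<zero>\<^bsub>K\<^esub>" "\<zero>\<^bsub>A\<^esub>"] by simp

text \<open>Transport of a 2-cochain along f. It is what \<open>HH0_map\<close> does to each member
  of a class.\<close>

definition push :: "('a list \<Rightarrow> 'a) \<Rightarrow> 'b list \<Rightarrow> 'b" where
  "push \<phi> = chain2 B (\<lambda>x y. f (\<phi> [h x, h y]))"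

lemma push_apply: "x \<in> carrier B \<Longrightarrow> y \<in> carrier B \<Longrightarrow> push \<phi> [x, y] = f (\<phi> [h x, h y])"
  unfolding push_def by (rule chain2_apply)

lemma push_linear: "A.linear L \<Longrightarrow> B.linear (\<lambda>x. f (L (h x)))"
  by (rule B.linearI) (simp_all add: A.linear_closed A.linear_map_add A.linear_map_smult)

lemma push_bilinear: assumes b: "A.bilinear b" shows "B.bilinear (\<lambda>x y. f (b (h x) (h y)))"
proof (rule B.bilinearI)
  fix x assume "x \<in> carrier B"
  then have "h x \<in> carrier A" by simp
  then show "B.linear (\<lambda>y. f (b (h x) (h y)))" "B.linear (\<lambda>y. f (b (h y) (h x)))"
    using push_linear[OF A.bilinear_linear(1)[OF b]] push_linear[OF A.bilinear_linear(2)[OF b]] by simp_all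
next
  fix i j x y assume "x \<in> gr' i" "y \<in> gr' j"
  then show "f (b (h x) (h y)) \<in> gr' (i + j)" by (intro f_props(6) A.bilinear_gr[OF b] h_props(6))
qed

lemma push_Z2: assumes p: "\<phi> \<in> A.Z2" shows "push \<phi> \<in> B.Z2"
  unfolding push_def
proof (rule B.chain2_cocycle)
  show "B.bilinear (\<lambda>x y. f (\<phi> [h x, h y]))" by (rule push_bilinear[OF A.Z2_D(2)[OF p]])
  show "B.bil_cocycle (\<lambda>x y. f (\<phi> [h x, h y]))"
    unfolding B.bil_cocycle_def
  proof (intro ballI)
    fix x y z assume v: "x \<in> carrier B" "y \<in> carrier B" "z \<in> carrier B"
    then have v': "h x \<in> carrier A" "h y \<in> carrier A" "h z \<in> carrier A" by simp_all
    note cl = A.Z2_D(4)[OF p]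
    have "f (\<phi> [h x \<otimes>\<^bsub>A\<^esub> h y, h z] \<oplus>\<^bsub>A\<^esub> \<phi> [h x, h y] \<otimes>\<^bsub>A\<^esub> h z) =
        f (\<phi> [h x, h y \<otimes>\<^bsub>A\<^esub> h z] \<oplus>\<^bsub>A\<^esub> h x \<otimes>\<^bsub>A\<^esub> \<phi> [h y, h z])"
      by (simp only: A.bil_cocycleD[OF A.Z2_D(3)[OF p] v'])
    then show "f (\<phi> [h (x \<otimes>\<^bsub>B\<^esub> y), h z]) \<oplus>\<^bsub>B\<^esub> f (\<phi> [h x, h y]) \<otimes>\<^bsub>B\<^esub> z =
        f (\<phi> [h x, h (y \<otimes>\<^bsub>B\<^esub> z)]) \<oplus>\<^bsub>B\<^esub> x \<otimes>\<^bsub>B\<^esub> f (\<phi> [h y, h z])"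
      using v v' cl by (simp add: fh)
  qed
qed

lemma push_normalized: "A.normalized \<phi> \<Longrightarrow> B.normalized (push \<phi>)"
  by (simp add: A.normalized_def B.normalized_def push_Z2 push_apply f_zero)

text \<open>Transport commutes with the differential: the coboundary of L goes to the coboundary of
  x \<mapsto> f(L(h x)).\<close>

lemma push_B2: assumes "b \<in> A.B2" shows "push b \<in> B.B2"
proof -
  obtain L where L: "A.graded_linear L" "b = chain2 A (A.del L)"
    using assms unfolding A.coboundaries_2_iff by (elim exE conjE)
  have l: "A.linear L" using L(1) by (simp add: A.graded_linear_def)
  let ?L = "\<lambda>x. f (L (h x))"
  have "B.graded_linear ?L" using L(1) by (simp add: A.graded_linear_def B.graded_linear_def push_linear)
  moreover have "push b = chain2 B (B.del ?L)"
    unfolding push_def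
  proof (rule chain2_eqI[OF chain2_extensional chain2_extensional])
    fix x y assume v: "x \<in> carrier B" "y \<in> carrier B"
    then have v': "h x \<in> carrier A" "h y \<in> carrier A" by simp_all
    show "chain2 B (\<lambda>x y. f (b [h x, h y])) [x, y] = chain2 B (B.del ?L) [x, y]"
      using v v' A.linear_closed[OF l] by (simp add: chain2_apply L(2) A.del_def B.del_def fh f_neg)
  qed
  ultimately show ?thesis unfolding B.coboundaries_2_iff by blast
qed

lemma HH0_map_eq: "HH0_map A B f 2 u = push ` u"
proof -
  have inv: "inv_into (carrier A) f y = h y" if "y \<in> carrier B" for y
    using that f by (intro inv_into_f_eq) (simp_all add: fh graded_alg_iso_def bij_betw_def)
  have "(\<lambda>bs\<in>tuples B 2. f (\<phi> (map (inv_into (carrier A) f) bs))) = push \<phi>" for \<phi>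
    by (rule chain2_eqI[of _ B]) (simp_all add: push_apply tuples_2 inv, simp add: push_def chain2_extensional)
  then show ?thesis by (simp add: HH0_map_def)
qed

lemma push_add: "\<phi> \<in> A.Z2 \<Longrightarrow> \<psi> \<in> A.Z2 \<Longrightarrow> push (\<phi> \<oplus>\<^bsub>A.C2\<^esub> \<psi>) = push \<phi> \<oplus>\<^bsub>B.C2\<^esub> push \<psi>"
proof (rule chain2_eqI[OF _ cochain_add_apply(2)])
  fix x y assume *: "\<phi> \<in> A.Z2" "\<psi> \<in> A.Z2" and v: "x \<in> carrier B" "y \<in> carrier B"
  then show "push (\<phi> \<oplus>\<^bsub>A.C2\<^esub> \<psi>) [x, y] = (push \<phi> \<oplus>\<^bsub>B.C2\<^esub> push \<psi>) [x, y]"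
    using A.Z2_D(4)[OF *(1)] A.Z2_D(4)[OF *(2)] by (simp add: push_apply cochain_add_apply)
qed (simp add: push_def chain2_extensional)

lemma HH0_map_hh: assumes p: "\<phi> \<in> A.Z2" shows "HH0_map A B f 2 (A.hh \<phi>) = B.hh (push \<phi>)"
  unfolding HH0_map_eq
proof (intro equalityI subsetI)
  fix w assume "w \<in> push ` A.hh \<phi>"
  then obtain \<psi> where q: "\<psi> \<in> A.hh \<phi>" "w = push \<psi>" by blast
  obtain b where b: "b \<in> A.B2" "\<psi> = b \<oplus>\<^bsub>A.C2\<^esub> \<phi>" using q(1) unfolding A.hh_mem_iff ..
  have "w = push b \<oplus>\<^bsub>B.C2\<^esub> push \<phi>" unfolding q(2) b(2) by (rule push_add[OF A.B2_Z2[OF b(1)] p])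
  then show "w \<in> B.hh (push \<phi>)" unfolding B.hh_mem_iff using push_B2[OF b(1)] by blast
next
  interpret I: algebra_iso K B gr' e' A gr e h f by (rule sym)
  fix w assume "w \<in> B.hh (push \<phi>)"
  then obtain c where c: "c \<in> B.B2" "w = c \<oplus>\<^bsub>B.C2\<^esub> push \<phi>" unfolding B.hh_mem_iff ..
  \<comment> \<open>Every coboundary of B is the transport of a coboundary of A, namely of its own
    transport back along h. This makes the image a full class.\<close>
  have b: "I.push c \<in> A.B2" by (rule I.push_B2[OF c(1)])
  have "push (I.push c) = c"
    by (rule chain2_eqI[OF _ B.Z2_D(1)[OF B.B2_Z2[OF c(1)]]])
      (simp_all add: push_apply I.push_apply fh B.Z2_D(4)[OF B.B2_Z2[OF c(1)]], simp add: push_def chain2_extensional)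
  then have "w = push (I.push c \<oplus>\<^bsub>A.C2\<^esub> \<phi>)" unfolding c(2) push_add[OF A.B2_Z2[OF b] p] by simp
  moreover have "I.push c \<oplus>\<^bsub>A.C2\<^esub> \<phi> \<in> A.hh \<phi>" unfolding A.hh_mem_iff using b by blast
  ultimately show "w \<in> push ` A.hh \<phi>" by blast
qed

definition fmat :: "'k mat" where
  "fmat = (\<lambda>i j. if j < 16 then B.co (f (e j)) i else \<zero>\<^bsub>K\<^esub>)"

lemma fmat_mats: "fmat \<in> mats K"
  by (rule matsI) (auto simp: fmat_def B.co_carrier B.co_outside A.e_carrier)

lemma fmat_col: "j < 16 \<Longrightarrow> col fmat j = B.co (f (e j))"
  by (rule ext) (simp add: col_def fmat_def)

lemma fmat_vec: assumes x: "x \<in> carrier A" shows "mat_vec K fmat (A.co x) = B.co (f x)"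
proof
  fix k
  have "B.co (f x) k = (\<Oplus>\<^bsub>K\<^esub>i\<in>{..<16}. A.co x i \<otimes>\<^bsub>K\<^esub> B.co (f (e i)) k)"
    by (rule A.functional_expand[OF _ _ _ x]) (simp_all add: B.co_carrier B.co_add B.co_smult)
  then show "mat_vec K fmat (A.co x) k = B.co (f x) k"
    unfolding mat_vec_def using x
    by (simp, intro A.K.finsum_eqI) (simp_all add: fmat_def A.co_carrier B.co_carrier A.e_carrier A.K.m_comm)
qed

lemma fmat_mul:
  assumes g: "g \<in> mats K" "\<And>j. j < 16 \<Longrightarrow> col g j = A.co (h (e' j))"
  shows "mat_mul K fmat g = mat_one K"
proof (rule mats_eqI)
  show "mat_mul K fmat g \<in> mats K" by (rule A.K.mat_mul_mats[OF fmat_mats g(1)])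
  show "mat_one K \<in> mats K" by (rule A.K.mat_one_mats)
  fix i j :: nat assume ij: "i < 16" "j < 16"
  have "mat_mul K fmat g i j = col (mat_mul K fmat g) j i" by (simp add: col_def)
  also have "\<dots> = B.co (f (h (e' j))) i"
    unfolding A.K.col_mat_mul g(2)[OF ij(2)] by (subst fmat_vec) (simp_all add: B.e_carrier ij)
  also have "\<dots> = mat_one K i j" using ij by (simp add: fh B.e_carrier B.co_e) (simp add: mat_one_def)
  finally show "mat_mul K fmat g i j = mat_one K i j" .
qed

text \<open>The inverse is the matrix of h, the blocks come from preservation of degrees, and the
  degree-0 block is 1 because f preserves the unit.\<close>

lemma fmat_G: "fmat \<in> G_pts K"
proof -
  interpret I: algebra_iso K B gr' e' A gr e h f by (rule sym)
  show ?thesis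
  proof (rule A.K.G_ptsI[OF fmat_mats])
    show "mat_inverse K fmat I.fmat"
      unfolding mat_inverse_def
      using I.fmat_mats fmat_mul[OF I.fmat_mats I.fmat_col] I.fmat_mul[OF fmat_mats fmat_col] by blast
    show "fmat 0 0 = \<one>\<^bsub>K\<^esub>" by (simp add: fmat_def A.e_0 B.co_one) (simp add: mat_one_def)
    fix i j assume ij: "bdeg i \<noteq> bdeg j"
    show "fmat i j = \<zero>\<^bsub>K\<^esub>"
    proof (cases "i < 16 \<and> j < 16")
      case True
      then have "f (e j) \<in> gr' (bdeg j)" by (simp add: A.e_gr)
      then show ?thesis using True ij by (simp add: fmat_def B.gr_iff_co)
    next
      case False
      then show ?thesis using mats_outside[OF fmat_mats] by (auto simp: not_less)
    qed
  qed
qed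

lemma fmat_sc: "X_act K fmat A.sc = B.sc"
  unfolding A.K.X_act_eq_iff[OF fmat_G A.sc_sconsts B.sc_sconsts]
  by (simp add: A.sc_eq fmat_col fmat_vec B.mulv_sc A.e_carrier)

text \<open>By construction f carries the product deformed by \<phi> to the one deformed by its
  transport. The matrix of f is lifted with zero \<epsilon>-part, so in the criterion for the action
  the terms that contain this part vanish.\<close>

lemma fmat_deformed:
  assumes p: "\<phi> \<in> A.Z2"
  shows "X_act (dual_numbers K) (mat_map (\<lambda>a. (a, \<zero>\<^bsub>K\<^esub>)) fmat) (A.dc \<phi>) = B.dc (push \<phi>)"
proof -
  let ?z = "\<lambda>(i::nat) (j::nat). \<zero>\<^bsub>K\<^esub>"
  interpret j: ring_hom_cring K "dual_numbers K" "\<lambda>a. (a, \<zero>\<^bsub>K\<^esub>)"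
    by (rule ring_hom_cringI2[OF A.K.cring_axioms A.K.dual_numbers_cring A.K.dual_numbers_homs(2)])
  have m: "mat_map (\<lambda>a. (a, \<zero>\<^bsub>K\<^esub>)) fmat = pairm fmat ?z" by (simp add: mat_map_def pairm_def)
  have G: "pairm fmat ?z \<in> G_pts (dual_numbers K)" unfolding m[symmetric] by (rule j.mat_map_G_pts[OF fmat_G])
  have z: "?z \<in> mats K" by (rule matsI) simp_all
  have zc: "col ?z i = (\<lambda>_. \<zero>\<^bsub>K\<^esub>)" for i by (simp add: col_def)
  have zv: "mat_vec K ?z v k = \<zero>\<^bsub>K\<^esub>" if "v \<in> vecs K" for v k
    unfolding mat_vec_def using that by (intro A.K.finsum_zeroI) simp_all
  let ?b = "\<lambda>x y. \<phi> [x, y]" and ?c = "\<lambda>x y. push \<phi> [x, y]"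
  note b = A.Z2_D(2)[OF p] and c = B.Z2_D(2)[OF push_Z2[OF p]]
  have main: "mat_vec K fmat (A.consts_of ?b i j) = mulv K (B.consts_of ?c) (col fmat i) (col fmat j)"
    "mat_vec K fmat (A.sc i j) = mulv K B.sc (col fmat i) (col fmat j)"
    if ij: "i < 16" "j < 16" for i j
  proof -
    have "mat_vec K fmat (A.consts_of ?b i j) = B.co (f (\<phi> [e i, e j]))"
      using ij A.Z2_D(4)[OF p] by (simp add: A.consts_of_eq fmat_vec A.e_carrier)
    also have "\<dots> = B.co (push \<phi> [f (e i), f (e j)])"
      using ij by (simp add: push_apply A.e_carrier hf)
    also have "\<dots> = mulv K (B.consts_of ?c) (col fmat i) (col fmat j)"
      unfolding fmat_col[OF ij(1)] fmat_col[OF ij(2)] using ij by (intro B.mulv_consts_of[OF c, symmetric]) (simp_all add: A.e_carrier)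
    finally show "mat_vec K fmat (A.consts_of ?b i j) = mulv K (B.consts_of ?c) (col fmat i) (col fmat j)" .
    show "mat_vec K fmat (A.sc i j) = mulv K B.sc (col fmat i) (col fmat j)"
      using ij by (simp add: A.sc_eq fmat_col fmat_vec B.mulv_sc A.e_carrier)
  qed
  have mv: "mulv K (B.consts_of ?c) (col fmat i) (col fmat j) k \<in> carrier K" if ij: "i < 16" "j < 16" for i j k
    unfolding main(1)[OF ij, symmetric] using ij A.Z2_D(4)[OF p]
    by (simp add: A.consts_of_eq fmat_vec A.e_carrier B.co_carrier)
  have cv: "col fmat i \<in> vecs K" if "i < 16" for i
    using that by (simp add: fmat_col B.co_props(1) A.e_carrier)
  show ?thesis
    unfolding m A.deformed_consts_pairc B.deformed_consts_pairc
      A.K.X_act_pairc_iff[OF G fmat_mats z A.sc_sconsts A.consts_of_sconsts[OF b] B.sc_sconsts B.consts_of_sconsts[OF c]]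
    using mv by (simp add: main zc zv sconsts_vecs[OF A.sc_sconsts] A.K.mulv_zero[OF B.sc_sconsts cv])
qed

text \<open>For a normalized representative both sides are classes of deformations over the point of
  B, and the matrix of f relates them through \<open>tan_map_def_class\<close>.\<close>

lemma hh_to_tan_natural:
  fixes \<iota> :: "'k \<Rightarrow> 'u"
  assumes U: "universe K \<iota>" and u: "u \<in> carrier (HH0 K A gr 2)"
  shows "tan_map K (alg_pt K B e') (alg_pt_mor K e B e' f) (hh_to_tan K A gr e u :: ('k, 'u) tvec) =
    hh_to_tan K B gr' e' (HH0_map A B f 2 u)"
proof -
  interpret U: universe K \<iota> by (rule U)
  interpret A': algebra_point K A gr e \<iota> ..
  interpret B': algebra_point K B gr' e' \<iota> ..
  obtain \<phi> where p: "A.normalized \<phi>" "u = A.hh \<phi>" by (rule A.HH0_normalized[OF u])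
  have g: "alg_pt_mor K e B e' f = (\<lambda>S p. mat_mul (fst S) p (mat_map (snd S) fmat))"
    by (simp add: alg_pt_mor_def fmat_def)
  have "tan_map K (stack_pt B.sc) (alg_pt_mor K e B e' f) (A'.tv \<phi>) = B'.tv (push \<phi>)"
    by (rule U.tan_map_def_class[OF A.sc_X_pts A.deformed_consts_deformation[OF p(1)] B.sc_X_pts
          B.deformed_consts_deformation[OF push_normalized[OF p(1)]] fmat_G fmat_sc fmat_deformed[OF A.normalizedD(1)[OF p(1)]] g])
  then show ?thesis
    unfolding p(2) HH0_map_hh[OF A.normalizedD(1)[OF p(1)]] A'.hh_to_tan_hh[OF p(1)]
      B'.hh_to_tan_hh[OF push_normalized[OF p(1)]] alg_pt_def .
qed

end

text \<open>Every class contains a normalized cocycle, so the formula on normalized cocycles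
  determines the isomorphism. The basis e fixes coordinates for the point of the stack; naturality
  with B = A and f the identity compares two choices of basis.\<close>

theorem proposition5p9:
  fixes K :: "'k ring"
  assumes "algebraically_closed K"
    and "\<forall>n::nat. n > 0 \<longrightarrow> [n] \<cdot>\<^bsub>K\<^esub> \<one>\<^bsub>K\<^esub> \<noteq> \<zero>\<^bsub>K\<^esub>"
    and "\<exists>\<iota> :: 'k \<Rightarrow> 'u. inj_on \<iota> (carrier K)"
  shows "\<exists>\<Phi> :: ('k, 'a) module \<Rightarrow> (nat \<Rightarrow> 'a set) \<Rightarrow> (nat \<Rightarrow> 'a) \<Rightarrow>
                ('a list \<Rightarrow> 'a) set \<Rightarrow> ('k, 'u) tvec.
    (\<forall>A gr e. frobenius_algebra4 K A gr \<and> homogeneous_basis K A gr e \<longrightarrow>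
       \<Phi> A gr e \<in> module_iso K (HH0 K A gr 2) (tangent_space K (alg_pt K A e)) \<and>
       (\<forall>\<phi>\<in>cocycles K A gr 2. \<phi> [\<one>\<^bsub>A\<^esub>, \<one>\<^bsub>A\<^esub>] = \<zero>\<^bsub>A\<^esub> \<longrightarrow>
          \<Phi> A gr e (hh_class K A gr 2 \<phi>) =
            tan_class K (alg_pt K A e) (stack_pt (deformed_consts K A e \<phi>)) (\<lambda>S p. p))) \<and>
    (\<forall>A gr e B gr' e' f.
       frobenius_algebra4 K A gr \<and> homogeneous_basis K A gr e \<and>
       frobenius_algebra4 K B gr' \<and> homogeneous_basis K B gr' e' \<and>
       graded_alg_iso K A gr B gr' f \<longrightarrow>
       (\<forall>u\<in>carrier (HH0 K A gr 2).
          tan_map K (alg_pt K B e') (alg_pt_mor K e B e' f) (\<Phi> A gr e u) =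
          \<Phi> B gr' e' (HH0_map A B f 2 u)))"
proof -
  have K: "field K"
    using assms(1) by (simp add: algebraically_closed_def)
  obtain \<iota> :: "'k \<Rightarrow> 'u" where \<iota>: "inj_on \<iota> (carrier K)" using assms(3) ..
  have "infinite (carrier K)"
    by (rule char_0_infinite_carrier[OF fieldE(1)[OF K] assms(2)])
  then have "infinite (UNIV :: 'u set)"
    using finite_imageD[OF finite_subset[OF subset_UNIV] \<iota>] by blast
  then have U: "universe K \<iota>" using K \<iota> by (intro universe.intro)
  have 1: "hh_to_tan K A gr e \<in> module_iso K (HH0 K A gr 2) (tangent_space K (alg_pt K A e :: ('k, 'u) qobj))"
    "\<forall>\<phi>\<in>cocycles K A gr 2. \<phi> [\<one>\<^bsub>A\<^esub>, \<one>\<^bsub>A\<^esub>] = \<zero>\<^bsub>A\<^esub> \<longrightarrow> (hh_to_tan K A gr e (hh_class K A gr 2 \<phi>) :: ('k, 'u) tvec) =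
       tan_class K (alg_pt K A e) (stack_pt (deformed_consts K A e \<phi>)) (\<lambda>S p. p)"
    if "frobenius_algebra4 K A gr" "homogeneous_basis K A gr e" for A :: "('k, 'a) module" and gr e
  proof -
    interpret universe K \<iota> by (rule U)
    interpret based_algebra K A gr e by (rule based_algebra.intro[OF that])
    interpret algebra_point K A gr e \<iota> ..
    show "hh_to_tan K A gr e \<in> module_iso K (HH0 K A gr 2) (tangent_space K (alg_pt K A e :: ('k, 'u) qobj))"
      by (rule hh_to_tan_iso)
    show "\<forall>\<phi>\<in>cocycles K A gr 2. \<phi> [\<one>\<^bsub>A\<^esub>, \<one>\<^bsub>A\<^esub>] = \<zero>\<^bsub>A\<^esub> \<longrightarrow> (hh_to_tan K A gr e (hh_class K A gr 2 \<phi>) :: ('k, 'u) tvec) =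
       tan_class K (alg_pt K A e) (stack_pt (deformed_consts K A e \<phi>)) (\<lambda>S p. p)"
      using hh_to_tan_hh by (simp add: normalized_def def_class_def alg_pt_def)
  qed
  have 2: "tan_map K (alg_pt K B e') (alg_pt_mor K e B e' f) (hh_to_tan K A gr e u :: ('k, 'u) tvec) =
      hh_to_tan K B gr' e' (HH0_map A B f 2 u)"
    if A: "frobenius_algebra4 K A gr" "homogeneous_basis K A gr e"
      and B: "frobenius_algebra4 K B gr'" "homogeneous_basis K B gr' e'"
      and f: "graded_alg_iso K A gr B gr' f" and u: "u \<in> carrier (HH0 K A gr 2)"
    for A B :: "('k, 'a) module" and gr gr' e e' f u
  proof -
    interpret A: based_algebra K A gr e by (rule based_algebra.intro[OF A])
    interpret B: based_algebra K B gr' e' by (rule based_algebra.intro[OF B])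
    define h where "h = inv_into (carrier A) f"
    have bij: "bij_betw f (carrier A) (carrier B)" using f by (simp add: graded_alg_iso_def)
    have hf: "h (f x) = x" if "x \<in> carrier A" for x using that bij by (simp add: h_def bij_betw_def)
    have fh: "f (h y) = y" if "y \<in> carrier B" for y using that bij unfolding h_def by (rule bij_betw_inv_into_right[rotated])
    have "algebra_iso K A gr e B gr' e' f h"
    proof
      show "graded_alg_iso K A gr B gr' f" by (rule f)
      show "graded_alg_iso K B gr' A gr h" by (rule graded_alg_iso_inv[OF A.ring_A A.module_A A.gr_carrier f, folded h_def])
    qed (rule hf, assumption, rule fh, assumption)
    then show ?thesis by (rule algebra_iso.hh_to_tan_natural[OF _ U u])
  qed
  show ?thesis
    by (intro exI[of _ "hh_to_tan K"] conjI allI impI ballI) (elim conjE, (rule 1 1[rule_format] 2; assumption))+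
qed

end
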